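(* There are exactly $16$ isomorphism classes $M_1,\dots,M_{16}$ of abstract light dual multinets of order $6$ having a unique superline. For each class we list (A) the length of the superline, (B) the set $L(M)$ of indices $j\in\{1,\dots,12\}$ such that the multinet can be labeled (up to isomorphism) by a quasigroup isostrophic to $Q_{6.j}$, and (C) the structure of its automorphism group: $M_1$: (A) $3$, (B) $\{1,9\}$, (C) $((C_3\times C_3\times C_3):C_3):(C_2\times C_2)$ (order $324$); $M_2$: $3$, $\{2,3,9\}$, $((C_3\times C_3\times C_3):C_3):(C_2\times C_2)$ (order $324$); $M_3$: $2$, $\{1,4\}$, $C_2\times S_4$; $M_4$: $2$, $\{2,5\}$, $C_2\times S_4$; $M_5$: $2$, $\{4\}$, $C_2\times S_4$; $M_6$: $2$, $\{7\}$, $C_2\times S_4$; $M_7$: $2$, $\{5\}$, $C_2\times D_8$; $M_8$: $2$, $\{8,11\}$, $C_2\times D_8$; $M_9$: $2$, $\{10\}$, $C_2\times D_8$; $M_{10}$: $2$, $\{11\}$, $C_2\times D_8$; $M_{11}$: $2$, $\{9,12\}$, $C_2\times C_2\times C_2$; $M_{12}$: $2$, $\{12\}$, $C_2\times C_2\times C_2$; $M_{13}$: $2$, $\{6,7\}$, $S_3$; $M_{14}$: $2$, $\{5,10\}$, $C_2\times C_2$; $M_{15}$: $2$, $\{7,10\}$, $C_2\times C_2$; $M_{16}$: $2$, $\{11,12\}$, $C_2\times C_2$. Here $D_8$ is the dihedral group of order $8$ and $A:B$ denotes a semidirect product.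
   Context: A quasigroup $(Q,\cdot)$ is a set with a binary operation such that $x\cdot y=z$ is uniquely solvable for any one of $x,y,z$ given the other two; write $y=x\backslash z$, $x=z/y$. Quasigroups $Q,R$ are isostrophic if there are $\sigma\in S_3$ and bijections $\gamma_1,\gamma_2,\gamma_3:Q\to R$ such that $x_{\sigma(1)}\cdot x_{\sigma(2)}=x_{\sigma(3)}$ iff $\gamma_1(x_1)\circ\gamma_2(x_2)=\gamma_3(x_3)$. A triple $(S_1,S_2,S_3)$ of subsets of $Q$ is a subsquare if $S_1\cdot S_2\subseteq S_3$, $S_1\backslash S_3\subseteq S_2$, $S_3/S_2\subseteq S_1$; its order is $|S_1|=|S_2|=|S_3|$. An abstract light dual multinet labeled by $Q$ is a pair $(\mathcal{P},\mathcal{M})$ such that: (1) $\mathcal{P}$ is the disjoint union of $\mathcal{P}_1,\mathcal{P}_2,\mathcal{P}_3$; (2) $\mathcal{M}$ is a set of subsets of $\mathcal{P}$ (blocks) with any two points in at most one block; (3) there are bijections $\alpha_i:Q\to\mathcal{P}_i$ such that for all $x,y\in Q$ some block contains $\alpha_1(x),\alpha_2(y),\alpha_3(x\cdot y)$; (4) $|\mathcal{M}|>1$. Its order is $|Q|$. For a block $B$ the sets $S_i=\{x\mid\alpha_i(x)\in B\}$ form a subsquare whose order is the length of $B$; a superline is a block of length at least $2$. Isomorphisms are bijections of point sets mapping the set of blocks onto the set of blocks; automorphisms are isomorphisms to itself. Up to isostrophy there are $12$ quasigroups of order $6$, with representatives $Q_{6.1},\dots,Q_{6.12}$ on $\{1,\dots,6\}$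 given by their rows (row $x$ lists $x\cdot1,\dots,x\cdot6$): $Q_{6.1}$: 123456, 234561, 345612, 456123, 561234, 612345; $Q_{6.2}$: 123456, 215634, 361542, 456123, 542361, 634215; $Q_{6.3}$: 123456, 231564, 312645, 465213, 546321, 654132; $Q_{6.4}$: 123456, 214365, 345612, 436521, 561243, 652134; $Q_{6.5}$: 123456, 215634, 362541, 456213, 541362, 634125; $Q_{6.6}$: 123456, 214563, 362145, 456231, 531624, 645312; $Q_{6.7}$: 123456, 214365, 351642, 465123, 536214, 642531; $Q_{6.8}$: 123456, 216534, 361245, 452163, 534612, 645321; $Q_{6.9}$: 123456, 231645, 312564, 465123, 546231, 654312; $Q_{6.10}$: 123456, 216543, 351264, 462135, 534621, 645312; $Q_{6.11}$: 123456, 214563, 342615, 456231, 561324, 635142; $Q_{6.12}$: 123456, 215643, 354261, 462315, 546132, 631524.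
   Formalization: Every block is required to meet each of the three components P_1, P_2, P_3; axioms (1)-(4) alone would allow superfluous blocks (for example the empty set added to M_1), which give further isomorphism classes and make the count of 16 false. *)

theory Defs
  imports
    "HOL-Algebra.Sym_Groups"
    "HOL-Algebra.Elementary_Groups"
    "HOL-Algebra.Bij"
begin

section \<open>Quasigroups\<close>

locale quasigroup =
  fixes Q :: "'q set" and mul :: "'q \<Rightarrow> 'q \<Rightarrow> 'q"
  assumes closed: "\<lbrakk>x \<in> Q; y \<in> Q\<rbrakk> \<Longrightarrow> mul x y \<in> Q"
    and left_div: "\<lbrakk>x \<in> Q; z \<in> Q\<rbrakk> \<Longrightarrow> \<exists>!y. y \<in> Q \<and> mul x y = z"
    and right_div: "\<lbrakk>y \<in> Q; z \<in> Q\<rbrakk> \<Longrightarrow> \<exists>!x. x \<in> Q \<and> mul x y = z"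

text \<open>Triples \<open>(x\<^sub>1, x\<^sub>2, x\<^sub>3)\<close> are functions on the index set \<open>{1, 2, 3}\<close>.\<close>

definition isostrophic ::
    "'q set \<Rightarrow> ('q \<Rightarrow> 'q \<Rightarrow> 'q) \<Rightarrow> 'r set \<Rightarrow> ('r \<Rightarrow> 'r \<Rightarrow> 'r) \<Rightarrow> bool" where
  "isostrophic Q mul R mul' \<longleftrightarrow>
     (\<exists>(\<sigma> :: nat \<Rightarrow> nat) (\<gamma> :: nat \<Rightarrow> 'q \<Rightarrow> 'r).
        \<sigma> permutes {1, 2, 3} \<and>
        (\<forall>i\<in>{1, 2, 3}. bij_betw (\<gamma> i) Q R) \<and>
        (\<forall>x. (\<forall>i\<in>{1, 2, 3}. x i \<in> Q) \<longrightarrow>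
             (mul (x (\<sigma> 1)) (x (\<sigma> 2)) = x (\<sigma> 3) \<longleftrightarrow>
              mul' (\<gamma> 1 (x 1)) (\<gamma> 2 (x 2)) = \<gamma> 3 (x 3))))"

text \<open>The three inclusions are
  \<open>S\<^sub>1 \<cdot> S\<^sub>2 \<subseteq> S\<^sub>3\<close>,
  \<open>S\<^sub>1 \ S\<^sub>3 \<subseteq> S\<^sub>2\<close> and \<open>S\<^sub>3 / S\<^sub>2 \<subseteq> S\<^sub>1\<close>.\<close>

definition subsquare ::
    "'q set \<Rightarrow> ('q \<Rightarrow> 'q \<Rightarrow> 'q) \<Rightarrow> 'q set \<Rightarrow> 'q set \<Rightarrow> 'q set \<Rightarrow> bool" where
  "subsquare Q mul S1 S2 S3 \<longleftrightarrow>
     S1 \<subseteq> Q \<and> S2 \<subseteq> Q \<and> S3 \<subseteq> Q \<and>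
     (\<forall>x\<in>S1. \<forall>y\<in>S2. mul x y \<in> S3) \<and>
     (\<forall>x\<in>S1. \<forall>y\<in>Q. mul x y \<in> S3 \<longrightarrow> y \<in> S2) \<and>
     (\<forall>y\<in>S2. \<forall>x\<in>Q. mul x y \<in> S3 \<longrightarrow> x \<in> S1)"

definition Q6_table :: "nat \<Rightarrow> nat list list" where
  "Q6_table j =
    [[[1,2,3,4,5,6], [2,3,4,5,6,1], [3,4,5,6,1,2], [4,5,6,1,2,3], [5,6,1,2,3,4], [6,1,2,3,4,5]],
     [[1,2,3,4,5,6], [2,1,5,6,3,4], [3,6,1,5,4,2], [4,5,6,1,2,3], [5,4,2,3,6,1], [6,3,4,2,1,5]],
     [[1,2,3,4,5,6], [2,3,1,5,6,4], [3,1,2,6,4,5], [4,6,5,2,1,3], [5,4,6,3,2,1], [6,5,4,1,3,2]],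
     [[1,2,3,4,5,6], [2,1,4,3,6,5], [3,4,5,6,1,2], [4,3,6,5,2,1], [5,6,1,2,4,3], [6,5,2,1,3,4]],
     [[1,2,3,4,5,6], [2,1,5,6,3,4], [3,6,2,5,4,1], [4,5,6,2,1,3], [5,4,1,3,6,2], [6,3,4,1,2,5]],
     [[1,2,3,4,5,6], [2,1,4,5,6,3], [3,6,2,1,4,5], [4,5,6,2,3,1], [5,3,1,6,2,4], [6,4,5,3,1,2]],
     [[1,2,3,4,5,6], [2,1,4,3,6,5], [3,5,1,6,4,2], [4,6,5,1,2,3], [5,3,6,2,1,4], [6,4,2,5,3,1]],
     [[1,2,3,4,5,6], [2,1,6,5,3,4], [3,6,1,2,4,5], [4,5,2,1,6,3], [5,3,4,6,1,2], [6,4,5,3,2,1]],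
     [[1,2,3,4,5,6], [2,3,1,6,4,5], [3,1,2,5,6,4], [4,6,5,1,2,3], [5,4,6,2,3,1], [6,5,4,3,1,2]],
     [[1,2,3,4,5,6], [2,1,6,5,4,3], [3,5,1,2,6,4], [4,6,2,1,3,5], [5,3,4,6,2,1], [6,4,5,3,1,2]],
     [[1,2,3,4,5,6], [2,1,4,5,6,3], [3,4,2,6,1,5], [4,5,6,2,3,1], [5,6,1,3,2,4], [6,3,5,1,4,2]],
     [[1,2,3,4,5,6], [2,1,5,6,4,3], [3,5,4,2,6,1], [4,6,2,3,1,5], [5,4,6,1,3,2], [6,3,1,5,2,4]]]
    ! (j - 1)"

definition Q6 :: "nat \<Rightarrow> nat \<Rightarrow> nat \<Rightarrow> nat" where
  "Q6 j x y = Q6_table j ! (x - 1) ! (y - 1)"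

lemma quasigroup_Q6:
  assumes "j \<in> {1..12}"
  shows "quasigroup {1..6} (Q6 j)"
proof -
  have "\<forall>j\<in>set [1..<13]. \<forall>x\<in>set [1..<7]. set (map (Q6 j x) [1..<7]) = set [1..<7] \<and>
          set (map (\<lambda>y. Q6 j y x) [1..<7]) = set [1..<7]"
    by code_simp
  moreover have eq: "set [1..<7] = {1..6::nat}" "set [1..<13] = {1..12::nat}" by auto
  ultimately have img: "Q6 j x ` {1..6} = {1..6}" "(\<lambda>y. Q6 j y x) ` {1..6} = {1..6}"
    if "x \<in> {1..6}" for x
    using assms that by (simp_all only: set_map eq)
  have inj: "inj_on (Q6 j x) {1..6}" "inj_on (\<lambda>y. Q6 j y x) {1..6}" if "x \<in> {1..6}" for x
    by (rule eq_card_imp_inj_on; simp only: img[OF that] finite_atLeastAtMost)+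
  show ?thesis
  proof
    fix x y :: nat assume "x \<in> {1..6}" "y \<in> {1..6}"
    then show "Q6 j x y \<in> {1..6}" using img(1) by blast
  next
    fix x z :: nat assume x: "x \<in> {1..6}" and z: "z \<in> {1..6}"
    then obtain y where y: "y \<in> {1..6}" "z = Q6 j x y" using img(1)[OF x] by (metis imageE)
    show "\<exists>!y. y \<in> {1..6} \<and> Q6 j x y = z"
      by (rule ex1I[of _ y]) (use y inj_onD[OF inj(1)[OF x]] in auto)
  next
    fix y z :: nat assume y: "y \<in> {1..6}" and z: "z \<in> {1..6}"
    then obtain x where x: "x \<in> {1..6}" "z = Q6 j x y" using img(2)[OF y] by (metis imageE)
    show "\<exists>!x. x \<in> {1..6} \<and> Q6 j x y = z"
      by (rule ex1I[of _ x]) (use x inj_onD[OF inj(2)[OF y]] in auto)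
  qed
qed


section \<open>Abstract light dual multinets\<close>

text \<open>
  \<open>(P, M)\<close> is labeled by the quasigroup \<open>Q\<close>; \<open>Pc\<close> is the family of components and \<open>\<alpha>\<close> the
  family of labelings, both indexed by \<open>{1, 2, 3}\<close>.

  Assumption \<open>block_meets\<close> makes explicit the convention that every block of a multinet defines a
  subsquare having an order that is at least 1.  Without it, the remaining axioms would tolerate
  superfluous blocks (the empty set, singletons, or uncovered sets inside one component), and these
  have no length.  Conversely, \<open>block_subsquare\<close> and \<open>block_cards\<close> below derive the
  subsquare property and the equality of the three cardinalities from it.
\<close>

locale light_dual_multinet = quasigroup Q mul
  for Q :: "'q set" and mul :: "'q \<Rightarrow> 'q \<Rightarrow> 'q" +
  fixes P :: "'p set" and M :: "'p set set"
    and Pc :: "nat \<Rightarrow> 'p set" and \<alpha> :: "nat \<Rightarrow> 'q \<Rightarrow> 'p"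
  assumes components: "P = Pc 1 \<union> Pc 2 \<union> Pc 3"
    and components_disjoint: "disjoint_family_on Pc {1, 2, 3}"
    and blocks: "M \<subseteq> Pow P"
    and block_unique:
      "\<lbrakk>p \<in> P; q \<in> P; p \<noteq> q; B \<in> M; B' \<in> M; {p, q} \<subseteq> B; {p, q} \<subseteq> B'\<rbrakk> \<Longrightarrow> B = B'"
    and block_meets: "\<lbrakk>B \<in> M; i \<in> {1, 2, 3}\<rbrakk> \<Longrightarrow> B \<inter> Pc i \<noteq> {}"
    and labeling: "i \<in> {1, 2, 3} \<Longrightarrow> bij_betw (\<alpha> i) Q (Pc i)"
    and labeling_block:
      "\<lbrakk>x \<in> Q; y \<in> Q\<rbrakk> \<Longrightarrow> \<exists>B\<in>M. {\<alpha> 1 x, \<alpha> 2 y, \<alpha> 3 (mul x y)} \<subseteq> B"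
    and two_blocks: "\<exists>B\<in>M. \<exists>B'\<in>M. B \<noteq> B'"

definition block_labels :: "'q set \<Rightarrow> (nat \<Rightarrow> 'q \<Rightarrow> 'p) \<Rightarrow> 'p set \<Rightarrow> nat \<Rightarrow> 'q set" where
  "block_labels Q \<alpha> B i = {x \<in> Q. \<alpha> i x \<in> B}"

text \<open>The length of a block is the order of its subsquare, i.e. the common cardinality of the three
  sets of labels (see \<open>block_cards\<close>).  By \<open>card_block\<close> it does not depend on the labeling.\<close>

definition block_length :: "'q set \<Rightarrow> (nat \<Rightarrow> 'q \<Rightarrow> 'p) \<Rightarrow> 'p set \<Rightarrow> nat" where
  "block_length Q \<alpha> B = card (block_labels Q \<alpha> B 1)"

definition superline :: "'q set \<Rightarrow> (nat \<Rightarrow> 'q \<Rightarrow> 'p) \<Rightarrow> 'p set set \<Rightarrow> 'p set \<Rightarrow> bool" where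
  "superline Q \<alpha> M B \<longleftrightarrow> B \<in> M \<and> 2 \<le> block_length Q \<alpha> B"

context light_dual_multinet
begin

lemma label_in_component: "i \<in> {1, 2, 3} \<Longrightarrow> x \<in> Q \<Longrightarrow> \<alpha> i x \<in> Pc i"
  using labeling by (meson bij_betwE)

lemma label_in_P: "i \<in> {1, 2, 3} \<Longrightarrow> x \<in> Q \<Longrightarrow> \<alpha> i x \<in> P"
  using label_in_component[of i x] components by auto

lemma label_neq:
  assumes "i \<in> {1, 2, 3}" "j \<in> {1, 2, 3}" "i \<noteq> j" "x \<in> Q" "y \<in> Q"
  shows "\<alpha> i x \<noteq> \<alpha> j y"
proof -
  have "Pc i \<inter> Pc j = {}"
    using components_disjoint assms unfolding disjoint_family_on_def by blast
  then show ?thesis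
    using label_in_component[of i x] label_in_component[of j y] assms by auto
qed

lemma block_determined:
  assumes "B \<in> M" "B' \<in> M" "i \<in> {1, 2, 3}" "j \<in> {1, 2, 3}" "i \<noteq> j" "x \<in> Q" "y \<in> Q"
    and "\<alpha> i x \<in> B" "\<alpha> j y \<in> B" "\<alpha> i x \<in> B'" "\<alpha> j y \<in> B'"
  shows "B = B'"
  using block_unique[OF label_in_P label_in_P label_neq] assms by auto

lemma block_labels_ne:
  assumes "B \<in> M" "i \<in> {1, 2, 3}"
  shows "block_labels Q \<alpha> B i \<noteq> {}"
proof -
  obtain p where "p \<in> B" "p \<in> Pc i" using block_meets[OF assms] by auto
  then obtain x where "x \<in> Q" "\<alpha> i x = p"
    using labeling[OF assms(2)] by (metis bij_betw_def imageE)
  with \<open>p \<in> B\<close> show ?thesis unfolding block_labels_def by auto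
qed

lemma block_subsquare:
  assumes B: "B \<in> M"
  shows "subsquare Q mul (block_labels Q \<alpha> B 1) (block_labels Q \<alpha> B 2) (block_labels Q \<alpha> B 3)"
proof -
  have *: "(\<alpha> 1 x \<in> B \<and> \<alpha> 2 y \<in> B \<longrightarrow> \<alpha> 3 (mul x y) \<in> B) \<and>
           (\<alpha> 1 x \<in> B \<and> \<alpha> 3 (mul x y) \<in> B \<longrightarrow> \<alpha> 2 y \<in> B) \<and>
           (\<alpha> 2 y \<in> B \<and> \<alpha> 3 (mul x y) \<in> B \<longrightarrow> \<alpha> 1 x \<in> B)" if xy: "x \<in> Q" "y \<in> Q" for x y
  proof -
    obtain C where C: "C \<in> M" "{\<alpha> 1 x, \<alpha> 2 y, \<alpha> 3 (mul x y)} \<subseteq> C"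
      using labeling_block[OF xy] by auto
    have z: "mul x y \<in> Q" using closed xy by blast
    have "B = C" if "\<alpha> 1 x \<in> B" "\<alpha> 2 y \<in> B"
      by (rule block_determined[OF B C(1), of 1 2 x y]) (use that C(2) xy in simp_all)
    moreover have "B = C" if "\<alpha> 1 x \<in> B" "\<alpha> 3 (mul x y) \<in> B"
      by (rule block_determined[OF B C(1), of 1 3 x "mul x y"]) (use that C(2) xy z in simp_all)
    moreover have "B = C" if "\<alpha> 2 y \<in> B" "\<alpha> 3 (mul x y) \<in> B"
      by (rule block_determined[OF B C(1), of 2 3 y "mul x y"]) (use that C(2) xy z in simp_all)
    ultimately show ?thesis using C(2) by blast
  qed
  show ?thesis unfolding subsquare_def
  proof (intro conjI ballI impI)
    fix x y assume "x \<in> block_labels Q \<alpha> B 1" "y \<in> block_labels Q \<alpha> B 2"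
    then show "mul x y \<in> block_labels Q \<alpha> B 3"
      using *[of x y] closed[of x y] by (simp add: block_labels_def)
  next
    fix x y assume "x \<in> block_labels Q \<alpha> B 1" "y \<in> Q" "mul x y \<in> block_labels Q \<alpha> B 3"
    then show "y \<in> block_labels Q \<alpha> B 2" using *[of x y] by (simp add: block_labels_def)
  next
    fix y x assume "y \<in> block_labels Q \<alpha> B 2" "x \<in> Q" "mul x y \<in> block_labels Q \<alpha> B 3"
    then show "x \<in> block_labels Q \<alpha> B 1" using *[of x y] by (simp add: block_labels_def)
  qed (simp_all add: block_labels_def)
qed

lemma block_cards:
  assumes B: "B \<in> M" and i: "i \<in> {1, 2, 3}"
  shows "card (block_labels Q \<alpha> B i) = block_length Q \<alpha> B"
proof -
  let ?S = "block_labels Q \<alpha> B"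
  have sub: "subsquare Q mul (?S 1) (?S 2) (?S 3)" by (rule block_subsquare[OF B])
  obtain a b where a: "a \<in> ?S 1" "a \<in> Q" and b: "b \<in> ?S 2" "b \<in> Q"
    using block_labels_ne[OF B, of 1] block_labels_ne[OF B, of 2] unfolding block_labels_def by auto
  have sub3: "mul x y \<in> ?S 3" if "x \<in> ?S 1" "y \<in> ?S 2" for x y
    using sub that unfolding subsquare_def by blast
  have sub2: "y \<in> ?S 2" if "x \<in> ?S 1" "y \<in> Q" "mul x y \<in> ?S 3" for x y
    using sub that unfolding subsquare_def by blast
  have sub1: "x \<in> ?S 1" if "y \<in> ?S 2" "x \<in> Q" "mul x y \<in> ?S 3" for x y
    using sub that unfolding subsquare_def by blast
  have sQ: "?S i \<subseteq> Q" for i unfolding block_labels_def by auto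
  have "bij_betw (mul a) (?S 2) (?S 3)"
    unfolding bij_betw_def
  proof
    show "inj_on (mul a) (?S 2)"
    proof (rule inj_onI)
      fix y y' assume "y \<in> ?S 2" "y' \<in> ?S 2" "mul a y = mul a y'"
      then show "y = y'" using left_div[OF a(2), of "mul a y"] closed[OF a(2), of y] sQ[of 2] by auto
    qed
    show "mul a ` ?S 2 = ?S 3"
    proof
      show "mul a ` ?S 2 \<subseteq> ?S 3" using sub3[OF a(1)] by blast
      show "?S 3 \<subseteq> mul a ` ?S 2"
      proof
        fix z assume z: "z \<in> ?S 3"
        then obtain y where "y \<in> Q" "z = mul a y" using left_div[OF a(2), of z] sQ[of 3] by auto
        with z sub2[OF a(1), of y] show "z \<in> mul a ` ?S 2" by blast
      qed
    qed
  qed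
  moreover have "bij_betw (\<lambda>x. mul x b) (?S 1) (?S 3)"
    unfolding bij_betw_def
  proof
    show "inj_on (\<lambda>x. mul x b) (?S 1)"
    proof (rule inj_onI)
      fix x x' assume "x \<in> ?S 1" "x' \<in> ?S 1" "mul x b = mul x' b"
      then show "x = x'" using right_div[OF b(2), of "mul x b"] closed[OF _ b(2), of x] sQ[of 1] by auto
    qed
    show "(\<lambda>x. mul x b) ` ?S 1 = ?S 3"
    proof
      show "(\<lambda>x. mul x b) ` ?S 1 \<subseteq> ?S 3" using sub3[OF _ b(1)] by blast
      show "?S 3 \<subseteq> (\<lambda>x. mul x b) ` ?S 1"
      proof
        fix z assume z: "z \<in> ?S 3"
        then obtain x where "x \<in> Q" "z = mul x b" using right_div[OF b(2), of z] sQ[of 3] by auto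
        with z sub1[OF b(1), of x] show "z \<in> (\<lambda>x. mul x b) ` ?S 1" by blast
      qed
    qed
  qed
  ultimately show ?thesis
    using i unfolding block_length_def by (auto dest!: bij_betw_same_card)
qed

lemma card_block:
  assumes B: "B \<in> M" and fin: "finite Q"
  shows "card B = 3 * block_length Q \<alpha> B"
proof -
  let ?S = "block_labels Q \<alpha> B"
  have im: "B \<inter> Pc i = \<alpha> i ` ?S i" if "i \<in> {1, 2, 3}" for i
    using labeling[OF that] unfolding bij_betw_def block_labels_def by auto
  have c: "card (B \<inter> Pc i) = block_length Q \<alpha> B" if "i \<in> {1, 2, 3}" for i
  proof -
    have "inj_on (\<alpha> i) (?S i)"
      using labeling[OF that] unfolding bij_betw_def block_labels_def inj_on_def by auto
    then show ?thesis using im[OF that] block_cards[OF B that] by (simp add: card_image)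
  qed
  have f: "finite (B \<inter> Pc i)" if "i \<in> {1, 2, 3}" for i
    using im[OF that] fin unfolding block_labels_def by auto
  have "B = (\<Union>i\<in>{1, 2, 3}. B \<inter> Pc i)" using blocks B components by auto
  also have "card \<dots> = (\<Sum>i\<in>{1, 2, 3}. card (B \<inter> Pc i))"
    by (rule card_UN_disjoint)
      (use f components_disjoint in \<open>auto simp: disjoint_family_on_def\<close>)
  also have "\<dots> = 3 * block_length Q \<alpha> B" using c by simp
  finally show ?thesis .
qed

end

type_synonym 'p point_block = "'p set \<times> 'p set set"

definition multinet_iso :: "'p point_block \<Rightarrow> 'r point_block \<Rightarrow> bool" where
  "multinet_iso N N' \<longleftrightarrow> (\<exists>f. bij_betw f (fst N) (fst N') \<and> (`) f ` snd N = snd N')"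

text \<open>As in \<^term>\<open>BijGroup\<close>, automorphisms are extensional functions on the point set.\<close>

definition multinet_aut :: "'p point_block \<Rightarrow> ('p \<Rightarrow> 'p) monoid" where
  "multinet_aut N = BijGroup (fst N) \<lparr>carrier := {f \<in> Bij (fst N). (`) f ` snd N = snd N}\<rparr>"

text \<open>Since the order is finite, labels and points may be taken to be natural numbers in the
  following two definitions.\<close>

definition order6_with_superline_length :: "'p point_block \<Rightarrow> nat \<Rightarrow> bool" where
  "order6_with_superline_length N k \<longleftrightarrow>
     (\<exists>(Q :: nat set) mul Pc \<alpha>.
        light_dual_multinet Q mul (fst N) (snd N) Pc \<alpha> \<and> card Q = 6 \<and>
        (\<exists>!B. superline Q \<alpha> (snd N) B) \<and>
        (\<forall>B. superline Q \<alpha> (snd N) B \<longrightarrow> block_length Q \<alpha> B = k))"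

definition label_indices :: "'p point_block \<Rightarrow> nat set" where
  "label_indices N =
     {j \<in> {1..12}.
        \<exists>(N' :: nat point_block) (Q :: nat set) mul Pc \<alpha>.
          multinet_iso N N' \<and>
          light_dual_multinet Q mul (fst N') (snd N') Pc \<alpha> \<and>
          isostrophic Q mul {1..6} (Q6 j)}"


section \<open>Group structures\<close>

abbreviation C :: "nat \<Rightarrow> int monoid" where
  "C n \<equiv> integer_mod_group n"

definition semidirect ::
    "('a, 'c) monoid_scheme \<Rightarrow> ('b, 'd) monoid_scheme \<Rightarrow> ('b \<Rightarrow> 'a \<Rightarrow> 'a) \<Rightarrow> ('a \<times> 'b) monoid" where
  "semidirect A B \<phi> =
     \<lparr>carrier = carrier A \<times> carrier B,
      mult = (\<lambda>(a, b) (a', b'). (a \<otimes>\<^bsub>A\<^esub> \<phi> b a', b \<otimes>\<^bsub>B\<^esub> b')),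
      one = (\<one>\<^bsub>A\<^esub>, \<one>\<^bsub>B\<^esub>)\<rparr>"

lemma group_semidirect:
  assumes A: "group A" and B: "group B" and \<phi>: "\<phi> \<in> hom B (AutoGroup A)"
  shows "group (semidirect A B \<phi>)"
proof -
  interpret A: group A by fact
  interpret B: group B by fact
  have aut: "\<phi> b \<in> auto A" if "b \<in> carrier B" for b
    using \<phi> that by (auto simp: hom_def AutoGroup_def)
  then have Bij: "\<phi> b \<in> Bij (carrier A)" if "b \<in> carrier B" for b
    using that by (auto simp: auto_def)
  have clos: "\<phi> b a \<in> carrier A" if "b \<in> carrier B" "a \<in> carrier A" for a b
    using Bij_imp_funcset[OF Bij[OF that(1)]] that(2) by auto
  have mult: "\<phi> b (a \<otimes>\<^bsub>A\<^esub> a') = \<phi> b a \<otimes>\<^bsub>A\<^esub> \<phi> b a'"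
    if "b \<in> carrier B" "a \<in> carrier A" "a' \<in> carrier A" for a a' b
    using aut[OF that(1)] that by (auto simp: auto_def hom_def)
  have comp: "\<phi> (b \<otimes>\<^bsub>B\<^esub> b') a = \<phi> b (\<phi> b' a)"
    if "b \<in> carrier B" "b' \<in> carrier B" "a \<in> carrier A" for a b b'
  proof -
    have "\<phi> (b \<otimes>\<^bsub>B\<^esub> b') = \<phi> b \<otimes>\<^bsub>AutoGroup A\<^esub> \<phi> b'" using \<phi> that by (auto simp: hom_def)
    also have "\<dots> = compose (carrier A) (\<phi> b) (\<phi> b')"
      using Bij that by (simp add: AutoGroup_def BijGroup_def)
    finally show ?thesis using that by (simp add: compose_def)
  qed
  have one: "\<phi> \<one>\<^bsub>B\<^esub> a = a" if a: "a \<in> carrier A" for a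
  proof -
    have "inj_on (\<phi> \<one>\<^bsub>B\<^esub>) (carrier A)" using Bij[OF B.one_closed] by (auto simp: Bij_def bij_betw_def)
    moreover have "\<phi> \<one>\<^bsub>B\<^esub> (\<phi> \<one>\<^bsub>B\<^esub> a) = \<phi> \<one>\<^bsub>B\<^esub> a"
      by (metis comp[OF B.one_closed B.one_closed a] B.l_one[OF B.one_closed])
    ultimately show ?thesis
      by (rule inj_onD) (use a clos[OF B.one_closed a] in simp_all)
  qed
  show ?thesis
  proof (rule groupI)
    fix x assume "x \<in> carrier (semidirect A B \<phi>)"
    then obtain a b where x: "x = (a, b)" "a \<in> carrier A" "b \<in> carrier B"
      by (auto simp: semidirect_def)
    show "\<exists>y\<in>carrier (semidirect A B \<phi>). y \<otimes>\<^bsub>semidirect A B \<phi>\<^esub> x = \<one>\<^bsub>semidirect A B \<phi>\<^esub>"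
      by (rule bexI[of _ "(inv\<^bsub>A\<^esub> (\<phi> (inv\<^bsub>B\<^esub> b) a), inv\<^bsub>B\<^esub> b)"])
        (use x in \<open>simp_all add: semidirect_def clos\<close>)
  qed (auto simp: semidirect_def clos mult comp one A.m_assoc B.m_assoc)
qed

definition is_semidirect_product ::
    "('g, 'x) monoid_scheme \<Rightarrow> ('a, 'c) monoid_scheme \<Rightarrow> ('b, 'd) monoid_scheme \<Rightarrow> bool" where
  "is_semidirect_product G A B \<longleftrightarrow> (\<exists>\<phi> \<in> hom B (AutoGroup A). G \<cong> semidirect A B \<phi>)"

text \<open>The shape \<open>((C\<^sub>3 \<times> C\<^sub>3 \<times> C\<^sub>3) : C\<^sub>3) : (C\<^sub>2 \<times> C\<^sub>2)\<close>.\<close>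

definition is_C3_cubed_C3_C2_C2 :: "('g, 'x) monoid_scheme \<Rightarrow> bool" where
  "is_C3_cubed_C3_C2_C2 G \<longleftrightarrow>
     (\<exists>\<phi> \<in> hom (C 3) (AutoGroup (C 3 \<times>\<times> C 3 \<times>\<times> C 3)).
        is_semidirect_product G (semidirect (C 3 \<times>\<times> C 3 \<times>\<times> C 3) (C 3) \<phi>) (C 2 \<times>\<times> C 2))"

text \<open>The index is the number of vertices of the polygon, so \<open>dihedral n\<close> has order \<open>2 n\<close>.\<close>

definition dihedral :: "nat \<Rightarrow> (int \<times> int) monoid" where
  "dihedral n =
     semidirect (C n) (C 2)
       (\<lambda>s. \<lambda>x\<in>carrier (C n). if s = 0 then x else inv\<^bsub>C n\<^esub> x)"

lemma dihedral_action:
  "(\<lambda>s. \<lambda>x\<in>carrier (C n). if s = 0 then x else inv\<^bsub>C n\<^esub> x)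
     \<in> hom (C 2) (AutoGroup (C n))"
proof -
  interpret group "C n" by simp
  let ?i = "\<lambda>s :: int. \<lambda>x\<in>carrier (C n). if s = 0 then x else inv\<^bsub>C n\<^esub> x"
  have comm: "x \<otimes>\<^bsub>C n\<^esub> y = y \<otimes>\<^bsub>C n\<^esub> x" for x y by (simp add: add.commute)
  have "bij_betw (?i s) (carrier (C n)) (carrier (C n))" for s
    by (rule bij_betw_byWitness[where f' = "?i s"])
      (auto simp del: inv_integer_mod_group mult_integer_mod_group)
  then have Bij: "?i s \<in> Bij (carrier (C n))" for s by (simp add: Bij_def)
  have "?i s \<in> hom (C n) (C n)" for s
    by (rule homI)
      (auto simp: inv_mult_group comm simp del: inv_integer_mod_group mult_integer_mod_group)
  with Bij have "?i s \<in> auto (C n)" for s by (simp add: auto_def)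
  moreover have "?i (s \<otimes>\<^bsub>C 2\<^esub> t) = compose (carrier (C n)) (?i s) (?i t)"
    if "s \<in> carrier (C 2)" "t \<in> carrier (C 2)" for s t
  proof -
    have "s = 0 \<or> s = 1" "t = 0 \<or> t = 1" using that by (auto simp: carrier_integer_mod_group)
    moreover have "(1 :: int) \<otimes>\<^bsub>C 2\<^esub> 1 = 0" "(0 :: int) \<otimes>\<^bsub>C 2\<^esub> 1 = 1"
      "(1 :: int) \<otimes>\<^bsub>C 2\<^esub> 0 = 1" "(0 :: int) \<otimes>\<^bsub>C 2\<^esub> 0 = 0" by simp_all
    ultimately show ?thesis
      by (auto simp: compose_def fun_eq_iff restrict_def
          simp del: inv_integer_mod_group mult_integer_mod_group)
  qed
  ultimately show ?thesis
    using Bij by (auto simp: hom_def AutoGroup_def BijGroup_def)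
qed

lemma group_dihedral: "group (dihedral n)"
  unfolding dihedral_def by (intro group_semidirect dihedral_action) simp_all

lemma order_dihedral: "n > 0 \<Longrightarrow> order (dihedral n) = 2 * n"
  by (simp add: order_def dihedral_def semidirect_def carrier_integer_mod_group)

abbreviation D8 :: "(int \<times> int) monoid" where
  "D8 \<equiv> dihedral 4"

end

theory Submission
  imports Defs
begin

text \<open>
  A multinet of order \<open>6\<close> with a unique superline of length \<open>k\<close> is a Latin square of order \<open>6\<close> with a
  \<open>k \<times> k\<close> subsquare cut out, and \<open>k \<in> {2, 3}\<close>.  Two points in the same component, not both on the
  superline, lie on no common block, whereas points of distinct components always do; hence
  the components can be recovered from the blocks, isomorphisms permute them, and the quasigroups
  labeling a multinet are up to isostrophy the fillings of the hole.

  A suitable choice of the labelings makes the square reduced with its hole in the corner; for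
  \<open>k = 2\<close> the second row is moreover determined by a derangement of four symbols, which is a
  product of two transpositions or a cycle.  This leaves \<open>224 + 176 + 48\<close> squares, each of which is
  mapped to one of sixteen representatives by an explicit permutation of the points.  The
  sixteen sets of indices of fillings are pairwise distinct, so the representatives are not
  isomorphic.  The twelve quasigroups are told apart by counting two small configurations.
  Automorphisms are bounded in number by a backtracking search and generated by explicit permutations.
\<close>

text \<open>Isomorphisms may exchange rows, columns and symbols, so tables alone are too rigid:
  everything is stated for the eighteen points and for collinearity, which
  \<open>third_point\<close> computes from a table. The permutations, generators and search plans
  listed below are bare data; each is checked by evaluation inside the logic, which is why numerals
  are unfolded to successors and the code equations avoid needless work. One search serves twice.
  With an empty hole (\<open>k = 0\<close>) the number of solutions of a fixed plan is an isostrophy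
  invariant, which separates the twelve quasigroups; with the true hole it bounds the number of
  automorphisms. Separating the twelve classes also makes the label sets exact: without it a filling
  could belong to classes other than the certified one. An automorphism group is identified without
  analysing the group itself: a model group acts faithfully by explicit permutations, and the search
  bound equals the order of the model, so the embedding is onto.\<close>

datatype component = Row | Col | Sym

definition dec :: "nat \<Rightarrow> component \<times> nat" where
  "dec u = (if u < 6 then (Row, u) else if u < 12 then (Col, u - 6) else (Sym, u - 12))"

definition inhole :: "nat \<Rightarrow> nat \<Rightarrow> bool" where
  "inhole k u \<longleftrightarrow> snd (dec u) < k"

definition hole :: "nat \<Rightarrow> nat set" where
  "hole k = {u. u < 18 \<and> inhole k u}"

definition lines :: "nat \<Rightarrow> (nat \<Rightarrow> nat \<Rightarrow> nat) \<Rightarrow> nat set set" where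
  "lines k L = {{x, 6 + y, 12 + L x y} | x y. x < 6 \<and> y < 6 \<and> \<not> (x < k \<and> y < k)}"

definition net :: "nat \<Rightarrow> (nat \<Rightarrow> nat \<Rightarrow> nat) \<Rightarrow> nat point_block" where
  "net k L = ({..<18}, insert (hole k) (lines k L))"

definition on_line :: "nat \<Rightarrow> (nat \<Rightarrow> nat \<Rightarrow> nat) \<Rightarrow> nat \<Rightarrow> nat \<Rightarrow> nat \<Rightarrow> bool" where
  "on_line k L u v w \<longleftrightarrow> u \<noteq> v \<and> u \<noteq> w \<and> v \<noteq> w \<and> {u, v, w} \<in> lines k L"

text \<open>Only closure of the corner is demanded; the two division conditions of a subsquare
  follow by finiteness in \<open>holed_hole\<close>. The value \<open>k = 0\<close> is allowed and
  makes the hole empty.\<close>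

definition holed :: "nat \<Rightarrow> (nat \<Rightarrow> nat \<Rightarrow> nat) \<Rightarrow> bool" where
  "holed k L \<longleftrightarrow> quasigroup {..<6} L \<and> (\<forall>x<k. \<forall>y<k. L x y < k) \<and> k < 6"

section \<open>Latin squares of order 6 with a subsquare in the corner\<close>

lemma (in quasigroup) mul_left_cancel:
  "\<lbrakk>x \<in> Q; y \<in> Q; y' \<in> Q\<rbrakk> \<Longrightarrow> mul x y = mul x y' \<longleftrightarrow> y = y'"
  using left_div[of x "mul x y"] closed[of x y] by metis

lemma (in quasigroup) mul_right_cancel:
  "\<lbrakk>x \<in> Q; x' \<in> Q; y \<in> Q\<rbrakk> \<Longrightarrow> mul x y = mul x' y \<longleftrightarrow> x = x'"
  using right_div[of y "mul x y"] closed[of x y] by metis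

lemma holed_quasigroup: "holed k L \<Longrightarrow> quasigroup {..<6} L"
  by (simp add: holed_def)

lemma holed_less: "\<lbrakk>holed k L; x < 6; y < 6\<rbrakk> \<Longrightarrow> L x y < 6"
  using quasigroup.closed[OF holed_quasigroup, of k L x y] by simp

lemma holed_left_cancel: "\<lbrakk>holed k L; x < 6; y < 6; y' < 6\<rbrakk> \<Longrightarrow> L x y = L x y' \<longleftrightarrow> y = y'"
  using quasigroup.mul_left_cancel[OF holed_quasigroup, of k L x y y'] by simp

lemma holed_right_cancel: "\<lbrakk>holed k L; x < 6; x' < 6; y < 6\<rbrakk> \<Longrightarrow> L x y = L x' y \<longleftrightarrow> x = x'"
  using quasigroup.mul_right_cancel[OF holed_quasigroup, of k L x x' y] by simp

text \<open>An injective map of the finite set \<open>{..<k}\<close> into itself is onto, so in a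
  row or column through the hole the values below \<open>k\<close> are already used up inside
  it.\<close>

lemma holed_hole:
  assumes "holed k L" "x < 6" "y < 6"
  shows "x < k \<Longrightarrow> y < k \<longleftrightarrow> L x y < k" "y < k \<Longrightarrow> x < k \<longleftrightarrow> L x y < k"
proof -
  have k: "k < 6" and sub: "\<And>x y. x < k \<Longrightarrow> y < k \<Longrightarrow> L x y < k"
    using assms(1) by (auto simp: holed_def)
  show "y < k \<longleftrightarrow> L x y < k" if x: "x < k"
  proof
    assume *: "L x y < k"
    have "inj_on (L x) {..<k}"
      using holed_left_cancel[OF assms(1,2)] k by (auto simp: inj_on_def)
    then have "L x ` {..<k} = {..<k}"
      by (intro endo_inj_surj) (use sub x in auto)
    then obtain y' where "y' < k" "L x y = L x y'" using * by (metis imageE lessThan_iff)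
    then show "y < k" using holed_left_cancel[OF assms(1,2,3), of y'] k by simp
  qed (use sub x in auto)
  show "x < k \<longleftrightarrow> L x y < k" if y: "y < k"
  proof
    assume *: "L x y < k"
    have "inj_on (\<lambda>x. L x y) {..<k}"
      using holed_right_cancel[OF assms(1)] assms(3) k by (auto simp: inj_on_def)
    then have "(\<lambda>x. L x y) ` {..<k} = {..<k}"
      by (intro endo_inj_surj) (use sub y in auto)
    then obtain x' where "x' < k" "L x y = L x' y" using * by (metis (no_types, lifting) imageE lessThan_iff)
    then show "x < k" using holed_right_cancel[OF assms(1,2), of x' y] assms(3) k by simp
  qed (use sub y in auto)
qed

lemma triple_eq_iff:
  fixes x y z x' y' z' :: nat
  assumes "x < 6" "y < 6" "z < 6" "x' < 6" "y' < 6" "z' < 6"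
  shows "{x, 6 + y, 12 + z} = {x', 6 + y', 12 + z'} \<longleftrightarrow> x = x' \<and> y = y' \<and> z = z'"
proof
  assume e: "{x, 6 + y, 12 + z} = {x', 6 + y', 12 + z'}"
  have "x \<in> {x', 6 + y', 12 + z'}" "6 + y \<in> {x', 6 + y', 12 + z'}" "12 + z \<in> {x', 6 + y', 12 + z'}"
    using e by blast+
  then show "x = x' \<and> y = y' \<and> z = z'" using assms by auto
qed auto

lemma lines_memI: "\<lbrakk>x < 6; y < 6; \<not> (x < k \<and> y < k)\<rbrakk> \<Longrightarrow> {x, 6 + y, 12 + L x y} \<in> lines k L"
  unfolding lines_def by blast

lemma lines_sub: "holed k L \<Longrightarrow> B \<in> lines k L \<Longrightarrow> B \<subseteq> {..<18}"
  unfolding lines_def using holed_less[of k L] by fastforce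

lemma card_line: "B \<in> lines k L \<Longrightarrow> card B = 3"
  by (auto simp: lines_def card_insert_if)

lemma finite_lines: "finite (lines k L)"
proof -
  have "lines k L \<subseteq> (\<lambda>(x, y). {x, 6 + y, 12 + L x y}) ` ({..<6} \<times> {..<6})"
    by (auto simp: lines_def)
  then show ?thesis by (rule finite_subset) auto
qed

text \<open>The number depends on \<open>k\<close> only; this is what turns an injection between the
  lines of two squares into a bijection.\<close>

lemma card_lines:
  assumes "holed k L"
  shows "card (lines k L) = card {(x, y). x < 6 \<and> y < 6 \<and> \<not> (x < k \<and> y < (k::nat))}"
proof -
  let ?I = "{(x, y). x < 6 \<and> y < 6 \<and> \<not> (x < k \<and> y < (k::nat))}"
  let ?f = "\<lambda>(x, y). {x, 6 + y, 12 + L x y}"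
  have "inj_on ?f ?I"
  proof (rule inj_onI, clarify)
    fix x y x' y'
    assume "x < 6" "y < 6" "x' < 6" "y' < 6" "{x, 6 + y, 12 + L x y} = {x', 6 + y', 12 + L x' y'}"
    then show "x = x' \<and> y = y'"
      using triple_eq_iff[of x y "L x y" x' y' "L x' y'"] holed_less[OF assms] by blast
  qed
  moreover have "lines k L = ?f ` ?I" by (auto simp: lines_def)
  ultimately show ?thesis by (simp add: card_image)
qed

lemma nat_less18_cases:
  assumes "(u::nat) < 18"
  obtains "u < 6" | y where "y < 6" "u = 6 + y" | z where "z < 6" "u = 12 + z"
proof -
  consider "u < 6" | "6 \<le> u" "u < 12" | "12 \<le> u" by linarith
  then show ?thesis
  proof cases
    case 2 then show ?thesis using that(2)[of "u - 6"] by simp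
  next
    case 3 then show ?thesis using that(3)[of "u - 12"] assms by simp
  qed (use that in blast)
qed

lemma inhole_simps [simp]:
  "x < 6 \<Longrightarrow> inhole k x = (x < k)"
  "y < 6 \<Longrightarrow> inhole k (6 + y) = (y < k)"
  "z < 6 \<Longrightarrow> inhole k (12 + z) = (z < k)"
  by (auto simp: inhole_def dec_def)

lemma on_line_cases:
  assumes "on_line k L u v w"
  obtains x y where "x < 6" "y < 6" "\<not> (x < k \<and> y < k)"
    "(u, v, w) \<in> {(x, 6 + y, 12 + L x y), (x, 12 + L x y, 6 + y), (6 + y, x, 12 + L x y),
       (6 + y, 12 + L x y, x), (12 + L x y, x, 6 + y), (12 + L x y, 6 + y, x)}"
proof -
  obtain x y where xy: "x < 6" "y < 6" "\<not> (x < k \<and> y < k)" "{u, v, w} = {x, 6 + y, 12 + L x y}"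
    using assms by (auto simp: on_line_def lines_def)
  have "u \<in> {x, 6 + y, 12 + L x y}" "v \<in> {x, 6 + y, 12 + L x y}" "w \<in> {x, 6 + y, 12 + L x y}"
    using xy(4) by blast+
  moreover have "u \<noteq> v" "u \<noteq> w" "v \<noteq> w" using assms by (auto simp: on_line_def)
  ultimately show ?thesis using that[OF xy(1-3)] by auto
qed

lemma on_line_triple:
  assumes "x < 6" "y < 6" "\<not> (x < k \<and> y < k)"
  shows "on_line k L x (6 + y) (12 + L x y)"
  using assms lines_memI[OF assms] by (auto simp: on_line_def)

lemma on_line_perm:
  assumes "on_line k L u v w"
  shows "on_line k L u w v" "on_line k L v u w" "on_line k L v w u" "on_line k L w u v" "on_line k L w v u"
  using assms by (auto simp: on_line_def insert_commute)

lemma triple_common: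
  fixes u x y z x' y' z' :: nat
  assumes "x < 6" "y < 6" "z < 6" "x' < 6" "y' < 6" "z' < 6"
    and "u \<in> {x, 6 + y, 12 + z}" "u \<in> {x', 6 + y', 12 + z'}"
  shows "u = x \<and> x = x' \<or> u = 6 + y \<and> y = y' \<or> u = 12 + z \<and> z = z'"
  using assms(7,8) assms(1-6) by (elim insertE emptyE) linarith+

text \<open>Two common points fix two of the three entries of a cell triple, and cancellation fixes
  the remaining one.\<close>

lemma line_unique:
  assumes h: "holed k L" and B: "B \<in> lines k L" and B': "B' \<in> lines k L"
    and uv: "u \<noteq> v" "{u, v} \<subseteq> B" "{u, v} \<subseteq> B'"
  shows "B = B'"
proof -
  obtain x y where xy: "x < 6" "y < 6" "B = {x, 6 + y, 12 + L x y}" using B unfolding lines_def by blast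
  obtain x' y' where xy': "x' < 6" "y' < 6" "B' = {x', 6 + y', 12 + L x' y'}"
    using B' unfolding lines_def by blast
  have z: "L x y < 6" "L x' y' < 6" using xy xy' holed_less[OF h] by auto
  have u: "u = x \<and> x = x' \<or> u = 6 + y \<and> y = y' \<or> u = 12 + L x y \<and> L x y = L x' y'"
    by (rule triple_common) (use xy xy' z uv in blast)+
  have v: "v = x \<and> x = x' \<or> v = 6 + y \<and> y = y' \<or> v = 12 + L x y \<and> L x y = L x' y'"
    by (rule triple_common) (use xy xy' z uv in blast)+
  have "x = x' \<and> y = y' \<or> x = x' \<and> L x y = L x' y' \<or> y = y' \<and> L x y = L x' y'"
    using u v uv(1) by blast
  then have "x = x' \<and> y = y'"
    using holed_left_cancel[OF h, of x y y'] holed_right_cancel[OF h, of x x' y] xy xy' by metis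
  then show ?thesis using xy xy' by simp
qed

text \<open>The third point on the line through \<open>u\<close> and \<open>v\<close>, with junk value \<open>18\<close> when \<open>u\<close> and \<open>v\<close>
  lie in the same component or both in the hole.\<close>

fun idx :: "nat \<Rightarrow> nat list \<Rightarrow> nat" where
  "idx z [] = 0"
| "idx z (x # xs) = (if x = z then 0 else Suc (idx z xs))"

fun third :: "nat \<Rightarrow> (nat \<Rightarrow> nat list) \<Rightarrow> component \<times> nat \<Rightarrow> component \<times> nat \<Rightarrow> nat" where
  "third k T (Row, x) (Row, y) = 18"
| "third k T (Row, x) (Col, y) = (if x < k \<and> y < k then 18 else 12 + T x ! y)"
| "third k T (Row, x) (Sym, z) = (if x < k \<and> z < k then 18 else 6 + idx z (T x))"
| "third k T (Col, y) (Row, x) = (if x < k \<and> y < k then 18 else 12 + T x ! y)"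
| "third k T (Col, y) (Col, x) = 18"
| "third k T (Col, y) (Sym, z) = (if y < k \<and> z < k then 18 else idx z (map (\<lambda>x. T x ! y) [0..<6]))"
| "third k T (Sym, z) (Row, x) = (if x < k \<and> z < k then 18 else 6 + idx z (T x))"
| "third k T (Sym, z) (Col, y) = (if y < k \<and> z < k then 18 else idx z (map (\<lambda>x. T x ! y) [0..<6]))"
| "third k T (Sym, z) (Sym, x) = 18"

definition third_point :: "nat \<Rightarrow> (nat \<Rightarrow> nat list) \<Rightarrow> nat \<Rightarrow> nat \<Rightarrow> nat" where
  "third_point k T u v = third k T (dec u) (dec v)"

definition entry :: "(nat \<Rightarrow> nat list) \<Rightarrow> nat \<Rightarrow> nat \<Rightarrow> nat" where
  "entry T x y = T x ! y"

definition table :: "(nat \<Rightarrow> nat list) \<Rightarrow> bool" where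
  "table T \<longleftrightarrow> (\<forall>x<6. length (T x) = 6)"

lemma idx_nth: "distinct xs \<Longrightarrow> i < length xs \<Longrightarrow> idx (xs ! i) xs = i"
proof (induction xs arbitrary: i)
  case (Cons a xs)
  then show ?case by (cases i) auto
qed simp

lemma nth_idx: "z \<in> set xs \<Longrightarrow> idx z xs < length xs \<and> xs ! idx z xs = z"
  by (induction xs) auto

lemma bij_betw_row: "holed k L \<Longrightarrow> x < 6 \<Longrightarrow> bij_betw (L x) {..<6} {..<6}"
  unfolding bij_betw_def
  by (intro conjI endo_inj_surj) (auto simp: inj_on_def holed_left_cancel holed_less)

lemma bij_betw_col: "holed k L \<Longrightarrow> y < 6 \<Longrightarrow> bij_betw (\<lambda>x. L x y) {..<6} {..<6}"
  unfolding bij_betw_def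
  by (intro conjI endo_inj_surj) (auto simp: inj_on_def holed_right_cancel holed_less)

lemma map_nth_upt: "length xs = n \<Longrightarrow> map ((!) xs) [0..<n] = xs"
  by (metis map_nth)

lemma row_list:
  assumes "table T" "holed k (entry T)" "x < 6"
  shows "length (T x) = 6" "distinct (T x)" "set (T x) = {..<6}"
proof -
  show l: "length (T x) = 6" using assms by (simp add: table_def)
  have m: "T x = map (entry T x) [0..<6]" using map_nth_upt[OF l] by (simp add: entry_def[abs_def])
  have b: "bij_betw (entry T x) {0..<6} {0..<6}" using bij_betw_row[OF assms(2,3)] by (simp add: lessThan_atLeast0)
  have "set (T x) = entry T x ` {0..<6}" by (subst m) (simp only: set_map set_upt)
  then show "set (T x) = {..<6}" using b by (simp add: bij_betw_def lessThan_atLeast0)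
  show "distinct (T x)" by (subst m) (use b in \<open>simp add: distinct_map bij_betw_def\<close>)
qed

lemma col_list:
  assumes "table T" "holed k (entry T)" "y < 6"
  shows "distinct (map (\<lambda>x. T x ! y) [0..<6])" "set (map (\<lambda>x. T x ! y) [0..<6]) = {..<6}"
proof -
  have m: "map (\<lambda>x. T x ! y) [0..<6] = map (\<lambda>x. entry T x y) [0..<6]"
    by (simp add: entry_def)
  have b: "bij_betw (\<lambda>x. entry T x y) {0..<6} {0..<6}" using bij_betw_col[OF assms(2,3)] by (simp add: lessThan_atLeast0)
  show "set (map (\<lambda>x. T x ! y) [0..<6]) = {..<6}"
    unfolding m by (simp only: set_map set_upt) (use b in \<open>simp add: bij_betw_def lessThan_atLeast0\<close>)
  show "distinct (map (\<lambda>x. T x ! y) [0..<6])" unfolding m using b by (simp add: distinct_map bij_betw_def)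
qed

lemma idx_row:
  assumes "table T" "holed k (entry T)" "x < 6" "y < 6"
  shows "idx (entry T x y) (T x) = y"
  using row_list[OF assms(1-3)] assms(4) by (simp add: entry_def idx_nth)

lemma idx_col:
  assumes "table T" "holed k (entry T)" "x < 6" "y < 6"
  shows "idx (entry T x y) (map (\<lambda>x. T x ! y) [0..<6]) = x"
  using idx_nth[OF col_list(1)[OF assms(1,2,4)], of x] assms by (simp add: entry_def table_def)

text \<open>Any two of the three points of a cell may be looked up, in either order;
  \<open>holed_hole\<close> guarantees that none of these lookups falls into the guarded hole
  case.\<close>

lemma third_point_on_line:
  assumes t: "table T" and h: "holed k (entry T)" and l: "on_line k (entry T) u v w"
  shows "third_point k T u v = w"
  using l
proof (cases rule: on_line_cases)
  case (1 x y)
  have z: "entry T x y < 6" using holed_less[OF h 1(1,2)] .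
  have i: "idx (entry T x y) (T x) = y" "idx (entry T x y) (map (\<lambda>x. T x ! y) [0..<6]) = x"
    using idx_row[OF t h 1(1,2)] idx_col[OF t h 1(1,2)] .
  have k: "\<not> (x < k \<and> entry T x y < k)" "\<not> (y < k \<and> entry T x y < k)"
    using holed_hole[OF h 1(1,2)] 1(3) by auto
  have "third_point k T x (6 + y) = 12 + entry T x y" "third_point k T (6 + y) x = 12 + entry T x y"
    using 1(1-3) by (auto simp: third_point_def dec_def entry_def)
  moreover have "third_point k T x (12 + entry T x y) = 6 + y" "third_point k T (12 + entry T x y) x = 6 + y"
    using 1(1) z i(1) k(1) by (auto simp: third_point_def dec_def)
  moreover have "third_point k T (6 + y) (12 + entry T x y) = x" "third_point k T (12 + entry T x y) (6 + y) = x"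
    using 1(2) z i(2) k(2) by (auto simp: third_point_def dec_def)
  ultimately show ?thesis
    using 1(4) by (elim insertE emptyE Pair_inject) simp_all
qed

text \<open>A lookup below 18 can only come from an unguarded case, where bijectivity of rows and
  columns supplies a cell; its third point is then the looked-up one by
  \<open>third_point_on_line\<close>.\<close>

lemma on_line_third_point:
  assumes t: "table T" and h: "holed k (entry T)" and uv: "u < 18" "v < 18" and w: "third_point k T u v < 18"
  shows "on_line k (entry T) u v (third_point k T u v)"
proof -
  have "\<exists>w. on_line k (entry T) u v w"
  proof -
    have rc: "\<exists>w. on_line k (entry T) x (6 + y) w \<and> on_line k (entry T) (6 + y) x w"
      if "x < 6" "y < 6" "\<not> (x < k \<and> y < k)" for x y
      using on_line_triple[OF that, of "entry T"] on_line_perm(2)[OF on_line_triple[OF that, of "entry T"]] by blast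
    have rs: "\<exists>w. on_line k (entry T) x (12 + z) w \<and> on_line k (entry T) (12 + z) x w"
      if xz: "x < 6" "z < 6" "\<not> (x < k \<and> z < k)" for x z
    proof -
      obtain y where y: "y < 6" "entry T x y = z"
        using bij_betw_row[OF h xz(1)] xz(2) by (metis bij_betw_iff_bijections lessThan_iff)
      then have "\<not> (x < k \<and> y < k)" using that holed_hole(1)[OF h, of x y] by auto
      from on_line_triple[OF xz(1) y(1) this, of "entry T"] y(2)
      have "on_line k (entry T) x (6 + y) (12 + z)" by simp
      from on_line_perm(1)[OF this] on_line_perm(4)[OF this] show ?thesis by blast
    qed
    have cs: "\<exists>w. on_line k (entry T) (6 + y) (12 + z) w \<and> on_line k (entry T) (12 + z) (6 + y) w"
      if yz: "y < 6" "z < 6" "\<not> (y < k \<and> z < k)" for y z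
    proof -
      obtain x where x: "x < 6" "entry T x y = z"
        using bij_betw_col[OF h yz(1)] yz(2) by (metis bij_betw_iff_bijections lessThan_iff)
      then have "\<not> (x < k \<and> y < k)" using that holed_hole(2)[OF h, of x y] by auto
      from on_line_triple[OF x(1) yz(1) this, of "entry T"] x(2)
      have "on_line k (entry T) x (6 + y) (12 + z)" by simp
      from on_line_perm(3)[OF this] on_line_perm(5)[OF this] show ?thesis by blast
    qed
    from uv(1) show ?thesis
    proof (cases rule: nat_less18_cases)
      case 1
      from uv(2) show ?thesis
      proof (cases rule: nat_less18_cases)
        case 1 with \<open>u < 6\<close> w show ?thesis by (simp add: third_point_def dec_def)
      next
        case (2 y) with \<open>u < 6\<close> w rc[of u y] show ?thesis by (auto simp: third_point_def dec_def split: if_splits)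
      next
        case (3 z) with \<open>u < 6\<close> w rs[of u z] show ?thesis by (auto simp: third_point_def dec_def split: if_splits)
      qed
    next
      case (2 y)
      note u = this
      from uv(2) show ?thesis
      proof (cases rule: nat_less18_cases)
        case 1 with u w rc[of v y] show ?thesis by (auto simp: third_point_def dec_def split: if_splits)
      next
        case (2 y) with u w show ?thesis by (simp add: third_point_def dec_def)
      next
        case (3 z) with u w cs[of y z] show ?thesis by (auto simp: third_point_def dec_def split: if_splits)
      qed
    next
      case (3 z)
      note u = this
      from uv(2) show ?thesis
      proof (cases rule: nat_less18_cases)
        case 1 with u w rs[of v z] show ?thesis by (auto simp: third_point_def dec_def split: if_splits)
      next
        case (2 y) with u w cs[of y z] show ?thesis by (auto simp: third_point_def dec_def split: if_splits)
      next
        case 3 with u w show ?thesis by (simp add: third_point_def dec_def)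
      qed
    qed
  qed
  then obtain w where w: "on_line k (entry T) u v w" by blast
  with third_point_on_line[OF t h w] show ?thesis by simp
qed

section \<open>Deciding from a table whether it is a square with a hole\<close>

lemma quasigroupI:
  assumes fin: "finite Q" and cl: "\<And>x y. x \<in> Q \<Longrightarrow> y \<in> Q \<Longrightarrow> mul x y \<in> Q"
    and row: "\<And>x. x \<in> Q \<Longrightarrow> inj_on (mul x) Q"
    and col: "\<And>y. y \<in> Q \<Longrightarrow> inj_on (\<lambda>x. mul x y) Q"
  shows "quasigroup Q mul"
proof
  fix x z assume x: "x \<in> Q" and z: "z \<in> Q"
  have "mul x ` Q = Q" by (rule endo_inj_surj[OF fin _ row[OF x]]) (use cl x in auto)
  with z obtain y where y: "y \<in> Q" "z = mul x y" by (metis imageE)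
  show "\<exists>!y. y \<in> Q \<and> mul x y = z"
    by (rule ex1I[of _ y]) (use y inj_onD[OF row[OF x]] in auto)
next
  fix y z assume y: "y \<in> Q" and z: "z \<in> Q"
  have "(\<lambda>x. mul x y) ` Q = Q" by (rule endo_inj_surj[OF fin _ col[OF y]]) (use cl y in auto)
  with z obtain x where x: "x \<in> Q" "z = mul x y" by (metis (no_types, lifting) imageE)
  show "\<exists>!x. x \<in> Q \<and> mul x y = z"
    by (rule ex1I[of _ x]) (use x inj_onD[OF col[OF y]] in auto)
qed (use cl in auto)

definition square :: "nat \<Rightarrow> (nat \<Rightarrow> nat list) \<Rightarrow> bool" where
  "square k T \<longleftrightarrow> k < 6 \<and>
     list_all (\<lambda>x. length (T x) = 6 \<and> distinct (T x) \<and> list_all (\<lambda>v. v < 6) (T x)) [0..<6] \<and>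
     list_all (\<lambda>y. distinct (map (\<lambda>x. T x ! y) [0..<6])) [0..<6] \<and>
     list_all (\<lambda>x. list_all (\<lambda>y. T x ! y < k) [0..<k]) [0..<k]"

lemma square_table: "square k T \<Longrightarrow> table T"
  by (simp add: square_def table_def list_all_iff)

lemma square_holed:
  assumes "square k T"
  shows "holed k (entry T)"
proof -
  have l: "\<And>x. x < 6 \<Longrightarrow> length (T x) = 6" "\<And>x. x < 6 \<Longrightarrow> distinct (T x)"
    "\<And>x y. x < 6 \<Longrightarrow> y < 6 \<Longrightarrow> T x ! y < 6"
    "\<And>y. y < 6 \<Longrightarrow> distinct (map (\<lambda>x. T x ! y) [0..<6])" "\<And>x y. x < k \<Longrightarrow> y < k \<Longrightarrow> T x ! y < k" "k < 6"
    using assms by (auto simp: square_def list_all_iff all_set_conv_all_nth simp del: upt_Suc)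
  have "quasigroup {..<6} (entry T)"
  proof (rule quasigroupI)
    show "inj_on (entry T x) {..<6}" if "x \<in> {..<6}" for x
      using that l(1,2)[of x] by (auto simp: inj_on_def entry_def nth_eq_iff_index_eq)
    show "inj_on (\<lambda>x. entry T x y) {..<6}" if "y \<in> {..<6}" for y
      using that l(4)[of y] by (simp add: distinct_map entry_def lessThan_atLeast0 del: upt_Suc)
  qed (use l in \<open>auto simp: entry_def\<close>)
  then show ?thesis using l by (auto simp: holed_def entry_def)
qed

section \<open>Maps between nets\<close>

text \<open>Components are not mentioned, as the map may exchange them. Preserving hole membership
  pointwise and lines forwards suffices, since the converse directions follow by counting.\<close>

definition net_map ::
    "nat \<Rightarrow> (nat \<Rightarrow> nat \<Rightarrow> nat) \<Rightarrow> (nat \<Rightarrow> nat \<Rightarrow> nat) \<Rightarrow> (nat \<Rightarrow> nat) \<Rightarrow> bool" where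
  "net_map k L L' f \<longleftrightarrow> bij_betw f {..<18} {..<18} \<and> (\<forall>u<18. inhole k (f u) = inhole k u) \<and>
     (\<forall>B\<in>lines k L. f ` B \<in> lines k L')"

lemma net_map_less: "net_map k L L' f \<Longrightarrow> u < 18 \<Longrightarrow> f u < 18"
  unfolding net_map_def by (meson bij_betwE lessThan_iff)

lemma net_map_inj: "net_map k L L' f \<Longrightarrow> u < 18 \<Longrightarrow> v < 18 \<Longrightarrow> f u = f v \<longleftrightarrow> u = v"
  unfolding net_map_def bij_betw_def inj_on_def by auto

lemma on_line_less: 
  assumes "holed k L" "on_line k L u v w" shows "u < 18 \<and> v < 18 \<and> w < 18"
proof -
  have "{u, v, w} \<subseteq> {..<18}" using lines_sub[OF assms(1)] assms(2) unfolding on_line_def by blast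
  then show ?thesis by simp
qed

lemma net_map_on_line:
  assumes "holed k L" "net_map k L L' f" "on_line k L u v w"
  shows "on_line k L' (f u) (f v) (f w)"
proof -
  have "f ` {u, v, w} \<in> lines k L'" using assms(2,3) unfolding net_map_def on_line_def by blast
  moreover have "f ` {u, v, w} = {f u, f v, f w}" by simp
  ultimately show ?thesis
    using assms(3) on_line_less[OF assms(1,3)] net_map_inj[OF assms(2)] unfolding on_line_def by metis
qed

lemma finite_hole: "finite (hole k)"
  unfolding hole_def by simp

text \<open>Both parts are injections of finite sets: the hole goes into itself, and the lines go
  into a set of the same size by \<open>card_lines\<close>.\<close>

lemma net_map_blocks:
  assumes h: "holed k L" "holed k L'" and f: "net_map k L L' f"
  shows "(`) f ` snd (net k L) = snd (net k L')"
proof -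
  have inj: "inj_on f {..<18}" using f by (simp add: net_map_def bij_betw_def)
  have "f ` hole k = hole k"
    by (rule endo_inj_surj[OF finite_hole])
      (use f net_map_less[OF f] inj_on_subset[OF inj, of "{u. u < 18 \<and> inhole k u}"] in \<open>auto simp: hole_def net_map_def\<close>)
  moreover have "(`) f ` lines k L = lines k L'"
  proof (rule card_subset_eq[OF finite_lines])
    show "(`) f ` lines k L \<subseteq> lines k L'" using f by (auto simp: net_map_def)
    have "inj_on ((`) f) (lines k L)"
      by (rule inj_on_subset[OF inj_on_image_Pow[OF inj]]) (use lines_sub[OF h(1)] in blast)
    then show "card ((`) f ` lines k L) = card (lines k L')"
      using card_lines[OF h(1)] card_lines[OF h(2)] by (simp add: card_image)
  qed
  ultimately show ?thesis by (simp add: net_def)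
qed

text \<open>Needed because searches may also demand that points are not joined. Every line of the
  target is the image of a line, and injectivity pulls the two points back onto it.\<close>

lemma net_map_on_line_iff:
  assumes h: "holed k L" "holed k L'" and f: "net_map k L L' f" and uv: "u < 18" "v < 18"
  shows "(\<exists>w. on_line k L' (f u) (f v) w) \<longleftrightarrow> (\<exists>w. on_line k L u v w)"
proof
  assume "\<exists>w. on_line k L' (f u) (f v) w"
  then obtain w where w: "on_line k L' (f u) (f v) w" by blast
  have inj: "inj_on f {..<18}" using f by (simp add: net_map_def bij_betw_def)
  have "{f u, f v, w} \<in> (`) f ` lines k L"
  proof -
    \<comment> \<open>The line could only be the image of the hole if all three of its points lay in
      the hole, which no line allows.\<close>
    have "{f u, f v, w} \<noteq> f ` hole k"
    proof
      assume e: "{f u, f v, w} = f ` hole k"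
      have "f ` hole k \<subseteq> hole k" using f net_map_less[OF f] by (auto simp: hole_def net_map_def)
      then have "{f u, f v, w} \<subseteq> hole k" using e by simp
      then have "inhole k (f u)" "inhole k (f v)" "inhole k w" by (simp_all add: hole_def)
      from w this show False
        by (cases rule: on_line_cases) (auto simp: holed_less[OF h(2)])
    qed
    moreover have "{f u, f v, w} \<in> (`) f ` snd (net k L)"
      using net_map_blocks[OF h f] w by (simp add: net_def on_line_def)
    ultimately show ?thesis by (auto simp: net_def)
  qed
  then obtain B where B: "B \<in> lines k L" "f ` B = {f u, f v, w}" by blast
  have "f u \<in> f ` B" "f v \<in> f ` B" using B(2) by auto
  then have uB: "u \<in> B" "v \<in> B"
    using inj_on_image_mem_iff[OF inj, of u B] inj_on_image_mem_iff[OF inj, of v B] lines_sub[OF h(1) B(1)] uv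
    by auto
  have "u \<noteq> v" using w by (auto simp: on_line_def)
  with uB card_line[OF B(1)] have "card (B - {u, v}) = 1"
    by (subst card_Diff_subset) auto
  then obtain w' where "B - {u, v} = {w'}" by (auto simp: card_1_singleton_iff)
  then have "B = {u, v, w'}" "u \<noteq> w'" "v \<noteq> w'" using uB by auto
  then show "\<exists>w. on_line k L u v w" using B(1) \<open>u \<noteq> v\<close> by (auto simp: on_line_def)
qed (use net_map_on_line[OF h(1) f] in blast)

lemma card_hole:
  assumes "k \<in> {2, 3}"
  shows "card (hole k) = 3 * k"
proof -
  have e: "hole k = set (filter (inhole k) [0..<18])" by (auto simp: hole_def)
  have "card (set (filter (inhole 2) [0..<18])) = 3 * 2" "card (set (filter (inhole 3) [0..<18])) = 3 * 3"
    by code_simp+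
  then show ?thesis using assms unfolding e by auto
qed

text \<open>Lines have 3 points and the hole has 6 or 9, so a bijection preserving the blocks cannot
  exchange the hole with a line.\<close>

lemma blocks_net_map:
  assumes h: "holed k L" "holed k L'" and k: "k \<in> {2, 3}" and bij: "bij_betw f {..<18} {..<18}"
    and b: "(`) f ` snd (net k L) = snd (net k L')"
  shows "net_map k L L' f"
proof -
  have inj: "inj_on f {..<18}" using bij by (simp add: bij_betw_def)
  have hs: "hole k \<subseteq> {..<18}" by (auto simp: hole_def)
  have img: "f ` B \<in> insert (hole k) (lines k L')" if "B \<in> insert (hole k) (lines k L)" for B
    using b that unfolding net_def by auto
  have L: "f ` B \<in> lines k L'" if B: "B \<in> lines k L" for B
  proof -
    have "card (f ` B) = 3"
      using card_line[OF B] card_image[OF inj_on_subset[OF inj lines_sub[OF h(1) B]]] by simp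
    then have "f ` B \<noteq> hole k" using card_hole[OF k] k by auto
    then show ?thesis using img B by auto
  qed
  have H: "f ` hole k = hole k"
  proof -
    have "card (f ` hole k) = 3 * k"
      using card_hole[OF k] card_image[OF inj_on_subset[OF inj hs]] by simp
    then have "f ` hole k \<notin> lines k L'" using card_line[of "f ` hole k" k L'] k by auto
    then show ?thesis using img by auto
  qed
  have "inhole k (f u) = inhole k u" if u: "u < 18" for u
  proof -
    have fu: "f u < 18" using bij u by (meson bij_betwE lessThan_iff)
    have "f u \<in> hole k \<longleftrightarrow> u \<in> hole k"
      using inj_on_image_mem_iff[OF inj, of u "hole k"] hs u H by simp
    then show ?thesis using u fu by (simp add: hole_def)
  qed
  with L bij show ?thesis by (simp add: net_map_def)
qed

text \<open>Entry \<open>p ! u\<close> is the image of point \<open>u\<close>. The lookup in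
  \<open>T'\<close> must return an entry of \<open>p\<close>, which lies below 18, so the junk value
  can never satisfy the test.\<close>

definition iso_cert :: "nat \<Rightarrow> (nat \<Rightarrow> nat list) \<Rightarrow> (nat \<Rightarrow> nat list) \<Rightarrow> nat list \<Rightarrow> bool" where
  "iso_cert k T T' p \<longleftrightarrow> length p = 18 \<and> distinct p \<and> list_all (\<lambda>v. v < 18) p \<and>
     list_all (\<lambda>u. inhole k (p ! u) = inhole k u) [0..<18] \<and>
     list_all (\<lambda>x. list_all (\<lambda>y. x < k \<and> y < k \<or>
       third_point k T' (p ! x) (p ! (6 + y)) = p ! (12 + T x ! y)) [0..<6]) [0..<6]"

lemma iso_cert_net_map:
  assumes T: "square k T" and T': "square k T'" and c: "iso_cert k T T' p"
  shows "net_map k (entry T) (entry T') ((!) p)"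
  unfolding net_map_def
proof (intro conjI allI impI ballI)
  have p: "length p = 18" "distinct p" "\<And>u. u < 18 \<Longrightarrow> p ! u < 18"
    using c by (auto simp: iso_cert_def list_all_iff all_set_conv_all_nth)
  have inj: "inj_on ((!) p) {..<18}" using p by (simp add: inj_on_nth)
  show "bij_betw ((!) p) {..<18} {..<18}"
    unfolding bij_betw_def using inj p by (intro conjI endo_inj_surj) auto
  show "inhole k (p ! u) = inhole k u" if "u < 18" for u
    using c that by (auto simp: iso_cert_def list_all_iff)
  fix B assume "B \<in> lines k (entry T)"
  then obtain x y where B: "x < 6" "y < 6" "\<not> (x < k \<and> y < k)" "B = {x, 6 + y, 12 + entry T x y}"
    unfolding lines_def by blast
  have z: "entry T x y < 6" using holed_less[OF square_holed[OF T] B(1,2)] .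
  have t: "third_point k T' (p ! x) (p ! (6 + y)) = p ! (12 + entry T x y)"
  proof -
    have "\<forall>x\<in>{0..<6}. \<forall>y\<in>{0..<6}. x < k \<and> y < k \<or> third_point k T' (p ! x) (p ! (6 + y)) = p ! (12 + entry T x y)"
      using c by (simp add: iso_cert_def list_all_iff entry_def)
    then show ?thesis using B(1-3) by (meson atLeastLessThan_iff zero_le)
  qed
  have "on_line k (entry T') (p ! x) (p ! (6 + y)) (p ! (12 + entry T x y))"
    using on_line_third_point[OF square_table[OF T'] square_holed[OF T'], of "p ! x" "p ! (6 + y)"] t p B z by auto
  then have "{p ! x, p ! (6 + y), p ! (12 + entry T x y)} \<in> lines k (entry T')" by (simp add: on_line_def)
  then show "(!) p ` B \<in> lines k (entry T')" using B(4) by simp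
qed

lemma multinet_iso_netI:
  assumes "holed k L" "holed k L'" "net_map k L L' f"
  shows "multinet_iso (net k L) (net k L')"
  using net_map_blocks[OF assms] assms(3) unfolding multinet_iso_def net_map_def net_def by auto

section \<open>Backtracking search\<close>

text \<open>A plan builds a list of points one position at a time. \<open>Free h js\<close> chooses
  any new point with hole flag \<open>h\<close> that shares no line with those at positions
  \<open>js\<close>; \<open>Forced i j\<close> appends the third point of the line through positions
  \<open>i\<close> and \<open>j\<close>; \<open>Check i j l\<close> tests collinearity without
  appending.\<close>

datatype step = Free bool "nat list" | Forced nat nat | Check nat nat nat

fun ok :: "nat \<Rightarrow> (nat \<Rightarrow> nat list) \<Rightarrow> bool \<Rightarrow> nat list \<Rightarrow> nat list \<Rightarrow> nat \<Rightarrow> bool" where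
  "ok k T h js acc v \<longleftrightarrow> \<not> List.member acc v \<and> inhole k v = h \<and> list_all (\<lambda>i. third_point k T (acc ! i) v = 18) js"

fun search :: "nat \<Rightarrow> (nat \<Rightarrow> nat list) \<Rightarrow> step list \<Rightarrow> nat list \<Rightarrow> nat list list" where
  "search k T [] acc = [acc]"
| "search k T (Free h js # pl) acc =
     concat (map (\<lambda>v. search k T pl (acc @ [v])) (filter (ok k T h js acc) (rev [0..<18])))"
| "search k T (Forced i j # pl) acc =
     (if third_point k T (acc ! i) (acc ! j) < 18 \<and> third_point k T (acc ! i) (acc ! j) \<notin> set acc
      then search k T pl (acc @ [third_point k T (acc ! i) (acc ! j)]) else [])"
| "search k T (Check i j l # pl) acc =
     (if third_point k T (acc ! i) (acc ! j) = acc ! l then search k T pl acc else [])"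

text \<open>The constraints of a plan read as a predicate on a complete list, with \<open>n\<close>
  the number of positions already consumed. Distinctness, which the search enforces, is kept as a
  separate condition on \<open>us\<close>.\<close>

fun valid :: "nat \<Rightarrow> (nat \<Rightarrow> nat list) \<Rightarrow> step list \<Rightarrow> nat list \<Rightarrow> nat \<Rightarrow> bool" where
  "valid k T [] us n \<longleftrightarrow> n = length us"
| "valid k T (Free h js # pl) us n \<longleftrightarrow> n < length us \<and> inhole k (us ! n) = h \<and>
     list_all (\<lambda>i. i < n \<and> third_point k T (us ! i) (us ! n) = 18) js \<and> valid k T pl us (Suc n)"
| "valid k T (Forced i j # pl) us n \<longleftrightarrow> n < length us \<and> i < n \<and> j < n \<and>
     third_point k T (us ! i) (us ! j) = us ! n \<and> valid k T pl us (Suc n)"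
| "valid k T (Check i j l # pl) us n \<longleftrightarrow> n \<le> length us \<and> i < n \<and> j < n \<and> l < n \<and>
     third_point k T (us ! i) (us ! j) = us ! l \<and> valid k T pl us n"

text \<open>Besides the two lookup lemmas this rests on lookups never exceeding 18, so that failing
  to be below 18 means being 18.\<close>

lemma third_point_junk_iff:
  assumes "square k T" "u < 18" "v < 18"
  shows "third_point k T u v = 18 \<longleftrightarrow> \<not> (\<exists>w. on_line k (entry T) u v w)"
proof -
  note T = square_table[OF assms(1)] square_holed[OF assms(1)]
  have "third k T (dec u) (dec v) \<le> 18"
  proof -
    have "idx z (T x) < 6" if "x < 6" "z < 6" for x z
      using nth_idx[of z "T x"] row_list[OF T that(1)] that(2) by auto
    then have b1: "idx z (T x) \<le> 12" if "x < 6" "z < 6" for x z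
      using that by fastforce
    have "idx z (map (\<lambda>x. T x ! y) [0..<6]) < 6" if "y < 6" "z < 6" for y z
      using nth_idx[of z "map (\<lambda>x. T x ! y) [0..<6]"] col_list[OF T that(1)] that(2)
      by (simp del: upt_Suc)
    then have b2: "idx z (map (\<lambda>x. T x ! y) [0..<6]) \<le> 18" if "y < 6" "z < 6" for y z
      using that by fastforce
    have b3: "T x ! y \<le> 6" if "x < 6" "y < 6" for x y
      using holed_less[OF T(2) that] by (simp add: entry_def)
    have d: "snd (dec u) < 6" "snd (dec v) < 6" using assms by (auto simp: dec_def)
    show ?thesis
      by (cases "(k, T, dec u, dec v)" rule: third.cases) (use d in \<open>auto simp: b1 b2 b3 simp del: upt_Suc\<close>)
  qed
  then have "third_point k T u v < 18 \<or> third_point k T u v = 18" by (auto simp: third_point_def)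
  then show ?thesis
    using on_line_third_point[OF T assms(2,3)] third_point_on_line[OF T] on_line_less[OF T(2)] by (metis less_irrefl)
qed

lemma net_map_third_point:
  assumes T: "square k T" and T': "square k T'" and f: "net_map k (entry T) (entry T') f"
    and uv: "u < 18" "v < 18" "third_point k T u v < 18"
  shows "third_point k T' (f u) (f v) = f (third_point k T u v)"
  by (rule third_point_on_line[OF square_table[OF T'] square_holed[OF T']])
    (rule net_map_on_line[OF square_holed[OF T] f on_line_third_point[OF square_table[OF T] square_holed[OF T] uv]])

text \<open>A net map sends lines to lines, unjoined pairs to unjoined pairs and hole points to hole
  points, so the image of a list obeying the plan is a branch that the search in the target
  visits.\<close>

lemma search_complete:
  assumes T: "square k T" and T': "square k T'" and f: "net_map k (entry T) (entry T') f"
    and us: "distinct us" "set us \<subseteq> {..<18}"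
  shows "valid k T pl us n \<Longrightarrow> map f us \<in> set (search k T' pl (map f (take n us)))"
proof (induction pl arbitrary: n)
  case Nil then show ?case by simp
next
  case (Cons s pl)
  have less: "us ! i < 18" if "i < length us" for i using us(2) that by (meson lessThan_iff nth_mem subsetD)
  have new: "f (us ! n) \<notin> set (map f (take n us))" if n: "n < length us"
  proof
    assume "f (us ! n) \<in> set (map f (take n us))"
    then obtain i where "i < n" "f (us ! n) = f (us ! i)" using n by (auto simp: in_set_conv_nth)
    then have "us ! n = us ! i" using net_map_inj[OF f] less n by auto
    then show False using us(1) \<open>i < n\<close> n by (simp add: nth_eq_iff_index_eq)
  qed
  have junk: "third_point k T' (f (us ! i)) (f (us ! j)) = 18" if "i < length us" "j < length us" "third_point k T (us ! i) (us ! j) = 18" for i j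
    using third_point_junk_iff[OF T less less] third_point_junk_iff[OF T' net_map_less[OF f less] net_map_less[OF f less]]
      net_map_on_line_iff[OF square_holed[OF T] square_holed[OF T'] f less less] that by blast
  have app: "map f (take n us) @ [f (us ! n)] = map f (take (Suc n) us)" if "n < length us"
    using that by (simp add: take_Suc_conv_app_nth)
  show ?case
  proof (cases s)
    case (Free h js)
    with Cons have n: "n < length us" "inhole k (us ! n) = h" "valid k T pl us (Suc n)"
      and j: "\<forall>i\<in>set js. i < n \<and> third_point k T (us ! i) (us ! n) = 18" by (auto simp: list_all_iff)
    have jj: "list_all (\<lambda>i. third_point k T' (map f (take n us) ! i) (f (us ! n)) = 18) js"
      using junk n(1) j by (auto simp: list_all_iff)
    have "map f us \<in> set (search k T' pl (map f (take n us) @ [f (us ! n)]))"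
      using Cons.IH[OF n(3)] app[OF n(1)] by simp
    moreover have "f (us ! n) < 18" "inhole k (f (us ! n)) = h"
      using f n less[OF n(1)] net_map_less[OF f] by (auto simp: net_map_def)
    ultimately show ?thesis using new[OF n(1)] Free jj by (auto simp del: upt_Suc)
  next
    case (Forced i j)
    with Cons have n: "n < length us" "i < n" "j < n" "third_point k T (us ! i) (us ! j) = us ! n"
      "valid k T pl us (Suc n)" by auto
    have "third_point k T' (f (us ! i)) (f (us ! j)) = f (us ! n)"
      using net_map_third_point[OF T T' f, of "us ! i" "us ! j"] n less by auto
    then show ?thesis
      using Forced n app[OF n(1)] Cons.IH[OF n(5)] new[OF n(1)] net_map_less[OF f less[OF n(1)]] by simp
  next
    case (Check i j l)
    with Cons have n: "n \<le> length us" "i < n" "j < n" "l < n" "third_point k T (us ! i) (us ! j) = us ! l"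
      "valid k T pl us n" by auto
    have "third_point k T' (f (us ! i)) (f (us ! j)) = f (us ! l)"
      using net_map_third_point[OF T T' f, of "us ! i" "us ! j"] n less by auto
    then show ?thesis using Check n Cons.IH[OF n(6)] by simp
  qed
qed

fun wf_plan :: "step list \<Rightarrow> nat \<Rightarrow> bool" where
  "wf_plan [] n = True"
| "wf_plan (Free h js # pl) n = (list_all (\<lambda>i. i < n) js \<and> wf_plan pl (Suc n))"
| "wf_plan (Forced i j # pl) n = (i < n \<and> j < n \<and> wf_plan pl (Suc n))"
| "wf_plan (Check i j l # pl) n = (i < n \<and> j < n \<and> l < n \<and> wf_plan pl n)"

text \<open>Converse of \<open>search_complete\<close> within a single net. \<open>wf_plan\<close>
  ensures that every index points to an already chosen position, so later extensions do not alter
  the tests.\<close>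

lemma search_valid:
  assumes "xs \<in> set (search k T pl acc)" "wf_plan pl (length acc)" "distinct acc" "set acc \<subseteq> {..<18}"
  shows "take (length acc) xs = acc \<and> distinct xs \<and> set xs \<subseteq> {..<18} \<and> length acc \<le> length xs \<and>
    valid k T pl xs (length acc)"
  using assms
proof (induction pl arbitrary: acc)
  case (Cons s pl)
  have nth: "xs ! i = acc ! i" if "take n xs = acc @ zs" "i < length acc" "i < n" for i n zs
    using that by (metis nth_append nth_take)
  have last: "xs ! length acc = v" if "take (Suc (length acc)) xs = acc @ [v]" for v
    using that by (metis lessI nth_append_length nth_take)
  show ?case
  proof (cases s)
    case (Free h js)
    with Cons.prems obtain v where v: "v \<notin> set acc" "inhole k v = h" "v < 18"
      "xs \<in> set (search k T pl (acc @ [v]))" "\<forall>i\<in>set js. third_point k T (acc ! i) v = 18"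
      by (auto simp: list_all_iff simp del: upt_Suc)
    have IH: "take (Suc (length acc)) xs = acc @ [v]" "distinct xs" "set xs \<subseteq> {..<18}"
      "Suc (length acc) \<le> length xs" "valid k T pl xs (Suc (length acc))"
      using Cons.IH[OF v(4)] Cons.prems Free v by auto
    have "take (length acc) xs = acc" using arg_cong[OF IH(1), of "take (length acc)"] by simp
    moreover have "\<forall>i\<in>set js. i < length acc \<and> third_point k T (xs ! i) (xs ! length acc) = 18"
      using v(5) Cons.prems(2) Free last[OF IH(1)] nth[OF IH(1)] by (auto simp: list_all_iff)
    ultimately show ?thesis using IH last[OF IH(1)] v Free by (auto simp: list_all_iff)
  next
    case (Forced i j)
    define v where "v = third_point k T (acc ! i) (acc ! j)"
    with Cons.prems Forced have v: "v \<notin> set acc" "v = third_point k T (acc ! i) (acc ! j)" "v < 18"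
      "xs \<in> set (search k T pl (acc @ [v]))" by (auto split: if_splits)
    have IH: "take (Suc (length acc)) xs = acc @ [v]" "distinct xs" "set xs \<subseteq> {..<18}"
      "Suc (length acc) \<le> length xs" "valid k T pl xs (Suc (length acc))"
      using Cons.IH[OF v(4)] Cons.prems Forced v by auto
    have "take (length acc) xs = acc" using arg_cong[OF IH(1), of "take (length acc)"] by simp
    then show ?thesis using IH last[OF IH(1)] v Forced nth[OF IH(1)] Cons.prems(2) by auto
  next
    case (Check i j l)
    with Cons.prems have v: "third_point k T (acc ! i) (acc ! j) = acc ! l" "xs \<in> set (search k T pl acc)"
      by (auto split: if_splits)
    have IH: "take (length acc) xs = acc" "distinct xs" "set xs \<subseteq> {..<18}"
      "length acc \<le> length xs" "valid k T pl xs (length acc)"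
      using Cons.IH[OF v(2)] Cons.prems Check by auto
    then show ?thesis using v Check nth[of "length acc" "[]"] Cons.prems(2) by auto
  qed
qed auto

lemma distinct_concat_map:
  assumes "distinct xs" "\<And>x. x \<in> set xs \<Longrightarrow> distinct (g x)"
    and "\<And>x y. x \<in> set xs \<Longrightarrow> y \<in> set xs \<Longrightarrow> x \<noteq> y \<Longrightarrow> set (g x) \<inter> set (g y) = {}"
  shows "distinct (concat (map g xs))"
  using assms by (induction xs) auto

text \<open>Branches with different choices differ at the position of that choice, so no solution is
  listed twice and lengths count solutions.\<close>

lemma distinct_search:
  "wf_plan pl (length acc) \<Longrightarrow> distinct acc \<Longrightarrow> set acc \<subseteq> {..<18} \<Longrightarrow> distinct (search k T pl acc)"
proof (induction pl arbitrary: acc)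
  case (Cons s pl)
  show ?case
  proof (cases s)
    case (Free h js)
    show ?thesis unfolding Free search.simps
    proof (rule distinct_concat_map)
      fix v assume v: "v \<in> set (filter (ok k T h js acc) (rev [0..<18]))"
      then show "distinct (search k T pl (acc @ [v]))"
        using Cons Free by (auto simp del: upt_Suc)
      fix w assume w: "w \<in> set (filter (ok k T h js acc) (rev [0..<18]))" "v \<noteq> w"
      have pre: "take (Suc (length acc)) xs = acc @ [v]"
        if "xs \<in> set (search k T pl (acc @ [v]))" "v < 18" "v \<notin> set acc" for xs v
        using search_valid[OF that(1)] that Cons.prems Free by auto
      show "set (search k T pl (acc @ [v])) \<inter> set (search k T pl (acc @ [w])) = {}"
      proof (rule ccontr)
        assume "set (search k T pl (acc @ [v])) \<inter> set (search k T pl (acc @ [w])) \<noteq> {}"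
        then obtain xs where "xs \<in> set (search k T pl (acc @ [v]))" "xs \<in> set (search k T pl (acc @ [w]))" by blast
        then have "acc @ [v] = acc @ [w]" using pre[of xs v] pre[of xs w] v w by (auto simp del: upt_Suc)
        then show False using w(2) by simp
      qed
    qed (simp del: upt_Suc)
  next
    case (Forced i j) then show ?thesis using Cons by auto
  next
    case (Check i j l) then show ?thesis using Cons by auto
  qed
qed simp

text \<open>Composition with an injective \<open>f\<close> embeds the solutions over
  \<open>T\<close> into those over \<open>T'\<close>.\<close>

lemma search_length_le:
  assumes T: "square k T" and T': "square k T'" and f: "net_map k (entry T) (entry T') f"
    and wf: "wf_plan pl 0"
  shows "length (search k T pl []) \<le> length (search k T' pl [])"
proof -
  have v: "distinct xs \<and> set xs \<subseteq> {..<18} \<and> valid k T pl xs 0" if "xs \<in> set (search k T pl [])" for xs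
    using search_valid[OF that] wf by simp
  have "map f ` set (search k T pl []) \<subseteq> set (search k T' pl [])"
    using search_complete[OF T T' f] v by fastforce
  moreover have "inj_on (map f) (set (search k T pl []))"
  proof (rule inj_onI)
    fix xs ys assume *: "xs \<in> set (search k T pl [])" "ys \<in> set (search k T pl [])" "map f xs = map f ys"
    have "inj_on f (set xs \<union> set ys)"
      using f v[OF *(1)] v[OF *(2)] by (auto simp: net_map_def bij_betw_def intro: inj_on_subset)
    with *(3) show "xs = ys" by (rule map_inj_on)
  qed
  ultimately have "card (set (search k T pl [])) \<le> card (set (search k T' pl []))"
    by (metis List.finite_set card_image card_mono)
  then show ?thesis using distinct_card[OF distinct_search] wf by (metis list.size(3) distinct.simps(1) empty_set empty_subsetI)
qed

section \<open>Evaluation by rewriting\<close>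

text \<open>Unary constants, since code equations match natural numbers against \<open>0\<close> and \<open>Suc\<close>.\<close>

abbreviation "d1 \<equiv> Suc 0"
abbreviation "d2 \<equiv> Suc d1"
abbreviation "d3 \<equiv> Suc d2"
abbreviation "d4 \<equiv> Suc d3"
abbreviation "d5 \<equiv> Suc d4"
abbreviation "d6 \<equiv> Suc d5"
abbreviation "d7 \<equiv> Suc d6"
abbreviation "d8 \<equiv> Suc d7"
abbreviation "d9 \<equiv> Suc d8"
abbreviation "d10 \<equiv> Suc d9"
abbreviation "d11 \<equiv> Suc d10"
abbreviation "d12 \<equiv> Suc d11"
abbreviation "d13 \<equiv> Suc d12"
abbreviation "d14 \<equiv> Suc d13"
abbreviation "d15 \<equiv> Suc d14"
abbreviation "d16 \<equiv> Suc d15"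
abbreviation "d17 \<equiv> Suc d16"
abbreviation "d18 \<equiv> Suc d17"
abbreviation (input) "s6 y \<equiv> Suc (Suc (Suc (Suc (Suc (Suc y)))))"
abbreviation (input) "s12 z \<equiv> Suc (Suc (Suc (Suc (Suc (Suc (Suc (Suc (Suc (Suc (Suc (Suc z)))))))))))"

lemma dec_code [code]:
  "dec 0 = (Row, 0)"
  "dec d1 = (Row, d1)"
  "dec d2 = (Row, d2)"
  "dec d3 = (Row, d3)"
  "dec d4 = (Row, d4)"
  "dec d5 = (Row, d5)"
  "dec d6 = (Col, 0)"
  "dec d7 = (Col, d1)"
  "dec d8 = (Col, d2)"
  "dec d9 = (Col, d3)"
  "dec d10 = (Col, d4)"
  "dec d11 = (Col, d5)"
  "dec (s12 z) = (Sym, z)"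
  by (simp_all add: dec_def)

lemma third_code [code]:
  "third k T (Row, x) (Row, x') = d18"
  "third k T (Row, x) (Col, y) = (if x < k \<and> y < k then d18 else s12 (T x ! y))"
  "third k T (Row, x) (Sym, z) = (if x < k \<and> z < k then d18 else s6 (idx z (T x)))"
  "third k T (Col, y) (Row, x) = (if x < k \<and> y < k then d18 else s12 (T x ! y))"
  "third k T (Col, y) (Col, y') = d18"
  "third k T (Col, y) (Sym, z) = (if y < k \<and> z < k then d18 else idx z (map (\<lambda>x. T x ! y) [0, d1, d2, d3, d4, d5]))"
  "third k T (Sym, z) (Row, x) = (if x < k \<and> z < k then d18 else s6 (idx z (T x)))"
  "third k T (Sym, z) (Col, y) = (if y < k \<and> z < k then d18 else idx z (map (\<lambda>x. T x ! y) [0, d1, d2, d3, d4, d5]))"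
  "third k T (Sym, z) (Sym, z') = d18"
proof -
  have "[0..<6] = [0, d1, d2, d3, d4, d5]" by (simp add: upt_rec)
  then show "third k T (Col, y) (Sym, z) = (if y < k \<and> z < k then d18 else idx z (map (\<lambda>x. T x ! y) [0, d1, d2, d3, d4, d5]))"
    "third k T (Sym, z) (Col, y) = (if y < k \<and> z < k then d18 else idx z (map (\<lambda>x. T x ! y) [0, d1, d2, d3, d4, d5]))"
    by (simp_all only: third.simps) simp_all
qed simp_all

text \<open>Nested conditionals instead of a conjunction, so that evaluation stops at the first
  failing test.\<close>

fun junk :: "(nat \<Rightarrow> nat \<Rightarrow> nat) \<Rightarrow> nat list \<Rightarrow> nat list \<Rightarrow> nat \<Rightarrow> bool" where
  "junk t [] acc v = True"
| "junk t (i # js) acc v = (if t (acc ! i) v = d18 then junk t js acc v else False)"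

lemma ok_code [code]:
  "ok k T h js acc v = (if List.member acc v then False
     else if inhole k v = h then junk (third_point k T) js acc v else False)"
  by (induction js) auto

text \<open>The candidate loop of a \<open>Free\<close> step, turned by the code equations into a
  recursion on the number of candidates left. It visits them downwards, in accordance with the
  \<open>rev\<close> in \<open>search\<close>.\<close>

definition search_free ::
    "nat \<Rightarrow> (nat \<Rightarrow> nat list) \<Rightarrow> bool \<Rightarrow> nat list \<Rightarrow> step list \<Rightarrow> nat list \<Rightarrow> nat \<Rightarrow> nat list list" where
  "search_free k T h js pl acc n =
     concat (map (\<lambda>v. search k T pl (acc @ [v])) (filter (ok k T h js acc) (rev [0..<n])))"

lemma search_free_code [code]:
  "search_free k T h js pl acc 0 = []"
  "search_free k T h js pl acc (Suc n) = (if ok k T h js acc n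
     then search k T pl (acc @ [n]) @ search_free k T h js pl acc n else search_free k T h js pl acc n)"
  by (simp_all add: search_free_def)

definition search_forced ::
    "nat \<Rightarrow> (nat \<Rightarrow> nat list) \<Rightarrow> step list \<Rightarrow> nat list \<Rightarrow> nat \<Rightarrow> nat list list" where
  "search_forced k T pl acc v =
     (if v < d18 then if List.member acc v then [] else search k T pl (acc @ [v]) else [])"

lemma search_code [code]:
  "search k T [] acc = [acc]"
  "search k T (Free h js # pl) acc = search_free k T h js pl acc d18"
  "search k T (Forced i j # pl) acc = search_forced k T pl acc (third_point k T (acc ! i) (acc ! j))"
  "search k T (Check i j l # pl) acc =
     (if third_point k T (acc ! i) (acc ! j) = acc ! l then search k T pl acc else [])"
proof -
  have d: "d18 = 18" by simp
  show "search k T (Free h js # pl) acc = search_free k T h js pl acc d18"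
    unfolding search_free_def d by simp
  show "search k T (Forced i j # pl) acc = search_forced k T pl acc (third_point k T (acc ! i) (acc ! j))"
    unfolding search_forced_def d by simp
qed simp_all

section \<open>Isostrophy\<close>

text \<open>The second relation reads coordinate \<open>\<tau> i\<close> where the first has
  \<open>i\<close>; hence the permutations compose as \<open>\<tau> \<circ> \<sigma>\<close> and the
  first bijections are reindexed by the inverse of \<open>\<tau>\<close>.\<close>

lemma isostrophic_trans:
  assumes "isostrophic Q mul R mul'" "isostrophic R mul' S mul''"
  shows "isostrophic Q mul S mul''"
proof -
  let ?I = "{1, 2, 3} :: nat set"
  obtain \<sigma> \<gamma> where s: "\<sigma> permutes ?I" and g: "\<forall>i\<in>?I. bij_betw (\<gamma> i) Q R"
    and sg: "\<And>x. (\<forall>i\<in>?I. x i \<in> Q) \<Longrightarrow> (mul (x (\<sigma> 1)) (x (\<sigma> 2)) = x (\<sigma> 3) \<longleftrightarrow>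
              mul' (\<gamma> 1 (x 1)) (\<gamma> 2 (x 2)) = \<gamma> 3 (x 3))"
    using assms(1) unfolding isostrophic_def by blast
  obtain \<tau> \<delta> where t: "\<tau> permutes ?I" and d: "\<forall>i\<in>?I. bij_betw (\<delta> i) R S"
    and td: "\<And>x. (\<forall>i\<in>?I. x i \<in> R) \<Longrightarrow> (mul' (x (\<tau> 1)) (x (\<tau> 2)) = x (\<tau> 3) \<longleftrightarrow>
              mul'' (\<delta> 1 (x 1)) (\<delta> 2 (x 2)) = \<delta> 3 (x 3))"
    using assms(2) unfolding isostrophic_def by blast
  let ?t = "inv_into UNIV \<tau>"
  have ti: "?t i \<in> ?I \<longleftrightarrow> i \<in> ?I" "?t (\<tau> i) = i" "\<tau> (?t i) = i" for i
    using permutes_in_image[OF permutes_inv[OF t]] permutes_inverses[OF t] by auto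
  have si: "\<sigma> i \<in> ?I \<longleftrightarrow> i \<in> ?I" for i using permutes_in_image[OF s] .
  show ?thesis unfolding isostrophic_def
  proof (intro exI conjI ballI allI impI)
    show "\<tau> \<circ> \<sigma> permutes ?I" using s t by (rule permutes_compose)
    show "bij_betw (\<delta> i \<circ> \<gamma> (?t i)) Q S" if "i \<in> ?I" for i
      by (rule bij_betw_trans) (use g d ti(1) that in blast)+
    fix x assume x: "\<forall>i\<in>?I. x i \<in> Q"
    have xt: "\<forall>i\<in>?I. x (\<tau> i) \<in> Q" using x permutes_in_image[OF t] by blast
    have R: "\<forall>i\<in>?I. \<gamma> (?t i) (x i) \<in> R"
      using g x ti(1) by (meson bij_betwE)
    have "mul (x (\<tau> (\<sigma> 1))) (x (\<tau> (\<sigma> 2))) = x (\<tau> (\<sigma> 3)) \<longleftrightarrow>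
        mul' (\<gamma> 1 (x (\<tau> 1))) (\<gamma> 2 (x (\<tau> 2))) = \<gamma> 3 (x (\<tau> 3))"
      using sg[of "x \<circ> \<tau>"] xt by simp
    also have "\<dots> \<longleftrightarrow> mul'' (\<delta> 1 (\<gamma> (?t 1) (x 1))) (\<delta> 2 (\<gamma> (?t 2) (x 2))) = \<delta> 3 (\<gamma> (?t 3) (x 3))"
      using td[of "\<lambda>i. \<gamma> (?t i) (x i)"] R by (simp add: ti(2))
    finally show "mul (x ((\<tau> \<circ> \<sigma>) 1)) (x ((\<tau> \<circ> \<sigma>) 2)) = x ((\<tau> \<circ> \<sigma>) 3) \<longleftrightarrow>
        mul'' ((\<delta> 1 \<circ> \<gamma> (?t 1)) (x 1)) ((\<delta> 2 \<circ> \<gamma> (?t 2)) (x 2)) = (\<delta> 3 \<circ> \<gamma> (?t 3)) (x 3)"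
      by simp
  qed
qed

lemma isostrophic_sym:
  assumes "isostrophic Q mul R mul'"
  shows "isostrophic R mul' Q mul"
proof -
  let ?I = "{1, 2, 3} :: nat set"
  obtain \<sigma> \<gamma> where s: "\<sigma> permutes ?I" and g: "\<forall>i\<in>?I. bij_betw (\<gamma> i) Q R"
    and sg: "\<And>x. (\<forall>i\<in>?I. x i \<in> Q) \<Longrightarrow> (mul (x (\<sigma> 1)) (x (\<sigma> 2)) = x (\<sigma> 3) \<longleftrightarrow>
              mul' (\<gamma> 1 (x 1)) (\<gamma> 2 (x 2)) = \<gamma> 3 (x 3))"
    using assms unfolding isostrophic_def by blast
  let ?s = "inv_into UNIV \<sigma>"
  have si: "?s i \<in> ?I \<longleftrightarrow> i \<in> ?I" "?s (\<sigma> i) = i" "\<sigma> (?s i) = i" "\<sigma> i \<in> ?I \<longleftrightarrow> i \<in> ?I" for i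
    using permutes_in_image[OF permutes_inv[OF s]] permutes_inverses[OF s] permutes_in_image[OF s] by auto
  define h where "h i = inv_into Q (\<gamma> i)" for i
  have h: "bij_betw (h i) R Q" "\<And>y. y \<in> R \<Longrightarrow> \<gamma> i (h i y) = y" if "i \<in> ?I" for i
    using g that unfolding h_def by (auto intro: bij_betw_inv_into simp: bij_betw_inv_into_right)
  show ?thesis unfolding isostrophic_def
  proof (intro exI conjI ballI allI impI)
    show "?s permutes ?I" using s by (rule permutes_inv)
    show "bij_betw (h (\<sigma> i)) R Q" if "i \<in> ?I" for i using h(1) si(4) that by blast
    fix x assume x: "\<forall>i\<in>?I. x i \<in> R"
    \<comment> \<open>The triple over \<open>Q\<close> with
      \<open>z (\<sigma> i) = h (\<sigma> i) (x i)\<close>, to which the given equivalence is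
      applied.\<close>
    define z where "z i = h i (x (?s i))" for i
    have xs: "x (?s i) \<in> R" if "i \<in> ?I" for i using x si(1) that by blast
    have z: "z i \<in> Q" "\<gamma> i (z i) = x (?s i)" if "i \<in> ?I" for i
      unfolding z_def using h(1)[OF that] h(2)[OF that xs[OF that]] xs[OF that] by (auto dest: bij_betwE)
    have "mul (z (\<sigma> 1)) (z (\<sigma> 2)) = z (\<sigma> 3) \<longleftrightarrow> mul' (\<gamma> 1 (z 1)) (\<gamma> 2 (z 2)) = \<gamma> 3 (z 3)"
      by (rule sg) (use z in blast)
    moreover have "\<gamma> 1 (z 1) = x (?s 1)" "\<gamma> 2 (z 2) = x (?s 2)" "\<gamma> 3 (z 3) = x (?s 3)"
      by (simp_all add: z)
    ultimately show "mul' (x (?s 1)) (x (?s 2)) = x (?s 3) \<longleftrightarrow>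
        mul (h (\<sigma> 1) (x 1)) (h (\<sigma> 2) (x 2)) = h (\<sigma> 3) (x 3)"
      by (simp add: z_def si(2))
  qed
qed

section \<open>Isostrophies as permutations of the eighteen points\<close>

definition pt :: "nat \<Rightarrow> nat \<Rightarrow> nat" where
  "pt i a = 6 * (i - 1) + a"

lemma pt_simps [simp]: "pt 1 a = a" "pt (Suc 0) a = a" "pt 2 a = 6 + a" "pt 3 a = 12 + a"
  by (simp_all add: pt_def)

lemma pt_div_mod:
  "i \<in> {1, 2, 3} \<Longrightarrow> a < 6 \<Longrightarrow> pt i a div 6 + 1 = i" "i \<in> {1, 2, 3} \<Longrightarrow> a < 6 \<Longrightarrow> pt i a mod 6 = a"
  by (auto simp: pt_def)

lemma pt_less: "i \<in> {1, 2, 3} \<Longrightarrow> a < 6 \<Longrightarrow> pt i a < 18"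
  by auto

lemma pt_inj:
  assumes "i \<in> {1, 2, 3}" "j \<in> {1, 2, 3}" "a < 6" "b < 6"
  shows "pt i a = pt j b \<longleftrightarrow> i = j \<and> a = b"
  using assms pt_div_mod by metis

lemma pt_cases:
  assumes "u < 18" obtains i a where "i \<in> {1, 2, 3}" "a < 6" "u = pt i a"
  using assms
proof (cases rule: nat_less18_cases)
  case 1 then show ?thesis using that[of 1 u] by simp
next
  case (2 y) then show ?thesis using that[of 2 y] by simp
next
  case (3 z) then show ?thesis using that[of 3 z] by simp
qed

text \<open>The entry in position \<open>i\<close> of a product triple of \<open>L\<close> becomes
  coordinate \<open>\<sigma> i\<close> of a triple of \<open>L'\<close>, so component
  \<open>i\<close> is carried to component \<open>\<sigma> i\<close> by
  \<open>\<gamma> (\<sigma> i)\<close>. With \<open>k = 0\<close> all 36 cells are lines, hence the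
  whole multiplication table is preserved.\<close>

lemma isostrophic_net_map:
  assumes "isostrophic {..<6} L {..<6} L'" and h: "holed 0 L"
  shows "\<exists>f. net_map 0 L L' f"
proof -
  let ?I = "{1, 2, 3} :: nat set"
  obtain \<sigma> \<gamma> where s: "\<sigma> permutes ?I" and g: "\<forall>i\<in>?I. bij_betw (\<gamma> i) {..<6::nat} {..<6}"
    and sg: "\<And>x. (\<forall>i\<in>?I. x i \<in> {..<6}) \<Longrightarrow> (L (x (\<sigma> 1)) (x (\<sigma> 2)) = x (\<sigma> 3) \<longleftrightarrow>
              L' (\<gamma> 1 (x 1)) (\<gamma> 2 (x 2)) = \<gamma> 3 (x 3))"
    using assms(1) unfolding isostrophic_def by blast
  have si: "\<sigma> i \<in> ?I" if "i \<in> ?I" for i using permutes_in_image[OF s] that by blast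
  have gl: "\<gamma> i a < 6" if "i \<in> ?I" "a < 6" for i a using g that by (meson bij_betwE lessThan_iff)
  define f where "f u = pt (\<sigma> (u div 6 + 1)) (\<gamma> (\<sigma> (u div 6 + 1)) (u mod 6))" for u
  have f: "f (pt i a) = pt (\<sigma> i) (\<gamma> (\<sigma> i) a)" if "i \<in> ?I" "a < 6" for i a
    unfolding f_def pt_div_mod[OF that] ..
  have inj: "inj_on f {..<18}"
  proof (rule inj_onI)
    fix u v assume u: "u \<in> {..<18}" and v: "v \<in> {..<18}" and e: "f u = f v"
    obtain i a where ia: "i \<in> ?I" "a < 6" "u = pt i a" using u pt_cases by (metis lessThan_iff)
    obtain j b where jb: "j \<in> ?I" "b < 6" "v = pt j b" using v pt_cases by (metis lessThan_iff)
    have "pt (\<sigma> i) (\<gamma> (\<sigma> i) a) = pt (\<sigma> j) (\<gamma> (\<sigma> j) b)"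
      using e f[OF ia(1,2)] f[OF jb(1,2)] ia(3) jb(3) by simp
    then have "\<sigma> i = \<sigma> j \<and> \<gamma> (\<sigma> i) a = \<gamma> (\<sigma> j) b"
      using pt_inj[OF si[OF ia(1)] si[OF jb(1)] gl[OF si[OF ia(1)] ia(2)] gl[OF si[OF jb(1)] jb(2)]] by blast
    then have "\<sigma> i = \<sigma> j" "\<gamma> (\<sigma> i) a = \<gamma> (\<sigma> j) b" by blast+
    moreover have "i = j" using calculation(1) permutes_inj[OF s] by (simp add: inj_eq)
    moreover have "inj_on (\<gamma> (\<sigma> i)) {..<6}" using g si[OF ia(1)] by (auto simp: bij_betw_def)
    ultimately show "u = v" using ia jb by (auto dest: inj_onD)
  qed
  have "f ` {..<18} \<subseteq> {..<18}"
  proof clarsimp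
    fix u :: nat assume "u < 18"
    then obtain i a where ia: "i \<in> ?I" "a < 6" "u = pt i a" using pt_cases by metis
    then show "f u < 18" using f[OF ia(1,2)] pt_less[OF si[OF ia(1)] gl[OF si[OF ia(1)] ia(2)]] by simp
  qed
  then have bij: "bij_betw f {..<18} {..<18}"
    unfolding bij_betw_def using inj by (intro conjI endo_inj_surj) auto
  have "f ` B \<in> lines 0 L'" if B: "B \<in> lines 0 L" for B
  proof -
    obtain a b where ab: "a < 6" "b < 6" "B = {a, 6 + b, 12 + L a b}"
      using B unfolding lines_def by blast
    have c: "L a b < 6" using holed_less[OF h ab(1,2)] .
    define t where "t = (\<lambda>i::nat. if i = 1 then a else if i = 2 then b else L a b)"
    \<comment> \<open>Chosen so that \<open>x (\<sigma> i) = t i\<close>; the left side of the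
      isostrophy equivalence at \<open>x\<close> is then the equation of the given cell.\<close>
    define x where "x = t \<circ> inv_into UNIV \<sigma>"
    have xs: "x (\<sigma> i) = t i" for i unfolding x_def using permutes_inverses(2)[OF s] by simp
    have xi: "x i < 6" for i unfolding x_def t_def using ab c by simp
    have "L (x (\<sigma> 1)) (x (\<sigma> 2)) = x (\<sigma> 3)" unfolding xs by (simp add: t_def)
    then have L': "L' (\<gamma> 1 (x 1)) (\<gamma> 2 (x 2)) = \<gamma> 3 (x 3)" using sg[of x] xi by simp
    have "B = (\<lambda>i. pt i (t i)) ` ?I" using ab by (simp add: t_def)
    also have "f ` \<dots> = (\<lambda>i. pt (\<sigma> i) (\<gamma> (\<sigma> i) (x (\<sigma> i)))) ` ?I"
      unfolding image_image by (rule image_cong) (use f ab c xs in \<open>auto simp: t_def\<close>)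
    also have "\<dots> = (\<lambda>i. pt i (\<gamma> i (x i))) ` \<sigma> ` ?I" unfolding image_image ..
    also have "\<dots> = {\<gamma> 1 (x 1), 6 + \<gamma> 2 (x 2), 12 + \<gamma> 3 (x 3)}"
      unfolding permutes_image[OF s] by simp
    also have "\<dots> \<in> lines 0 L'"
      using lines_memI[of "\<gamma> 1 (x 1)" "\<gamma> 2 (x 2)" 0 L'] gl xi L' by simp
    finally show ?thesis .
  qed
  moreover have "inhole 0 u = False" for u by (simp add: inhole_def)
  ultimately show ?thesis using bij unfolding net_map_def by auto
qed

text \<open>Isostrophy is symmetric, so the inequality of \<open>search_length_le\<close> holds both
  ways.\<close>

lemma isostrophic_search:
  assumes T: "square 0 T" and T': "square 0 T'" and "isostrophic {..<6} (entry T) {..<6} (entry T')"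
    and wf: "wf_plan pl 0"
  shows "length (search 0 T pl []) = length (search 0 T' pl [])"
proof (rule antisym)
  show "length (search 0 T pl []) \<le> length (search 0 T' pl [])"
    using isostrophic_net_map[OF assms(3) square_holed[OF T]] search_length_le[OF T T' _ wf] by blast
  show "length (search 0 T' pl []) \<le> length (search 0 T pl [])"
    using isostrophic_net_map[OF isostrophic_sym[OF assms(3)] square_holed[OF T']]
      search_length_le[OF T' T _ wf] by blast
qed

text \<open>Pairs \<open>(\<sigma>, \<gamma>)\<close> are given by their lists of values.\<close>

definition isostrophy_cert ::
    "(nat \<Rightarrow> nat \<Rightarrow> nat) \<Rightarrow> (nat \<Rightarrow> nat \<Rightarrow> nat) \<Rightarrow> nat list \<Rightarrow> nat list list \<Rightarrow> bool" where
  "isostrophy_cert mul mul' s g \<longleftrightarrow> length s = 3 \<and> distinct s \<and> list_all (\<lambda>v. v \<in> {1, 2, 3}) s \<and>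
     length g = 3 \<and> list_all (\<lambda>h. length h = 6 \<and> distinct h \<and> list_all (\<lambda>v. 1 \<le> v \<and> v \<le> 6) h) g \<and>
     list_all (\<lambda>a. list_all (\<lambda>b. list_all (\<lambda>c.
       (mul ([a, b, c] ! (s ! 0 - 1)) ([a, b, c] ! (s ! 1 - 1)) = [a, b, c] ! (s ! 2 - 1)) =
       (mul' (g ! 0 ! a) (g ! 1 ! b) = g ! 2 ! c)) [0..<6]) [0..<6]) [0..<6]"

lemma isostrophy_cert:
  assumes c: "isostrophy_cert mul mul' s g"
  shows "isostrophic {..<6} mul {1..6} mul'"
proof -
  let ?I = "{1, 2, 3} :: nat set"
  have s: "length s = 3" "distinct s" "\<And>i. i < 3 \<Longrightarrow> s ! i \<in> ?I"
    using c by (auto simp: isostrophy_cert_def list_all_iff all_set_conv_all_nth)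
  have g: "length (g ! i) = 6" "distinct (g ! i)" "\<And>a. a < 6 \<Longrightarrow> g ! i ! a \<in> {1..6}" if "i < 3" for i
    using c that by (auto simp: isostrophy_cert_def list_all_iff all_set_conv_all_nth)
  \<comment> \<open>The list is zero-based while the indices are 1, 2, 3; outside them
    \<open>\<sigma>\<close> has to be the identity to satisfy \<open>permutes\<close>.\<close>
  define \<sigma> where "\<sigma> i = (if i \<in> ?I then s ! (i - 1) else i)" for i
  have I: "i - 1 < 3" if "i \<in> ?I" for i using that by auto
  show ?thesis unfolding isostrophic_def
  proof (intro exI conjI ballI allI impI)
    have inj: "inj_on \<sigma> ?I"
    proof (rule inj_onI)
      fix i j assume i: "i \<in> ?I" and j: "j \<in> ?I" and "\<sigma> i = \<sigma> j"
      then have "i - 1 = j - 1" using s(1,2) I[OF i] I[OF j] by (simp add: \<sigma>_def nth_eq_iff_index_eq)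
      then show "i = j" using i j by auto
    qed
    have "\<sigma> ` ?I = ?I"
      by (rule endo_inj_surj[OF _ _ inj]) (use s(3) I in \<open>auto simp: \<sigma>_def\<close>)
    with inj have "bij_betw \<sigma> ?I ?I" by (simp add: bij_betw_def)
    then show "\<sigma> permutes ?I" by (rule bij_imp_permutes) (simp add: \<sigma>_def)
    show "bij_betw ((!) (g ! (i - 1))) {..<6} {1..6}" if i: "i \<in> ?I" for i
    proof -
      have inj: "inj_on ((!) (g ! (i - 1))) {..<6}" using g(1,2)[OF I[OF i]] by (simp add: inj_on_nth)
      moreover have "(!) (g ! (i - 1)) ` {..<6} = {1..6}"
        by (rule card_subset_eq) (use g(3)[OF I[OF i]] card_image[OF inj] in auto)
      ultimately show ?thesis by (simp add: bij_betw_def)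
    qed
    fix x :: "nat \<Rightarrow> nat" assume x: "\<forall>i\<in>?I. x i \<in> {..<6}"
    have x3: "x 1 < 6" "x 2 < 6" "x 3 < 6" using x by auto
    have nth: "[x 1, x 2, x 3] ! (i - 1) = x i" if "i \<in> ?I" for i using that by (auto simp: numeral_2_eq_2 numeral_3_eq_3)
    have "\<forall>a\<in>{0..<6}. \<forall>b\<in>{0..<6}. \<forall>c\<in>{0..<6}. (mul ([a, b, c] ! (s ! 0 - 1)) ([a, b, c] ! (s ! 1 - 1)) = [a, b, c] ! (s ! 2 - 1)) =
       (mul' (g ! 0 ! a) (g ! 1 ! b) = g ! 2 ! c)"
      using c unfolding isostrophy_cert_def list_all_iff set_upt by blast
    then have "(mul ([x 1, x 2, x 3] ! (s ! 0 - 1)) ([x 1, x 2, x 3] ! (s ! 1 - 1)) = [x 1, x 2, x 3] ! (s ! 2 - 1)) =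
       (mul' (g ! 0 ! x 1) (g ! 1 ! x 2) = g ! 2 ! x 3)"
      using x3 by (meson atLeastLessThan_iff zero_le)
    then have "(mul (x (s ! 0)) (x (s ! 1)) = x (s ! 2)) = (mul' (g ! 0 ! x 1) (g ! 1 ! x 2) = g ! 2 ! x 3)"
      using s(3)[of 0] s(3)[of 1] s(3)[of 2] nth by simp
    then show "mul (x (\<sigma> 1)) (x (\<sigma> 2)) = x (\<sigma> 3) \<longleftrightarrow>
        mul' (g ! (1 - 1) ! x 1) (g ! (2 - 1) ! x 2) = g ! (3 - 1) ! x 3"
      by (simp add: \<sigma>_def numeral_2_eq_2)
  qed
qed

section \<open>The twelve quasigroups and two configuration counts\<close>

definition Q6_row :: "nat \<Rightarrow> nat \<Rightarrow> nat list" where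
  "Q6_row j x = map (\<lambda>v. v - 1) (Q6_table j ! x)"

lemma Q6_row_code [code]:
  "Q6_row d1 0 = [0, d1, d2, d3, d4, d5]"
  "Q6_row d1 d1 = [d1, d2, d3, d4, d5, 0]"
  "Q6_row d1 d2 = [d2, d3, d4, d5, 0, d1]"
  "Q6_row d1 d3 = [d3, d4, d5, 0, d1, d2]"
  "Q6_row d1 d4 = [d4, d5, 0, d1, d2, d3]"
  "Q6_row d1 d5 = [d5, 0, d1, d2, d3, d4]"
  "Q6_row d2 0 = [0, d1, d2, d3, d4, d5]"
  "Q6_row d2 d1 = [d1, 0, d4, d5, d2, d3]"
  "Q6_row d2 d2 = [d2, d5, 0, d4, d3, d1]"
  "Q6_row d2 d3 = [d3, d4, d5, 0, d1, d2]"
  "Q6_row d2 d4 = [d4, d3, d1, d2, d5, 0]"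
  "Q6_row d2 d5 = [d5, d2, d3, d1, 0, d4]"
  "Q6_row d3 0 = [0, d1, d2, d3, d4, d5]"
  "Q6_row d3 d1 = [d1, d2, 0, d4, d5, d3]"
  "Q6_row d3 d2 = [d2, 0, d1, d5, d3, d4]"
  "Q6_row d3 d3 = [d3, d5, d4, d1, 0, d2]"
  "Q6_row d3 d4 = [d4, d3, d5, d2, d1, 0]"
  "Q6_row d3 d5 = [d5, d4, d3, 0, d2, d1]"
  "Q6_row d4 0 = [0, d1, d2, d3, d4, d5]"
  "Q6_row d4 d1 = [d1, 0, d3, d2, d5, d4]"
  "Q6_row d4 d2 = [d2, d3, d4, d5, 0, d1]"
  "Q6_row d4 d3 = [d3, d2, d5, d4, d1, 0]"
  "Q6_row d4 d4 = [d4, d5, 0, d1, d3, d2]"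
  "Q6_row d4 d5 = [d5, d4, d1, 0, d2, d3]"
  "Q6_row d5 0 = [0, d1, d2, d3, d4, d5]"
  "Q6_row d5 d1 = [d1, 0, d4, d5, d2, d3]"
  "Q6_row d5 d2 = [d2, d5, d1, d4, d3, 0]"
  "Q6_row d5 d3 = [d3, d4, d5, d1, 0, d2]"
  "Q6_row d5 d4 = [d4, d3, 0, d2, d5, d1]"
  "Q6_row d5 d5 = [d5, d2, d3, 0, d1, d4]"
  "Q6_row d6 0 = [0, d1, d2, d3, d4, d5]"
  "Q6_row d6 d1 = [d1, 0, d3, d4, d5, d2]"
  "Q6_row d6 d2 = [d2, d5, d1, 0, d3, d4]"
  "Q6_row d6 d3 = [d3, d4, d5, d1, d2, 0]"
  "Q6_row d6 d4 = [d4, d2, 0, d5, d1, d3]"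
  "Q6_row d6 d5 = [d5, d3, d4, d2, 0, d1]"
  "Q6_row d7 0 = [0, d1, d2, d3, d4, d5]"
  "Q6_row d7 d1 = [d1, 0, d3, d2, d5, d4]"
  "Q6_row d7 d2 = [d2, d4, 0, d5, d3, d1]"
  "Q6_row d7 d3 = [d3, d5, d4, 0, d1, d2]"
  "Q6_row d7 d4 = [d4, d2, d5, d1, 0, d3]"
  "Q6_row d7 d5 = [d5, d3, d1, d4, d2, 0]"
  "Q6_row d8 0 = [0, d1, d2, d3, d4, d5]"
  "Q6_row d8 d1 = [d1, 0, d5, d4, d2, d3]"
  "Q6_row d8 d2 = [d2, d5, 0, d1, d3, d4]"
  "Q6_row d8 d3 = [d3, d4, d1, 0, d5, d2]"
  "Q6_row d8 d4 = [d4, d2, d3, d5, 0, d1]"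
  "Q6_row d8 d5 = [d5, d3, d4, d2, d1, 0]"
  "Q6_row d9 0 = [0, d1, d2, d3, d4, d5]"
  "Q6_row d9 d1 = [d1, d2, 0, d5, d3, d4]"
  "Q6_row d9 d2 = [d2, 0, d1, d4, d5, d3]"
  "Q6_row d9 d3 = [d3, d5, d4, 0, d1, d2]"
  "Q6_row d9 d4 = [d4, d3, d5, d1, d2, 0]"
  "Q6_row d9 d5 = [d5, d4, d3, d2, 0, d1]"
  "Q6_row d10 0 = [0, d1, d2, d3, d4, d5]"
  "Q6_row d10 d1 = [d1, 0, d5, d4, d3, d2]"
  "Q6_row d10 d2 = [d2, d4, 0, d1, d5, d3]"
  "Q6_row d10 d3 = [d3, d5, d1, 0, d2, d4]"
  "Q6_row d10 d4 = [d4, d2, d3, d5, d1, 0]"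
  "Q6_row d10 d5 = [d5, d3, d4, d2, 0, d1]"
  "Q6_row d11 0 = [0, d1, d2, d3, d4, d5]"
  "Q6_row d11 d1 = [d1, 0, d3, d4, d5, d2]"
  "Q6_row d11 d2 = [d2, d3, d1, d5, 0, d4]"
  "Q6_row d11 d3 = [d3, d4, d5, d1, d2, 0]"
  "Q6_row d11 d4 = [d4, d5, 0, d2, d1, d3]"
  "Q6_row d11 d5 = [d5, d2, d4, 0, d3, d1]"
  "Q6_row d12 0 = [0, d1, d2, d3, d4, d5]"
  "Q6_row d12 d1 = [d1, 0, d4, d5, d3, d2]"
  "Q6_row d12 d2 = [d2, d4, d3, d1, d5, 0]"
  "Q6_row d12 d3 = [d3, d5, d1, d2, 0, d4]"
  "Q6_row d12 d4 = [d4, d3, d5, 0, d2, d1]"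
  "Q6_row d12 d5 = [d5, d2, 0, d4, d1, d3]"
  by (simp_all add: Q6_row_def Q6_table_def)

text \<open>The Pasch configuration: in list positions its lines are 012, 134, 235 and 045. In a
  Latin square it is an intercalate, that is, a subsquare of order 2. Each one is found 24 times:
  six choices for the first point and four for the second determine the rest.\<close>

definition pasch :: "step list" where
  "pasch = [Free False [], Free False [], Forced 0 1, Free False [0], Forced 3 1, Forced 3 2, Check 0 4 5]"

text \<open>Ten points and eight lines. If positions 0 and 1 are a row and a column, these are eight
  cells in three rows and four columns, with two symbols occurring three times and a third one
  twice.\<close>

definition second_pattern :: "step list" where
  "second_pattern = [Free False [], Free False [], Forced 0 1, Free False [0], Forced 2 3, Forced 0 4, Forced 3 5,
     Forced 2 6, Forced 4 7, Forced 5 7, Check 1 3 8]"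

lemma square_Q6_row: 
  assumes "j \<in> {1..12}" shows "square 0 (Q6_row j)"
proof -
  have "list_all (\<lambda>j. square 0 (Q6_row j)) [1..<13]" by code_simp
  then show ?thesis using assms by (auto simp: list_all_iff)
qed

lemma isostrophic_Q6_row:
  assumes "j \<in> {1..12}"
  shows "isostrophic {..<6} (entry (Q6_row j)) {1..6} (Q6 j)"
proof -
  have "list_all (\<lambda>j. isostrophy_cert (entry (Q6_row j)) (Q6 j) [1, 2, 3] [[1..<7], [1..<7], [1..<7]]) [1..<13]"
    by code_simp
  then show ?thesis using assms by (intro isostrophy_cert[of _ _ "[1, 2, 3]" "[[1..<7], [1..<7], [1..<7]]"]) (auto simp: list_all_iff simp del: upt_Suc upt_rec_numeral)
qed

text \<open>Divided by 24 these are 9, 27, 0, 9, 19, 4, 11, 15, 9, 15, 7 and 5 intercalates; the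
  only ties are among 1, 4, 9 and between 8 and 10.\<close>

lemma pasch_count:
  "map (\<lambda>j. length (search 0 (Q6_row j) pasch [])) [1..<13] =
     [216, 648, 0, 216, 456, 96, 264, 360, 216, 360, 168, 120]"
  by code_simp

lemma second_pattern_count:
  "map (\<lambda>j. length (search 0 (Q6_row j) second_pattern [])) [1, 4, 9, 8, 10] = [432, 144, 216, 0, 72]"
  by code_simp

text \<open>Distinct indices differ in the intercalate count or fall into one of the ties 1, 4, 9
  and 8, 10, where the second count differs.\<close>

lemma Q6_not_isostrophic:
  assumes j: "j \<in> {1..12}" "j' \<in> {1..12}" and iso: "isostrophic {1..6} (Q6 j) {1..6} (Q6 j')"
  shows "j = j'"
proof -
  have i: "isostrophic {..<6} (entry (Q6_row j)) {..<6} (entry (Q6_row j'))"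
    using isostrophic_trans[OF isostrophic_trans[OF isostrophic_Q6_row[OF j(1)] iso]
      isostrophic_sym[OF isostrophic_Q6_row[OF j(2)]]] .
  have e: "length (search 0 (Q6_row j) pl []) = length (search 0 (Q6_row j') pl [])" if "wf_plan pl 0" for pl
    using isostrophic_search[OF square_Q6_row[OF j(1)] square_Q6_row[OF j(2)] i that] .
  have "wf_plan pasch 0" "wf_plan second_pattern 0" by (simp_all add: pasch_def second_pattern_def)
  note e = this[THEN e]
  have "[1..<13] = [1, 2, 3, 4, 5, 6, 7, 8, 9, 10, 11, 12::nat]" by (simp add: upt_rec)
  note c = pasch_count[unfolded this, simplified] second_pattern_count[simplified]
  have cases: "i \<in> {1, 2, 3, 4, 5, 6, 7, 8, 9, 10, 11, 12}" if "i \<in> {1..12}" for i :: nat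
    using that unfolding atLeastAtMost_iff insert_iff empty_iff by presburger
  note * = cases[OF j(1)] cases[OF j(2)]
  show ?thesis using * e by (elim insertE emptyE) (simp_all add: c)
qed

section \<open>Nets of squares as light dual multinets\<close>

text \<open>Two coordinates below \<open>k\<close> would force the third by
  \<open>holed_hole\<close> and put the cell into the hole.\<close>

lemma line_hole:
  assumes h: "holed k L" and B: "B \<in> lines k L" and pq: "p \<in> B" "q \<in> B" "p \<in> hole k" "q \<in> hole k"
  shows "p = q"
proof -
  obtain x y where xy: "x < 6" "y < 6" "\<not> (x < k \<and> y < k)" "B = {x, 6 + y, 12 + L x y}"
    using B unfolding lines_def by blast
  have z: "L x y < 6" using holed_less[OF h xy(1,2)] .
  have *: "u = x \<and> x < k \<or> u = 6 + y \<and> y < k \<or> u = 12 + L x y \<and> L x y < k" if "u \<in> B" "u \<in> hole k" for u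
    using that xy z by (auto simp: hole_def)
  show ?thesis using *[OF pq(1,3)] *[OF pq(2,4)] holed_hole[OF h xy(1,2)] xy(3) by blast
qed

lemma pt_hole: "i \<in> {1, 2, 3} \<Longrightarrow> a < 6 \<Longrightarrow> pt i a \<in> hole k \<longleftrightarrow> a < k"
  by (auto simp: hole_def)

lemma line_meets_pt:
  assumes h: "holed k L" and B: "B \<in> lines k L" and i: "i \<in> {1, 2, 3}"
  shows "\<exists>!a. a < 6 \<and> pt i a \<in> B"
proof -
  obtain x y where xy: "x < 6" "y < 6" "B = {x, 6 + y, 12 + L x y}"
    using B unfolding lines_def by blast
  have z: "L x y < 6" using holed_less[OF h xy(1,2)] .
  from i show ?thesis
  proof (elim insertE emptyE)
    assume "i = 1" then show ?thesis using xy z by (intro ex1I[of _ x]) auto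
  next
    assume "i = 2" then show ?thesis using xy z by (intro ex1I[of _ y]) auto
  next
    assume "i = 3" then show ?thesis using xy z by (intro ex1I[of _ "L x y"]) auto
  qed
qed

lemma UN_pt: "(\<Union>i\<in>{1, 2, 3}. pt i ` {..<6}) = {..<18}"
proof
  show "{..<18} \<subseteq> (\<Union>i\<in>{1, 2, 3}. pt i ` {..<6})"
  proof
    fix u :: nat assume "u \<in> {..<18}"
    then obtain i a where "i \<in> {1, 2, 3}" "a < 6" "u = pt i a" using pt_cases by (metis lessThan_iff)
    then show "u \<in> (\<Union>i\<in>{1, 2, 3}. pt i ` {..<6})" by blast
  qed
qed (auto dest: pt_less)

lemma net_blocks_unique:
  assumes h: "holed k L" and "p \<noteq> q" "B \<in> insert (hole k) (lines k L)" "B' \<in> insert (hole k) (lines k L)"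
    "{p, q} \<subseteq> B" "{p, q} \<subseteq> B'"
  shows "B = B'"
proof (cases "B = hole k \<or> B' = hole k")
  case True
  with assms line_hole[OF h, of B p q] line_hole[OF h, of B' p q] show ?thesis by auto
next
  case False
  with assms line_unique[OF h, of B B' p q] show ?thesis by simp
qed

lemma net_multinet:
  assumes h: "holed k L" and k: "0 < k"
  shows "light_dual_multinet {..<6} L {..<18} (insert (hole k) (lines k L)) (\<lambda>i. pt i ` {..<6}) pt"
proof -
  interpret quasigroup "{..<6}" L using h by (rule holed_quasigroup)
  have k6: "k < 6" using h by (simp add: holed_def)
  show ?thesis
  proof
    show "{..<18} = pt 1 ` {..<6} \<union> pt 2 ` {..<6} \<union> pt 3 ` {..<6}"
      using UN_pt by auto
    show "disjoint_family_on (\<lambda>i. pt i ` {..<6}) {1, 2, 3}"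
      unfolding disjoint_family_on_def using pt_inj by fastforce
    show "insert (hole k) (lines k L) \<subseteq> Pow {..<18}"
      using lines_sub[OF h] by (auto simp: hole_def)
    show "B = B'" if "p \<noteq> q" "B \<in> insert (hole k) (lines k L)" "B' \<in> insert (hole k) (lines k L)"
      "{p, q} \<subseteq> B" "{p, q} \<subseteq> B'" for p q B B'
      by (rule net_blocks_unique[OF h that])
    show "B \<inter> pt i ` {..<6} \<noteq> {}" if "B \<in> insert (hole k) (lines k L)" "i \<in> {1, 2, 3}" for B i
    proof (cases "B = hole k")
      case True then show ?thesis using pt_hole[OF that(2), of 0 k] k by auto
    next
      case False then show ?thesis using line_meets_pt[OF h _ that(2), of B] that(1) by auto
    qed
    show "bij_betw (pt i) {..<6} (pt i ` {..<6})" if "i \<in> {1, 2, 3}" for i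
      using pt_inj[OF that that] by (auto simp: bij_betw_def inj_on_def)
    show "\<exists>B\<in>insert (hole k) (lines k L). {pt 1 x, pt 2 y, pt 3 (L x y)} \<subseteq> B"
      if "x \<in> {..<6}" "y \<in> {..<6}" for x y
    proof (cases "x < k \<and> y < k")
      case True
      then have "L x y < k" using h by (simp add: holed_def)
      then have "{pt 1 x, pt 2 y, pt 3 (L x y)} \<subseteq> hole k" using True k6 by (auto simp: hole_def)
      then show ?thesis by blast
    next
      case False
      then have "{x, 6 + y, 12 + L x y} \<in> lines k L" using that by (intro lines_memI) auto
      then show ?thesis by (rule bexI[rotated, OF insertI2]) simp
    qed
    \<comment> \<open>The cell (5, 5) lies outside the hole since \<open>k < 6\<close>; it supplies
      a second block.\<close>
    have l: "{5, 6 + 5, 12 + L 5 5} \<in> lines k L" using k6 by (intro lines_memI) auto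
    have "5 \<notin> hole k" using k6 by (simp add: hole_def)
    then have "{5, 6 + 5, 12 + L 5 5} \<noteq> hole k" by blast
    then
    show "\<exists>B\<in>insert (hole k) (lines k L). \<exists>B'\<in>insert (hole k) (lines k L). B \<noteq> B'"
      using l by (intro bexI[OF _ insertI2[OF l]] bexI[OF _ insertI1])
  qed
qed

text \<open>A line has exactly one point in each component, so its length is 1 and only the hole can
  be a superline.\<close>

lemma net_superline:
  assumes h: "holed k L" and k: "2 \<le> k"
  shows "superline {..<6} pt (insert (hole k) (lines k L)) B \<longleftrightarrow> B = hole k"
    and "block_length {..<6} pt (hole k) = k"
proof -
  have k6: "k < 6" using h by (simp add: holed_def)
  have "block_labels {..<6} pt (hole k) 1 = {..<k}"
    using k6 by (auto simp: block_labels_def hole_def)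
  then show len: "block_length {..<6} pt (hole k) = k" by (simp add: block_length_def)
  have "block_length {..<6} pt B = 1" if B: "B \<in> lines k L"
  proof -
    have "\<exists>!a. a < 6 \<and> pt 1 a \<in> B" by (rule line_meets_pt[OF h B]) simp
    then have "\<exists>!a. a \<in> block_labels {..<6} pt B 1"
      by (simp only: block_labels_def mem_Collect_eq lessThan_iff)
    then obtain a where "block_labels {..<6} pt B 1 = {a}" by (elim ex1E) blast
    then show ?thesis by (simp add: block_length_def)
  qed
  with len k show "superline {..<6} pt (insert (hole k) (lines k L)) B \<longleftrightarrow> B = hole k"
    by (auto simp: superline_def)
qed

lemma net_order6:
  assumes h: "holed k L" and k: "2 \<le> k"
  shows "order6_with_superline_length (net k L) k"
  unfolding order6_with_superline_length_def net_def fst_conv snd_conv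
proof (intro exI conjI)
  show "light_dual_multinet {..<6} L {..<18} (insert (hole k) (lines k L)) (\<lambda>i. pt i ` {..<6}) pt"
    using net_multinet[OF h] k by simp
qed (use net_superline[OF assms] in auto)

section \<open>Labelings of a given net\<close>

definition tri :: "'a \<Rightarrow> 'a \<Rightarrow> 'a \<Rightarrow> nat \<Rightarrow> 'a" where
  "tri a b c i = (if i = 1 then a else if i = 2 then b else if i = 3 then c else undefined)"

lemma tri_simps [simp]: "tri a b c 1 = a" "tri a b c (Suc 0) = a" "tri a b c 2 = b" "tri a b c 3 = c"
  by (simp_all add: tri_def)

lemma tri_eq: "(tri a b c)(3 := c') = tri a b c'" "(tri a b c)(2 := b') = tri a b' c" "(tri a b c)(1 := a') = tri a' b c"
  by (auto simp: fun_eq_iff tri_def)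

context quasigroup
begin

text \<open>The quasigroup axioms in symmetric form: any two coordinates of a triple determine the
  remaining one.\<close>

lemma coordinate_ex1:
  assumes "j \<in> {1, 2, 3::nat}" "\<And>i. i \<in> {1, 2, 3} \<Longrightarrow> i \<noteq> j \<Longrightarrow> t i \<in> Q"
  shows "\<exists>!v. v \<in> Q \<and> mul ((t(j := v)) 1) ((t(j := v)) 2) = (t(j := v)) 3"
  using assms(1)
proof (elim insertE emptyE)
  assume j: "j = 1"
  then show ?thesis using right_div[of "t 2" "t 3"] assms(2)[of 2] assms(2)[of 3] by simp
next
  assume j: "j = 2"
  then show ?thesis using left_div[of "t 1" "t 3"] assms(2)[of 1] assms(2)[of 3] by simp
next
  assume j: "j = 3"
  then show ?thesis using closed[of "t 1" "t 2"] assms(2)[of 1] assms(2)[of 2] by auto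
qed

text \<open>The permuted relation still determines each coordinate from the other two, so it is the
  graph of a quasigroup, a parastrophe of the given one. It absorbs the freedom in numbering the
  components.\<close>

lemma parastrophe:
  assumes s: "\<sigma> permutes {1, 2, 3::nat}"
  shows "\<exists>m. quasigroup Q m \<and> (\<forall>a\<in>Q. \<forall>b\<in>Q. \<forall>c\<in>Q.
    mul (tri a b c (\<sigma> 1)) (tri a b c (\<sigma> 2)) = tri a b c (\<sigma> 3) \<longleftrightarrow> m a b = c)"
proof -
  let ?I = "{1, 2, 3} :: nat set"
  define R where "R t \<longleftrightarrow> mul (t (\<sigma> 1)) (t (\<sigma> 2)) = t (\<sigma> 3)" for t
  have ex1: "\<exists>!v. v \<in> Q \<and> R (t(i := v))" if "i \<in> ?I" "\<And>j. j \<in> ?I \<Longrightarrow> j \<noteq> i \<Longrightarrow> t j \<in> Q" for t i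
  proof -
    have "i \<in> \<sigma> ` ?I" unfolding permutes_image[OF s] by (fact that(1))
    then obtain i' where i': "i' \<in> ?I" "\<sigma> i' = i" by blast
    have "t(i := v) \<circ> \<sigma> = (t \<circ> \<sigma>)(i' := v)" for v
      using i'(2) permutes_inj[OF s] by (auto simp: fun_eq_iff inj_eq)
    then have "R (t(i := v)) \<longleftrightarrow> mul (((t \<circ> \<sigma>)(i' := v)) 1) (((t \<circ> \<sigma>)(i' := v)) 2) = ((t \<circ> \<sigma>)(i' := v)) 3" for v
      unfolding R_def by (metis comp_apply)
    moreover have "\<exists>!v. v \<in> Q \<and> mul (((t \<circ> \<sigma>)(i' := v)) 1) (((t \<circ> \<sigma>)(i' := v)) 2) = ((t \<circ> \<sigma>)(i' := v)) 3"
    proof (rule coordinate_ex1[OF i'(1)])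
      fix j assume "j \<in> ?I" "j \<noteq> i'"
      then have "\<sigma> j \<in> ?I" "\<sigma> j \<noteq> i"
        using permutes_in_image[OF s] i'(2) permutes_inj[OF s] by (auto simp: inj_eq)
      then show "(t \<circ> \<sigma>) j \<in> Q" using that(2) by simp
    qed
    ultimately show ?thesis by simp
  qed
  have ex: "\<exists>!c. c \<in> Q \<and> R (tri a b c)" "\<exists>!c. c \<in> Q \<and> R (tri a c b)" "\<exists>!c. c \<in> Q \<and> R (tri c a b)"
    if "a \<in> Q" "b \<in> Q" for a b
    by (rule ex1[of 3 "tri a b a", unfolded tri_eq] ex1[of 2 "tri a a b", unfolded tri_eq]
        ex1[of 1 "tri a a b", unfolded tri_eq]; use that in \<open>auto simp: tri_def\<close>)+
  define m where "m a b = (THE c. c \<in> Q \<and> R (tri a b c))" for a b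
  have m: "m a b \<in> Q \<and> R (tri a b (m a b))" if "a \<in> Q" "b \<in> Q" for a b
    unfolding m_def by (rule theI'[OF ex(1)[OF that]])
  have iff: "R (tri a b c) \<longleftrightarrow> m a b = c" if "a \<in> Q" "b \<in> Q" "c \<in> Q" for a b c
    using m[OF that(1,2)] ex(1)[OF that(1,2)] that(3) by blast
  have "quasigroup Q m"
  proof
    show "\<exists>!y. y \<in> Q \<and> m x y = z" if "x \<in> Q" "z \<in> Q" for x z
      using ex(2)[OF that] iff[OF that(1) _ that(2)] by metis
    show "\<exists>!x. x \<in> Q \<and> m x y = z" if "y \<in> Q" "z \<in> Q" for y z
      using ex(3)[OF that] iff[OF _ that] by metis
  qed (use m in blast)
  then show ?thesis using iff unfolding R_def by blast
qed

end

context light_dual_multinet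
begin

lemma label_preimage: "p \<in> Pc i \<Longrightarrow> i \<in> {1, 2, 3} \<Longrightarrow> \<exists>x\<in>Q. p = \<alpha> i x"
  using labeling[of i] unfolding bij_betw_def by blast

text \<open>Two labels in different coordinates extend to a product triple, and the labeling puts
  that triple on a block.\<close>

lemma components_joined:
  assumes "p \<in> Pc i" "q \<in> Pc j" "i \<in> {1, 2, 3}" "j \<in> {1, 2, 3}" "i \<noteq> j"
  shows "\<exists>B\<in>M. p \<in> B \<and> q \<in> B"
proof -
  obtain x where x: "x \<in> Q" "p = \<alpha> i x" using label_preimage assms by blast
  obtain y where y: "y \<in> Q" "q = \<alpha> j y" using label_preimage assms by blast
  define t where "t l = (if l = i then x else y)" for l
  have t: "t i = x" "t j = y" "\<And>l. t l \<in> Q" using x y assms(5) by (auto simp: t_def)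
  \<comment> \<open>\<open>l\<close> is the remaining index, whose coordinate is solved for.\<close>
  obtain l where l: "l \<in> {1, 2, 3}" "{i, j, l} = {1, 2, 3}"
    using assms(3-5) that[of 1] that[of 2] that[of 3] by auto
  then have ll: "l' \<in> {1, 2, 3} \<Longrightarrow> l' = i \<or> l' = j \<or> l' = l" for l' by blast
  obtain v where v: "v \<in> Q" "mul ((t(l := v)) 1) ((t(l := v)) 2) = (t(l := v)) 3"
    using coordinate_ex1[OF l(1), of t] t(3) by blast
  have "l \<noteq> i" "l \<noteq> j" using l assms(3-5) by (elim insertE emptyE; force)+
  moreover have "(t(l := v)) n \<in> Q" for n using t(3) v(1) by simp
  moreover obtain B where B: "B \<in> M" "{\<alpha> 1 ((t(l := v)) 1), \<alpha> 2 ((t(l := v)) 2), \<alpha> 3 ((t(l := v)) 3)} \<subseteq> B"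
    using labeling_block[of "(t(l := v)) 1" "(t(l := v)) 2"] calculation(3) v(2) by metis
  moreover have "\<alpha> n ((t(l := v)) n) \<in> B" if "n \<in> {1, 2, 3}" for n using B(2) that by blast
  ultimately show ?thesis using t x(2) y(2) assms(3,4) by (metis fun_upd_other)
qed

lemma card_components:
  assumes "finite P"
  shows "finite Q" "card P = 3 * card Q" "i \<in> {1, 2, 3} \<Longrightarrow> finite (Pc i)" "i \<in> {1, 2, 3} \<Longrightarrow> card (Pc i) = card Q"
proof -
  have fin: "finite (Pc i)" if "i \<in> {1, 2, 3}" for i
    using assms that components by (auto intro: finite_subset)
  have card: "card (Pc i) = card Q" if "i \<in> {1, 2, 3}" for i
    using bij_betw_same_card[OF labeling[OF that]] by simp
  show "finite Q" using bij_betw_finite[OF labeling[of 1]] fin[of 1] by simp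
  have "P = (\<Union>i\<in>{1, 2, 3}. Pc i)" using components by auto
  also have "card \<dots> = (\<Sum>i\<in>{1, 2, 3}. card (Pc i))"
    by (rule card_UN_disjoint) (use fin components_disjoint in \<open>auto simp: disjoint_family_on_def\<close>)
  also have "\<dots> = 3 * card Q" using card by simp
  finally show "card P = 3 * card Q" .
  show "finite (Pc i)" "card (Pc i) = card Q" if "i \<in> {1, 2, 3}" using fin card that by blast+
qed

end

text \<open>Recovers a square from an arbitrary labeling of the net. The components are read off
  from which points share a block, a parastrophe aligns their numbering, and uniqueness of blocks
  forces agreement off the hole.\<close>

lemma net_fill:
  assumes h: "holed k L" and k: "0 < k"
    and M: "light_dual_multinet Q mul {..<18} (insert (hole k) (lines k L)) Pc \<alpha>"
  obtains L' where "holed k L'" "\<And>x y. x < 6 \<Longrightarrow> y < 6 \<Longrightarrow> \<not> (x < k \<and> y < k) \<Longrightarrow> L' x y = L x y"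
    "isostrophic Q mul {..<6} L'"
proof -
  let ?I = "{1, 2, 3} :: nat set"
  let ?M = "insert (hole k) (lines k L)"
  have k6: "k < 6" using h by (simp add: holed_def)
  interpret light_dual_multinet Q mul "{..<18}" ?M Pc \<alpha> by fact
  have cQ: "card Q = 6" "finite Q" "\<And>i. i \<in> ?I \<Longrightarrow> finite (Pc i)" "\<And>i. i \<in> ?I \<Longrightarrow> card (Pc i) = 6"
    using card_components by auto
  \<comment> \<open>One of the two points must lie outside the hole, as two hole points of a
    component do share a block.\<close>
  have noncol: "\<not> (pt i a \<in> B \<and> pt i b \<in> B)" if "i \<in> ?I" "a < 6" "b < 6" "a \<noteq> b" "k \<le> b" "B \<in> ?M" for i a b B
  proof (cases "B = hole k")
    case True then show ?thesis using pt_hole[OF that(1,3), of k] that(5) by simp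
  next
    case False then show ?thesis using line_meets_pt[OF h _ that(1), of B] that by blast
  qed
  have ex: "\<exists>j\<in>?I. pt i 5 \<in> Pc j" if "i \<in> ?I" for i
    using pt_less[OF that, of 5] components by auto
  \<comment> \<open>Label 5 is outside the hole, so \<open>pt i 5\<close> is joined to no other
    point of its standard component; the member of \<open>Pc\<close> containing it therefore
    contains that whole component.\<close>
  define \<tau> where "\<tau> i = (if i \<in> ?I then SOME j. j \<in> ?I \<and> pt i 5 \<in> Pc j else i)" for i
  have t: "\<tau> i \<in> ?I" "pt i 5 \<in> Pc (\<tau> i)" if "i \<in> ?I" for i
    using someI_ex[of "\<lambda>j. j \<in> ?I \<and> pt i 5 \<in> Pc j"] ex[OF that] that unfolding \<tau>_def by auto
  have sub: "pt i a \<in> Pc (\<tau> i)" if i: "i \<in> ?I" and a: "a < 6" for i a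
  proof (rule ccontr)
    assume n: "pt i a \<notin> Pc (\<tau> i)"
    obtain j where j: "j \<in> ?I" "pt i a \<in> Pc j" using pt_less[OF i a] components by auto
    have "a \<noteq> 5" using n t(2)[OF i] by auto
    have "j \<noteq> \<tau> i" using n j by auto
    then obtain B where "B \<in> ?M" "pt i a \<in> B" "pt i 5 \<in> B"
      using components_joined[OF j(2) t(2)[OF i] j(1) t(1)[OF i]] by blast
    then show False using noncol[OF i a, of 5 B] \<open>a \<noteq> 5\<close> k6 by auto
  qed
  have inj_pt: "inj_on (pt i) {..<6}" if "i \<in> ?I" for i
    using pt_inj[OF that that] by (auto simp: inj_on_def)
  have img: "pt i ` {..<6} = Pc (\<tau> i)" if i: "i \<in> ?I" for i
    by (rule card_subset_eq[OF cQ(3)[OF t(1)[OF i]]])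
      (use sub[OF i] card_image[OF inj_pt[OF i]] cQ(4)[OF t(1)[OF i]] in auto)
  have inj: "inj_on \<tau> ?I"
  proof (rule inj_onI)
    fix i j assume ij: "i \<in> ?I" "j \<in> ?I" "\<tau> i = \<tau> j"
    have "pt i 0 \<in> pt i ` {..<6}" by simp
    then have "pt i 0 \<in> pt j ` {..<6}" unfolding img[OF ij(1)] img[OF ij(2)] ij(3) .
    then obtain a where "a < 6" "pt i 0 = pt j a" by auto
    then show "i = j" using pt_inj[OF ij(1,2), of 0 a] by simp
  qed
  have "\<tau> ` ?I = ?I" by (rule endo_inj_surj[OF _ _ inj]) (use t(1) in auto)
  with inj have "bij_betw \<tau> ?I ?I" by (simp add: bij_betw_def)
  then have perm: "\<tau> permutes ?I" by (rule bij_imp_permutes) (simp add: \<tau>_def)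
  let ?\<sigma> = "inv_into UNIV \<tau>"
  have sperm: "?\<sigma> permutes ?I" by (rule permutes_inv[OF perm])
  have st: "\<tau> (?\<sigma> i) = i" for i using permutes_inverses[OF perm] by simp
  have sI: "?\<sigma> i \<in> ?I" if "i \<in> ?I" for i using permutes_in_image[OF sperm] that by blast
  obtain m where m: "quasigroup Q m"
    and mR: "\<And>a b c. a \<in> Q \<Longrightarrow> b \<in> Q \<Longrightarrow> c \<in> Q \<Longrightarrow>
      mul (tri a b c (?\<sigma> 1)) (tri a b c (?\<sigma> 2)) = tri a b c (?\<sigma> 3) \<longleftrightarrow> m a b = c"
    using parastrophe[OF sperm] by blast
  \<comment> \<open>\<open>\<delta> i u\<close> is the label that the given labeling attaches to the
    standard point \<open>pt i u\<close>; \<open>\<gamma> i\<close> below inverts it.\<close>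
  define \<delta> where "\<delta> i u = inv_into Q (\<alpha> (\<tau> i)) (pt i u)" for i u
  have \<alpha>img: "\<alpha> (\<tau> i) ` Q = pt i ` {..<6}" if "i \<in> ?I" for i
    using labeling[OF t(1)[OF that]] img[OF that] by (simp add: bij_betw_def)
  have d: "\<delta> i u \<in> Q" "\<alpha> (\<tau> i) (\<delta> i u) = pt i u" if "i \<in> ?I" "u < 6" for i u
    unfolding \<delta>_def using \<alpha>img[OF that(1)] that(2) by (auto intro: inv_into_into f_inv_into_f)
  have dbij: "bij_betw (\<delta> i) {..<6} Q" if i: "i \<in> ?I" for i
  proof -
    have "inj_on (\<delta> i) {..<6}"
    proof (rule inj_onI)
      fix u v assume "u \<in> {..<6}" "v \<in> {..<6}" "\<delta> i u = \<delta> i v"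
      then have "pt i u = pt i v" using d(2)[OF i, of u] d(2)[OF i, of v] by simp
      then show "u = v" using inj_pt[OF i] \<open>u \<in> {..<6}\<close> \<open>v \<in> {..<6}\<close> by (auto dest: inj_onD)
    qed
    moreover have "\<delta> i ` {..<6} = Q"
      by (rule card_subset_eq[OF cQ(2)]) (use d(1)[OF i] card_image[OF calculation] cQ(1) in auto)
    ultimately show ?thesis by (simp add: bij_betw_def)
  qed
  define \<gamma> where "\<gamma> i = inv_into {..<6} (\<delta> i)" for i
  have g: "bij_betw (\<gamma> i) Q {..<6}" "\<And>a. a \<in> Q \<Longrightarrow> \<delta> i (\<gamma> i a) = a" "\<And>u. u < 6 \<Longrightarrow> \<gamma> i (\<delta> i u) = u"
    "\<And>a. a \<in> Q \<Longrightarrow> \<gamma> i a < 6" if i: "i \<in> ?I" for i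
    unfolding \<gamma>_def using dbij[OF i] bij_betw_inv_into[OF dbij[OF i]]
    by (auto simp: bij_betw_inv_into_right bij_betw_inv_into_left dest: bij_betwE)
  \<comment> \<open>The parastrophe \<open>m\<close> rewritten on the standard labels 0 to
    5.\<close>
  define L' where "L' u v = \<gamma> 3 (m (\<delta> 1 u) (\<delta> 2 v))" for u v
  interpret m: quasigroup Q m by fact
  have mQ: "m (\<delta> 1 u) (\<delta> 2 v) \<in> Q" if "u < 6" "v < 6" for u v using d that m.closed by simp
  have L'6: "L' u v < 6" if "u < 6" "v < 6" for u v
    unfolding L'_def using g(4)[of 3] mQ[OF that] by simp
  have dL': "\<delta> 3 (L' u v) = m (\<delta> 1 u) (\<delta> 2 v)" if "u < 6" "v < 6" for u v
    unfolding L'_def using g(2)[of 3] mQ[OF that] by simp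
  have block: "\<exists>B\<in>?M. {u, 6 + v, 12 + L' u v} \<subseteq> B" if uv: "u < 6" "v < 6" for u v
  proof -
    define T where "T = tri (\<delta> 1 u) (\<delta> 2 v) (\<delta> 3 (L' u v))"
    have T: "T i \<in> Q" if "i \<in> ?I" for i using that d uv L'6[OF uv] by (auto simp: T_def)
    have "mul (T (?\<sigma> 1)) (T (?\<sigma> 2)) = T (?\<sigma> 3)"
      unfolding T_def by (subst mR) (use d uv L'6[OF uv] dL'[OF uv] mQ[OF uv] in auto)
    then obtain B where B: "B \<in> ?M" "{\<alpha> 1 (T (?\<sigma> 1)), \<alpha> 2 (T (?\<sigma> 2)), \<alpha> 3 (T (?\<sigma> 3))} \<subseteq> B"
      using labeling_block[of "T (?\<sigma> 1)" "T (?\<sigma> 2)"] T sI by auto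
    have "\<alpha> (\<tau> i) (T i) \<in> B" if "i \<in> ?I" for i
    proof -
      have "\<alpha> (\<tau> i) (T (?\<sigma> (\<tau> i))) \<in> B" using B(2) t(1)[OF that] by auto
      then show ?thesis using permutes_inverses[OF perm] by simp
    qed
    from this[of 1] this[of 2] this[of 3]
    have "{u, 6 + v, 12 + L' u v} \<subseteq> B"
      using d(2)[of 1 u] d(2)[of 2 v] d(2)[of 3 "L' u v"] uv L'6[OF uv] by (simp add: T_def)
    with B(1) show ?thesis by blast
  qed
  have agree: "L' x y = L x y" if xy: "x < 6" "y < 6" "\<not> (x < k \<and> y < k)" for x y
  proof -
    obtain B where B: "B \<in> ?M" "{x, 6 + y, 12 + L' x y} \<subseteq> B" using block[OF xy(1,2)] by blast
    have l: "{x, 6 + y, 12 + L x y} \<in> lines k L" using lines_memI[OF xy] .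
    \<comment> \<open>Both blocks contain the two points \<open>x\<close> and
      \<open>6 + y\<close>.\<close>
    have "B = {x, 6 + y, 12 + L x y}"
      by (rule net_blocks_unique[OF h, of x "6 + y"]) (use B l xy in auto)
    then have "12 + L' x y \<in> {x, 6 + y, 12 + L x y}" using B(2) by blast
    then show ?thesis using xy by auto
  qed
  have "quasigroup {..<6} L'"
  proof (rule quasigroupI)
    have inj3: "inj_on (\<gamma> 3) Q" using g(1)[of 3] by (simp add: bij_betw_def)
    show "inj_on (L' x) {..<6}" if "x \<in> {..<6}" for x
    proof (rule inj_onI)
      fix y y' assume *: "y \<in> {..<6}" "y' \<in> {..<6}" "L' x y = L' x y'"
      then have "m (\<delta> 1 x) (\<delta> 2 y) = m (\<delta> 1 x) (\<delta> 2 y')"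
        using dL'[of x y] dL'[of x y'] that by simp
      then have "\<delta> 2 y = \<delta> 2 y'"
        using m.mul_left_cancel[of "\<delta> 1 x" "\<delta> 2 y" "\<delta> 2 y'"] d(1)[of 1 x] d(1)[of 2 y] d(1)[of 2 y'] *(1,2) that
        by simp
      from arg_cong[OF this, of "\<gamma> 2"] show "y = y'" using g(3)[of 2 y] g(3)[of 2 y'] *(1,2) by simp
    qed
    show "inj_on (\<lambda>x. L' x y) {..<6}" if "y \<in> {..<6}" for y
    proof (rule inj_onI)
      fix x x' assume *: "x \<in> {..<6}" "x' \<in> {..<6}" "L' x y = L' x' y"
      then have "m (\<delta> 1 x) (\<delta> 2 y) = m (\<delta> 1 x') (\<delta> 2 y)"
        using dL'[of x y] dL'[of x' y] that by simp
      then have "\<delta> 1 x = \<delta> 1 x'"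
        using m.mul_right_cancel[of "\<delta> 1 x" "\<delta> 1 x'" "\<delta> 2 y"] d(1)[of 1 x] d(1)[of 1 x'] d(1)[of 2 y] *(1,2) that
        by simp
      from arg_cong[OF this, of "\<gamma> 1"] show "x = x'" using g(3)[of 1 x] g(3)[of 1 x'] *(1,2) by simp
    qed
  qed (use L'6 in auto)
  moreover have "L' x y < k" if xy: "x < k" "y < k" for x y
  proof -
    obtain B where B: "B \<in> ?M" "{x, 6 + y, 12 + L' x y} \<subseteq> B" using block[of x y] xy k6 by auto
    \<comment> \<open>Here \<open>x\<close> and \<open>6 + y\<close> are both hole points, so the
      block of the triple is the hole.\<close>
    have "B = hole k"
      by (rule net_blocks_unique[OF h, of x "6 + y"]) (use B xy k6 in \<open>auto simp: hole_def\<close>)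
    then show ?thesis using B(2) L'6[of x y] xy k6 by (auto simp: hole_def)
  qed
  ultimately have "holed k L'" using k6 by (simp add: holed_def)
  moreover have "isostrophic Q mul {..<6} L'"
    unfolding isostrophic_def
  proof (intro exI conjI ballI allI impI)
    show "?\<sigma> permutes ?I" by fact
    show "bij_betw (\<gamma> i) Q {..<6}" if "i \<in> ?I" for i using g(1)[OF that] .
    fix x assume x: "\<forall>i\<in>?I. x i \<in> Q"
    have e: "x (?\<sigma> i) = tri (x 1) (x 2) (x 3) (?\<sigma> i)" if "i \<in> ?I" for i using sI[OF that] by auto
    have "mul (x (?\<sigma> 1)) (x (?\<sigma> 2)) = x (?\<sigma> 3) \<longleftrightarrow> m (x 1) (x 2) = x 3"
      using mR[of "x 1" "x 2" "x 3"] e[of 1] e[of 2] e[of 3] x by simp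
    also have "\<dots> \<longleftrightarrow> \<gamma> 3 (m (x 1) (x 2)) = \<gamma> 3 (x 3)"
      using g(2)[of 3] x m.closed by (metis insertCI)
    finally show "mul (x (?\<sigma> 1)) (x (?\<sigma> 2)) = x (?\<sigma> 3) \<longleftrightarrow> L' (\<gamma> 1 (x 1)) (\<gamma> 2 (x 2)) = \<gamma> 3 (x 3)"
      using g(2) x by (simp add: L'_def)
  qed
  ultimately show ?thesis using that agree by blast
qed

section \<open>Transport along isomorphisms\<close>

lemma multinet_iso_trans: "multinet_iso N N' \<Longrightarrow> multinet_iso N' N'' \<Longrightarrow> multinet_iso N N''"
proof -
  assume N: "multinet_iso N N'" and N': "multinet_iso N' N''"
  obtain f where f: "bij_betw f (fst N) (fst N')" "(`) f ` snd N = snd N'"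
    using N unfolding multinet_iso_def by blast
  obtain g where g: "bij_betw g (fst N') (fst N'')" "(`) g ` snd N' = snd N''"
    using N' unfolding multinet_iso_def by blast
  have "(`) (g \<circ> f) ` snd N = (`) g ` (`) f ` snd N" by (simp add: image_image image_comp comp_def)
  then show ?thesis unfolding multinet_iso_def using bij_betw_trans[OF f(1) g(1)] f(2) g(2) by metis
qed

lemma inv_blocks:
  assumes f: "bij_betw f P P'" "(`) f ` M = M'" and M: "M \<subseteq> Pow P"
  shows "bij_betw (inv_into P f) P' P" "(`) (inv_into P f) ` M' = M"
proof -
  show "bij_betw (inv_into P f) P' P" using f(1) by (rule bij_betw_inv_into)
  have "inv_into P f ` f ` B = B" if "B \<in> M" for B
  proof -
    have "B \<subseteq> P" using M that by blast
    then show ?thesis using f(1) by (intro inv_into_image_cancel) (auto simp: bij_betw_def)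
  qed
  then have "(`) (inv_into P f) ` (`) f ` M = id ` M"
    unfolding image_image by (intro image_cong) auto
  then show "(`) (inv_into P f) ` M' = M" using f(2) by simp
qed

lemma multinet_iso_sym:
  assumes "multinet_iso N N'" "snd N \<subseteq> Pow (fst N)"
  shows "multinet_iso N' N"
  using assms inv_blocks unfolding multinet_iso_def by metis

lemma multinet_iso_refl: "multinet_iso N N"
  unfolding multinet_iso_def by (rule exI[of _ id]) simp

lemma light_dual_multinet_transport:
  assumes "light_dual_multinet Q mul P M Pc \<alpha>" and g: "bij_betw g P P'" and M': "M' = (`) g ` M"
  shows "light_dual_multinet Q mul P' M' (\<lambda>i. g ` Pc i) (\<lambda>i x. g (\<alpha> i x))"
proof -
  interpret light_dual_multinet Q mul P M Pc \<alpha> by fact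
  have inj: "inj_on g P" and img: "g ` P = P'" using g by (auto simp: bij_betw_def)
  have sub: "Pc i \<subseteq> P" if "i \<in> {1, 2, 3}" for i using components that by auto
  have mem: "g p \<in> g ` B \<longleftrightarrow> p \<in> B" if "p \<in> P" "B \<in> M" for p B
    by (rule inj_on_image_mem_iff[OF inj that(1)]) (use blocks that(2) in auto)
  show ?thesis
  proof
    show "P' = g ` Pc 1 \<union> g ` Pc 2 \<union> g ` Pc 3" unfolding img[symmetric] components by (simp add: image_Un)
    show "disjoint_family_on (\<lambda>i. g ` Pc i) {1, 2, 3}"
      unfolding disjoint_family_on_def
    proof (intro ballI impI)
      fix i j :: nat assume ij: "i \<in> {1, 2, 3}" "j \<in> {1, 2, 3}" "i \<noteq> j"
      have "g ` Pc i \<inter> g ` Pc j = g ` (Pc i \<inter> Pc j)"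
        by (rule inj_on_image_Int[OF inj sub[OF ij(1)] sub[OF ij(2)], symmetric])
      also have "Pc i \<inter> Pc j = {}" using components_disjoint ij unfolding disjoint_family_on_def by blast
      finally show "g ` Pc i \<inter> g ` Pc j = {}" by simp
    qed
    show "M' \<subseteq> Pow P'" using blocks img M' by auto
    show "B = B'" if pq: "p \<in> P'" "q \<in> P'" "p \<noteq> q" "B \<in> M'" "B' \<in> M'" "{p, q} \<subseteq> B" "{p, q} \<subseteq> B'" for p q B B'
    proof -
      obtain p0 q0 where p0: "p0 \<in> P" "p = g p0" "q0 \<in> P" "q = g q0" using pq(1,2) img by auto
      obtain D D' where D: "D \<in> M" "B = g ` D" "D' \<in> M" "B' = g ` D'" using pq(4,5) M' by auto
      have "{p0, q0} \<subseteq> D" "{p0, q0} \<subseteq> D'" using pq(6,7) D p0 mem by auto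
      then have "D = D'" using block_unique[OF p0(1,3) _ D(1,3)] pq(3) p0 by auto
      then show ?thesis using D by simp
    qed
    show "B \<inter> g ` Pc i \<noteq> {}" if "B \<in> M'" "i \<in> {1, 2, 3}" for B i
      using block_meets[OF _ that(2)] that(1) M' by fastforce
    show "bij_betw (\<lambda>x. g (\<alpha> i x)) Q (g ` Pc i)" if "i \<in> {1, 2, 3}" for i
      using bij_betw_trans[OF labeling[OF that] bij_betw_subset[OF g sub[OF that] refl]] by (simp add: comp_def)
    show "\<exists>B\<in>M'. {g (\<alpha> 1 x), g (\<alpha> 2 y), g (\<alpha> 3 (mul x y))} \<subseteq> B" if "x \<in> Q" "y \<in> Q" for x y
      using labeling_block[OF that] M' by fastforce
    obtain B B' where B: "B \<in> M" "B' \<in> M" "B \<noteq> B'" using two_blocks by blast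
    have "g ` B \<noteq> g ` B'" using inj_on_image_eq_iff[OF inj, of B B'] blocks B by blast
    then show "\<exists>B\<in>M'. \<exists>B'\<in>M'. B \<noteq> B'" using B M' by blast
  qed
qed

section \<open>Fillings of the hole\<close>

definition fill :: "nat \<Rightarrow> (nat \<Rightarrow> nat list) \<Rightarrow> nat list list \<Rightarrow> nat \<Rightarrow> nat list" where
  "fill k T s x = (if x < k then s ! x @ drop k (T x) else T x)"

text \<open>There are 2 such squares for \<open>k = 2\<close> and 12 for \<open>k = 3\<close>; the
  lists in \<open>fill_certs\<close> follow the order of this enumeration.\<close>

definition latin_squares :: "nat \<Rightarrow> nat list list list" where
  "latin_squares k = filter (\<lambda>s. list_all (\<lambda>y. distinct (map (\<lambda>r. r ! y) s)) [0..<k])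
     (List.n_lists k (filter distinct (List.n_lists k [0..<k])))"

lemma latin_squaresD:
  "s \<in> set (latin_squares k) \<Longrightarrow> length s = k \<and> (\<forall>r\<in>set s. length r = k)"
  by (auto simp: latin_squares_def set_n_lists)

lemma entry_fill_off:
  assumes "table T" "s \<in> set (latin_squares k)" "x < 6" "y < 6" "\<not> (x < k \<and> y < k)" "k < 6"
  shows "entry (fill k T s) x y = entry T x y"
proof (cases "x < k")
  case True
  then have "length (s ! x) = k" using latin_squaresD[OF assms(2)] by simp
  then show ?thesis using True assms by (simp add: entry_def fill_def nth_append table_def)
qed (simp add: entry_def fill_def)

text \<open>Closure of the corner makes the values of \<open>L'\<close> there a Latin square on
  \<open>{..<k}\<close>, hence one of those enumerated.\<close>

lemma fill_exists:
  assumes T: "table T" and h: "holed k L'"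
    and agree: "\<And>x y. x < 6 \<Longrightarrow> y < 6 \<Longrightarrow> \<not> (x < k \<and> y < k) \<Longrightarrow> L' x y = entry T x y"
  obtains s where "s \<in> set (latin_squares k)"
    "\<And>x y. x < 6 \<Longrightarrow> y < 6 \<Longrightarrow> L' x y = entry (fill k T s) x y"
proof -
  have k6: "k < 6" and sub: "\<And>x y. x < k \<Longrightarrow> y < k \<Longrightarrow> L' x y < k" using h by (auto simp: holed_def)
  define s where "s = map (\<lambda>x. map (L' x) [0..<k]) [0..<k]"
  have nth: "s ! x ! y = L' x y" if "x < k" "y < k" for x y using that by (simp add: s_def)
  have len: "length (s ! x) = k" if "x < k" for x using that by (simp add: s_def)
  have row: "distinct (map (L' x) [0..<k])" if "x < k" for x
    using holed_left_cancel[OF h, of x] that k6 by (auto simp: distinct_map inj_on_def)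
  have col: "distinct (map (\<lambda>r. r ! y) s)" if "y < k" for y
  proof -
    have e: "map (\<lambda>r. r ! y) s = map (\<lambda>x. L' x y) [0..<k]" using that by (simp add: s_def)
    show ?thesis unfolding e using holed_right_cancel[OF h, of _ _ y] that k6 by (auto simp: distinct_map inj_on_def)
  qed
  have "set s \<subseteq> {r. length r = k \<and> set r \<subseteq> {0..<k} \<and> distinct r}"
    using row sub by (auto simp: s_def)
  then have "s \<in> set (latin_squares k)"
    using col unfolding latin_squares_def by (auto simp: set_n_lists list_all_iff s_def)
  moreover have "L' x y = entry (fill k T s) x y" if xy: "x < 6" "y < 6" for x y
  proof (cases "x < k \<and> y < k")
    case True
    then show ?thesis using nth len by (simp add: entry_def fill_def nth_append)
  next
    case False
    then show ?thesis using entry_fill_off[OF T calculation xy False k6] agree[OF xy False] by simp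
  qed
  ultimately show ?thesis using that by blast
qed

lemma isostrophic_cong:
  assumes "isostrophic Q mul R m" "\<And>x y. x \<in> R \<Longrightarrow> y \<in> R \<Longrightarrow> m x y = m' x y"
  shows "isostrophic Q mul R m'"
proof -
  obtain \<sigma> \<gamma> where s: "\<sigma> permutes {1, 2, 3::nat}" and g: "\<forall>i\<in>{1, 2, 3::nat}. bij_betw (\<gamma> i) Q R"
    and sg: "\<forall>x. (\<forall>i\<in>{1, 2, 3::nat}. x i \<in> Q) \<longrightarrow> (mul (x (\<sigma> 1)) (x (\<sigma> 2)) = x (\<sigma> 3) \<longleftrightarrow>
              m (\<gamma> 1 (x 1)) (\<gamma> 2 (x 2)) = \<gamma> 3 (x 3))"
    using assms(1) unfolding isostrophic_def by blast
  have "m (\<gamma> 1 (x 1)) (\<gamma> 2 (x 2)) = m' (\<gamma> 1 (x 1)) (\<gamma> 2 (x 2))" if "\<forall>i\<in>{1, 2, 3::nat}. x i \<in> Q" for x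
    using assms(2) g that by (meson bij_betwE insertCI)
  then show ?thesis unfolding isostrophic_def using s g sg by (intro exI[of _ \<sigma>] exI[of _ \<gamma>]) simp
qed

lemma lines_cong:
  assumes "\<And>x y. x < 6 \<Longrightarrow> y < 6 \<Longrightarrow> \<not> (x < k \<and> y < k) \<Longrightarrow> L' x y = L x y"
  shows "lines k L' = lines k L"
proof -
  have "B \<in> lines k L1 \<Longrightarrow> B \<in> lines k L2"
    if "\<And>x y. x < 6 \<Longrightarrow> y < 6 \<Longrightarrow> \<not> (x < k \<and> y < k) \<Longrightarrow> L1 x y = L2 x y" for L1 L2 :: "nat \<Rightarrow> nat \<Rightarrow> nat" and B
  proof -
    assume "B \<in> lines k L1"
    then obtain x y where "x < 6" "y < 6" "\<not> (x < k \<and> y < k)" "B = {x, 6 + y, 12 + L1 x y}"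
      unfolding lines_def by blast
    then show "B \<in> lines k L2" using lines_memI[of x y k L2] that[of x y] by simp
  qed
  from this[of L' L] this[of L L'] show ?thesis using assms by fastforce
qed

definition fill_cert :: "nat \<Rightarrow> (nat \<Rightarrow> nat list) \<Rightarrow> nat list list \<Rightarrow> nat \<times> nat list \<times> nat list list \<Rightarrow> bool" where
  "fill_cert k T s c = (case c of (j, p, g) \<Rightarrow> 1 \<le> j \<and> j \<le> 12 \<and> square k (fill k T s) \<and>
     isostrophy_cert (entry (fill k T s)) (Q6 j) p g)"

text \<open>A labeling of an isomorphic copy is pulled back to the net and becomes a filling of the
  hole, whose certificate names its class; \<open>Q6_not_isostrophic\<close> identifies that class
  with \<open>j\<close>. Conversely each filling labels the net itself, since \<open>lines\<close>
  ignores the cells of the hole.\<close>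

lemma label_indices_net:
  assumes T: "square k T" and k: "0 < k" and c: "list_all2 (fill_cert k T) (latin_squares k) cs"
  shows "label_indices (net k (entry T)) = set (map fst cs)"
proof
  note h = square_holed[OF T]
  have k6: "k < 6" using T by (simp add: square_def)
  show "label_indices (net k (entry T)) \<subseteq> set (map fst cs)"
  proof
    fix j assume "j \<in> label_indices (net k (entry T))"
    then obtain N' :: "nat point_block" and Q :: "nat set" and mul Pc \<alpha> where j: "j \<in> {1..12}"
      and N': "multinet_iso (net k (entry T)) N'" and M: "light_dual_multinet Q mul (fst N') (snd N') Pc \<alpha>"
      and iso: "isostrophic Q mul {1..6} (Q6 j)"
      unfolding label_indices_def by blast
    obtain f where f: "bij_betw f {..<18} (fst N')" "(`) f ` insert (hole k) (lines k (entry T)) = snd N'"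
      using N' unfolding multinet_iso_def net_def by auto
    have "insert (hole k) (lines k (entry T)) \<subseteq> Pow {..<18}"
      using lines_sub[OF h] by (auto simp: hole_def)
    note g = inv_blocks[OF f this]
    obtain L' where L': "holed k L'" "\<And>x y. x < 6 \<Longrightarrow> y < 6 \<Longrightarrow> \<not> (x < k \<and> y < k) \<Longrightarrow> L' x y = entry T x y"
      "isostrophic Q mul {..<6} L'"
      using net_fill[OF h k light_dual_multinet_transport[OF M g(1) g(2)[symmetric]]] by blast
    obtain s where s: "s \<in> set (latin_squares k)" "\<And>x y. x < 6 \<Longrightarrow> y < 6 \<Longrightarrow> L' x y = entry (fill k T s) x y"
      using fill_exists[OF square_table[OF T] L'(1,2)] by blast
    then obtain j' p g where c': "(j', p, g) \<in> set cs" "fill_cert k T s (j', p, g)"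
      using c by (metis list_all2_conv_all_nth in_set_conv_nth prod_cases3)
    then have j': "j' \<in> {1..12}" "isostrophic {..<6} (entry (fill k T s)) {1..6} (Q6 j')"
      using isostrophy_cert by (auto simp: fill_cert_def)
    have "isostrophic Q mul {..<6} (entry (fill k T s))"
      using isostrophic_cong[OF L'(3)] s(2) by simp
    then have "isostrophic {1..6} (Q6 j) {1..6} (Q6 j')"
      using isostrophic_trans[OF isostrophic_sym[OF iso]] isostrophic_trans[OF _ j'(2)] by blast
    then have "j = j'" using Q6_not_isostrophic[OF j j'(1)] by blast
    then show "j \<in> set (map fst cs)" using c'(1) by force
  qed
  show "set (map fst cs) \<subseteq> label_indices (net k (entry T))"
  proof
    fix j assume "j \<in> set (map fst cs)"
    then obtain p g where "(j, p, g) \<in> set cs" by auto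
    then obtain s where s: "s \<in> set (latin_squares k)" "fill_cert k T s (j, p, g)"
      using c by (metis list_all2_conv_all_nth in_set_conv_nth)
    then have j: "j \<in> {1..12}" and F: "square k (fill k T s)"
      and iso: "isostrophic {..<6} (entry (fill k T s)) {1..6} (Q6 j)"
      using isostrophy_cert by (auto simp: fill_cert_def)
    have "lines k (entry (fill k T s)) = lines k (entry T)"
      by (rule lines_cong) (rule entry_fill_off[OF square_table[OF T] s(1) _ _ _ k6])
    then have "light_dual_multinet {..<6} (entry (fill k T s)) (fst (net k (entry T))) (snd (net k (entry T)))
        (\<lambda>i. pt i ` {..<6}) pt"
      using net_multinet[OF square_holed[OF F] k] by (simp add: net_def)
    then show "j \<in> label_indices (net k (entry T))"
      unfolding label_indices_def using j iso multinet_iso_refl by blast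
  qed
qed

text \<open>The side condition on the blocks makes the isomorphism invertible, so that labelings can
  be transferred both ways.\<close>

lemma label_indices_iso:
  assumes "multinet_iso N N'" "snd N \<subseteq> Pow (fst N)"
  shows "label_indices N = label_indices N'"
  unfolding label_indices_def
  using multinet_iso_trans assms(1) multinet_iso_trans[OF multinet_iso_sym[OF assms]] by metis

section \<open>Reduction to squares with a hole in the corner\<close>

context light_dual_multinet
begin

text \<open>With \<open>k\<close> the length of the superline, a row off it sends its
  \<open>k\<close> columns injectively to symbols off it, so \<open>2 * k \<le> 6\<close>. Such a
  row exists because every other block would share two points with a block containing all
  points.\<close>

lemma superline_length:
  assumes cQ: "card Q = 6" and B: "superline Q \<alpha> M B"
  shows "block_length Q \<alpha> B \<in> {2, 3}"
proof -
  let ?S = "block_labels Q \<alpha> B"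
  have BM: "B \<in> M" and k2: "2 \<le> block_length Q \<alpha> B" using B by (auto simp: superline_def)
  have fin: "finite Q" using cQ by (metis card.infinite zero_neq_numeral)
  have sub: "subsquare Q mul (?S 1) (?S 2) (?S 3)" by (rule block_subsquare[OF BM])
  have S: "?S i \<subseteq> Q" for i by (auto simp: block_labels_def)
  have "?S 1 \<noteq> Q"
  proof
    assume "?S 1 = Q"
    then have "card (?S i) = card Q" if "i \<in> {1, 2, 3}" for i
      using block_cards[OF BM that] by (simp add: block_length_def)
    then have full: "?S i = Q" if "i \<in> {1, 2, 3}" for i
      using card_subset_eq[OF fin S] that by blast
    have PB: "Pc i \<subseteq> B" if i: "i \<in> {1, 2, 3}" for i
    proof
      fix p assume "p \<in> Pc i"
      then obtain x where "x \<in> Q" "p = \<alpha> i x" using label_preimage i by blast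
      then show "p \<in> B" using full[OF i] by (auto simp: block_labels_def)
    qed
    obtain D D' where D: "D \<in> M" "D' \<in> M" "D \<noteq> D'" using two_blocks by blast
    obtain B' where B': "B' \<in> M" "B' \<noteq> B"
    proof (cases "D = B")
      case True with D that[of D'] show ?thesis by blast
    next
      case False with D that[of D] show ?thesis by blast
    qed
    obtain p q where pq: "p \<in> B'" "p \<in> Pc 1" "q \<in> B'" "q \<in> Pc 2"
      using block_meets[OF B'(1), of 1] block_meets[OF B'(1), of 2] by auto
    have "p \<noteq> q" using pq components_disjoint by (auto simp: disjoint_family_on_def)
    then have "B' = B"
      using block_unique[of p q B' B] pq B' BM PB[of 1] PB[of 2] components by auto
    with B' show False by simp
  qed
  then obtain a where a: "a \<in> Q" "a \<notin> ?S 1" using S by blast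
  have "inj_on (mul a) (?S 2)"
    using mul_left_cancel[OF a(1)] S[of 2] by (auto simp: inj_on_def)
  then have "card (mul a ` ?S 2) = block_length Q \<alpha> B" using block_cards[OF BM, of 2] by (simp add: card_image)
  moreover have "mul a ` ?S 2 \<subseteq> Q - ?S 3"
    using sub a closed S[of 2] unfolding subsquare_def by blast
  ultimately have "block_length Q \<alpha> B \<le> card (Q - ?S 3)" using fin by (metis card_mono finite_Diff)
  also have "\<dots> = 6 - block_length Q \<alpha> B"
    using card_Diff_subset[OF finite_subset[OF S fin] S[of 3]] block_cards[OF BM, of 3] cQ by simp
  finally show ?thesis using k2 by auto
qed

text \<open>A block of length 1 has one point in each component, and closure of its subsquare makes
  the third label the product.\<close>

lemma short_block:
  assumes fin: "finite Q" and D: "D \<in> M" "\<not> superline Q \<alpha> M D"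
  obtains x y where "x \<in> Q" "y \<in> Q" "D = {\<alpha> 1 x, \<alpha> 2 y, \<alpha> 3 (mul x y)}"
proof -
  let ?S = "block_labels Q \<alpha> D"
  have S: "?S i \<subseteq> Q" for i by (auto simp: block_labels_def)
  have "card (?S i) = 1" if i: "i \<in> {1, 2, 3}" for i
  proof -
    have "block_length Q \<alpha> D < 2" using D by (simp add: superline_def)
    moreover have "card (?S i) > 0"
      using block_labels_ne[OF D(1) i] finite_subset[OF S fin] by (simp add: card_gt_0_iff)
    ultimately show ?thesis using block_cards[OF D(1) i] by simp
  qed
  then obtain x y z where xyz: "?S 1 = {x}" "?S 2 = {y}" "?S 3 = {z}"
    by (metis card_1_singletonE insertCI)
  have xy: "x \<in> Q" "y \<in> Q" using xyz S[of 1] S[of 2] by auto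
  have "mul x y \<in> ?S 3" using block_subsquare[OF D(1)] xyz unfolding subsquare_def by blast
  then have z: "z = mul x y" using xyz by simp
  have "D = {\<alpha> 1 x, \<alpha> 2 y, \<alpha> 3 z}"
  proof
    show "D \<subseteq> {\<alpha> 1 x, \<alpha> 2 y, \<alpha> 3 z}"
    proof
      fix p assume p: "p \<in> D"
      then obtain i where i: "i \<in> {1, 2, 3}" "p \<in> Pc i" using blocks D(1) components by blast
      then obtain t where "t \<in> Q" "p = \<alpha> i t" using label_preimage by blast
      then have "t \<in> ?S i" using p by (simp add: block_labels_def)
      then show "p \<in> {\<alpha> 1 x, \<alpha> 2 y, \<alpha> 3 z}" using i(1) xyz \<open>p = \<alpha> i t\<close> by auto
    qed
    have "x \<in> ?S 1" "y \<in> ?S 2" "z \<in> ?S 3" using xyz by auto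
    then show "{\<alpha> 1 x, \<alpha> 2 y, \<alpha> 3 z} \<subseteq> D" by (simp add: block_labels_def)
  qed
  with xy z that show ?thesis by blast
qed

text \<open>Symbols are named by their column in row \<open>a\<close> and rows by their symbol in
  column \<open>b 0\<close>, so row 0 and column 0 become identities. The last property expresses
  \<open>L\<close> through \<open>mul\<close>; it lets the caller arrange the second row by ordering
  the columns suitably.\<close>

lemma reduced_square:
  assumes cQ: "card Q = 6" and B: "superline Q \<alpha> M B" and uniq: "\<forall>B'. superline Q \<alpha> M B' \<longrightarrow> B' = B"
    and k: "k = block_length Q \<alpha> B"
    and a: "a \<in> block_labels Q \<alpha> B 1" and b: "bij_betw b {..<6} Q" "b ` {..<k} = block_labels Q \<alpha> B 2"
  obtains L where "holed k L" "\<And>y. y < 6 \<Longrightarrow> L 0 y = y" "\<And>x. x < 6 \<Longrightarrow> L x 0 = x"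
    "multinet_iso (P, M) (net k L)"
    "\<And>x y z. x < 6 \<Longrightarrow> y < 6 \<Longrightarrow> z < 6 \<Longrightarrow> L x y = z \<longleftrightarrow>
       (\<exists>r\<in>Q. mul r (b 0) = mul a (b x) \<and> mul r (b y) = mul a (b z))"
proof -
  let ?S = "block_labels Q \<alpha> B"
  have BM: "B \<in> M" and k2: "2 \<le> k" using B k by (auto simp: superline_def)
  have k3: "k \<in> {2, 3}" using superline_length[OF cQ B] k by simp
  then have k6: "k < 6" by auto
  have fin: "finite Q" using cQ by (metis card.infinite zero_neq_numeral)
  have S: "?S i \<subseteq> Q" for i by (auto simp: block_labels_def)
  have cS: "card (?S i) = k" if "i \<in> {1, 2, 3}" for i using block_cards[OF BM that] k by simp
  have sub3: "mul x y \<in> ?S 3" if "x \<in> ?S 1" "y \<in> ?S 2" for x y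
    using block_subsquare[OF BM] that unfolding subsquare_def by blast
  have sub1: "x \<in> ?S 1" if "y \<in> ?S 2" "x \<in> Q" "mul x y \<in> ?S 3" for x y
    using block_subsquare[OF BM] that unfolding subsquare_def by blast
  have aQ: "a \<in> Q" using a S by blast
  have bQ: "b y \<in> Q" if "y < 6" for y using b(1) that by (meson bij_betwE lessThan_iff)
  define c where "c y = mul a (b y)" for y
  have bij_c: "bij_betw c {..<6} Q"
  proof -
    have "inj_on c {..<6}"
      using mul_left_cancel[OF aQ] bQ b(1) by (auto simp: c_def inj_on_def bij_betw_def)
    moreover have "c ` {..<6} = Q"
      by (rule card_subset_eq[OF fin]) (use closed[OF aQ] bQ card_image[OF calculation] cQ in \<open>auto simp: c_def\<close>)
    ultimately show ?thesis by (simp add: bij_betw_def)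
  qed
  have cQ': "c y \<in> Q" if "y < 6" for y using bij_c that by (meson bij_betwE lessThan_iff)
  have b0: "b 0 \<in> ?S 2" unfolding b(2)[symmetric] using k2 by (intro imageI) simp
  define r where "r x = (THE s. s \<in> Q \<and> mul s (b 0) = c x)" for x
  have r: "r x \<in> Q" "mul (r x) (b 0) = c x" if "x < 6" for x
    using theI'[OF right_div[OF bQ[of 0] cQ'[OF that]]] unfolding r_def by auto
  have r_eq: "r x = s" if "x < 6" "s \<in> Q" "mul s (b 0) = c x" for x s
    using mul_right_cancel[OF r(1)[OF that(1)] that(2) bQ[of 0]] r(2)[OF that(1)] that(3) by simp
  have bij_r: "bij_betw r {..<6} Q"
  proof -
    have "inj_on r {..<6}"
      using r(2) bij_c by (metis bij_betw_def inj_on_def lessThan_iff)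
    moreover have "r ` {..<6} = Q"
      by (rule card_subset_eq[OF fin]) (use r(1) card_image[OF calculation] cQ in auto)
    ultimately show ?thesis by (simp add: bij_betw_def)
  qed
  have cS3: "c ` {..<k} = ?S 3"
  proof (rule card_subset_eq[OF finite_subset[OF S fin]])
    show "c ` {..<k} \<subseteq> ?S 3" using sub3[OF a] b(2) by (auto simp: c_def)
    have "inj_on c {..<k}" using bij_c k6 by (auto simp: bij_betw_def intro: inj_on_subset)
    then show "card (c ` {..<k}) = card (?S 3)" using cS[of 3] by (simp add: card_image)
  qed
  have rS1: "r ` {..<k} = ?S 1"
  proof (rule card_subset_eq[OF finite_subset[OF S fin]])
    show "r ` {..<k} \<subseteq> ?S 1"
    proof clarify
      fix x assume x: "x < k"
      then have x6: "x < 6" using k6 by simp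
      have "mul (r x) (b 0) \<in> ?S 3" using cS3 x r(2)[OF x6] by auto
      then show "r x \<in> ?S 1" using sub1[OF b0 r(1)[OF x6]] by blast
    qed
    have "inj_on r {..<k}" using bij_r k6 by (auto simp: bij_betw_def intro: inj_on_subset)
    then show "card (r ` {..<k}) = card (?S 1)" using cS[of 1] by (simp add: card_image)
  qed
  \<comment> \<open>The column in which row \<open>a\<close> carries the symbol found in row
    \<open>r x\<close> and column \<open>b y\<close>.\<close>
  define L where "L x y = inv_into {..<6} c (mul (r x) (b y))" for x y
  have L: "c (L x y) = mul (r x) (b y)" "L x y < 6" if "x < 6" "y < 6" for x y
  proof -
    have "mul (r x) (b y) \<in> c ` {..<6}" using closed[OF r(1)[OF that(1)] bQ[OF that(2)]] bij_c by (simp add: bij_betw_def)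
    then show "c (L x y) = mul (r x) (b y)" "L x y < 6"
      unfolding L_def using f_inv_into_f[of _ c "{..<6}"] inv_into_into[of _ c "{..<6}"] by auto
  qed
  have L_eq: "L x y = z \<longleftrightarrow> mul (r x) (b y) = c z" if "x < 6" "y < 6" "z < 6" for x y z
    using L[OF that(1,2)] bij_c that(3) by (metis bij_betw_def inj_onD lessThan_iff)
  have L0: "L 0 y = y" if "y < 6" for y
    using L_eq[OF _ that that, of 0] r_eq[of 0 a] aQ that by (simp add: c_def)
  have Lx0: "L x 0 = x" if "x < 6" for x using L_eq[OF that _ that, of 0] r(2)[OF that] by simp
  have inS: "b y \<in> ?S 2 \<longleftrightarrow> y < k" "c y \<in> ?S 3 \<longleftrightarrow> y < k" "r y \<in> ?S 1 \<longleftrightarrow> y < k" if "y < 6" for y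
  proof -
    have *: "g y \<in> g ` {..<k} \<longleftrightarrow> y < k" if "bij_betw g {..<6} Q" for g :: "nat \<Rightarrow> 'q"
      using that \<open>y < 6\<close> k6 inj_on_image_mem_iff[of g "{..<6}" y "{..<k}"] by (auto simp: bij_betw_def)
    show "b y \<in> ?S 2 \<longleftrightarrow> y < k" "c y \<in> ?S 3 \<longleftrightarrow> y < k" "r y \<in> ?S 1 \<longleftrightarrow> y < k"
      using *[OF b(1)] *[OF bij_c] *[OF bij_r] b(2) cS3 rS1 by auto
  qed
  have "quasigroup {..<6} L"
  proof (rule quasigroupI)
    show "inj_on (L x) {..<6}" if "x \<in> {..<6}" for x
    proof (rule inj_onI)
      fix y y' assume *: "y \<in> {..<6}" "y' \<in> {..<6}" "L x y = L x y'"
      then have "mul (r x) (b y) = mul (r x) (b y')" using L(1) that by (metis lessThan_iff)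
      then have "b y = b y'" using mul_left_cancel[of "r x" "b y" "b y'"] r(1)[of x] bQ[of y] bQ[of y'] *(1,2) that by simp
      then show "y = y'" using b(1) *(1,2) by (auto simp: bij_betw_def dest: inj_onD)
    qed
    show "inj_on (\<lambda>x. L x y) {..<6}" if "y \<in> {..<6}" for y
    proof (rule inj_onI)
      fix x x' assume *: "x \<in> {..<6}" "x' \<in> {..<6}" "L x y = L x' y"
      then have "mul (r x) (b y) = mul (r x') (b y)" using L(1) that by (metis lessThan_iff)
      then have "r x = r x'" using mul_right_cancel[of "r x" "r x'" "b y"] r(1)[of x] r(1)[of x'] bQ[of y] *(1,2) that by simp
      then show "x = x'" using bij_r *(1,2) by (auto simp: bij_betw_def dest: inj_onD)
    qed
  qed (use L(2) in auto)
  moreover have "L x y < k" if "x < k" "y < k" for x y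
  proof -
    have xy: "x < 6" "y < 6" using that k6 by auto
    have "mul (r x) (b y) \<in> ?S 3" using sub3 inS(3)[OF xy(1)] inS(1)[OF xy(2)] that by blast
    then show ?thesis using L[OF xy] inS(2)[OF L(2)[OF xy]] by simp
  qed
  ultimately have h: "holed k L" using k6 by (simp add: holed_def)
  \<comment> \<open>Rows, columns and symbols are relabelled by \<open>r\<close>, \<open>b\<close>
    and \<open>c\<close>; composed with the labeling this gives a bijection \<open>f\<close> from
    the standard points onto \<open>P\<close>.\<close>
  define \<beta> where "\<beta> = tri r b c"
  have bij_\<beta>: "bij_betw (\<beta> i) {..<6} Q" if "i \<in> {1, 2, 3}" for i
    using that b(1) bij_c bij_r unfolding \<beta>_def by auto
  define f where "f u = \<alpha> (u div 6 + 1) (\<beta> (u div 6 + 1) (u mod 6))" for u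
  have f: "f (pt i u) = \<alpha> i (\<beta> i u)" if "i \<in> {1, 2, 3}" "u < 6" for i u
    unfolding f_def pt_div_mod[OF that] ..
  have fc: "bij_betw (\<lambda>u. f (pt i u)) {..<6} (Pc i)" if i: "i \<in> {1, 2, 3}" for i
    using bij_betw_cong[of "{..<6}" "\<lambda>u. f (pt i u)" "\<alpha> i \<circ> \<beta> i" "Pc i"]
      bij_betw_trans[OF bij_\<beta>[OF i] labeling[OF i]] f[OF i] by simp
  have bij_f: "bij_betw f {..<18} P"
    unfolding bij_betw_def
  proof
    show "inj_on f {..<18}"
    proof (rule inj_onI)
      fix u v assume u: "u \<in> {..<18}" and v: "v \<in> {..<18}" and e: "f u = f v"
      obtain i x where ix: "i \<in> {1, 2, 3}" "x < 6" "u = pt i x" using u pt_cases by (metis lessThan_iff)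
      obtain j y where jy: "j \<in> {1, 2, 3}" "y < 6" "v = pt j y" using v pt_cases by (metis lessThan_iff)
      have "f u \<in> Pc i" "f v \<in> Pc j" using fc[OF ix(1)] fc[OF jy(1)] ix jy by (auto dest: bij_betwE)
      then have "i = j" using components_disjoint ix(1) jy(1) e by (metis disjoint_family_on_def disjoint_iff)
      moreover have "inj_on (\<lambda>u. f (pt i u)) {..<6}" using fc[OF ix(1)] by (simp add: bij_betw_def)
      ultimately show "u = v" using ix jy e by (auto dest: inj_onD)
    qed
    have "f ` {..<18} = (\<Union>i\<in>{1, 2, 3}. (\<lambda>u. f (pt i u)) ` {..<6})"
      unfolding UN_pt[symmetric] image_UN image_image ..
    also have "\<dots> = (\<Union>i\<in>{1, 2, 3}. Pc i)"
      using fc by (intro SUP_cong) (auto simp: bij_betw_def)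
    also have "\<dots> = P" using components by auto
    finally show "f ` {..<18} = P" .
  qed
  have f3: "f x = \<alpha> 1 (r x)" "f (6 + x) = \<alpha> 2 (b x)" "f (12 + x) = \<alpha> 3 (c x)" if "x < 6" for x
    using f[of 1 x] f[of 2 x] f[of 3 x] that by (simp_all add: \<beta>_def)
  have fB: "f ` hole k = B"
  proof -
    have inB: "f (pt i x) \<in> B \<longleftrightarrow> x < k" if "i \<in> {1, 2, 3}" "x < 6" for i x
    proof -
      have "\<beta> i x \<in> Q" using bij_\<beta>[OF that(1)] that(2) by (meson bij_betwE lessThan_iff)
      then have "f (pt i x) \<in> B \<longleftrightarrow> \<beta> i x \<in> ?S i" using f[OF that] by (simp add: block_labels_def)
      also have "\<dots> \<longleftrightarrow> x < k" using that(1) inS[OF that(2)] unfolding \<beta>_def by auto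
      finally show ?thesis .
    qed
    show ?thesis
    proof
      show "f ` hole k \<subseteq> B"
      proof
        fix p assume "p \<in> f ` hole k"
        then obtain u where u: "u \<in> hole k" "p = f u" by blast
        then obtain i x where ix: "i \<in> {1, 2, 3}" "x < 6" "u = pt i x"
          using pt_cases by (metis (no_types, lifting) hole_def mem_Collect_eq)
        then show "p \<in> B" using u inB[OF ix(1,2)] pt_hole[OF ix(1,2)] by simp
      qed
      show "B \<subseteq> f ` hole k"
      proof
        fix p assume p: "p \<in> B"
        then obtain u where "u < 18" "p = f u" using blocks BM bij_f by (auto simp: bij_betw_def)
        moreover obtain i x where ix: "i \<in> {1, 2, 3}" "x < 6" "u = pt i x" using calculation(1) pt_cases by metis
        ultimately show "p \<in> f ` hole k" using p inB[OF ix(1,2)] pt_hole[OF ix(1,2), of k] by simp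
      qed
    qed
  qed
  have line: "f ` {x, 6 + y, 12 + L x y} = {\<alpha> 1 (r x), \<alpha> 2 (b y), \<alpha> 3 (mul (r x) (b y))}"
    if "x < 6" "y < 6" for x y
    using f3(1)[OF that(1)] f3(2)[OF that(2)] f3(3)[OF L(2)[OF that]] L(1)[OF that] by simp
  have "(`) f ` insert (hole k) (lines k L) = M"
  proof
    show "(`) f ` insert (hole k) (lines k L) \<subseteq> M"
    proof
      fix X assume "X \<in> (`) f ` insert (hole k) (lines k L)"
      then consider "X = f ` hole k" | D where "D \<in> lines k L" "X = f ` D" by blast
      then show "X \<in> M"
      proof cases
        case 1 then show ?thesis using fB BM by simp
      next
        case 2
        then obtain x y where xy: "x < 6" "y < 6" "\<not> (x < k \<and> y < k)" "D = {x, 6 + y, 12 + L x y}"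
          unfolding lines_def by blast
        have X: "X = {\<alpha> 1 (r x), \<alpha> 2 (b y), \<alpha> 3 (mul (r x) (b y))}" using 2(2) line[OF xy(1,2)] xy(4) by simp
        obtain D' where D': "D' \<in> M" "X \<subseteq> D'" using labeling_block[OF r(1)[OF xy(1)] bQ[OF xy(2)]] X by blast
        have "D' \<noteq> B"
        proof
          assume "D' = B"
          then have "r x \<in> ?S 1" "b y \<in> ?S 2" using D'(2) X r(1)[OF xy(1)] bQ[OF xy(2)]
            by (auto simp: block_labels_def)
          then show False using inS xy by blast
        qed
        then have "\<not> superline Q \<alpha> M D'" using uniq by blast
        then obtain x' y' where D'': "x' \<in> Q" "y' \<in> Q" "D' = {\<alpha> 1 x', \<alpha> 2 y', \<alpha> 3 (mul x' y')}"
          using short_block[OF fin D'(1)] by blast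
        have "card X = 3" "card D' \<le> 3" unfolding X D''(3)
          using label_neq[of 1 2 "r x" "b y"] label_neq[of 1 3 "r x" "mul (r x) (b y)"]
            label_neq[of 2 3 "b y" "mul (r x) (b y)"] r(1)[OF xy(1)] bQ[OF xy(2)] closed
          by (simp_all add: card_insert_if)
        then have "X = D'" using card_seteq[OF _ D'(2)] D''(3) by simp
        then show ?thesis using D'(1) by simp
      qed
    qed
    show "M \<subseteq> (`) f ` insert (hole k) (lines k L)"
    proof
      fix D assume D: "D \<in> M"
      show "D \<in> (`) f ` insert (hole k) (lines k L)"
      proof (cases "D = B")
        case True then show ?thesis using fB by blast
      next
        case False
        then have "\<not> superline Q \<alpha> M D" using uniq by blast
        then obtain s t where st: "s \<in> Q" "t \<in> Q" "D = {\<alpha> 1 s, \<alpha> 2 t, \<alpha> 3 (mul s t)}"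
          using short_block[OF fin D] by blast
        obtain x where x: "x < 6" "s = r x" using bij_r st(1) by (auto simp: bij_betw_def)
        obtain y where y: "y < 6" "t = b y" using b(1) st(2) by (auto simp: bij_betw_def)
        have "\<not> (x < k \<and> y < k)"
        proof
          assume "x < k \<and> y < k"
          then have "\<alpha> 1 s \<in> B" "\<alpha> 2 t \<in> B" using inS x y by (auto simp: block_labels_def)
          then show False using block_determined[OF D BM, of 1 2 s t] st False by simp
        qed
        then have "{x, 6 + y, 12 + L x y} \<in> lines k L" using lines_memI x y by blast
        moreover have "D = f ` {x, 6 + y, 12 + L x y}" using line[OF x(1) y(1)] st x y by simp
        ultimately show ?thesis by blast
      qed
    qed
  qed
  then have "multinet_iso (net k L) (P, M)"
    using bij_f unfolding multinet_iso_def net_def by auto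
  then have iso: "multinet_iso (P, M) (net k L)"
    by (rule multinet_iso_sym) (use lines_sub[OF h] in \<open>auto simp: net_def hole_def\<close>)
  have "L x y = z \<longleftrightarrow> (\<exists>s\<in>Q. mul s (b 0) = mul a (b x) \<and> mul s (b y) = mul a (b z))"
    if "x < 6" "y < 6" "z < 6" for x y z
    using L_eq[OF that] r[OF that(1)] r_eq[OF that(1)] unfolding c_def by metis
  with that h L0 Lx0 iso show ?thesis by blast
qed

end

section \<open>The sixteen nets\<close>

text \<open>Indices start at 0, so \<open>rep i\<close> represents class \<open>i + 1\<close>; the
  first two classes have a superline of length 3.\<close>

definition hole_size :: "nat \<Rightarrow> nat" where
  "hole_size i = (if i < 2 then 3 else 2)"

text \<open>Each net is stored as one of its filled squares. The filling chosen in the corner does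
  not affect \<open>net\<close>, as \<open>lines\<close> omits those cells.\<close>

definition rep :: "nat \<Rightarrow> nat \<Rightarrow> nat list" where
  "rep i x =
    [[[0,1,2,3,4,5], [1,2,0,4,5,3], [2,0,1,5,3,4], [3,4,5,0,1,2], [4,5,3,1,2,0], [5,3,4,2,0,1]],
     [[0,1,2,3,4,5], [1,2,0,4,5,3], [2,0,1,5,3,4], [3,4,5,0,1,2], [4,5,3,2,0,1], [5,3,4,1,2,0]],
     [[0,1,2,3,4,5], [1,0,3,2,5,4], [2,3,4,5,0,1], [3,2,5,4,1,0], [4,5,0,1,2,3], [5,4,1,0,3,2]],
     [[0,1,2,3,4,5], [1,0,3,2,5,4], [2,4,0,5,1,3], [3,5,1,4,0,2], [4,2,5,0,3,1], [5,3,4,1,2,0]],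
     [[0,1,2,3,4,5], [1,0,3,2,5,4], [2,3,4,5,0,1], [3,2,5,4,1,0], [4,5,1,0,2,3], [5,4,0,1,3,2]],
     [[0,1,2,3,4,5], [1,0,3,2,5,4], [2,4,0,5,3,1], [3,5,4,0,1,2], [4,2,5,1,0,3], [5,3,1,4,2,0]],
     [[0,1,2,3,4,5], [1,0,3,2,5,4], [2,4,0,5,1,3], [3,5,1,4,0,2], [4,2,5,1,3,0], [5,3,4,0,2,1]],
     [[0,1,2,3,4,5], [1,0,3,2,5,4], [2,4,0,5,1,3], [3,5,4,0,2,1], [4,3,5,1,0,2], [5,2,1,4,3,0]],
     [[0,1,2,3,4,5], [1,0,3,2,5,4], [2,4,0,5,1,3], [3,5,4,0,2,1], [4,2,5,1,3,0], [5,3,1,4,0,2]],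
     [[0,1,2,3,4,5], [1,0,3,2,5,4], [2,4,0,5,3,1], [3,5,4,0,1,2], [4,3,5,1,2,0], [5,2,1,4,0,3]],
     [[0,1,2,3,4,5], [1,0,3,2,5,4], [2,3,4,5,0,1], [3,4,5,0,1,2], [4,5,0,1,2,3], [5,2,1,4,3,0]],
     [[0,1,2,3,4,5], [1,0,3,2,5,4], [2,3,4,5,0,1], [3,4,5,1,2,0], [4,5,1,0,3,2], [5,2,0,4,1,3]],
     [[0,1,2,3,4,5], [1,0,3,4,5,2], [2,3,0,5,1,4], [3,5,4,0,2,1], [4,2,5,1,0,3], [5,4,1,2,3,0]],
     [[0,1,2,3,4,5], [1,0,3,2,5,4], [2,4,0,5,1,3], [3,5,1,4,0,2], [4,3,5,0,2,1], [5,2,4,1,3,0]],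
     [[0,1,2,3,4,5], [1,0,3,2,5,4], [2,4,0,5,1,3], [3,5,1,4,2,0], [4,3,5,1,0,2], [5,2,4,0,3,1]],
     [[0,1,2,3,4,5], [1,0,3,4,5,2], [2,3,0,5,1,4], [3,4,5,0,2,1], [4,5,1,2,3,0], [5,2,4,1,0,3]]] ! i ! x"

lemma rep_code [code]:
  "rep 0 0 = [0, d1, d2, d3, d4, d5]"
  "rep 0 d1 = [d1, d2, 0, d4, d5, d3]"
  "rep 0 d2 = [d2, 0, d1, d5, d3, d4]"
  "rep 0 d3 = [d3, d4, d5, 0, d1, d2]"
  "rep 0 d4 = [d4, d5, d3, d1, d2, 0]"
  "rep 0 d5 = [d5, d3, d4, d2, 0, d1]"
  "rep d1 0 = [0, d1, d2, d3, d4, d5]"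
  "rep d1 d1 = [d1, d2, 0, d4, d5, d3]"
  "rep d1 d2 = [d2, 0, d1, d5, d3, d4]"
  "rep d1 d3 = [d3, d4, d5, 0, d1, d2]"
  "rep d1 d4 = [d4, d5, d3, d2, 0, d1]"
  "rep d1 d5 = [d5, d3, d4, d1, d2, 0]"
  "rep d2 0 = [0, d1, d2, d3, d4, d5]"
  "rep d2 d1 = [d1, 0, d3, d2, d5, d4]"
  "rep d2 d2 = [d2, d3, d4, d5, 0, d1]"
  "rep d2 d3 = [d3, d2, d5, d4, d1, 0]"
  "rep d2 d4 = [d4, d5, 0, d1, d2, d3]"
  "rep d2 d5 = [d5, d4, d1, 0, d3, d2]"
  "rep d3 0 = [0, d1, d2, d3, d4, d5]"
  "rep d3 d1 = [d1, 0, d3, d2, d5, d4]"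
  "rep d3 d2 = [d2, d4, 0, d5, d1, d3]"
  "rep d3 d3 = [d3, d5, d1, d4, 0, d2]"
  "rep d3 d4 = [d4, d2, d5, 0, d3, d1]"
  "rep d3 d5 = [d5, d3, d4, d1, d2, 0]"
  "rep d4 0 = [0, d1, d2, d3, d4, d5]"
  "rep d4 d1 = [d1, 0, d3, d2, d5, d4]"
  "rep d4 d2 = [d2, d3, d4, d5, 0, d1]"
  "rep d4 d3 = [d3, d2, d5, d4, d1, 0]"
  "rep d4 d4 = [d4, d5, d1, 0, d2, d3]"
  "rep d4 d5 = [d5, d4, 0, d1, d3, d2]"
  "rep d5 0 = [0, d1, d2, d3, d4, d5]"
  "rep d5 d1 = [d1, 0, d3, d2, d5, d4]"
  "rep d5 d2 = [d2, d4, 0, d5, d3, d1]"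
  "rep d5 d3 = [d3, d5, d4, 0, d1, d2]"
  "rep d5 d4 = [d4, d2, d5, d1, 0, d3]"
  "rep d5 d5 = [d5, d3, d1, d4, d2, 0]"
  "rep d6 0 = [0, d1, d2, d3, d4, d5]"
  "rep d6 d1 = [d1, 0, d3, d2, d5, d4]"
  "rep d6 d2 = [d2, d4, 0, d5, d1, d3]"
  "rep d6 d3 = [d3, d5, d1, d4, 0, d2]"
  "rep d6 d4 = [d4, d2, d5, d1, d3, 0]"
  "rep d6 d5 = [d5, d3, d4, 0, d2, d1]"
  "rep d7 0 = [0, d1, d2, d3, d4, d5]"
  "rep d7 d1 = [d1, 0, d3, d2, d5, d4]"
  "rep d7 d2 = [d2, d4, 0, d5, d1, d3]"
  "rep d7 d3 = [d3, d5, d4, 0, d2, d1]"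
  "rep d7 d4 = [d4, d3, d5, d1, 0, d2]"
  "rep d7 d5 = [d5, d2, d1, d4, d3, 0]"
  "rep d8 0 = [0, d1, d2, d3, d4, d5]"
  "rep d8 d1 = [d1, 0, d3, d2, d5, d4]"
  "rep d8 d2 = [d2, d4, 0, d5, d1, d3]"
  "rep d8 d3 = [d3, d5, d4, 0, d2, d1]"
  "rep d8 d4 = [d4, d2, d5, d1, d3, 0]"
  "rep d8 d5 = [d5, d3, d1, d4, 0, d2]"
  "rep d9 0 = [0, d1, d2, d3, d4, d5]"
  "rep d9 d1 = [d1, 0, d3, d2, d5, d4]"
  "rep d9 d2 = [d2, d4, 0, d5, d3, d1]"
  "rep d9 d3 = [d3, d5, d4, 0, d1, d2]"
  "rep d9 d4 = [d4, d3, d5, d1, d2, 0]"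
  "rep d9 d5 = [d5, d2, d1, d4, 0, d3]"
  "rep d10 0 = [0, d1, d2, d3, d4, d5]"
  "rep d10 d1 = [d1, 0, d3, d2, d5, d4]"
  "rep d10 d2 = [d2, d3, d4, d5, 0, d1]"
  "rep d10 d3 = [d3, d4, d5, 0, d1, d2]"
  "rep d10 d4 = [d4, d5, 0, d1, d2, d3]"
  "rep d10 d5 = [d5, d2, d1, d4, d3, 0]"
  "rep d11 0 = [0, d1, d2, d3, d4, d5]"
  "rep d11 d1 = [d1, 0, d3, d2, d5, d4]"
  "rep d11 d2 = [d2, d3, d4, d5, 0, d1]"
  "rep d11 d3 = [d3, d4, d5, d1, d2, 0]"
  "rep d11 d4 = [d4, d5, d1, 0, d3, d2]"
  "rep d11 d5 = [d5, d2, 0, d4, d1, d3]"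
  "rep d12 0 = [0, d1, d2, d3, d4, d5]"
  "rep d12 d1 = [d1, 0, d3, d4, d5, d2]"
  "rep d12 d2 = [d2, d3, 0, d5, d1, d4]"
  "rep d12 d3 = [d3, d5, d4, 0, d2, d1]"
  "rep d12 d4 = [d4, d2, d5, d1, 0, d3]"
  "rep d12 d5 = [d5, d4, d1, d2, d3, 0]"
  "rep d13 0 = [0, d1, d2, d3, d4, d5]"
  "rep d13 d1 = [d1, 0, d3, d2, d5, d4]"
  "rep d13 d2 = [d2, d4, 0, d5, d1, d3]"
  "rep d13 d3 = [d3, d5, d1, d4, 0, d2]"
  "rep d13 d4 = [d4, d3, d5, 0, d2, d1]"
  "rep d13 d5 = [d5, d2, d4, d1, d3, 0]"
  "rep d14 0 = [0, d1, d2, d3, d4, d5]"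
  "rep d14 d1 = [d1, 0, d3, d2, d5, d4]"
  "rep d14 d2 = [d2, d4, 0, d5, d1, d3]"
  "rep d14 d3 = [d3, d5, d1, d4, d2, 0]"
  "rep d14 d4 = [d4, d3, d5, d1, 0, d2]"
  "rep d14 d5 = [d5, d2, d4, 0, d3, d1]"
  "rep d15 0 = [0, d1, d2, d3, d4, d5]"
  "rep d15 d1 = [d1, 0, d3, d4, d5, d2]"
  "rep d15 d2 = [d2, d3, 0, d5, d1, d4]"
  "rep d15 d3 = [d3, d4, d5, 0, d2, d1]"
  "rep d15 d4 = [d4, d5, d1, d2, d3, 0]"
  "rep d15 d5 = [d5, d2, d4, d1, 0, d3]"
  by (simp_all add: rep_def)

lemma square_rep:
  assumes "i < 16" shows "square (hole_size i) (rep i)"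
proof -
  have "list_all (\<lambda>i. square (hole_size i) (rep i)) [0..<16]" by code_simp
  then show ?thesis using assms by (auto simp: list_all_iff)
qed

section \<open>Enumeration of reduced squares\<close>

text \<open>Fills the rest of a row. The first argument lists, for each remaining column, the
  symbols already present there; \<open>used\<close> lists those already in the row.\<close>

fun ext :: "nat list list \<Rightarrow> nat list \<Rightarrow> nat list list" where
  "ext [] used = [[]]"
| "ext (c # cs) used = concat (map (\<lambda>v. map ((#) v) (ext cs (v # used)))
     (filter (\<lambda>v. \<not> List.member used v \<and> \<not> List.member c v) [0..<6]))"

lemma ext_code [code]:
  "ext [] used = [[]]"
  "ext (c # cs) used = concat (map (\<lambda>v. map ((#) v) (ext cs (v # used)))
     (filter (\<lambda>v. \<not> List.member used v \<and> \<not> List.member c v) [0, d1, d2, d3, d4, d5]))"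
proof -
  have "[0..<6] = [0, d1, d2, d3, d4, d5]" by (simp add: upt_rec)
  then show "ext (c # cs) used = concat (map (\<lambda>v. map ((#) v) (ext cs (v # used)))
     (filter (\<lambda>v. \<not> List.member used v \<and> \<not> List.member c v) [0, d1, d2, d3, d4, d5]))"
    by (simp only: ext.simps)
qed simp

text \<open>One prefix in \<open>ps\<close> per row fixes the normalized entries; a finished row is
  added to the column lists before the next row is filled.\<close>

fun completions :: "nat list list \<Rightarrow> nat list list \<Rightarrow> nat list list list" where
  "completions cs [] = [[]]"
| "completions cs (p # ps) = concat (map (\<lambda>xs. map ((#) (p @ xs)) (completions (map2 (#) (p @ xs) cs) ps))
     (ext (drop (length p) cs) p))"

lemma ext_complete:
  assumes "length xs = length cs" "distinct xs" "set xs \<inter> set used = {}"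
    "\<forall>i<length cs. xs ! i \<notin> set (cs ! i) \<and> xs ! i < 6"
  shows "xs \<in> set (ext cs used)"
  using assms
proof (induction cs arbitrary: xs used)
  case (Cons c cs)
  from Cons.prems(1) obtain v ys where xs: "xs = v # ys" by (cases xs) simp_all
  have all: "ys ! i \<notin> set (cs ! i) \<and> ys ! i < 6" if "i < length cs" for i
    using Cons.prems(4) that unfolding xs by force
  have v: "v < 6" "v \<notin> set c" "v \<notin> set used" using Cons.prems(3,4) unfolding xs by auto
  have ys: "ys \<in> set (ext cs (v # used))"
    by (rule Cons.IH) (use Cons.prems(1-3) all in \<open>auto simp: xs\<close>)
  have "v \<in> set (filter (\<lambda>v. \<not> List.member used v \<and> \<not> List.member c v) [0..<6])"
    using v by (simp del: upt_Suc upt_rec_numeral)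
  then show ?case
    unfolding xs ext.simps set_concat set_map by (rule UN_I[OF imageI]) (use ys in simp)
qed simp

definition row_ok :: "nat list \<Rightarrow> nat list \<Rightarrow> bool" where
  "row_ok p r \<longleftrightarrow> length r = 6 \<and> distinct r \<and> set r \<subseteq> {..<6} \<and> (\<exists>ys. r = p @ ys)"

text \<open>No Latin square with the prescribed prefixes is missed, so one certificate per listed
  square covers all cases.\<close>

lemma completions_complete:
  assumes "list_all2 row_ok ps Rs" "sorted_wrt (\<lambda>r r'. \<forall>y<6. r ! y \<noteq> r' ! y) Rs"
    "\<forall>r\<in>set Rs. \<forall>y<6. r ! y \<notin> set (cs ! y)" "length cs = 6"
  shows "Rs \<in> set (completions cs ps)"
  using assms
proof (induction ps arbitrary: Rs cs)
  case (Cons p ps)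
  then obtain r Rs' where R: "Rs = r # Rs'" "row_ok p r" "list_all2 row_ok ps Rs'"
    by (auto simp: list_all2_Cons1)
  obtain xs where r: "r = p @ xs" "length (p @ xs) = 6" "distinct (p @ xs)" "set (p @ xs) \<subseteq> {..<6}"
    using R(2) by (auto simp: row_ok_def)
  have "xs \<in> set (ext (drop (length p) cs) p)"
  proof (rule ext_complete)
    show "\<forall>i<length (drop (length p) cs). xs ! i \<notin> set (drop (length p) cs ! i) \<and> xs ! i < 6"
    proof (intro allI impI)
      fix i assume i: "i < length (drop (length p) cs)"
      then have i6: "length p + i < 6" using Cons.prems(4) by simp
      then have "r ! (length p + i) \<notin> set (cs ! (length p + i))" using Cons.prems(3) R(1) by simp
      moreover have "xs ! i \<in> set (p @ xs)" using i6 r(2) by simp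
      then have "xs ! i < 6" using r(4) by blast
      ultimately show "xs ! i \<notin> set (drop (length p) cs ! i) \<and> xs ! i < 6"
        using r Cons.prems(4) i6 by auto
    qed
  qed (use r Cons.prems(4) in auto)
  moreover have "Rs' \<in> set (completions (map2 (#) r cs) ps)"
  proof (rule Cons.IH[OF R(3)])
    show "sorted_wrt (\<lambda>r r'. \<forall>y<6. r ! y \<noteq> r' ! y) Rs'" using Cons.prems(2) R(1) by simp
    show "length (map2 (#) r cs) = 6" using r Cons.prems(4) by simp
    show "\<forall>r'\<in>set Rs'. \<forall>y<6. r' ! y \<notin> set (map2 (#) r cs ! y)"
    proof (intro ballI allI impI)
      fix r' y assume *: "r' \<in> set Rs'" "y < (6::nat)"
      have "map2 (#) r cs ! y = r ! y # cs ! y" using * r Cons.prems(4) by simp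
      moreover have "r ! y \<noteq> r' ! y" "r' ! y \<notin> set (cs ! y)" using Cons.prems(2,3) R(1) * by auto
      ultimately show "r' ! y \<notin> set (map2 (#) r cs ! y)" by simp
    qed
  qed
  ultimately show ?case unfolding R(1) using r(1) by auto
qed simp

lemma square_completions:
  assumes h: "holed k L" and p: "length ps = 6" "\<And>x. x < 6 \<Longrightarrow> map (L x) [0..<length (ps ! x)] = ps ! x"
    "\<And>x. x < 6 \<Longrightarrow> length (ps ! x) \<le> 6"
  shows "map (\<lambda>x. map (L x) [0..<6]) [0..<6] \<in> set (completions (replicate 6 []) ps)"
proof (rule completions_complete)
  show "list_all2 row_ok ps (map (\<lambda>x. map (L x) [0..<6]) [0..<6])"
  proof (rule list_all2_all_nthI)
    fix x assume "x < length ps"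
    then have x: "x < 6" using p(1) by simp
    have "distinct (map (L x) [0..<6])"
      using holed_left_cancel[OF h x] by (auto simp: distinct_map inj_on_def simp del: upt_Suc upt_rec_numeral)
    moreover have "set (map (L x) [0..<6]) \<subseteq> {..<6}" using holed_less[OF h x] by (auto simp del: upt_Suc upt_rec_numeral)
    moreover have "map (L x) [0..<6] = ps ! x @ map (L x) [length (ps ! x)..<6]"
    proof -
      have "[0..<6] = [0..<length (ps ! x)] @ [length (ps ! x)..<6]"
        using upt_add_eq_append[of 0 "length (ps ! x)" "6 - length (ps ! x)"] p(3)[OF x] by simp
      then show ?thesis using p(2)[OF x] by (metis map_append)
    qed
    ultimately have "row_ok (ps ! x) (map (L x) [0..<6])" unfolding row_ok_def using p(3)[OF x] by (auto simp del: upt_Suc upt_rec_numeral)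
    then show "row_ok (ps ! x) (map (\<lambda>x. map (L x) [0..<6]) [0..<6] ! x)" using x by (simp del: upt_Suc upt_rec_numeral)
  qed (use p(1) in simp)
  show "sorted_wrt (\<lambda>r r'. \<forall>y<6. r ! y \<noteq> r' ! y) (map (\<lambda>x. map (L x) [0..<6]) [0..<6])"
    unfolding sorted_wrt_iff_nth_less
    using holed_right_cancel[OF h] by (auto simp del: upt_Suc upt_rec_numeral)
qed (auto simp del: upt_Suc upt_rec_numeral)

lemma entry_square_list:
  "x < 6 \<Longrightarrow> y < 6 \<Longrightarrow> entry ((!) (map (\<lambda>x. map (L x) [0..<6]) [0..<6])) x y = L x y"
  by (simp add: entry_def del: upt_Suc upt_rec_numeral)

section \<open>Matching every completion with a representative\<close>

definition square_cert :: "nat \<Rightarrow> nat list list \<Rightarrow> nat \<times> nat list \<Rightarrow> bool" where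
  "square_cert k R c = (case c of (i, p) \<Rightarrow> i < 16 \<and> hole_size i = k \<and> square k ((!) R) \<and> iso_cert k ((!) R) (rep i) p)"

text \<open>The square occurs among the completions, and the certificate at its position carries it
  to a representative.\<close>

lemma classify:
  assumes h: "holed k L" and c: "list_all2 (square_cert k) (completions (replicate 6 []) ps) cs"
    and p: "length ps = 6" "\<And>x. x < 6 \<Longrightarrow> map (L x) [0..<length (ps ! x)] = ps ! x"
      "\<And>x. x < 6 \<Longrightarrow> length (ps ! x) \<le> 6"
  shows "\<exists>i<16. multinet_iso (net k L) (net (hole_size i) (entry (rep i)))"
proof -
  define R where "R = map (\<lambda>x. map (L x) [0..<6]) [0..<6]"
  have "R \<in> set (completions (replicate 6 []) ps)"
    unfolding R_def by (rule square_completions[OF h p])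
  then obtain i p where "square_cert k R (i, p)"
    using c by (metis list_all2_conv_all_nth in_set_conv_nth prod.exhaust)
  then have i: "i < 16" "hole_size i = k" and R: "square k ((!) R)" and cert: "iso_cert k ((!) R) (rep i) p"
    by (auto simp: square_cert_def)
  have "net k (entry ((!) R)) = net k L"
    using lines_cong[of k "entry ((!) R)" L] entry_square_list[of _ _ L] by (simp add: net_def R_def del: upt_Suc upt_rec_numeral)
  moreover have "square k (rep i)" using square_rep[OF i(1)] i(2) by simp
  ultimately have "multinet_iso (net k L) (net k (entry (rep i)))"
    using multinet_iso_netI[OF square_holed[OF R] square_holed iso_cert_net_map[OF R _ cert]] by simp
  then show ?thesis using i by blast
qed

text \<open>Entries for hole size 2 whose derangement is a product of two transpositions, in the
  order of \<open>completions\<close>: index of the representative and images of the 18 points. A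
  first image from 6 on means that rows are carried to columns or symbols.\<close>

definition certs1 :: "(nat \<times> nat list) list" where
  "certs1 =
   [(2, [0,1,2,3,4,5,6,7,8,9,10,11,12,13,14,15,16,17]),
    (2, [0,1,3,2,4,5,6,7,9,8,10,11,13,12,15,14,16,17]),
    (4, [0,1,2,3,4,5,6,7,8,9,10,11,12,13,14,15,16,17]),
    (4, [0,1,5,4,2,3,6,7,11,10,8,9,12,13,17,16,14,15]),
    (10, [0,1,2,3,4,5,6,7,8,9,10,11,12,13,14,15,16,17]),
    (11, [0,1,2,3,4,5,6,7,8,9,10,11,12,13,14,15,16,17]),
    (10, [1,0,2,3,5,4,6,7,9,8,10,11,12,13,14,15,17,16]),
    (11, [0,1,4,5,3,2,6,7,10,11,9,8,12,13,16,17,15,14]),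
    (4, [0,1,4,5,2,3,6,7,10,11,8,9,12,13,16,17,14,15]),
    (4, [0,1,3,2,4,5,6,7,9,8,10,11,12,13,15,14,16,17]),
    (2, [0,1,2,3,4,5,6,7,8,9,10,11,13,12,14,15,16,17]),
    (2, [0,1,3,2,4,5,6,7,9,8,10,11,12,13,15,14,16,17]),
    (11, [0,1,2,3,4,5,6,7,8,9,10,11,13,12,14,15,16,17]),
    (10, [0,1,2,3,4,5,6,7,8,9,10,11,13,12,14,15,16,17]),
    (11, [0,1,4,5,3,2,6,7,10,11,9,8,13,12,16,17,15,14]),
    (10, [1,0,2,3,5,4,6,7,9,8,10,11,13,12,14,15,17,16]),
    (2, [0,1,2,3,5,4,6,7,8,9,11,10,13,12,14,15,17,16]),
    (2, [0,1,3,2,5,4,6,7,9,8,11,10,12,13,15,14,17,16]),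
    (4, [0,1,4,5,3,2,6,7,10,11,9,8,12,13,16,17,15,14]),
    (4, [0,1,3,2,5,4,6,7,9,8,11,10,12,13,15,14,17,16]),
    (11, [0,1,4,5,2,3,6,7,10,11,8,9,13,12,16,17,14,15]),
    (10, [1,0,2,3,4,5,6,7,9,8,11,10,13,12,14,15,16,17]),
    (11, [0,1,2,3,5,4,6,7,8,9,11,10,13,12,14,15,17,16]),
    (10, [0,1,2,3,5,4,6,7,8,9,11,10,13,12,14,15,17,16]),
    (4, [0,1,2,3,5,4,6,7,8,9,11,10,12,13,14,15,17,16]),
    (4, [0,1,5,4,3,2,6,7,11,10,9,8,12,13,17,16,15,14]),
    (2, [0,1,2,3,5,4,6,7,8,9,11,10,12,13,14,15,17,16]),
    (2, [0,1,3,2,5,4,6,7,9,8,11,10,13,12,15,14,17,16]),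
    (10, [1,0,2,3,4,5,6,7,9,8,11,10,12,13,14,15,16,17]),
    (11, [0,1,4,5,2,3,6,7,10,11,8,9,12,13,16,17,14,15]),
    (10, [0,1,2,3,5,4,6,7,8,9,11,10,12,13,14,15,17,16]),
    (11, [0,1,2,3,5,4,6,7,8,9,11,10,12,13,14,15,17,16]),
    (10, [0,1,3,2,4,5,6,7,9,8,10,11,12,13,15,14,16,17]),
    (3, [0,1,2,3,4,5,6,7,8,9,10,11,12,13,14,15,16,17]),
    (6, [0,1,2,3,4,5,6,7,8,9,10,11,12,13,14,15,16,17]),
    (13, [0,1,2,3,4,5,6,7,8,9,10,11,12,13,14,15,16,17]),
    (13, [0,1,2,3,5,4,7,6,10,11,8,9,13,12,16,17,14,15]),
    (13, [0,1,2,4,3,5,13,12,16,17,14,15,7,6,10,11,8,9]),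
    (14, [0,1,2,3,4,5,6,7,8,9,10,11,12,13,14,15,16,17]),
    (8, [0,1,2,3,4,5,6,7,8,9,10,11,12,13,14,15,16,17]),
    (7, [0,1,2,3,4,5,6,7,8,9,10,11,12,13,14,15,16,17]),
    (13, [0,1,2,4,3,5,12,13,14,15,16,17,6,7,8,9,10,11]),
    (14, [0,1,4,5,3,2,6,7,10,11,9,8,12,13,16,17,15,14]),
    (6, [0,1,2,5,3,4,12,13,14,15,16,17,6,7,8,9,10,11]),
    (11, [0,1,3,2,4,5,6,7,9,8,10,11,13,12,15,14,16,17]),
    (13, [0,1,5,3,4,2,12,13,17,16,15,14,6,7,11,10,9,8]),
    (14, [1,0,3,2,5,4,6,7,8,9,10,11,13,12,15,14,17,16]),
    (6, [12,13,14,16,15,17,0,1,2,3,5,4,6,7,8,10,9,11]),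
    (8, [6,7,8,10,9,11,0,1,2,4,3,5,12,13,14,16,15,17]),
    (13, [0,1,4,5,2,3,7,6,9,8,10,11,12,13,15,14,16,17]),
    (13, [0,1,5,4,2,3,6,7,11,10,8,9,12,13,17,16,14,15]),
    (5, [0,1,2,3,4,5,6,7,8,9,10,11,12,13,14,15,16,17]),
    (9, [0,1,2,3,4,5,6,7,8,9,10,11,12,13,14,15,16,17]),
    (8, [6,7,8,11,10,9,12,13,14,16,17,15,0,1,2,4,5,3]),
    (13, [0,1,4,2,5,3,12,13,15,14,17,16,7,6,9,8,11,10]),
    (14, [0,1,5,4,2,3,6,7,11,10,8,9,13,12,17,16,14,15]),
    (10, [0,1,3,2,4,5,6,7,9,8,10,11,13,12,15,14,16,17]),
    (6, [0,1,5,4,3,2,6,7,11,10,9,8,12,13,17,16,15,14]),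
    (3, [0,1,2,3,4,5,6,7,8,9,10,11,13,12,14,15,16,17]),
    (13, [0,1,2,3,5,4,7,6,10,11,8,9,12,13,16,17,14,15]),
    (13, [0,1,2,3,4,5,6,7,8,9,10,11,13,12,14,15,16,17]),
    (13, [0,1,2,4,3,5,13,12,16,17,14,15,6,7,10,11,8,9]),
    (14, [0,1,2,3,4,5,6,7,8,9,10,11,13,12,14,15,16,17]),
    (13, [0,1,2,4,3,5,12,13,14,15,16,17,7,6,8,9,10,11]),
    (14, [0,1,4,5,3,2,6,7,10,11,9,8,13,12,16,17,15,14]),
    (6, [0,1,5,2,4,3,12,13,15,14,17,16,6,7,9,8,11,10]),
    (8, [0,1,2,3,4,5,6,7,8,9,10,11,13,12,14,15,16,17]),
    (7, [0,1,2,3,4,5,6,7,8,9,10,11,13,12,14,15,16,17]),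
    (11, [0,1,3,2,4,5,6,7,9,8,10,11,12,13,15,14,16,17]),
    (13, [0,1,5,3,4,2,12,13,17,16,15,14,7,6,11,10,9,8]),
    (14, [1,0,3,2,5,4,6,7,8,9,10,11,12,13,15,14,17,16]),
    (8, [6,7,8,10,9,11,0,1,2,4,3,5,13,12,14,16,15,17]),
    (6, [12,13,15,17,14,16,0,1,5,4,2,3,6,7,9,11,8,10]),
    (13, [0,1,5,4,2,3,6,7,11,10,8,9,13,12,17,16,14,15]),
    (13, [0,1,4,5,2,3,7,6,9,8,10,11,13,12,15,14,16,17]),
    (8, [6,7,11,8,9,10,12,13,16,14,15,17,0,1,4,2,3,5]),
    (13, [0,1,4,2,5,3,12,13,15,14,17,16,6,7,9,8,11,10]),
    (14, [0,1,5,4,2,3,6,7,11,10,8,9,12,13,17,16,14,15]),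
    (5, [0,1,2,3,4,5,6,7,8,9,10,11,13,12,14,15,16,17]),
    (9, [0,1,2,3,4,5,6,7,8,9,10,11,13,12,14,15,16,17]),
    (11, [0,1,5,4,2,3,6,7,11,10,8,9,13,12,17,16,14,15]),
    (5, [0,1,4,5,2,3,7,6,8,9,10,11,13,12,14,15,16,17]),
    (9, [0,1,4,5,3,2,6,7,10,11,9,8,12,13,16,17,15,14]),
    (13, [0,1,5,3,4,2,13,12,15,14,17,16,7,6,9,8,11,10]),
    (14, [1,0,5,4,2,3,6,7,10,11,9,8,13,12,17,16,14,15]),
    (8, [6,7,10,9,8,11,13,12,14,16,17,15,0,1,2,4,5,3]),
    (6, [12,13,17,15,16,14,0,1,4,5,3,2,6,7,11,9,10,8]),
    (8, [6,7,10,8,11,9,0,1,4,2,5,3,13,12,16,14,17,15]),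
    (13, [0,1,5,4,3,2,7,6,8,9,11,10,13,12,14,15,17,16]),
    (13, [0,1,4,5,3,2,6,7,10,11,9,8,13,12,16,17,15,14]),
    (13, [0,1,4,2,5,3,13,12,17,16,15,14,6,7,11,10,9,8]),
    (14, [0,1,3,2,5,4,6,7,9,8,11,10,13,12,15,14,17,16]),
    (10, [1,0,3,2,4,5,6,7,8,9,11,10,12,13,15,14,16,17]),
    (8, [0,1,4,5,2,3,6,7,10,11,8,9,12,13,16,17,14,15]),
    (7, [1,0,2,3,4,5,6,7,9,8,11,10,12,13,14,15,16,17]),
    (6, [0,1,4,3,5,2,12,13,17,16,15,14,6,7,11,10,9,8]),
    (13, [0,1,3,5,2,4,13,12,14,15,16,17,6,7,8,9,10,11]),
    (14, [1,0,4,5,3,2,6,7,11,10,8,9,12,13,16,17,15,14]),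
    (13, [0,1,3,5,2,4,12,13,16,17,14,15,7,6,10,11,8,9]),
    (14, [1,0,2,3,4,5,6,7,9,8,11,10,12,13,14,15,16,17]),
    (3, [0,1,3,2,5,4,6,7,9,8,11,10,13,12,15,14,17,16]),
    (6, [0,1,4,5,2,3,6,7,10,11,8,9,12,13,16,17,14,15]),
    (13, [0,1,3,2,5,4,6,7,9,8,11,10,13,12,15,14,17,16]),
    (13, [0,1,3,2,4,5,7,6,11,10,9,8,12,13,17,16,15,14]),
    (11, [0,1,5,4,2,3,6,7,11,10,8,9,12,13,17,16,14,15]),
    (13, [0,1,5,3,4,2,13,12,15,14,17,16,6,7,9,8,11,10]),
    (14, [1,0,5,4,2,3,6,7,10,11,9,8,12,13,17,16,14,15]),
    (8, [6,7,9,10,11,8,13,12,16,14,15,17,0,1,4,2,3,5]),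
    (5, [0,1,4,5,2,3,7,6,8,9,10,11,12,13,14,15,16,17]),
    (9, [0,1,4,5,3,2,6,7,10,11,9,8,13,12,16,17,15,14]),
    (8, [6,7,10,8,11,9,0,1,4,2,5,3,12,13,16,14,17,15]),
    (6, [12,13,16,14,17,15,0,1,3,2,4,5,6,7,10,8,11,9]),
    (13, [0,1,4,5,3,2,6,7,10,11,9,8,12,13,16,17,15,14]),
    (13, [0,1,5,4,3,2,7,6,8,9,11,10,12,13,14,15,17,16]),
    (13, [0,1,4,2,5,3,13,12,17,16,15,14,7,6,11,10,9,8]),
    (14, [0,1,3,2,5,4,6,7,9,8,11,10,12,13,15,14,17,16]),
    (10, [1,0,3,2,4,5,6,7,8,9,11,10,13,12,15,14,16,17]),
    (6, [0,1,3,4,2,5,12,13,16,17,14,15,6,7,10,11,8,9]),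
    (13, [0,1,3,5,2,4,13,12,14,15,16,17,7,6,8,9,10,11]),
    (14, [1,0,4,5,3,2,6,7,11,10,8,9,13,12,16,17,15,14]),
    (8, [0,1,4,5,2,3,6,7,10,11,8,9,13,12,16,17,14,15]),
    (7, [1,0,2,3,4,5,6,7,9,8,11,10,13,12,14,15,16,17]),
    (13, [0,1,3,5,2,4,12,13,16,17,14,15,6,7,10,11,8,9]),
    (14, [1,0,2,3,4,5,6,7,9,8,11,10,13,12,14,15,16,17]),
    (6, [0,1,3,2,5,4,6,7,9,8,11,10,12,13,15,14,17,16]),
    (3, [0,1,3,2,5,4,6,7,9,8,11,10,12,13,15,14,17,16]),
    (13, [0,1,3,2,4,5,7,6,11,10,9,8,13,12,17,16,15,14]),
    (13, [0,1,3,2,5,4,6,7,9,8,11,10,12,13,15,14,17,16]),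
    (11, [0,1,3,2,5,4,6,7,9,8,11,10,13,12,15,14,17,16]),
    (13, [0,1,5,4,3,2,6,7,11,10,9,8,12,13,17,16,15,14]),
    (13, [0,1,4,5,3,2,7,6,9,8,11,10,12,13,15,14,17,16]),
    (8, [6,7,8,10,11,9,0,1,2,4,5,3,12,13,14,16,17,15]),
    (6, [12,13,14,16,17,15,0,1,2,3,4,5,6,7,8,10,11,9]),
    (14, [1,0,3,2,4,5,6,7,8,9,11,10,13,12,15,14,16,17]),
    (13, [0,1,5,3,2,4,12,13,17,16,14,15,6,7,11,10,8,9]),
    (9, [0,1,2,3,5,4,6,7,8,9,11,10,12,13,14,15,17,16]),
    (5, [0,1,2,3,5,4,6,7,8,9,11,10,12,13,14,15,17,16]),
    (14, [0,1,5,4,3,2,6,7,11,10,9,8,13,12,17,16,15,14]),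
    (13, [0,1,4,2,3,5,12,13,15,14,16,17,7,6,9,8,10,11]),
    (8, [6,7,8,11,9,10,12,13,14,16,15,17,0,1,2,4,3,5]),
    (10, [0,1,3,2,5,4,6,7,9,8,11,10,12,13,15,14,17,16]),
    (14, [0,1,2,3,5,4,6,7,8,9,11,10,12,13,14,15,17,16]),
    (13, [0,1,2,4,5,3,13,12,16,17,15,14,7,6,10,11,9,8]),
    (13, [0,1,2,3,4,5,7,6,10,11,9,8,13,12,16,17,15,14]),
    (13, [0,1,2,3,5,4,6,7,8,9,11,10,12,13,14,15,17,16]),
    (6, [0,1,2,3,5,4,6,7,8,9,11,10,12,13,14,15,17,16]),
    (3, [0,1,2,3,5,4,6,7,8,9,11,10,12,13,14,15,17,16]),
    (7, [0,1,2,3,5,4,6,7,8,9,11,10,12,13,14,15,17,16]),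
    (8, [0,1,2,3,5,4,6,7,8,9,11,10,12,13,14,15,17,16]),
    (6, [0,1,2,5,4,3,12,13,14,15,17,16,6,7,8,9,11,10]),
    (14, [0,1,4,5,2,3,6,7,10,11,8,9,12,13,16,17,14,15]),
    (13, [0,1,2,4,5,3,12,13,14,15,17,16,6,7,8,9,11,10]),
    (11, [0,1,3,2,5,4,6,7,9,8,11,10,12,13,15,14,17,16]),
    (13, [0,1,4,5,3,2,7,6,9,8,11,10,13,12,15,14,17,16]),
    (13, [0,1,5,4,3,2,6,7,11,10,9,8,13,12,17,16,15,14]),
    (6, [12,13,15,17,16,14,0,1,5,4,3,2,6,7,9,11,10,8]),
    (8, [6,7,8,10,11,9,0,1,2,4,5,3,13,12,14,16,17,15]),
    (14, [1,0,3,2,4,5,6,7,8,9,11,10,12,13,15,14,16,17]),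
    (13, [0,1,5,3,2,4,12,13,17,16,14,15,7,6,11,10,8,9]),
    (14, [0,1,5,4,3,2,6,7,11,10,9,8,12,13,17,16,15,14]),
    (13, [0,1,4,2,3,5,12,13,15,14,16,17,6,7,9,8,10,11]),
    (8, [6,7,11,8,10,9,12,13,16,14,17,15,0,1,4,2,5,3]),
    (9, [0,1,2,3,5,4,6,7,8,9,11,10,13,12,14,15,17,16]),
    (5, [0,1,2,3,5,4,6,7,8,9,11,10,13,12,14,15,17,16]),
    (10, [0,1,3,2,5,4,6,7,9,8,11,10,13,12,15,14,17,16]),
    (14, [0,1,2,3,5,4,6,7,8,9,11,10,13,12,14,15,17,16]),
    (13, [0,1,2,4,5,3,13,12,16,17,15,14,6,7,10,11,9,8]),
    (13, [0,1,2,3,5,4,6,7,8,9,11,10,13,12,14,15,17,16]),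
    (13, [0,1,2,3,4,5,7,6,10,11,9,8,12,13,16,17,15,14]),
    (3, [0,1,2,3,5,4,6,7,8,9,11,10,13,12,14,15,17,16]),
    (6, [0,1,5,4,2,3,6,7,11,10,8,9,12,13,17,16,14,15]),
    (6, [0,1,5,2,3,4,12,13,15,14,16,17,6,7,9,8,10,11]),
    (14, [0,1,4,5,2,3,6,7,10,11,8,9,13,12,16,17,14,15]),
    (13, [0,1,2,4,5,3,12,13,14,15,17,16,7,6,8,9,11,10]),
    (7, [0,1,2,3,5,4,6,7,8,9,11,10,13,12,14,15,17,16]),
    (8, [0,1,2,3,5,4,6,7,8,9,11,10,13,12,14,15,17,16]),
    (10, [1,0,3,2,5,4,6,7,8,9,10,11,12,13,15,14,17,16]),
    (7, [1,0,2,3,5,4,6,7,9,8,10,11,12,13,14,15,17,16]),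
    (8, [0,1,4,5,3,2,6,7,10,11,9,8,12,13,16,17,15,14]),
    (14, [1,0,4,5,2,3,6,7,11,10,9,8,12,13,16,17,14,15]),
    (13, [0,1,3,5,4,2,13,12,14,15,17,16,6,7,8,9,11,10]),
    (6, [0,1,4,3,2,5,12,13,17,16,14,15,6,7,11,10,8,9]),
    (13, [0,1,3,2,5,4,7,6,11,10,8,9,12,13,17,16,14,15]),
    (13, [0,1,3,2,4,5,6,7,9,8,10,11,13,12,15,14,16,17]),
    (6, [0,1,4,5,3,2,6,7,10,11,9,8,12,13,16,17,15,14]),
    (3, [0,1,3,2,4,5,6,7,9,8,10,11,13,12,15,14,16,17]),
    (14, [1,0,2,3,5,4,6,7,9,8,10,11,12,13,14,15,17,16]),
    (13, [0,1,3,5,4,2,12,13,16,17,15,14,7,6,10,11,9,8]),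
    (11, [0,1,5,4,3,2,6,7,11,10,9,8,13,12,17,16,15,14]),
    (9, [0,1,4,5,2,3,6,7,10,11,8,9,12,13,16,17,14,15]),
    (5, [0,1,4,5,3,2,7,6,8,9,11,10,13,12,14,15,17,16]),
    (8, [6,7,10,9,11,8,13,12,14,16,15,17,0,1,2,4,3,5]),
    (14, [1,0,5,4,3,2,6,7,10,11,8,9,13,12,17,16,15,14]),
    (13, [0,1,5,3,2,4,13,12,15,14,16,17,7,6,9,8,10,11]),
    (14, [0,1,3,2,4,5,6,7,9,8,10,11,13,12,15,14,16,17]),
    (13, [0,1,4,2,3,5,13,12,17,16,14,15,6,7,11,10,8,9]),
    (13, [0,1,4,5,2,3,6,7,10,11,8,9,13,12,16,17,14,15]),
    (13, [0,1,5,4,2,3,7,6,8,9,10,11,13,12,14,15,16,17]),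
    (8, [6,7,10,8,9,11,0,1,4,2,3,5,13,12,16,14,15,17]),
    (6, [12,13,17,15,14,16,0,1,4,5,2,3,6,7,11,9,8,10]),
    (10, [1,0,3,2,5,4,6,7,8,9,10,11,13,12,15,14,17,16]),
    (14, [1,0,4,5,2,3,6,7,11,10,9,8,13,12,16,17,14,15]),
    (13, [0,1,3,5,4,2,13,12,14,15,17,16,7,6,8,9,11,10]),
    (6, [0,1,3,4,5,2,12,13,16,17,15,14,6,7,10,11,9,8]),
    (7, [1,0,2,3,5,4,6,7,9,8,10,11,13,12,14,15,17,16]),
    (8, [0,1,4,5,3,2,6,7,10,11,9,8,13,12,16,17,15,14]),
    (13, [0,1,3,2,4,5,6,7,9,8,10,11,12,13,15,14,16,17]),
    (13, [0,1,3,2,5,4,7,6,11,10,8,9,13,12,17,16,14,15]),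
    (3, [0,1,3,2,4,5,6,7,9,8,10,11,12,13,15,14,16,17]),
    (6, [0,1,3,2,4,5,6,7,9,8,10,11,12,13,15,14,16,17]),
    (14, [1,0,2,3,5,4,6,7,9,8,10,11,13,12,14,15,17,16]),
    (13, [0,1,3,5,4,2,12,13,16,17,15,14,6,7,10,11,9,8]),
    (11, [0,1,5,4,3,2,6,7,11,10,9,8,12,13,17,16,15,14]),
    (8, [6,7,9,10,8,11,13,12,16,14,17,15,0,1,4,2,5,3]),
    (14, [1,0,5,4,3,2,6,7,10,11,8,9,12,13,17,16,15,14]),
    (13, [0,1,5,3,2,4,13,12,15,14,16,17,6,7,9,8,10,11]),
    (9, [0,1,4,5,2,3,6,7,10,11,8,9,13,12,16,17,14,15]),
    (5, [0,1,4,5,3,2,7,6,8,9,11,10,12,13,14,15,17,16]),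
    (14, [0,1,3,2,4,5,6,7,9,8,10,11,12,13,15,14,16,17]),
    (13, [0,1,4,2,3,5,13,12,17,16,14,15,7,6,11,10,8,9]),
    (13, [0,1,5,4,2,3,7,6,8,9,10,11,12,13,14,15,16,17]),
    (13, [0,1,4,5,2,3,6,7,10,11,8,9,12,13,16,17,14,15]),
    (6, [12,13,16,14,15,17,0,1,3,2,5,4,6,7,10,8,9,11]),
    (8, [6,7,10,8,9,11,0,1,4,2,3,5,12,13,16,14,15,17])]"

text \<open>The corresponding entries when the derangement is a 4-cycle.\<close>

definition certs2 :: "(nat \<times> nat list) list" where
  "certs2 =
   [(7, [6,7,8,11,9,10,12,13,14,17,15,16,0,1,2,5,3,4]),
    (15, [0,1,2,3,4,5,6,7,8,9,10,11,12,13,14,15,16,17]),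
    (9, [6,7,8,10,9,11,12,13,14,17,15,16,0,1,2,5,3,4]),
    (15, [0,1,3,4,5,2,6,7,9,10,11,8,12,13,15,16,17,14]),
    (12, [0,1,2,3,4,5,6,7,8,9,10,11,12,13,14,15,16,17]),
    (14, [6,7,10,8,9,11,12,13,16,14,17,15,0,1,4,2,5,3]),
    (14, [6,7,11,8,9,10,13,12,17,15,16,14,0,1,5,3,4,2]),
    (12, [1,0,2,4,3,5,7,6,8,11,10,9,12,13,15,14,17,16]),
    (9, [6,7,11,8,10,9,12,13,16,14,17,15,0,1,4,2,5,3]),
    (7, [6,7,8,11,9,10,12,13,14,17,15,16,1,0,2,5,3,4]),
    (15, [0,1,2,3,4,5,6,7,8,9,10,11,13,12,14,15,16,17]),
    (15, [0,1,3,4,5,2,6,7,9,10,11,8,13,12,15,16,17,14]),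
    (14, [6,7,11,8,9,10,13,12,17,15,16,14,1,0,5,3,4,2]),
    (12, [0,1,2,3,4,5,6,7,8,9,10,11,13,12,14,15,16,17]),
    (14, [6,7,10,8,9,11,12,13,16,14,17,15,1,0,4,2,5,3]),
    (12, [1,0,2,4,3,5,7,6,8,11,10,9,13,12,15,14,17,16]),
    (10, [6,7,8,9,10,11,0,1,2,3,4,5,12,13,14,15,16,17]),
    (11, [6,7,8,9,10,11,0,1,2,3,4,5,13,12,14,15,16,17]),
    (15, [0,1,5,2,3,4,6,7,11,8,9,10,13,12,17,14,15,16]),
    (10, [6,7,10,11,8,9,13,12,15,14,17,16,1,0,3,2,5,4]),
    (11, [6,7,11,10,8,9,12,13,15,14,17,16,0,1,3,2,5,4]),
    (15, [0,1,5,3,2,4,12,13,16,15,14,17,7,6,10,9,8,11]),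
    (15, [13,12,14,17,15,16,0,1,4,3,5,2,7,6,8,11,9,10]),
    (12, [1,0,5,4,3,2,6,7,10,9,8,11,13,12,17,16,15,14]),
    (11, [6,7,8,9,10,11,0,1,2,3,4,5,12,13,14,15,16,17]),
    (10, [6,7,8,9,10,11,0,1,2,3,4,5,13,12,14,15,16,17]),
    (15, [0,1,5,2,3,4,6,7,11,8,9,10,12,13,17,14,15,16]),
    (11, [6,7,8,9,11,10,12,13,17,16,15,14,0,1,5,4,3,2]),
    (10, [6,7,10,11,8,9,13,12,15,14,17,16,0,1,3,2,5,4]),
    (12, [1,0,5,4,3,2,6,7,10,9,8,11,12,13,17,16,15,14]),
    (15, [0,1,5,3,2,4,12,13,16,15,14,17,6,7,10,9,8,11]),
    (15, [13,12,14,17,15,16,0,1,4,3,5,2,6,7,8,11,9,10]),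
    (11, [6,7,10,11,8,9,0,1,4,5,2,3,13,12,16,17,14,15]),
    (10, [6,7,9,8,11,10,1,0,2,3,4,5,12,13,14,15,16,17]),
    (15, [0,1,4,5,2,3,6,7,10,11,8,9,12,13,16,17,14,15]),
    (10, [6,7,11,8,9,10,13,12,14,17,16,15,0,1,2,5,4,3]),
    (11, [6,7,9,11,10,8,12,13,16,15,14,17,0,1,4,3,2,5]),
    (12, [0,1,5,3,4,2,7,6,10,11,8,9,12,13,16,17,14,15]),
    (15, [12,13,16,15,17,14,0,1,5,3,4,2,7,6,10,9,11,8]),
    (15, [0,1,4,3,2,5,13,12,14,17,16,15,7,6,8,11,10,9]),
    (10, [6,7,9,8,11,10,1,0,2,3,4,5,13,12,14,15,16,17]),
    (11, [6,7,10,11,8,9,0,1,4,5,2,3,12,13,16,17,14,15]),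
    (11, [6,7,10,8,9,11,12,13,14,17,16,15,0,1,2,5,4,3]),
    (15, [0,1,4,5,2,3,6,7,10,11,8,9,13,12,16,17,14,15]),
    (10, [6,7,11,8,9,10,13,12,14,17,16,15,1,0,2,5,4,3]),
    (15, [12,13,16,15,17,14,0,1,5,3,4,2,6,7,10,9,11,8]),
    (12, [0,1,5,3,4,2,7,6,10,11,8,9,13,12,16,17,14,15]),
    (15, [0,1,4,3,2,5,13,12,14,17,16,15,6,7,8,11,10,9]),
    (15, [12,13,17,14,16,15,0,1,4,2,5,3,7,6,11,8,10,9]),
    (14, [6,7,8,10,9,11,0,1,2,4,3,5,12,13,14,16,15,17]),
    (12, [0,1,3,4,5,2,6,7,9,10,11,8,12,13,15,16,17,14]),
    (13, [6,7,8,10,9,11,0,1,2,4,3,5,12,13,14,16,15,17]),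
    (13, [7,6,10,8,11,9,0,1,2,5,3,4,13,12,16,14,17,15]),
    (14, [6,7,8,9,11,10,12,13,14,17,15,16,0,1,2,5,3,4]),
    (14, [6,7,8,9,10,11,13,12,15,16,14,17,1,0,3,4,2,5]),
    (13, [6,7,11,8,10,9,0,1,5,2,4,3,12,13,17,14,16,15]),
    (13, [7,6,9,10,8,11,0,1,4,2,5,3,12,13,15,16,14,17]),
    (15, [12,13,15,17,14,16,0,1,3,4,2,5,6,7,9,11,8,10]),
    (14, [6,7,8,10,9,11,1,0,3,5,2,4,13,12,15,17,14,16]),
    (12, [0,1,3,4,2,5,7,6,11,8,9,10,13,12,17,14,15,16]),
    (12, [0,1,4,5,2,3,6,7,10,11,8,9,12,13,16,17,14,15]),
    (15, [0,1,2,4,5,3,12,13,14,17,16,15,6,7,8,11,10,9]),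
    (7, [6,7,8,10,9,11,0,1,2,4,3,5,12,13,14,16,15,17]),
    (15, [0,1,3,2,4,5,12,13,15,14,17,16,6,7,9,8,11,10]),
    (14, [6,7,10,9,11,8,0,1,4,3,5,2,12,13,16,15,17,14]),
    (12, [1,0,4,3,2,5,6,7,9,8,11,10,13,12,16,15,14,17]),
    (14, [6,7,11,8,10,9,0,1,5,2,4,3,13,12,17,14,16,15]),
    (9, [6,7,8,10,9,11,0,1,2,4,3,5,12,13,14,16,15,17]),
    (15, [12,13,17,14,16,15,0,1,4,2,5,3,6,7,11,8,10,9]),
    (14, [6,7,8,10,9,11,0,1,2,4,3,5,13,12,14,16,15,17]),
    (12, [0,1,3,4,5,2,6,7,9,10,11,8,13,12,15,16,17,14]),
    (13, [7,6,10,8,11,9,0,1,2,5,3,4,12,13,16,14,17,15]),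
    (13, [6,7,8,10,9,11,0,1,2,4,3,5,13,12,14,16,15,17]),
    (14, [6,7,8,9,10,11,13,12,15,16,14,17,0,1,3,4,2,5]),
    (14, [6,7,8,9,11,10,12,13,14,17,15,16,1,0,2,5,3,4]),
    (13, [7,6,9,10,8,11,0,1,4,2,5,3,13,12,15,16,14,17]),
    (15, [12,13,15,17,14,16,0,1,3,4,2,5,7,6,9,11,8,10]),
    (13, [6,7,11,8,10,9,0,1,5,2,4,3,13,12,17,14,16,15]),
    (14, [6,7,8,10,9,11,1,0,3,5,2,4,12,13,15,17,14,16]),
    (12, [0,1,3,4,2,5,7,6,11,8,9,10,12,13,17,14,15,16]),
    (15, [0,1,2,4,5,3,12,13,14,17,16,15,7,6,8,11,10,9]),
    (12, [0,1,4,5,2,3,6,7,10,11,8,9,13,12,16,17,14,15]),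
    (7, [6,7,8,10,9,11,0,1,2,4,3,5,13,12,14,16,15,17]),
    (15, [0,1,3,2,4,5,12,13,15,14,17,16,7,6,9,8,11,10]),
    (14, [6,7,10,9,11,8,0,1,4,3,5,2,13,12,16,15,17,14]),
    (12, [1,0,4,3,2,5,6,7,9,8,11,10,12,13,16,15,14,17]),
    (14, [6,7,11,8,10,9,0,1,5,2,4,3,12,13,17,14,16,15]),
    (9, [6,7,8,10,9,11,0,1,2,4,3,5,13,12,14,16,15,17]),
    (12, [0,1,4,2,5,3,7,6,8,9,10,11,13,12,14,15,16,17]),
    (15, [0,1,2,5,4,3,13,12,16,15,14,17,7,6,10,9,8,11]),
    (9, [6,7,10,9,11,8,0,1,4,3,5,2,13,12,16,15,17,14]),
    (14, [6,7,10,9,11,8,1,0,5,2,4,3,13,12,17,14,16,15]),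
    (12, [1,0,4,3,5,2,7,6,11,10,9,8,12,13,14,17,16,15]),
    (14, [6,7,11,8,10,9,1,0,4,3,5,2,12,13,16,15,17,14]),
    (7, [6,7,9,11,8,10,1,0,2,4,3,5,13,12,14,16,15,17]),
    (15, [0,1,3,2,5,4,13,12,17,16,15,14,7,6,11,10,9,8]),
    (14, [6,7,9,11,10,8,12,13,17,15,16,14,0,1,5,3,4,2]),
    (12, [1,0,3,2,5,4,6,7,8,11,10,9,13,12,15,14,17,16]),
    (14, [6,7,9,10,11,8,13,12,16,14,17,15,1,0,4,2,5,3]),
    (15, [13,12,15,16,14,17,0,1,5,2,4,3,7,6,9,10,8,11]),
    (12, [1,0,3,5,2,4,7,6,10,9,8,11,12,13,17,16,15,14]),
    (14, [6,7,9,11,8,10,0,1,3,5,2,4,12,13,15,17,14,16]),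
    (13, [6,7,10,9,11,8,0,1,4,3,5,2,12,13,16,15,17,14]),
    (15, [13,12,17,15,16,14,0,1,3,5,2,4,6,7,11,9,10,8]),
    (13, [7,6,8,11,9,10,0,1,5,3,4,2,13,12,14,17,15,16]),
    (13, [6,7,9,11,8,10,0,1,3,5,2,4,13,12,15,17,14,16]),
    (13, [7,6,11,9,10,8,0,1,3,4,2,5,13,12,17,15,16,14]),
    (14, [6,7,9,11,8,10,1,0,2,4,3,5,13,12,14,16,15,17]),
    (12, [0,1,4,2,5,3,7,6,8,9,10,11,12,13,14,15,16,17]),
    (15, [0,1,2,5,4,3,13,12,16,15,14,17,6,7,10,9,8,11]),
    (14, [6,7,10,9,11,8,1,0,5,2,4,3,12,13,17,14,16,15]),
    (12, [1,0,4,3,5,2,7,6,11,10,9,8,13,12,14,17,16,15]),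
    (9, [6,7,10,9,11,8,0,1,4,3,5,2,12,13,16,15,17,14]),
    (14, [6,7,11,8,10,9,1,0,4,3,5,2,13,12,16,15,17,14]),
    (7, [6,7,9,11,8,10,1,0,2,4,3,5,12,13,14,16,15,17]),
    (15, [0,1,3,2,5,4,13,12,17,16,15,14,6,7,11,10,9,8]),
    (12, [1,0,3,2,5,4,6,7,8,11,10,9,12,13,15,14,17,16]),
    (14, [6,7,9,10,11,8,13,12,16,14,17,15,0,1,4,2,5,3]),
    (14, [6,7,9,11,10,8,12,13,17,15,16,14,1,0,5,3,4,2]),
    (12, [1,0,3,5,2,4,7,6,10,9,8,11,13,12,17,16,15,14]),
    (15, [13,12,15,16,14,17,0,1,5,2,4,3,6,7,9,10,8,11]),
    (13, [7,6,8,11,9,10,0,1,5,3,4,2,12,13,14,17,15,16]),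
    (14, [6,7,9,11,8,10,0,1,3,5,2,4,13,12,15,17,14,16]),
    (13, [6,7,10,9,11,8,0,1,4,3,5,2,13,12,16,15,17,14]),
    (15, [13,12,17,15,16,14,0,1,3,5,2,4,7,6,11,9,10,8]),
    (13, [7,6,11,9,10,8,0,1,3,4,2,5,12,13,17,15,16,14]),
    (13, [6,7,9,11,8,10,0,1,3,5,2,4,12,13,15,17,14,16]),
    (14, [6,7,9,11,8,10,1,0,2,4,3,5,12,13,14,16,15,17]),
    (11, [6,7,9,11,10,8,13,12,15,14,17,16,0,1,3,2,5,4]),
    (15, [0,1,4,5,2,3,7,6,11,8,9,10,12,13,17,14,15,16]),
    (10, [6,7,9,10,11,8,12,13,15,14,17,16,0,1,3,2,5,4]),
    (15, [0,1,4,5,3,2,12,13,17,16,15,14,7,6,11,10,9,8]),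
    (10, [6,7,9,10,11,8,0,1,3,4,5,2,12,13,15,16,17,14]),
    (12, [0,1,5,2,3,4,6,7,11,8,9,10,12,13,17,14,15,16]),
    (11, [6,7,9,10,11,8,0,1,3,4,5,2,13,12,15,16,17,14]),
    (15, [12,13,14,16,15,17,0,1,2,5,3,4,6,7,8,10,9,11]),
    (15, [0,1,4,5,2,3,7,6,11,8,9,10,13,12,17,14,15,16]),
    (10, [6,7,9,10,11,8,12,13,15,14,17,16,1,0,3,2,5,4]),
    (11, [6,7,10,8,9,11,13,12,17,16,15,14,0,1,5,4,3,2]),
    (15, [0,1,4,5,3,2,12,13,17,16,15,14,6,7,11,10,9,8]),
    (10, [6,7,9,10,11,8,0,1,3,4,5,2,13,12,15,16,17,14]),
    (12, [0,1,5,2,3,4,6,7,11,8,9,10,13,12,17,14,15,16]),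
    (15, [12,13,14,16,15,17,0,1,2,5,3,4,7,6,8,10,9,11]),
    (11, [6,7,9,10,11,8,0,1,3,4,5,2,12,13,15,16,17,14]),
    (15, [0,1,5,2,3,4,7,6,8,9,10,11,13,12,14,15,16,17]),
    (11, [6,7,11,10,8,9,13,12,14,17,16,15,0,1,2,5,4,3]),
    (10, [6,7,10,11,8,9,12,13,14,17,16,15,1,0,2,5,4,3]),
    (15, [13,12,16,14,17,15,0,1,2,4,3,5,6,7,10,8,11,9]),
    (11, [6,7,11,8,9,10,0,1,5,2,3,4,13,12,17,14,15,16]),
    (12, [1,0,5,2,4,3,7,6,9,8,11,10,13,12,16,15,14,17]),
    (15, [0,1,5,4,3,2,13,12,15,14,17,16,7,6,9,8,11,10]),
    (10, [6,7,8,11,10,9,1,0,3,4,5,2,12,13,15,16,17,14]),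
    (9, [6,7,11,8,10,9,13,12,14,17,15,16,0,1,2,5,3,4]),
    (7, [6,7,10,8,11,9,13,12,14,17,15,16,1,0,2,5,3,4]),
    (15, [0,1,2,3,4,5,7,6,9,10,11,8,13,12,15,16,17,14]),
    (15, [0,1,3,4,5,2,7,6,10,11,8,9,13,12,16,17,14,15]),
    (12, [1,0,2,5,4,3,6,7,11,10,9,8,13,12,14,17,16,15]),
    (14, [6,7,11,10,8,9,12,13,15,16,14,17,1,0,3,4,2,5]),
    (14, [6,7,10,11,8,9,13,12,14,17,15,16,1,0,2,5,3,4]),
    (12, [0,1,2,5,3,4,7,6,9,10,11,8,13,12,15,16,17,14]),
    (15, [0,1,5,2,3,4,7,6,8,9,10,11,12,13,14,15,16,17]),
    (10, [6,7,10,11,8,9,12,13,14,17,16,15,0,1,2,5,4,3]),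
    (11, [6,7,8,9,11,10,13,12,16,15,14,17,0,1,4,3,2,5]),
    (11, [6,7,11,8,9,10,0,1,5,2,3,4,12,13,17,14,15,16]),
    (15, [13,12,16,14,17,15,0,1,2,4,3,5,7,6,10,8,11,9]),
    (12, [1,0,5,2,4,3,7,6,9,8,11,10,12,13,16,15,14,17]),
    (15, [0,1,5,4,3,2,13,12,15,14,17,16,6,7,9,8,11,10]),
    (10, [6,7,8,11,10,9,1,0,3,4,5,2,13,12,15,16,17,14]),
    (7, [6,7,10,8,11,9,13,12,14,17,15,16,0,1,2,5,3,4]),
    (15, [0,1,2,3,4,5,7,6,9,10,11,8,12,13,15,16,17,14]),
    (9, [6,7,9,11,8,10,13,12,16,14,17,15,0,1,4,2,5,3]),
    (15, [0,1,3,4,5,2,7,6,10,11,8,9,12,13,16,17,14,15]),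
    (12, [1,0,2,5,4,3,6,7,11,10,9,8,12,13,14,17,16,15]),
    (14, [6,7,10,11,8,9,13,12,14,17,15,16,0,1,2,5,3,4]),
    (14, [6,7,11,10,8,9,12,13,15,16,14,17,0,1,3,4,2,5]),
    (12, [0,1,2,5,3,4,7,6,9,10,11,8,12,13,15,16,17,14])]"

text \<open>The entries for a hole of size 3; only the representatives 0 and 1 occur.\<close>

definition certs3 :: "(nat \<times> nat list) list" where
  "certs3 =
   [(0, [0,2,1,3,5,4,6,8,7,9,11,10,12,14,13,15,17,16]),
    (1, [0,2,1,3,5,4,6,8,7,9,11,10,12,14,13,15,17,16]),
    (1, [0,1,2,3,4,5,6,7,8,9,10,11,12,14,13,15,16,17]),
    (0, [0,1,2,3,4,5,6,7,8,9,10,11,12,14,13,15,16,17]),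
    (0, [0,1,2,4,5,3,6,7,8,10,11,9,12,14,13,16,17,15]),
    (1, [0,1,2,3,4,5,6,7,8,9,10,11,13,12,14,15,16,17]),
    (1, [0,2,1,3,5,4,6,8,7,9,11,10,13,12,14,15,17,16]),
    (0, [0,2,1,4,3,5,6,8,7,10,9,11,12,14,13,16,15,17]),
    (0, [0,2,1,5,4,3,6,8,7,11,10,9,12,14,13,17,16,15]),
    (1, [0,1,2,3,4,5,6,7,8,9,10,11,13,14,12,15,16,17]),
    (1, [0,2,1,3,5,4,6,8,7,9,11,10,13,14,12,15,17,16]),
    (0, [0,1,2,5,3,4,6,7,8,11,9,10,12,14,13,17,15,16]),
    (0, [0,2,1,3,5,4,6,7,8,9,11,10,12,14,13,15,17,16]),
    (1, [0,2,1,3,5,4,6,7,8,9,11,10,12,14,13,15,17,16]),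
    (1, [0,1,2,3,4,5,6,8,7,9,10,11,12,14,13,15,16,17]),
    (0, [0,1,2,3,4,5,6,8,7,9,10,11,12,14,13,15,16,17]),
    (0, [0,1,2,4,5,3,6,8,7,10,11,9,12,14,13,16,17,15]),
    (1, [0,1,2,3,4,5,6,8,7,9,10,11,13,12,14,15,16,17]),
    (1, [0,2,1,3,5,4,6,7,8,9,11,10,13,12,14,15,17,16]),
    (0, [0,2,1,4,3,5,6,7,8,10,9,11,12,14,13,16,15,17]),
    (0, [0,2,1,5,4,3,6,7,8,11,10,9,12,14,13,17,16,15]),
    (1, [0,1,2,3,4,5,6,8,7,9,10,11,13,14,12,15,16,17]),
    (1, [0,2,1,3,5,4,6,7,8,9,11,10,13,14,12,15,17,16]),
    (0, [0,1,2,5,3,4,6,8,7,11,9,10,12,14,13,17,15,16]),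
    (0, [0,1,2,3,5,4,6,8,7,9,11,10,12,14,13,15,17,16]),
    (1, [0,1,2,3,5,4,6,8,7,9,11,10,12,14,13,15,17,16]),
    (1, [0,2,1,3,4,5,6,7,8,9,10,11,12,14,13,15,16,17]),
    (0, [0,2,1,3,4,5,6,7,8,9,10,11,12,14,13,15,16,17]),
    (0, [0,2,1,4,5,3,6,7,8,10,11,9,12,14,13,16,17,15]),
    (1, [0,2,1,3,4,5,6,7,8,9,10,11,13,12,14,15,16,17]),
    (1, [0,1,2,3,5,4,6,8,7,9,11,10,13,12,14,15,17,16]),
    (0, [0,1,2,4,3,5,6,8,7,10,9,11,12,14,13,16,15,17]),
    (0, [0,1,2,5,4,3,6,8,7,11,10,9,12,14,13,17,16,15]),
    (1, [0,2,1,3,4,5,6,7,8,9,10,11,13,14,12,15,16,17]),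
    (1, [0,1,2,3,5,4,6,8,7,9,11,10,13,14,12,15,17,16]),
    (0, [0,2,1,5,3,4,6,7,8,11,9,10,12,14,13,17,15,16]),
    (0, [0,1,2,3,5,4,6,7,8,9,11,10,12,14,13,15,17,16]),
    (1, [0,1,2,3,5,4,6,7,8,9,11,10,12,14,13,15,17,16]),
    (1, [0,2,1,3,4,5,6,8,7,9,10,11,12,14,13,15,16,17]),
    (0, [0,2,1,3,4,5,6,8,7,9,10,11,12,14,13,15,16,17]),
    (0, [0,2,1,4,5,3,6,8,7,10,11,9,12,14,13,16,17,15]),
    (1, [0,2,1,3,4,5,6,8,7,9,10,11,13,12,14,15,16,17]),
    (1, [0,1,2,3,5,4,6,7,8,9,11,10,13,12,14,15,17,16]),
    (0, [0,1,2,4,3,5,6,7,8,10,9,11,12,14,13,16,15,17]),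
    (0, [0,1,2,5,4,3,6,7,8,11,10,9,12,14,13,17,16,15]),
    (1, [0,2,1,3,4,5,6,8,7,9,10,11,13,14,12,15,16,17]),
    (1, [0,1,2,3,5,4,6,7,8,9,11,10,13,14,12,15,17,16]),
    (0, [0,2,1,5,3,4,6,8,7,11,9,10,12,14,13,17,15,16])]"

text \<open>The prefixes contain the unique reduced Latin square of order 3 in the corner.\<close>

lemma certs3:
  "list_all2 (square_cert 3) (completions (replicate 6 [])
     [[0, 1, 2, 3, 4, 5], [1, 2, 0], [2, 0, 1], [3], [4], [5]]) certs3"
  by code_simp

lemma certs2:
  "list_all2 (square_cert 2) (completions (replicate 6 [])
     [[0, 1, 2, 3, 4, 5], [1, 0, 3, 4, 5, 2], [2], [3], [4], [5]]) certs2"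
  by code_simp

lemma certs1:
  "list_all2 (square_cert 2) (completions (replicate 6 [])
     [[0, 1, 2, 3, 4, 5], [1, 0, 3, 2, 5, 4], [2], [3], [4], [5]]) certs1"
  by code_simp

section \<open>Classification\<close>

text \<open>A 3-cycle on four elements would leave a fixed point, so only the cycle types (2, 2) and
  (4) remain; the elements are listed along the cycles.\<close>

lemma derangement4:
  assumes D: "card D = 4" and bij: "bij_betw \<pi> D D" and fp: "\<And>x. x \<in> D \<Longrightarrow> \<pi> x \<noteq> x"
  obtains c2 c3 c4 c5 where "D = {c2, c3, c4, c5}" "distinct [c2, c3, c4, c5]" "\<pi> c2 = c3"
    "\<pi> c3 = c2 \<and> \<pi> c4 = c5 \<and> \<pi> c5 = c4 \<or> \<pi> c3 = c4 \<and> \<pi> c4 = c5 \<and> \<pi> c5 = c2"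
proof -
  have fin: "finite D" using D by (metis card.infinite zero_neq_numeral)
  have in_D: "\<pi> x \<in> D" if "x \<in> D" for x using bij that by (rule bij_betwE[THEN bspec])
  have inj: "x = y" if "\<pi> x = \<pi> y" "x \<in> D" "y \<in> D" for x y
    using bij that by (auto simp: bij_betw_def dest: inj_onD)
  have full: "D = {c2, c3, c4, c5}" if "{c2, c3, c4, c5} \<subseteq> D" "distinct [c2, c3, c4, c5]" for c2 c3 c4 c5
    by (rule card_subset_eq[OF fin that(1), symmetric]) (use D that(2) in simp)
  obtain c2 where c2: "c2 \<in> D" using D by fastforce
  define c3 where "c3 = \<pi> c2"
  have c3: "c3 \<in> D" "c3 \<noteq> c2" using in_D c2 fp unfolding c3_def by blast+
  show ?thesis
  proof (cases "\<pi> c3 = c2")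
    case True
    have "card (D - {c2, c3}) = 2" using D c2 c3 fin by (subst card_Diff_subset) auto
    then obtain c4 where c4: "c4 \<in> D" "c4 \<noteq> c2" "c4 \<noteq> c3"
      by (metis Diff_iff card_eq_0_iff ex_in_conv insertCI zero_neq_numeral)
    define c5 where "c5 = \<pi> c4"
    have c5: "c5 \<in> D" "c5 \<noteq> c4" using in_D c4 fp unfolding c5_def by blast+
    have c5': "c5 \<noteq> c2" "c5 \<noteq> c3" using inj c4 c2 c3 True unfolding c5_def c3_def by metis+
    have dist: "distinct [c2, c3, c4, c5]" using c3 c4 c5 c5' by auto
    have F: "D = {c2, c3, c4, c5}" by (rule full[OF _ dist]) (use c2 c3 c4 c5 in blast)
    have "\<pi> c5 \<noteq> c2" "\<pi> c5 \<noteq> c3" "\<pi> c5 \<noteq> c5"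
      using inj[of c5 c3] inj[of c5 c2] fp c5 c2 c3 c5' True unfolding c3_def by metis+
    then have "\<pi> c5 = c4" using in_D[OF c5(1)] F by blast
    then show ?thesis using that[OF F dist] True unfolding c3_def c5_def by blast
  next
    case False
    define c4 where "c4 = \<pi> c3"
    have c4: "c4 \<in> D" "c4 \<noteq> c3" "c4 \<noteq> c2" using in_D c3 fp False unfolding c4_def by blast+
    define c5 where "c5 = \<pi> c4"
    have c5: "c5 \<in> D" "c5 \<noteq> c4" using in_D c4 fp unfolding c5_def by blast+
    have c53: "c5 \<noteq> c3" using inj[of c4 c2] c4 c2 unfolding c5_def c3_def by blast
    \<comment> \<open>Equality would close a 3-cycle and leave the fourth element fixed.\<close>
    have c52: "c5 \<noteq> c2"
    proof
      assume e: "c5 = c2"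
      have "card (D - {c2, c3, c4}) = 1" using D c2 c3 c4 fin by (subst card_Diff_subset) auto
      then obtain d where d: "d \<in> D" "d \<noteq> c2" "d \<noteq> c3" "d \<noteq> c4"
        by (metis Diff_iff card_eq_0_iff ex_in_conv insertCI zero_neq_one)
      have dist: "distinct [c2, c3, c4, d]" using c3 c4 d by auto
      have F: "D = {c2, c3, c4, d}" by (rule full[OF _ dist]) (use c2 c3 c4 d in blast)
      have "\<pi> d \<noteq> c2" using inj[of d c4] d c4 e unfolding c5_def by metis
      moreover have "\<pi> d \<noteq> c3" using inj[of d c2] d c2 unfolding c3_def by metis
      moreover have "\<pi> d \<noteq> c4" using inj[of d c3] d c3 unfolding c4_def by metis
      ultimately show False using in_D[OF d(1)] fp[OF d(1)] F by blast
    qed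
    have dist: "distinct [c2, c3, c4, c5]" using c3 c4 c5 c53 c52 by auto
    have F: "D = {c2, c3, c4, c5}" by (rule full[OF _ dist]) (use c2 c3 c4 c5 in blast)
    have "\<pi> c5 \<noteq> c3" using inj[of c5 c2] c5 c2 c52 unfolding c3_def by metis
    moreover have "\<pi> c5 \<noteq> c4" using inj[of c5 c3] c5 c3 c53 unfolding c4_def by metis
    ultimately have "\<pi> c5 = c2" using in_D[OF c5(1)] fp[OF c5(1)] F by blast
    then show ?thesis using that[OF F dist] unfolding c3_def c4_def c5_def by blast
  qed
qed

lemma nth_bij:
  assumes "distinct zs" "length zs = 6" "set zs = Q" "set (take k zs) = S" "k < 6"
  shows "bij_betw ((!) zs) {..<6} Q" "(!) zs ` {..<k} = S"
proof -
  show "bij_betw ((!) zs) {..<6} Q"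
    using bij_betw_nth[OF assms(1), of "{..<6}" Q] assms(2,3) by simp
  have "(!) zs ` {..<k} = set (take k zs)"
    using nth_image[of k zs] assms(2,5) by (simp add: lessThan_atLeast0)
  then show "(!) zs ` {..<k} = S" using assms(4) by simp
qed

lemma less_6_cases: "(x::nat) < 6 \<Longrightarrow> x = 0 \<or> x = 1 \<or> x = 2 \<or> x = 3 \<or> x = 4 \<or> x = 5"
  by presburger

text \<open>The corner of order 2 leaves only \<open>L 1 1 = 0\<close>, so the first two rows are
  completely known.\<close>

lemma classify_reduced2:
  assumes h: "holed 2 L" and r: "\<And>y. y < 6 \<Longrightarrow> L 0 y = y" "\<And>x. x < 6 \<Longrightarrow> L x 0 = x"
    and row1: "L 1 2 = 3 \<and> L 1 3 = 2 \<and> L 1 4 = 5 \<and> L 1 5 = 4 \<or> L 1 2 = 3 \<and> L 1 3 = 4 \<and> L 1 4 = 5 \<and> L 1 5 = 2"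
  shows "\<exists>i<16. multinet_iso (net 2 L) (net (hole_size i) (entry (rep i)))"
proof -
  have "L 1 1 < 2" using h by (simp add: holed_def)
  moreover have "L 1 1 \<noteq> L 0 1" using holed_right_cancel[OF h, of 1 0 1] by simp
  ultimately have L11: "L 1 1 = 0" using r(1)[of 1] by simp
  show ?thesis using row1
  proof
    assume row: "L 1 2 = 3 \<and> L 1 3 = 2 \<and> L 1 4 = 5 \<and> L 1 5 = 4"
    show ?thesis
    proof (rule classify[OF h certs1])
      fix x :: nat assume "x < 6"
      then show "map (L x) [0..<length ([[0, 1, 2, 3, 4, 5], [1, 0, 3, 2, 5, 4], [2], [3], [4], [5]] ! x)] =
          [[0, 1, 2, 3, 4, 5], [1, 0, 3, 2, 5, 4], [2], [3], [4], [5]] ! x"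
        using row L11 r by (elim disjE[OF less_6_cases] disjE) (simp_all add: upt_rec eval_nat_numeral)
    qed (auto dest!: less_6_cases)
  next
    assume row: "L 1 2 = 3 \<and> L 1 3 = 4 \<and> L 1 4 = 5 \<and> L 1 5 = 2"
    show ?thesis
    proof (rule classify[OF h certs2])
      fix x :: nat assume "x < 6"
      then show "map (L x) [0..<length ([[0, 1, 2, 3, 4, 5], [1, 0, 3, 4, 5, 2], [2], [3], [4], [5]] ! x)] =
          [[0, 1, 2, 3, 4, 5], [1, 0, 3, 4, 5, 2], [2], [3], [4], [5]] ! x"
        using row L11 r by (elim disjE[OF less_6_cases] disjE) (simp_all add: upt_rec eval_nat_numeral)
    qed (auto dest!: less_6_cases)
  qed
qed

text \<open>A reduced Latin square of order 3 is unique, so the whole corner is known.\<close>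

lemma classify_reduced3:
  assumes h: "holed 3 L" and r: "\<And>y. y < 6 \<Longrightarrow> L 0 y = y" "\<And>x. x < 6 \<Longrightarrow> L x 0 = x"
  shows "\<exists>i<16. multinet_iso (net 3 L) (net (hole_size i) (entry (rep i)))"
proof -
  have "L 1 1 < 3" "L 1 2 < 3" "L 2 1 < 3" "L 2 2 < 3" using h by (simp_all add: holed_def)
  moreover have "L 1 1 \<noteq> L 0 1" "L 1 1 \<noteq> L 1 0" "L 1 2 \<noteq> L 1 0" "L 1 2 \<noteq> L 0 2" "L 1 2 \<noteq> L 1 1"
    "L 2 1 \<noteq> L 2 0" "L 2 1 \<noteq> L 0 1" "L 2 2 \<noteq> L 2 0" "L 2 2 \<noteq> L 0 2" "L 2 2 \<noteq> L 2 1"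
    by (simp_all add: holed_right_cancel[OF h] holed_left_cancel[OF h])
  ultimately have L: "L 1 1 = 2" "L 1 2 = 0" "L 2 1 = 0" "L 2 2 = 1"
    using r(1)[of 1] r(1)[of 2] r(2)[of 1] r(2)[of 2] by simp_all
  show ?thesis
  proof (rule classify[OF h certs3])
    fix x :: nat assume "x < 6"
    then show "map (L x) [0..<length ([[0, 1, 2, 3, 4, 5], [1, 2, 0], [2, 0, 1], [3], [4], [5]] ! x)] =
        [[0, 1, 2, 3, 4, 5], [1, 2, 0], [2, 0, 1], [3], [4], [5]] ! x"
      using L r by (elim disjE[OF less_6_cases] disjE) (simp_all add: upt_rec eval_nat_numeral)
  qed (auto dest!: less_6_cases)
qed

text \<open>For length 3 any ordering that puts the columns of the superline first will do; for
  length 2 the other four columns are ordered along the cycles of a derangement.\<close>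

theorem (in light_dual_multinet) classification:
  assumes cQ: "card Q = 6" and u: "\<exists>!B. superline Q \<alpha> M B"
  shows "\<exists>i<16. multinet_iso (P, M) (net (hole_size i) (entry (rep i)))"
proof -
  obtain B where B: "superline Q \<alpha> M B" and uniq: "\<forall>B'. superline Q \<alpha> M B' \<longrightarrow> B' = B"
    using u by (elim ex1E) blast
  define k where "k = block_length Q \<alpha> B"
  let ?S = "block_labels Q \<alpha> B"
  have BM: "B \<in> M" using B by (simp add: superline_def)
  have fin: "finite Q" using cQ by (metis card.infinite zero_neq_numeral)
  have S: "?S i \<subseteq> Q" for i by (auto simp: block_labels_def)
  have fS: "finite (?S i)" for i using finite_subset[OF S fin] .
  have cS: "card (?S i) = k" if "i \<in> {1, 2, 3}" for i using block_cards[OF BM that] k_def by simp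
  have k: "k = 2 \<or> k = 3" using superline_length[OF cQ B] k_def by simp
  obtain a where a: "a \<in> ?S 1" using block_labels_ne[OF BM, of 1] by auto
  have aQ: "a \<in> Q" using a S by blast
  note red = reduced_square[OF cQ B uniq k_def a]
  from k show ?thesis
  proof
    assume k3: "k = 3"
    obtain xs where xs: "distinct xs" "set xs = ?S 2" using finite_distinct_list[OF fS] by blast
    obtain ys where ys: "distinct ys" "set ys = Q - ?S 2"
      using finite_distinct_list[OF finite_Diff[OF fin]] by blast
    have len: "length xs = 3" "length ys = 3"
      using distinct_card[OF xs(1)] distinct_card[OF ys(1)] xs(2) ys(2) cS[of 2] k3 cQ
        card_Diff_subset[OF fS S[of 2]] by simp_all
    have zs: "distinct (xs @ ys)" "length (xs @ ys) = 6" "set (xs @ ys) = Q" "set (take k (xs @ ys)) = ?S 2"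
      using xs ys S[of 2] len k3 by auto
    have "k < 6" using k3 by simp
    obtain L where L: "holed k L" "\<And>y. y < 6 \<Longrightarrow> L 0 y = y" "\<And>x. x < 6 \<Longrightarrow> L x 0 = x"
      "multinet_iso (P, M) (net k L)"
    proof (rule red[OF nth_bij[OF zs \<open>k < 6\<close>]])
      fix L assume *: "holed k L" "\<And>y. y < 6 \<Longrightarrow> L 0 y = y" "\<And>x. x < 6 \<Longrightarrow> L x 0 = x"
        "multinet_iso (P, M) (net k L)"
        "\<And>x y z. x < 6 \<Longrightarrow> y < 6 \<Longrightarrow> z < 6 \<Longrightarrow> L x y = z \<longleftrightarrow>
           (\<exists>r\<in>Q. mul r ((xs @ ys) ! 0) = mul a ((xs @ ys) ! x) \<and> mul r ((xs @ ys) ! y) = mul a ((xs @ ys) ! z))"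
      show thesis by (rule that) (fact *)+
    qed
    show ?thesis using classify_reduced3[of L] L multinet_iso_trans k3 by metis
  next
    assume k2: "k = 2"
    then obtain b0 b1 where b: "?S 2 = {b0, b1}" "b0 \<noteq> b1" using cS[of 2] by (auto simp: card_2_iff)
    then have bQ: "b0 \<in> Q" "b1 \<in> Q" using S[of 2] by auto
    have sub: "\<And>x y. x \<in> ?S 1 \<Longrightarrow> y \<in> ?S 2 \<Longrightarrow> mul x y \<in> ?S 3"
      "\<And>x y. x \<in> ?S 1 \<Longrightarrow> y \<in> Q \<Longrightarrow> mul x y \<in> ?S 3 \<Longrightarrow> y \<in> ?S 2"
      "\<And>x y. y \<in> ?S 2 \<Longrightarrow> x \<in> Q \<Longrightarrow> mul x y \<in> ?S 3 \<Longrightarrow> x \<in> ?S 1"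
      using block_subsquare[OF BM] unfolding subsquare_def by blast+
    \<comment> \<open>The second row of the superline; \<open>mul s b0 = mul a b1\<close> gives it
      index 1 after normalization.\<close>
    obtain s where s: "s \<in> Q" "mul s b0 = mul a b1" using right_div[OF bQ(1) closed[OF aQ bQ(2)]] by blast
    have sS: "s \<in> ?S 1" by (rule sub(3)[of b0]) (use s sub(1)[OF a, of b1] b(1) in auto)
    \<comment> \<open>\<open>\<pi>\<close> sends column \<open>c\<close> to the column in which row
      \<open>a\<close> carries the symbol that row \<open>s\<close> has in column
      \<open>c\<close>.\<close>
    define \<pi> where "\<pi> c = (THE c'. c' \<in> Q \<and> mul a c' = mul s c)" for c
    have \<pi>: "\<pi> c \<in> Q" "mul a (\<pi> c) = mul s c" if "c \<in> Q" for c
      using theI'[OF left_div[OF aQ closed[OF s(1) that]]] unfolding \<pi>_def by auto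
    let ?D = "Q - ?S 2"
    have cD: "card ?D = 4" using card_Diff_subset[OF fS S[of 2]] cS[of 2] k2 cQ by simp
    have \<pi>D: "\<pi> c \<in> ?D" if c: "c \<in> ?D" for c
    proof -
      have "c \<in> Q" using c by blast
      moreover have "\<pi> c \<notin> ?S 2"
      proof
        assume "\<pi> c \<in> ?S 2"
        then have "mul s c \<in> ?S 3" using sub(1)[OF a] \<pi>(2)[OF \<open>c \<in> Q\<close>] by metis
        then show False using sub(2)[OF sS \<open>c \<in> Q\<close>] c by blast
      qed
      ultimately show ?thesis using \<pi>(1) by blast
    qed
    have "inj_on \<pi> ?D"
    proof (rule inj_onI)
      fix c d assume c: "c \<in> ?D" and d: "d \<in> ?D" and e: "\<pi> c = \<pi> d"
      have cd: "c \<in> Q" "d \<in> Q" using c d by auto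
      have "mul s c = mul s d" using \<pi>(2)[OF cd(1)] \<pi>(2)[OF cd(2)] e by simp
      then show "c = d" using mul_left_cancel[OF s(1) cd] by simp
    qed
    moreover have "\<pi> ` ?D = ?D"
      by (rule endo_inj_surj[OF finite_Diff[OF fin] _ calculation]) (use \<pi>D in blast)
    ultimately have bij: "bij_betw \<pi> ?D ?D" by (simp add: bij_betw_def)
    \<comment> \<open>Distinct rows never agree in a column, which rules out fixed points of
      \<open>\<pi>\<close>.\<close>
    have "s \<noteq> a" using s(2) mul_left_cancel[OF aQ bQ] b(2) by auto
    then have fp: "\<pi> c \<noteq> c" if "c \<in> ?D" for c
      using \<pi>(2)[of c] mul_right_cancel[OF aQ s(1), of c] that by auto
    obtain c2 c3 c4 c5 where D: "?D = {c2, c3, c4, c5}" "distinct [c2, c3, c4, c5]" "\<pi> c2 = c3"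
      and cyc: "\<pi> c3 = c2 \<and> \<pi> c4 = c5 \<and> \<pi> c5 = c4 \<or> \<pi> c3 = c4 \<and> \<pi> c4 = c5 \<and> \<pi> c5 = c2"
      by (rule derangement4[OF cD bij fp])
    \<comment> \<open>Superline columns come first, the others follow along the cycles; this turns
      \<open>\<pi>\<close> into one of the two normal forms of the second row.\<close>
    define zs where "zs = [b0, b1, c2, c3, c4, c5]"
    have set_zs: "set zs = Q" using S[of 2] b(1) D(1) unfolding zs_def by auto
    have "distinct zs" by (rule card_distinct) (simp add: set_zs cQ, simp add: zs_def)
    then have zs: "distinct zs" "length zs = 6" "set zs = Q" "set (take k zs) = ?S 2"
      using set_zs b(1) k2 by (simp_all add: zs_def)
    have "k < 6" using k2 by simp
    obtain L where L: "holed k L" "\<And>y. y < 6 \<Longrightarrow> L 0 y = y" "\<And>x. x < 6 \<Longrightarrow> L x 0 = x"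
      "multinet_iso (P, M) (net k L)"
      and LR: "\<And>x y z. x < 6 \<Longrightarrow> y < 6 \<Longrightarrow> z < 6 \<Longrightarrow> L x y = z \<longleftrightarrow>
         (\<exists>r\<in>Q. mul r (zs ! 0) = mul a (zs ! x) \<and> mul r (zs ! y) = mul a (zs ! z))"
    proof (rule red[OF nth_bij[OF zs \<open>k < 6\<close>]])
      fix L assume *: "holed k L" "\<And>y. y < 6 \<Longrightarrow> L 0 y = y" "\<And>x. x < 6 \<Longrightarrow> L x 0 = x"
        "multinet_iso (P, M) (net k L)"
        "\<And>x y z. x < 6 \<Longrightarrow> y < 6 \<Longrightarrow> z < 6 \<Longrightarrow> L x y = z \<longleftrightarrow>
           (\<exists>r\<in>Q. mul r (zs ! 0) = mul a (zs ! x) \<and> mul r (zs ! y) = mul a (zs ! z))"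
      show thesis by (rule that) (fact *)+
    qed
    have row: "L 1 y = z" if "y < 6" "z < 6" "\<pi> (zs ! y) = zs ! z" for y z
    proof -
      have "zs ! y \<in> Q" using zs(2,3) that(1) nth_mem by metis
      then have "mul s (zs ! y) = mul a (zs ! z)" using \<pi>(2) that(3) by metis
      moreover have "mul s (zs ! 0) = mul a (zs ! 1)" using s(2) by (simp add: zs_def)
      ultimately show ?thesis using LR[of 1 y z] s(1) that by auto
    qed
    have "L 1 2 = 3 \<and> L 1 3 = 2 \<and> L 1 4 = 5 \<and> L 1 5 = 4 \<or> L 1 2 = 3 \<and> L 1 3 = 4 \<and> L 1 4 = 5 \<and> L 1 5 = 2"
      using cyc
    proof
      assume "\<pi> c3 = c2 \<and> \<pi> c4 = c5 \<and> \<pi> c5 = c4"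
      then show ?thesis
        using row[of 2 3] row[of 3 2] row[of 4 5] row[of 5 4] D(3) by (simp add: zs_def)
    next
      assume "\<pi> c3 = c4 \<and> \<pi> c4 = c5 \<and> \<pi> c5 = c2"
      then show ?thesis
        using row[of 2 3] row[of 3 4] row[of 4 5] row[of 5 2] D(3) by (simp add: zs_def)
    qed
    then show ?thesis using classify_reduced2[of L] L multinet_iso_trans k2 by metis
  qed
qed

text \<open>For every net one entry per filling: the index \<open>j\<close> of its class and an
  isostrophy to \<open>Q6 j\<close>, given by the value lists of \<open>\<sigma>\<close> and of the
  three bijections onto 1 to 6.\<close>

definition fill_certs :: "nat \<Rightarrow> (nat \<times> nat list \<times> nat list list) list" where
  "fill_certs i =
   [[(9, [1,2,3], [[1,2,3,6,5,4], [1,2,3,6,5,4], [2,1,3,6,5,4]]),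
      (9, [1,3,2], [[1,2,3,4,6,5], [1,3,2,4,5,6], [1,2,3,4,5,6]]),
      (9, [3,1,2], [[1,2,3,4,6,5], [1,3,2,4,5,6], [1,2,3,4,5,6]]),
      (1, [1,2,3], [[1,3,5,2,4,6], [1,3,5,2,4,6], [3,5,1,2,4,6]]),
      (1, [1,2,3], [[1,5,3,4,2,6], [1,5,3,4,2,6], [1,5,3,4,2,6]]),
      (9, [3,1,2], [[1,2,3,6,5,4], [2,1,3,5,6,4], [1,2,3,5,6,4]]),
      (9, [1,3,2], [[1,2,3,6,5,4], [2,1,3,5,6,4], [1,2,3,5,6,4]]),
      (9, [1,2,3], [[1,3,2,6,4,5], [1,3,2,6,4,5], [2,3,1,6,4,5]]),
      (9, [1,2,3], [[1,2,3,4,6,5], [1,2,3,4,6,5], [1,3,2,4,6,5]]),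
      (9, [1,3,2], [[1,3,2,6,4,5], [2,3,1,5,4,6], [1,3,2,5,4,6]]),
      (9, [3,1,2], [[1,3,2,6,4,5], [2,3,1,5,4,6], [1,3,2,5,4,6]]),
      (1, [1,2,3], [[1,5,3,2,6,4], [1,5,3,2,6,4], [3,1,5,2,6,4]])],
    [(9, [1,3,2], [[1,2,3,5,4,6], [6,5,4,1,3,2], [5,6,4,1,3,2]]),
      (9, [1,2,3], [[1,2,3,4,5,6], [4,5,6,1,2,3], [4,6,5,1,2,3]]),
      (2, [1,2,3], [[1,5,6,2,4,3], [1,6,5,2,4,3], [1,6,5,2,4,3]]),
      (9, [3,1,2], [[1,2,3,5,4,6], [6,4,5,1,3,2], [5,6,4,1,3,2]]),
      (9, [3,1,2], [[1,3,2,4,5,6], [4,6,5,1,2,3], [4,6,5,1,2,3]]),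
      (3, [1,2,3], [[1,2,3,4,5,6], [1,3,2,4,5,6], [2,1,3,4,5,6]]),
      (9, [1,2,3], [[1,2,3,6,4,5], [5,6,4,1,2,3], [6,5,4,1,2,3]]),
      (9, [1,3,2], [[1,3,2,5,6,4], [6,4,5,1,2,3], [5,4,6,1,2,3]]),
      (9, [1,3,2], [[1,2,3,4,6,5], [4,6,5,1,3,2], [4,5,6,1,3,2]]),
      (9, [1,2,3], [[1,3,2,6,5,4], [5,4,6,1,3,2], [6,4,5,1,3,2]]),
      (3, [1,2,3], [[1,3,2,4,6,5], [1,2,3,4,6,5], [2,3,1,4,6,5]]),
      (9, [3,1,2], [[1,3,2,5,6,4], [6,5,4,1,2,3], [5,4,6,1,2,3]])],
    [(1, [1,2,3], [[1,4,3,6,5,2], [1,4,3,6,5,2], [1,4,3,6,5,2]]),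
      (4, [1,2,3], [[1,2,4,3,5,6], [1,2,4,3,5,6], [2,1,4,3,5,6]])],
    [(2, [1,2,3], [[1,4,2,5,6,3], [1,4,2,5,6,3], [1,4,2,5,6,3]]),
      (5, [1,2,3], [[1,2,3,5,6,4], [1,2,3,5,6,4], [2,1,3,5,6,4]])],
    [(4, [1,2,3], [[1,2,3,4,5,6], [3,4,5,6,1,2], [3,4,5,6,1,2]]),
      (4, [1,2,3], [[1,2,5,6,3,4], [3,4,1,2,5,6], [4,3,1,2,5,6]])],
    [(7, [1,2,3], [[1,2,3,4,5,6], [1,2,3,4,5,6], [1,2,3,4,5,6]]),
      (7, [1,2,3], [[2,1,5,6,3,4], [2,1,4,3,6,5], [2,1,3,4,5,6]])],
    [(5, [1,2,3], [[3,5,6,4,2,1], [3,6,5,2,4,1], [2,1,4,6,5,3]]),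
      (5, [1,2,3], [[3,5,1,2,4,6], [3,6,1,4,2,5], [1,2,3,5,6,4]])],
    [(8, [3,1,2], [[1,6,2,3,5,4], [1,6,2,3,5,4], [1,6,2,3,5,4]]),
      (11, [3,1,2], [[1,2,3,5,6,4], [1,2,3,5,6,4], [2,1,3,5,6,4]])],
    [(10, [3,1,2], [[1,2,3,4,5,6], [1,2,3,4,6,5], [1,2,3,4,6,5]]),
      (10, [3,1,2], [[1,2,5,6,3,4], [1,2,5,6,4,3], [2,1,5,6,4,3]])],
    [(11, [3,1,2], [[3,5,4,6,1,2], [3,5,4,6,2,1], [2,1,6,5,4,3]]),
      (11, [3,1,2], [[3,5,1,2,6,4], [3,5,1,2,4,6], [1,2,3,4,6,5]])],
    [(9, [3,1,2], [[1,5,2,4,3,6], [4,2,5,1,6,3], [4,2,5,1,6,3]]),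
      (12, [3,1,2], [[1,2,4,6,3,5], [2,1,5,3,6,4], [1,2,5,3,6,4]])],
    [(12, [3,1,2], [[3,5,1,2,6,4], [4,6,2,1,5,3], [2,1,5,3,6,4]]),
      (12, [3,1,2], [[3,5,4,6,2,1], [4,6,5,3,2,1], [1,2,6,4,5,3]])],
    [(7, [1,2,3], [[1,6,3,2,4,5], [1,6,3,2,4,5], [1,6,3,2,4,5]]),
      (6, [1,2,3], [[1,2,4,5,6,3], [1,2,4,5,6,3], [2,1,4,5,6,3]])],
    [(5, [1,2,3], [[3,5,6,4,2,1], [4,1,6,3,2,5], [5,3,1,2,6,4]]),
      (10, [1,3,2], [[1,2,3,5,4,6], [4,5,2,1,6,3], [5,4,2,1,6,3]])],
    [(10, [3,1,2], [[1,4,2,6,3,5], [1,4,2,5,3,6], [1,4,2,5,3,6]]),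
      (7, [1,2,3], [[1,2,5,4,6,3], [3,4,6,5,2,1], [4,3,6,5,2,1]])],
    [(11, [1,2,3], [[3,4,6,5,1,2], [3,4,6,5,1,2], [2,6,5,1,3,4]]),
      (12, [1,2,3], [[3,6,2,1,5,4], [3,6,2,1,5,4], [1,4,5,3,6,2]])]] ! i"

lemma fill_certs:
  "list_all (\<lambda>i. list_all2 (fill_cert (hole_size i) (rep i)) (latin_squares (hole_size i)) (fill_certs i)) [0..<16]"
  by code_simp

lemma label_indices_rep:
  assumes "i < 16"
  shows "label_indices (net (hole_size i) (entry (rep i))) = set (map fst (fill_certs i))"
  by (rule label_indices_net[OF square_rep[OF assms]])
    (use assms fill_certs in \<open>auto simp: list_all_iff hole_size_def\<close>)

section \<open>Automorphism groups\<close>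

lemma fst_net [simp]: "fst (net k L) = {..<18}"
  by (simp add: net_def)

text \<open>The automorphisms form a subgroup of the symmetric group on the points; inverses
  preserve the blocks by \<open>inv_blocks\<close>.\<close>

lemma group_multinet_aut:
  assumes N: "snd N \<subseteq> Pow (fst N)"
  shows "group (multinet_aut N)"
proof -
  let ?S = "fst N" and ?A = "{f \<in> Bij (fst N). (`) f ` snd N = snd N}"
  interpret B: group "BijGroup ?S" by (rule group_BijGroup)
  have mult: "f \<otimes>\<^bsub>BijGroup ?S\<^esub> g = compose ?S f g" if "f \<in> Bij ?S" "g \<in> Bij ?S" for f g
    using that by (simp add: BijGroup_def)
  have im: "(`) (compose ?S f g) ` snd N = (`) f ` (`) g ` snd N" for f g :: "'a \<Rightarrow> 'a"
  proof -
    have "compose ?S f g ` B = f ` g ` B" if "B \<in> snd N" for B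
      using N that by (auto simp: compose_def image_iff)
    then have "(`) (compose ?S f g) ` snd N = (\<lambda>B. f ` g ` B) ` snd N" by (rule image_cong[OF refl])
    then show ?thesis by (simp only: image_image)
  qed
  have "subgroup ?A (BijGroup ?S)"
  proof (rule B.subgroupI)
    show "?A \<subseteq> carrier (BijGroup ?S)" by (auto simp: BijGroup_def)
    have "(\<lambda>x\<in>?S. x) \<in> ?A"
    proof -
      have "(\<lambda>x\<in>?S. x) ` B = B" if "B \<in> snd N" for B using N that by (auto simp: image_iff)
      then have "(`) (\<lambda>x\<in>?S. x) ` snd N = id ` snd N" by (intro image_cong) auto
      then show ?thesis using id_Bij[of ?S] by simp
    qed
    then show "?A \<noteq> {}" by blast
    fix f assume f: "f \<in> ?A"
    then have fB: "f \<in> Bij ?S" "bij_betw f ?S ?S" by (auto simp: Bij_def)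
    have inv: "inv\<^bsub>BijGroup ?S\<^esub> f = (\<lambda>x\<in>?S. inv_into ?S f x)" using fB(1) by (rule inv_BijGroup)
    have "(`) (\<lambda>x\<in>?S. inv_into ?S f x) ` snd N = (`) (inv_into ?S f) ` snd N"
      using N by (intro image_cong refl image_cong) auto
    also have "\<dots> = snd N" using inv_blocks(2)[OF fB(2) _ N] f by simp
    finally show "inv\<^bsub>BijGroup ?S\<^esub> f \<in> ?A" unfolding inv using restrict_inv_into_Bij[OF fB(1)] by simp
    fix g assume g: "g \<in> ?A"
    then show "f \<otimes>\<^bsub>BijGroup ?S\<^esub> g \<in> ?A"
      using f mult[of f g] im[of f g] compose_Bij[of f ?S g] by simp
  qed
  then show ?thesis unfolding multinet_aut_def by (rule B.subgroup_imp_group)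
qed

lemma group_aut_net: "holed k L \<Longrightarrow> group (multinet_aut (net k L))"
  by (rule group_multinet_aut) (use lines_sub in \<open>auto simp: net_def hole_def\<close>)

lemma carrier_multinet_aut: "carrier (multinet_aut N) = {f \<in> Bij (fst N). (`) f ` snd N = snd N}"
  by (simp add: multinet_aut_def)

text \<open>\<open>net_map_blocks\<close> upgrades forward preservation of lines to preservation of
  the block set, and \<open>blocks_net_map\<close> goes back by comparing block sizes.\<close>

lemma aut_carrier:
  assumes h: "holed k L" and k: "k \<in> {2, 3}"
  shows "carrier (multinet_aut (net k L)) = {f \<in> extensional {..<18}. net_map k L L f}"
proof (rule Set.set_eqI)
  fix f
  have "f \<in> carrier (multinet_aut (net k L)) \<longleftrightarrow>
      f \<in> extensional {..<18} \<and> bij_betw f {..<18} {..<18} \<and> (`) f ` snd (net k L) = snd (net k L)"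
    unfolding carrier_multinet_aut fst_net Bij_def mem_Collect_eq Int_iff by (rule conj_assoc)
  moreover have "net_map k L L f" if "bij_betw f {..<18} {..<18}" "(`) f ` snd (net k L) = snd (net k L)"
    by (rule blocks_net_map[OF h h k that])
  moreover have "bij_betw f {..<18} {..<18}" "(`) f ` snd (net k L) = snd (net k L)" if "net_map k L L f"
  proof -
    show "(`) f ` snd (net k L) = snd (net k L)" by (rule net_map_blocks[OF h h that])
    show "bij_betw f {..<18} {..<18}" using that unfolding net_map_def by (rule conjunct1)
  qed
  ultimately show "f \<in> carrier (multinet_aut (net k L)) \<longleftrightarrow> f \<in> {f \<in> extensional {..<18}. net_map k L L f}"
    by (metis (no_types, lifting) mem_Collect_eq)
qed

section \<open>Automorphisms as lists of images\<close>

definition perm_fun :: "nat list \<Rightarrow> nat \<Rightarrow> nat" where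
  "perm_fun p = (\<lambda>u\<in>{..<18}. p ! u)"

definition pcomp :: "nat list \<Rightarrow> nat list \<Rightarrow> nat list" where
  "pcomp p q = map ((!) p) q"

lemma net_map_cong:
  assumes "holed k L" "\<And>u. u < 18 \<Longrightarrow> f u = g u" "net_map k L L' f"
  shows "net_map k L L' g"
proof -
  have "f ` B = g ` B" if "B \<in> lines k L" for B
    using lines_sub[OF assms(1) that] assms(2) by (intro image_cong) auto
  moreover have "bij_betw g {..<18} {..<18}"
    using assms(3) bij_betw_cong[of "{..<18}" f g] assms(2) by (simp add: net_map_def)
  ultimately show ?thesis using assms(2,3) by (simp add: net_map_def)
qed

definition aut_list :: "nat \<Rightarrow> (nat \<Rightarrow> nat list) \<Rightarrow> nat list \<Rightarrow> bool" where
  "aut_list k T p \<longleftrightarrow> length p = 18 \<and> set p \<subseteq> {..<18} \<and> perm_fun p \<in> carrier (multinet_aut (net k (entry T)))"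

lemma iso_cert_aut_list:
  assumes T: "square k T" and k: "k \<in> {2, 3}" and c: "iso_cert k T T p"
  shows "aut_list k T p"
proof -
  have "net_map k (entry T) (entry T) (perm_fun p)"
    by (rule net_map_cong[OF square_holed[OF T] _ iso_cert_net_map[OF T T c]]) (simp add: perm_fun_def)
  then show ?thesis
    using c unfolding aut_list_def aut_carrier[OF square_holed[OF T] k]
    by (auto simp: perm_fun_def iso_cert_def list_all_iff)
qed

lemma perm_fun_pcomp:
  assumes p: "aut_list k T p" and q: "aut_list k T q"
  shows "perm_fun p \<otimes>\<^bsub>multinet_aut (net k (entry T))\<^esub> perm_fun q = perm_fun (pcomp p q)"
proof -
  have B: "perm_fun p \<in> Bij {..<18}" "perm_fun q \<in> Bij {..<18}"
    using p q unfolding aut_list_def carrier_multinet_aut fst_net by blast+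
  have q18: "length q = 18" "\<And>u. u < 18 \<Longrightarrow> q ! u < 18"
    using q unfolding aut_list_def by (auto dest!: subsetD[OF _ nth_mem])
  have "perm_fun p \<otimes>\<^bsub>multinet_aut (net k (entry T))\<^esub> perm_fun q = compose {..<18} (perm_fun p) (perm_fun q)"
    using B by (simp add: multinet_aut_def BijGroup_def)
  also have "\<dots> = perm_fun (pcomp p q)"
    using q18 by (auto simp: fun_eq_iff compose_def perm_fun_def pcomp_def)
  finally show ?thesis .
qed

lemma aut_list_pcomp:
  assumes T: "square k T" and p: "aut_list k T p" and q: "aut_list k T q"
  shows "aut_list k T (pcomp p q)"
proof -
  interpret group "multinet_aut (net k (entry T))" by (rule group_aut_net[OF square_holed[OF T]])
  have "perm_fun (pcomp p q) \<in> carrier (multinet_aut (net k (entry T)))"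
    unfolding perm_fun_pcomp[OF p q, symmetric] using p q by (intro m_closed) (simp_all add: aut_list_def)
  moreover have "p ! u \<in> set p" if "u \<in> set q" for u
    using that p q by (intro nth_mem) (auto simp: aut_list_def)
  ultimately show ?thesis using p q by (fastforce simp: aut_list_def pcomp_def)
qed

lemma pcomp_assoc: "aut_list k T q \<Longrightarrow> aut_list k T r \<Longrightarrow> pcomp (pcomp p q) r = pcomp p (pcomp q r)"
  by (auto simp: pcomp_def aut_list_def intro!: nth_map)

lemma aut_list_id:
  assumes T: "square k T" and k: "k \<in> {2, 3}"
  shows "aut_list k T [0..<18]"
proof -
  have "net_map k (entry T) (entry T) id" by (simp add: net_map_def)
  then have "net_map k (entry T) (entry T) (perm_fun [0..<18])"
    by (rule net_map_cong[OF square_holed[OF T], rotated]) (simp add: perm_fun_def del: upt_Suc upt_rec_numeral)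
  then show ?thesis
    unfolding aut_list_def aut_carrier[OF square_holed[OF T] k]
    by (simp add: perm_fun_def lessThan_atLeast0 del: upt_Suc upt_rec_numeral)
qed

lemma pcomp_id: "length p = 18 \<Longrightarrow> pcomp p [0..<18] = p" "set p \<subseteq> {..<18} \<Longrightarrow> pcomp [0..<18] p = p"
  by (simp_all only: pcomp_def map_nth_upt) (auto intro!: map_idI)

lemma perm_fun_inj:
  assumes "aut_list k T p" "aut_list k T q" "perm_fun p = perm_fun q"
  shows "p = q"
proof (rule nth_equalityI)
  show "length p = length q" using assms(1,2) by (simp add: aut_list_def)
  fix u assume "u < length p"
  then have "u < 18" using assms(1) by (simp add: aut_list_def)
  then show "p ! u = q ! u" using fun_cong[OF assms(3), of u] by (simp add: perm_fun_def)
qed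

text \<open>The group \<open>H\<close> is modelled by the codes \<open>cs\<close> with multiplication \<open>m\<close>, decoded by \<open>\<delta>\<close>.\<close>

definition group_model ::
    "('h, 'x) monoid_scheme \<Rightarrow> nat list list \<Rightarrow> (nat list \<Rightarrow> nat list \<Rightarrow> nat list) \<Rightarrow> (nat list \<Rightarrow> 'h) \<Rightarrow> bool" where
  "group_model H cs m \<delta> \<longleftrightarrow> group H \<and> distinct cs \<and> bij_betw \<delta> (set cs) (carrier H) \<and>
     (\<forall>c\<in>set cs. \<forall>d\<in>set cs. m c d \<in> set cs \<and> \<delta> (m c d) = \<delta> c \<otimes>\<^bsub>H\<^esub> \<delta> d)"

definition action_table ::
    "nat \<Rightarrow> (nat \<Rightarrow> nat list) \<Rightarrow> nat list list \<Rightarrow> (nat list \<Rightarrow> nat list \<Rightarrow> nat list) \<Rightarrow> (nat list \<Rightarrow> nat list) \<Rightarrow> bool" where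
  "action_table k T cs m F \<longleftrightarrow> (\<forall>c\<in>set cs. aut_list k T (F c)) \<and> inj_on F (set cs) \<and>
     (\<forall>c\<in>set cs. \<forall>d\<in>set cs. pcomp (F c) (F d) = F (m c d))"

text \<open>Decoding is a bijection, so the table of permutations transfers to an embedding of
  \<open>H\<close> into the automorphism group.\<close>

lemma action_hom:
  assumes T: "square k T" and H: "group_model H cs m \<delta>" and F: "action_table k T cs m F"
  obtains \<Phi> where "\<Phi> \<in> hom H (multinet_aut (net k (entry T)))" "inj_on \<Phi> (carrier H)"
    "\<And>c. c \<in> set cs \<Longrightarrow> \<Phi> (\<delta> c) = perm_fun (F c)"
proof -
  let ?G = "multinet_aut (net k (entry T))"
  have bij: "bij_betw \<delta> (set cs) (carrier H)"
    and m: "\<And>c d. c \<in> set cs \<Longrightarrow> d \<in> set cs \<Longrightarrow> m c d \<in> set cs \<and> \<delta> (m c d) = \<delta> c \<otimes>\<^bsub>H\<^esub> \<delta> d"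
    using H by (auto simp: group_model_def)
  have cert: "\<And>c. c \<in> set cs \<Longrightarrow> aut_list k T (F c)" and inj: "inj_on F (set cs)"
    and comp: "\<And>c d. c \<in> set cs \<Longrightarrow> d \<in> set cs \<Longrightarrow> pcomp (F c) (F d) = F (m c d)"
    using F by (auto simp: action_table_def)
  define \<Phi> where "\<Phi> h = perm_fun (F (inv_into (set cs) \<delta> h))" for h
  have \<Phi>: "\<Phi> (\<delta> c) = perm_fun (F c)" if "c \<in> set cs" for c
    unfolding \<Phi>_def using bij_betw_inv_into_left[OF bij that] by simp
  have rep: "\<exists>c\<in>set cs. h = \<delta> c" if "h \<in> carrier H" for h using bij that by (auto simp: bij_betw_def)
  have "\<Phi> \<in> hom H ?G"
  proof (rule homI)
    fix h assume "h \<in> carrier H"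
    then obtain c where c: "c \<in> set cs" "h = \<delta> c" using rep by blast
    then show "\<Phi> h \<in> carrier ?G" using \<Phi>[OF c(1)] cert[OF c(1)] by (simp add: aut_list_def)
    fix h' assume "h' \<in> carrier H"
    then obtain d where d: "d \<in> set cs" "h' = \<delta> d" using rep by blast
    then show "\<Phi> (h \<otimes>\<^bsub>H\<^esub> h') = \<Phi> h \<otimes>\<^bsub>?G\<^esub> \<Phi> h'"
      using c m[of c d] \<Phi>[of "m c d"] \<Phi>[of c] \<Phi>[of d] perm_fun_pcomp[OF cert cert, of c d] comp[of c d] by simp
  qed
  moreover have "inj_on \<Phi> (carrier H)"
  proof (rule inj_onI)
    fix h h' assume "h \<in> carrier H" "h' \<in> carrier H" and e: "\<Phi> h = \<Phi> h'"
    then obtain c d where c: "c \<in> set cs" "h = \<delta> c" and d: "d \<in> set cs" "h' = \<delta> d" using rep by blast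
    have "F c = F d" using perm_fun_inj[OF cert[OF c(1)] cert[OF d(1)]] e c d \<Phi> by simp
    then show "h = h'" using inj c d by (auto dest: inj_onD)
  qed
  ultimately show ?thesis using that \<Phi> by blast
qed

text \<open>The generator numbered \<open>i\<close> is \<open>gs ! i\<close> in the model and acts as \<open>ps ! i\<close>.\<close>

definition word_perm :: "nat list list \<Rightarrow> nat list \<Rightarrow> nat list" where
  "word_perm ps w = foldr (\<lambda>i. pcomp (ps ! i)) w [0..<18]"

definition words :: "nat list list \<Rightarrow> (nat list \<Rightarrow> nat list \<Rightarrow> nat list) \<Rightarrow> nat list list \<Rightarrow> nat list \<Rightarrow> (nat list \<Rightarrow> nat list) \<Rightarrow> bool" where
  "words cs m gs e w \<longleftrightarrow> list_all (List.member cs) gs \<and> List.member cs e \<and> list_all (\<lambda>c. m e c = c) cs \<and>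
     list_all (\<lambda>c. list_all (\<lambda>i. i < length gs) (w c) \<and> foldr (\<lambda>i. m (gs ! i)) (w c) e = c) cs"

text \<open>Multiplicativity is tested only for a generator times an arbitrary code, which keeps the
  number of products linear in the group order instead of quadratic.\<close>

definition action_cert ::
    "nat \<Rightarrow> (nat \<Rightarrow> nat list) \<Rightarrow> nat list list \<Rightarrow> (nat list \<Rightarrow> nat list \<Rightarrow> nat list) \<Rightarrow> nat list list \<Rightarrow> (nat list \<Rightarrow> nat list) \<Rightarrow> nat list list \<Rightarrow> bool" where
  "action_cert k T cs m gs w ps \<longleftrightarrow> length ps = length gs \<and> list_all (iso_cert k T T) ps \<and>
     distinct (map (\<lambda>c. word_perm ps (w c)) cs) \<and>
     list_all (\<lambda>c. list_all (\<lambda>i. pcomp (ps ! i) (word_perm ps (w c)) = word_perm ps (w (m (gs ! i) c))) [0..<length gs]) cs"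

text \<open>Induction over the word of the left factor extends multiplicativity from generators to
  all codes; associativity of the code product is inherited from \<open>H\<close>.\<close>

lemma action_tableI:
  assumes T: "square k T" and k: "k \<in> {2, 3}" and H: "group_model H cs m \<delta>"
    and w: "words cs m gs e w" and F: "action_cert k T cs m gs w ps"
  shows "action_table k T cs m (\<lambda>c. word_perm ps (w c))"
proof -
  define F where "F c = word_perm ps (w c)" for c
  interpret H: group H using H by (simp add: group_model_def)
  have bij: "bij_betw \<delta> (set cs) (carrier H)"
    and m: "\<And>c d. c \<in> set cs \<Longrightarrow> d \<in> set cs \<Longrightarrow> m c d \<in> set cs \<and> \<delta> (m c d) = \<delta> c \<otimes>\<^bsub>H\<^esub> \<delta> d"
    using H by (auto simp: group_model_def)
  have \<delta>: "\<delta> c \<in> carrier H" if "c \<in> set cs" for c using bij that by (auto simp: bij_betw_def)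
  have assoc: "m (m a b) c = m a (m b c)" if "a \<in> set cs" "b \<in> set cs" "c \<in> set cs" for a b c
  proof -
    have "\<delta> (m (m a b) c) = \<delta> (m a (m b c))" using m \<delta> that by (simp add: H.m_assoc)
    then show ?thesis using inj_onD[OF bij_betw_imp_inj_on[OF bij]] m that by simp
  qed
  have gs: "gs ! i \<in> set cs" if "i < length gs" for i
    using w that by (auto simp: words_def list_all_iff)
  have e: "e \<in> set cs" and id_e: "\<And>c. c \<in> set cs \<Longrightarrow> m e c = c"
    using w by (auto simp: words_def list_all_iff)
  have wc: "\<forall>i\<in>set (w c). i < length gs" "foldr (\<lambda>i. m (gs ! i)) (w c) e = c" if "c \<in> set cs" for c
    using w that by (auto simp: words_def list_all_iff)
  have ps: "aut_list k T (ps ! i)" if "i < length gs" for i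
    using F that iso_cert_aut_list[OF T k] by (auto simp: action_cert_def list_all_iff)
  have step: "pcomp (ps ! i) (F c) = F (m (gs ! i) c)" if "c \<in> set cs" "i < length gs" for c i
    using F that by (auto simp: action_cert_def list_all_iff F_def)
  have wp: "aut_list k T (word_perm ps v)" if "\<forall>i\<in>set v. i < length gs" for v
    using that by (induction v) (auto simp: word_perm_def aut_list_id[OF T k] intro!: aut_list_pcomp[OF T] ps simp del: upt_Suc upt_rec_numeral)
  have al: "aut_list k T (F c)" if "c \<in> set cs" for c using wp wc(1)[OF that] by (simp add: F_def)
  have ev: "foldr (\<lambda>i. m (gs ! i)) v e \<in> set cs \<and>
      (\<forall>d\<in>set cs. pcomp (word_perm ps v) (F d) = F (m (foldr (\<lambda>i. m (gs ! i)) v e) d))"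
    if "\<forall>i\<in>set v. i < length gs" for v
    using that
  proof (induction v)
    case Nil
    have "word_perm ps [] = [0..<18]" by (simp add: word_perm_def del: upt_Suc upt_rec_numeral)
    then show ?case
      using e al pcomp_id(2) id_e by (simp add: aut_list_def del: upt_Suc upt_rec_numeral)
  next
    case (Cons i v)
    define x where "x = foldr (\<lambda>i. m (gs ! i)) v e"
    have i: "i < length gs" and v: "\<forall>i\<in>set v. i < length gs" using Cons.prems by simp_all
    have x: "x \<in> set cs" and IH: "\<And>d. d \<in> set cs \<Longrightarrow> pcomp (word_perm ps v) (F d) = F (m x d)"
      using Cons.IH[OF v] by (simp_all add: x_def)
    have "pcomp (word_perm ps (i # v)) (F d) = F (m (m (gs ! i) x) d)" if d: "d \<in> set cs" for d
    proof -
      have "pcomp (word_perm ps (i # v)) (F d) = pcomp (ps ! i) (pcomp (word_perm ps v) (F d))"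
        unfolding pcomp_assoc[OF wp[OF v] al[OF d], symmetric] by (simp add: word_perm_def)
      also have "\<dots> = F (m (gs ! i) (m x d))"
        using IH[OF d] step[OF _ i] m[OF x d] by simp
      finally show ?thesis using assoc[OF gs[OF i] x d] by simp
    qed
    then show ?case using m[OF gs[OF i] x] by (simp add: x_def)
  qed
  have "pcomp (F c) (F d) = F (m c d)" if "c \<in> set cs" "d \<in> set cs" for c d
    using ev[OF wc(1)[OF that(1)]] wc(2)[OF that(1)] that(2) by (simp add: F_def)
  moreover have "inj_on F (set cs)" using F by (simp add: action_cert_def distinct_map F_def[abs_def])
  ultimately show ?thesis using al unfolding action_table_def F_def by blast
qed

text \<open>\<open>us\<close> runs through all points and obeys the plan, so an automorphism is
  determined by the solution that it produces in the search.\<close>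

lemma card_aut_le:
  assumes T: "square k T" and k: "k \<in> {2, 3}" and v: "valid k T pl us 0"
    and us: "distinct us" "set us = {..<18}"
  shows "finite (carrier (multinet_aut (net k (entry T))))"
    "card (carrier (multinet_aut (net k (entry T)))) \<le> length (search k T pl [])"
proof -
  let ?X = "carrier (multinet_aut (net k (entry T)))"
  have sub: "(\<lambda>f. map f us) ` ?X \<subseteq> set (search k T pl [])"
  proof clarify
    fix f assume "f \<in> ?X"
    then have "net_map k (entry T) (entry T) f" unfolding aut_carrier[OF square_holed[OF T] k] by simp
    from search_complete[OF T T this us(1) _ v] us(2) show "map f us \<in> set (search k T pl [])" by simp
  qed
  have inj: "inj_on (\<lambda>f. map f us) ?X"
  proof (rule inj_onI)
    fix f g assume fg: "f \<in> ?X" "g \<in> ?X" "map f us = map g us"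
    have "f u = g u" if "u < 18" for u using fg(3) us(2) that by (auto simp: map_eq_conv)
    then show "f = g" using fg(1,2) unfolding aut_carrier[OF square_holed[OF T] k]
      by (intro extensionalityI[of f "{..<18}" g]) auto
  qed
  show "finite ?X" by (rule inj_on_finite[OF inj sub]) simp
  have "card ?X \<le> card (set (search k T pl []))" using card_inj_on_le[OF inj sub] by simp
  also have "\<dots> \<le> length (search k T pl [])" by (rule card_length)
  finally show "card ?X \<le> length (search k T pl [])" .
qed

text \<open>The model embeds into the automorphism group, and the search bound leaves no room for
  further elements.\<close>

lemma aut_iso:
  assumes T: "square k T" and k: "k \<in> {2, 3}" and H: "group_model H cs m \<delta>" and F: "action_table k T cs m F"
    and v: "valid k T pl us 0" and us: "distinct us" "set us = {..<18}"
    and len: "length (search k T pl []) \<le> length cs"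
  shows "multinet_aut (net k (entry T)) \<cong> H"
proof -
  let ?G = "multinet_aut (net k (entry T))"
  obtain \<Phi> where \<Phi>: "\<Phi> \<in> hom H ?G" "inj_on \<Phi> (carrier H)" using action_hom[OF T H F] by blast
  have "card (carrier H) = length cs"
    using H unfolding group_model_def by (metis bij_betw_same_card distinct_card)
  then have "card (carrier ?G) \<le> card (\<Phi> ` carrier H)"
    using card_aut_le(2)[OF T k v us] len \<Phi>(2) by (simp add: card_image)
  moreover have "\<Phi> ` carrier H \<subseteq> carrier ?G" using \<Phi>(1) by (auto simp: hom_def)
  ultimately have "\<Phi> ` carrier H = carrier ?G"
    using card_seteq[OF card_aut_le(1)[OF T k v us]] by blast
  then have "\<Phi> \<in> iso H ?G" using \<Phi> by (simp add: iso_def bij_betw_def)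
  then have "H \<cong> ?G" by (auto simp: is_iso_def)
  moreover have "group H" using H by (simp add: group_model_def)
  ultimately show ?thesis by (rule group.iso_sym[rotated])
qed

section \<open>Semidirect products inside a group\<close>

text \<open>The element \<open>a'\<close> in the conjugation hypothesis is unique because
  \<open>\<alpha>\<close> is injective; sending \<open>a\<close> to \<open>a'\<close> is the action
  of \<open>b\<close>, and trivial intersection makes the product map injective.\<close>

lemma semidirect_embedding:
  assumes G: "group G" and A: "group A" and B: "group B"
    and \<alpha>: "\<alpha> \<in> hom A G" "inj_on \<alpha> (carrier A)" and \<beta>: "\<beta> \<in> hom B G" "inj_on \<beta> (carrier B)"
    and conj_ex: "\<forall>a\<in>carrier A. \<forall>b\<in>carrier B.
      \<exists>a'\<in>carrier A. \<beta> b \<otimes>\<^bsub>G\<^esub> \<alpha> a = \<alpha> a' \<otimes>\<^bsub>G\<^esub> \<beta> b"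
    and triv_Int: "\<forall>a\<in>carrier A. \<forall>b\<in>carrier B. \<alpha> a = \<beta> b \<longrightarrow> a = \<one>\<^bsub>A\<^esub>"
  obtains \<phi> where "\<phi> \<in> hom B (AutoGroup A)"
    "(\<lambda>(a, b). \<alpha> a \<otimes>\<^bsub>G\<^esub> \<beta> b) \<in> hom (semidirect A B \<phi>) G"
    "inj_on (\<lambda>(a, b). \<alpha> a \<otimes>\<^bsub>G\<^esub> \<beta> b) (carrier A \<times> carrier B)"
proof -
  interpret G: group G by fact
  interpret A: group A by fact
  interpret B: group B by fact
  interpret \<alpha>: group_hom A G \<alpha> by unfold_locales (rule \<alpha>(1))
  interpret \<beta>: group_hom B G \<beta> by unfold_locales (rule \<beta>(1))
  define act where "act b a = (THE a'. a' \<in> carrier A \<and> \<beta> b \<otimes>\<^bsub>G\<^esub> \<alpha> a = \<alpha> a' \<otimes>\<^bsub>G\<^esub> \<beta> b)" for a b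
  have uniq: "a' = a''" if "a' \<in> carrier A" "a'' \<in> carrier A" "b \<in> carrier B"
    "\<alpha> a' \<otimes>\<^bsub>G\<^esub> \<beta> b = \<alpha> a'' \<otimes>\<^bsub>G\<^esub> \<beta> b" for a' a'' b
    using that \<alpha>(2) by (auto dest: inj_onD)
  have act: "act b a \<in> carrier A" "\<beta> b \<otimes>\<^bsub>G\<^esub> \<alpha> a = \<alpha> (act b a) \<otimes>\<^bsub>G\<^esub> \<beta> b"
    if "a \<in> carrier A" "b \<in> carrier B" for a b
  proof -
    have "\<exists>!a'. a' \<in> carrier A \<and> \<beta> b \<otimes>\<^bsub>G\<^esub> \<alpha> a = \<alpha> a' \<otimes>\<^bsub>G\<^esub> \<beta> b"
      using conj_ex that uniq[OF _ _ that(2)] by metis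
    from theI'[OF this] show "act b a \<in> carrier A" "\<beta> b \<otimes>\<^bsub>G\<^esub> \<alpha> a = \<alpha> (act b a) \<otimes>\<^bsub>G\<^esub> \<beta> b"
      unfolding act_def by auto
  qed
  have act_eq: "act b a = a'" if "a \<in> carrier A" "b \<in> carrier B" "a' \<in> carrier A"
    "\<beta> b \<otimes>\<^bsub>G\<^esub> \<alpha> a = \<alpha> a' \<otimes>\<^bsub>G\<^esub> \<beta> b" for a b a'
    using uniq[OF act(1)[OF that(1,2)] that(3,2)] act(2)[OF that(1,2)] that(4) by simp
  have act_mult: "act b (a \<otimes>\<^bsub>A\<^esub> a') = act b a \<otimes>\<^bsub>A\<^esub> act b a'"
    if a: "a \<in> carrier A" "a' \<in> carrier A" and b: "b \<in> carrier B" for a a' b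
  proof (rule act_eq)
    have "\<beta> b \<otimes>\<^bsub>G\<^esub> \<alpha> (a \<otimes>\<^bsub>A\<^esub> a') = (\<beta> b \<otimes>\<^bsub>G\<^esub> \<alpha> a) \<otimes>\<^bsub>G\<^esub> \<alpha> a'"
      using a b by (simp add: G.m_assoc)
    also have "\<dots> = \<alpha> (act b a) \<otimes>\<^bsub>G\<^esub> (\<beta> b \<otimes>\<^bsub>G\<^esub> \<alpha> a')"
      using a b act[OF a(1) b] by (simp add: G.m_assoc)
    also have "\<dots> = \<alpha> (act b a \<otimes>\<^bsub>A\<^esub> act b a') \<otimes>\<^bsub>G\<^esub> \<beta> b"
      using a b act[OF a(1) b] act[OF a(2) b] by (simp add: G.m_assoc)
    finally show "\<beta> b \<otimes>\<^bsub>G\<^esub> \<alpha> (a \<otimes>\<^bsub>A\<^esub> a') = \<alpha> (act b a \<otimes>\<^bsub>A\<^esub> act b a') \<otimes>\<^bsub>G\<^esub> \<beta> b" .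
  qed (use a b act in simp_all)
  have act_comp: "act (b \<otimes>\<^bsub>B\<^esub> b') a = act b (act b' a)"
    if a: "a \<in> carrier A" and b: "b \<in> carrier B" "b' \<in> carrier B" for a b b'
  proof (rule act_eq)
    have "\<beta> (b \<otimes>\<^bsub>B\<^esub> b') \<otimes>\<^bsub>G\<^esub> \<alpha> a = \<beta> b \<otimes>\<^bsub>G\<^esub> (\<beta> b' \<otimes>\<^bsub>G\<^esub> \<alpha> a)"
      using a b by (simp add: G.m_assoc)
    also have "\<dots> = (\<beta> b \<otimes>\<^bsub>G\<^esub> \<alpha> (act b' a)) \<otimes>\<^bsub>G\<^esub> \<beta> b'"
      using a b act[OF a b(2)] by (simp add: G.m_assoc)
    also have "\<dots> = \<alpha> (act b (act b' a)) \<otimes>\<^bsub>G\<^esub> \<beta> (b \<otimes>\<^bsub>B\<^esub> b')"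
      using a b act[OF a b(2)] act[OF act(1)[OF a b(2)] b(1)] by (simp add: G.m_assoc)
    finally show "\<beta> (b \<otimes>\<^bsub>B\<^esub> b') \<otimes>\<^bsub>G\<^esub> \<alpha> a = \<alpha> (act b (act b' a)) \<otimes>\<^bsub>G\<^esub> \<beta> (b \<otimes>\<^bsub>B\<^esub> b')" .
  qed (use a b act in simp_all)
  have act_one: "act \<one>\<^bsub>B\<^esub> a = a" if "a \<in> carrier A" for a
    by (rule act_eq) (use that in simp_all)
  define \<phi> where "\<phi> b = (\<lambda>a\<in>carrier A. act b a)" for b
  have Bij: "\<phi> b \<in> Bij (carrier A)" if b: "b \<in> carrier B" for b
  proof -
    have "bij_betw (\<phi> b) (carrier A) (carrier A)"
    proof (rule bij_betw_byWitness[where f' = "act (inv\<^bsub>B\<^esub> b)"])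
      show "\<forall>a\<in>carrier A. act (inv\<^bsub>B\<^esub> b) (\<phi> b a) = a"
        using b act_comp[of _ "inv\<^bsub>B\<^esub> b" b] act_one by (simp add: \<phi>_def)
      show "\<forall>a\<in>carrier A. \<phi> b (act (inv\<^bsub>B\<^esub> b) a) = a"
        using b act(1) act_comp[of _ b "inv\<^bsub>B\<^esub> b"] act_one by (simp add: \<phi>_def)
    qed (use b act in \<open>auto simp: \<phi>_def\<close>)
    then show ?thesis by (simp add: Bij_def \<phi>_def)
  qed
  have hom: "\<phi> b \<in> hom A A" if "b \<in> carrier B" for b
    using that act act_mult by (intro homI) (simp_all add: \<phi>_def)
  have "\<phi> \<in> hom B (AutoGroup A)"
  proof (rule homI)
    show "\<phi> b \<in> carrier (AutoGroup A)" if "b \<in> carrier B" for b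
      using Bij[OF that] hom[OF that] by (simp add: AutoGroup_def auto_def)
    show "\<phi> (b \<otimes>\<^bsub>B\<^esub> b') = \<phi> b \<otimes>\<^bsub>AutoGroup A\<^esub> \<phi> b'" if b: "b \<in> carrier B" "b' \<in> carrier B" for b b'
      using Bij[OF b(1)] Bij[OF b(2)] act b act_comp
      by (auto simp: AutoGroup_def BijGroup_def compose_def \<phi>_def fun_eq_iff)
  qed
  moreover have "(\<lambda>(a, b). \<alpha> a \<otimes>\<^bsub>G\<^esub> \<beta> b) \<in> hom (semidirect A B \<phi>) G"
  proof (rule homI)
    fix x assume "x \<in> carrier (semidirect A B \<phi>)"
    then obtain a b where x: "x = (a, b)" "a \<in> carrier A" "b \<in> carrier B" by (auto simp: semidirect_def)
    then show "(case x of (a, b) \<Rightarrow> \<alpha> a \<otimes>\<^bsub>G\<^esub> \<beta> b) \<in> carrier G" by simp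
    fix y assume "y \<in> carrier (semidirect A B \<phi>)"
    then obtain a' b' where y: "y = (a', b')" "a' \<in> carrier A" "b' \<in> carrier B" by (auto simp: semidirect_def)
    have "\<alpha> (a \<otimes>\<^bsub>A\<^esub> act b a') \<otimes>\<^bsub>G\<^esub> \<beta> (b \<otimes>\<^bsub>B\<^esub> b') = \<alpha> a \<otimes>\<^bsub>G\<^esub> (\<alpha> (act b a') \<otimes>\<^bsub>G\<^esub> \<beta> b) \<otimes>\<^bsub>G\<^esub> \<beta> b'"
      using x y act by (simp add: G.m_assoc)
    also have "\<dots> = (\<alpha> a \<otimes>\<^bsub>G\<^esub> \<beta> b) \<otimes>\<^bsub>G\<^esub> (\<alpha> a' \<otimes>\<^bsub>G\<^esub> \<beta> b')"
      using x y act(2)[OF y(2) x(3), symmetric] by (simp add: G.m_assoc)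
    finally show "(case x \<otimes>\<^bsub>semidirect A B \<phi>\<^esub> y of (a, b) \<Rightarrow> \<alpha> a \<otimes>\<^bsub>G\<^esub> \<beta> b) =
        (case x of (a, b) \<Rightarrow> \<alpha> a \<otimes>\<^bsub>G\<^esub> \<beta> b) \<otimes>\<^bsub>G\<^esub> (case y of (a, b) \<Rightarrow> \<alpha> a \<otimes>\<^bsub>G\<^esub> \<beta> b)"
      using x y by (simp add: semidirect_def \<phi>_def)
  qed
  moreover have "inj_on (\<lambda>(a, b). \<alpha> a \<otimes>\<^bsub>G\<^esub> \<beta> b) (carrier A \<times> carrier B)"
  proof (rule inj_onI, clarify)
    fix a b a' b' assume a: "a \<in> carrier A" "a' \<in> carrier A" and b: "b \<in> carrier B" "b' \<in> carrier B"
      and e: "\<alpha> a \<otimes>\<^bsub>G\<^esub> \<beta> b = \<alpha> a' \<otimes>\<^bsub>G\<^esub> \<beta> b'"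
    \<comment> \<open>Rearranging the equal products exhibits an element common to both images,
      which must be trivial.\<close>
    have "\<alpha> (inv\<^bsub>A\<^esub> a' \<otimes>\<^bsub>A\<^esub> a) = inv\<^bsub>G\<^esub> (\<alpha> a') \<otimes>\<^bsub>G\<^esub> ((\<alpha> a \<otimes>\<^bsub>G\<^esub> \<beta> b) \<otimes>\<^bsub>G\<^esub> inv\<^bsub>G\<^esub> (\<beta> b))"
      using a b by (simp add: G.m_assoc)
    also have "\<dots> = inv\<^bsub>G\<^esub> (\<alpha> a') \<otimes>\<^bsub>G\<^esub> (\<alpha> a' \<otimes>\<^bsub>G\<^esub> (\<beta> b' \<otimes>\<^bsub>G\<^esub> inv\<^bsub>G\<^esub> (\<beta> b)))"
      unfolding e using a b by (simp add: G.m_assoc)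
    also have "\<dots> = \<beta> (b' \<otimes>\<^bsub>B\<^esub> inv\<^bsub>B\<^esub> b)"
      using a b by (simp add: G.m_assoc[symmetric])
    finally have e': "\<alpha> (inv\<^bsub>A\<^esub> a' \<otimes>\<^bsub>A\<^esub> a) = \<beta> (b' \<otimes>\<^bsub>B\<^esub> inv\<^bsub>B\<^esub> b)" .
    have "inv\<^bsub>A\<^esub> a' \<otimes>\<^bsub>A\<^esub> a = \<one>\<^bsub>A\<^esub>" by (rule triv_Int[rule_format, OF _ _ e']) (use a b in simp_all)
    then have "a = a'" using a by (metis A.inv_closed A.inv_equality A.inv_inv)
    moreover have "\<beta> b = \<beta> b'" using e a b unfolding \<open>a = a'\<close> by simp
    ultimately show "a = a' \<and> b = b'" using \<beta>(2) b by (auto dest: inj_onD)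
  qed
  ultimately show ?thesis using that by blast
qed

section \<open>The groups in question\<close>

text \<open>One-line notation with values from 1, to match \<open>sym_group n\<close> acting on
  \<open>{1..n}\<close>; hence the shift by one.\<close>

definition perm_mult :: "nat list \<Rightarrow> nat list \<Rightarrow> nat list" where
  "perm_mult c d = map (\<lambda>x. c ! (x - 1)) d"

definition perm_of :: "nat list \<Rightarrow> nat \<Rightarrow> nat" where
  "perm_of c x = (if 1 \<le> x \<and> x \<le> length c then c ! (x - 1) else x)"

definition perm_codes :: "nat \<Rightarrow> nat list list" where
  "perm_codes n = filter distinct (List.n_lists n [1..<Suc n])"

text \<open>Codes of a direct product with \<open>C n\<close> put a residue in front of a code of
  the other factor, so iterating this codes products of several groups.\<close>

definition cmult :: "nat \<Rightarrow> (nat list \<Rightarrow> nat list \<Rightarrow> nat list) \<Rightarrow> nat list \<Rightarrow> nat list \<Rightarrow> nat list" where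
  "cmult n m c d = ((hd c + hd d) mod n) # m (tl c) (tl d)"

definition ccodes :: "nat \<Rightarrow> nat list list \<Rightarrow> nat list list" where
  "ccodes n cs = concat (map (\<lambda>x. map ((#) x) cs) [0..<n])"

definition cdec :: "(nat list \<Rightarrow> 'h) \<Rightarrow> nat list \<Rightarrow> int \<times> 'h" where
  "cdec \<delta> c = (int (hd c), \<delta> (tl c))"

definition res_mult :: "nat \<Rightarrow> nat list \<Rightarrow> nat list \<Rightarrow> nat list" where
  "res_mult n c d = [(hd c + hd d) mod n]"

definition res_codes :: "nat \<Rightarrow> nat list list" where
  "res_codes n = map (\<lambda>x. [x]) [0..<n]"

definition res_dec :: "nat list \<Rightarrow> int" where
  "res_dec c = int (hd c)"

text \<open>The rotation of the second factor is inverted when the first contains the reflection;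
  \<open>4 - d ! 0\<close> stands for the negative exponent modulo 4.\<close>

definition d8_mult :: "nat list \<Rightarrow> nat list \<Rightarrow> nat list" where
  "d8_mult c d = [(c ! 0 + (if c ! 1 = 0 then d ! 0 else 4 - d ! 0)) mod 4, (c ! 1 + d ! 1) mod 2]"

definition d8_codes :: "nat list list" where
  "d8_codes = ccodes 4 (res_codes 2)"

lemma perm_of_permutes:
  assumes "c \<in> set (perm_codes n)"
  shows "perm_of c permutes {1..n}"
proof -
  have c: "length c = n" "distinct c" "set c \<subseteq> {1..n}"
    using assms by (auto simp: perm_codes_def set_n_lists)
  have "inj_on (perm_of c) {1..n}"
  proof (rule inj_onI)
    fix x y assume "x \<in> {1..n}" "y \<in> {1..n}" "perm_of c x = perm_of c y"
    then have "x - 1 = y - 1" using nth_eq_iff_index_eq[OF c(2), of "x - 1" "y - 1"] c(1) by (auto simp: perm_of_def)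
    then show "x = y" using \<open>x \<in> {1..n}\<close> \<open>y \<in> {1..n}\<close> by auto
  qed
  moreover have "perm_of c x \<in> {1..n}" if x: "x \<in> {1..n}" for x
  proof -
    have "c ! (x - 1) \<in> set c" using x c(1) by (intro nth_mem) auto
    then show ?thesis using x c by (auto simp: perm_of_def)
  qed
  then have "perm_of c ` {1..n} \<subseteq> {1..n}" by blast
  ultimately have "bij_betw (perm_of c) {1..n} {1..n}"
    unfolding bij_betw_def by (intro conjI endo_inj_surj) auto
  then show ?thesis by (rule bij_imp_permutes) (use c(1) in \<open>auto simp: perm_of_def\<close>)
qed

lemma perm_of_inj:
  assumes "c \<in> set (perm_codes n)" "d \<in> set (perm_codes n)" "perm_of c = perm_of d"
  shows "c = d"
proof (rule nth_equalityI)
  show l: "length c = length d" using assms by (auto simp: perm_codes_def set_n_lists)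
  fix i assume "i < length c"
  then show "c ! i = d ! i" using fun_cong[OF assms(3), of "Suc i"] l by (simp add: perm_of_def)
qed

lemma perm_of_mult:
  assumes "c \<in> set (perm_codes n)" "d \<in> set (perm_codes n)"
  shows "perm_of (perm_mult c d) = perm_of c \<circ> perm_of d"
proof
  fix x
  have l: "length c = n" "length d = n" "set d \<subseteq> {1..n}" using assms by (auto simp: perm_codes_def set_n_lists)
  show "perm_of (perm_mult c d) x = (perm_of c \<circ> perm_of d) x"
  proof (cases "1 \<le> x \<and> x \<le> n")
    case True
    then have "d ! (x - 1) \<in> set d" using l(2) by (intro nth_mem) auto
    then have "1 \<le> d ! (x - 1)" "d ! (x - 1) \<le> n" using l(3) by auto
    moreover have "x - 1 < n" using True by linarith
    ultimately show ?thesis using True l by (simp add: perm_of_def perm_mult_def)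
  qed (use l in \<open>auto simp: perm_of_def perm_mult_def\<close>)
qed

text \<open>Closure is evaluated for the two degrees; the decoded permutations exhaust the symmetric
  group because there are \<open>fact n\<close> of them.\<close>

lemma model_sym:
  assumes n: "n = 3 \<or> n = 4"
  shows "group_model (sym_group n) (perm_codes n) perm_mult perm_of"
proof -
  have "list_all (\<lambda>c. list_all (\<lambda>d. List.member (perm_codes 3) (perm_mult c d)) (perm_codes 3)) (perm_codes 3)"
    "list_all (\<lambda>c. list_all (\<lambda>d. List.member (perm_codes 4) (perm_mult c d)) (perm_codes 4)) (perm_codes 4)"
    "distinct (perm_codes 3)" "distinct (perm_codes 4)"
    "length (perm_codes 3) = 6" "length (perm_codes 4) = 24" by code_simp+
  then have closed: "\<forall>c\<in>set (perm_codes n). \<forall>d\<in>set (perm_codes n). perm_mult c d \<in> set (perm_codes n)"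
    and dist: "distinct (perm_codes n)" and len: "length (perm_codes n) = fact n"
    using n by (auto simp: list_all_iff fact_numeral)
  have inj: "inj_on perm_of (set (perm_codes n))" using perm_of_inj by (auto intro: inj_onI)
  have "perm_of ` set (perm_codes n) = carrier (sym_group n)"
  proof (rule card_seteq)
    show "finite (carrier (sym_group n))" by (simp add: sym_group_def finite_permutations)
    show "perm_of ` set (perm_codes n) \<subseteq> carrier (sym_group n)"
      using perm_of_permutes by (auto simp: sym_group_def)
    show "card (carrier (sym_group n)) \<le> card (perm_of ` set (perm_codes n))"
      using sym_group_card_carrier[of n] card_image[OF inj] distinct_card[OF dist] len by simp
  qed
  with inj have "bij_betw perm_of (set (perm_codes n)) (carrier (sym_group n))" by (simp add: bij_betw_def)
  then show ?thesis
    unfolding group_model_def using sym_group_is_group dist closed perm_of_mult by (simp add: sym_group_def)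
qed

lemma carrier_C: "0 < n \<Longrightarrow> carrier (C n) = int ` set [0..<n]"
  by (auto simp: carrier_integer_mod_group image_iff zless_nat_eq_int_zless intro!: bexI[of _ "nat _"])

lemma mult_C: "int x \<otimes>\<^bsub>C n\<^esub> int y = int ((x + y) mod n)"
  by (simp add: zmod_int)

lemma ccodes: "set (ccodes n cs) = (\<lambda>(x, c). x # c) ` (set [0..<n] \<times> set cs)"
  "distinct cs \<Longrightarrow> distinct (ccodes n cs)" "length (ccodes n cs) = n * length cs"
proof -
  show "set (ccodes n cs) = (\<lambda>(x, c). x # c) ` (set [0..<n] \<times> set cs)" by (auto simp: ccodes_def)
  show "distinct (ccodes n cs)" if "distinct cs"
    unfolding ccodes_def by (rule distinct_concat_map) (use that in \<open>auto simp: distinct_map\<close>)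
  show "length (ccodes n cs) = n * length cs"
    unfolding ccodes_def by (simp add: length_concat comp_def sum_list_triv)
qed

lemma cdec_bij:
  assumes "bij_betw \<delta> (set cs) A"
  shows "bij_betw (cdec \<delta>) (set (ccodes n cs)) (int ` set [0..<n] \<times> A)"
  unfolding bij_betw_def
proof
  show "inj_on (cdec \<delta>) (set (ccodes n cs))"
    unfolding ccodes using assms by (auto simp: inj_on_def bij_betw_def cdec_def)
  have "cdec \<delta> ` set (ccodes n cs) = (int ` set [0..<n]) \<times> (\<delta> ` set cs)"
    unfolding ccodes by (auto simp: image_iff cdec_def)
  then show "cdec \<delta> ` set (ccodes n cs) = int ` set [0..<n] \<times> A" using assms by (simp add: bij_betw_def)
qed

lemma model_cons:
  assumes n: "0 < n" and H: "group_model H cs m \<delta>"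
  shows "group_model (C n \<times>\<times> H) (ccodes n cs) (cmult n m) (cdec \<delta>)"
proof -
  have bij: "bij_betw \<delta> (set cs) (carrier H)" and G: "group H" and d: "distinct cs"
    and m: "\<And>c d. c \<in> set cs \<Longrightarrow> d \<in> set cs \<Longrightarrow> m c d \<in> set cs \<and> \<delta> (m c d) = \<delta> c \<otimes>\<^bsub>H\<^esub> \<delta> d"
    using H by (auto simp: group_model_def)
  have "carrier (C n \<times>\<times> H) = int ` set [0..<n] \<times> carrier H"
    using n by (simp add: carrier_C DirProd_def)
  then have "bij_betw (cdec \<delta>) (set (ccodes n cs)) (carrier (C n \<times>\<times> H))"
    using cdec_bij[OF bij, of n] by simp
  moreover have "group (C n \<times>\<times> H)" by (rule DirProd_group) (simp_all add: G)
  moreover have "cmult n m c d \<in> set (ccodes n cs) \<and> cdec \<delta> (cmult n m c d) = cdec \<delta> c \<otimes>\<^bsub>C n \<times>\<times> H\<^esub> cdec \<delta> d"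
    if cd: "c \<in> set (ccodes n cs)" "d \<in> set (ccodes n cs)" for c d
  proof -
    obtain x c' where c: "c = x # c'" "x < n" "c' \<in> set cs" using cd(1) unfolding ccodes by auto
    obtain y d' where d: "d = y # d'" "y < n" "d' \<in> set cs" using cd(2) unfolding ccodes by auto
    have "cmult n m c d = ((x + y) mod n) # m c' d'" by (simp add: cmult_def c d)
    moreover have "cdec \<delta> c \<otimes>\<^bsub>C n \<times>\<times> H\<^esub> cdec \<delta> d = (int ((x + y) mod n), \<delta> c' \<otimes>\<^bsub>H\<^esub> \<delta> d')"
      unfolding c d cdec_def by (simp only: list.sel mult_DirProd mult_C)
    ultimately show ?thesis using m[OF c(3) d(3)] n unfolding ccodes by (auto simp: cdec_def)
  qed
  ultimately show ?thesis unfolding group_model_def using ccodes(2)[OF d] by blast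
qed

lemma model_C:
  assumes n: "0 < n"
  shows "group_model (C n) (res_codes n) (res_mult n) res_dec"
proof -
  have "bij_betw res_dec (set (res_codes n)) (carrier (C n))"
    using n by (auto simp: bij_betw_def inj_on_def carrier_C image_iff res_codes_def res_dec_def)
  moreover have "distinct (res_codes n)" by (simp add: distinct_map inj_on_def res_codes_def)
  moreover have "res_mult n c d \<in> set (res_codes n) \<and> res_dec (res_mult n c d) = res_dec c \<otimes>\<^bsub>C n\<^esub> res_dec d"
    for c d
    unfolding res_dec_def mult_C using n by (simp add: res_codes_def res_mult_def)
  ultimately show ?thesis unfolding group_model_def by simp
qed

lemma model_D8: "group_model D8 d8_codes d8_mult (cdec res_dec)"
proof -
  have car: "carrier D8 = int ` set [0..<4] \<times> int ` set [0..<2]"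
    by (simp add: dihedral_def semidirect_def carrier_C)
  have "bij_betw (cdec res_dec) (set d8_codes) (carrier D8)"
    unfolding car d8_codes_def using cdec_bij[of res_dec "res_codes 2" "int ` set [0..<2]" 4] model_C[of 2]
    by (simp add: group_model_def carrier_C)
  moreover have "distinct d8_codes" unfolding d8_codes_def by (rule ccodes(2)) (simp add: res_codes_def distinct_map inj_on_def)
  moreover have "d8_mult c d \<in> set d8_codes \<and> cdec res_dec (d8_mult c d) = cdec res_dec c \<otimes>\<^bsub>D8\<^esub> cdec res_dec d"
    if cd: "c \<in> set d8_codes" "d \<in> set d8_codes" for c d
  proof -
    have *: "\<exists>x y. c = [x, y] \<and> x < 4 \<and> y < 2" if "c \<in> set d8_codes" for c
      using that unfolding d8_codes_def ccodes by (auto simp: res_codes_def)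
    obtain x y where c: "c = [x, y]" "x < 4" "y < 2" using *[OF cd(1)] by blast
    obtain x' y' where d: "d = [x', y']" "x' < 4" "y' < 2" using *[OF cd(2)] by blast
    have mem: "[a, b] \<in> set d8_codes" if "a < 4" "b < 2" for a b
      using that unfolding d8_codes_def ccodes by (force simp: res_codes_def)
    have inC: "int x' \<in> carrier (C 4)" using d by (simp add: carrier_C)
    \<comment> \<open>Natural subtraction is exact because \<open>x' < 4\<close>, and the added 4
      vanishes modulo 4.\<close>
    have neg: "int x \<otimes>\<^bsub>C 4\<^esub> inv\<^bsub>C 4\<^esub> (int x') = int ((x + (4 - x')) mod 4)"
    proof -
      have "int ((x + (4 - x')) mod 4) = (int x - int x' + 4) mod 4"
        using d by (simp add: zmod_int of_nat_diff algebra_simps)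
      also have "\<dots> = (int x - int x') mod 4" by (rule mod_add_self2)
      also have "\<dots> = (int x + (- int x') mod 4) mod 4" by (simp add: mod_add_right_eq)
      finally show ?thesis using inC by simp
    qed
    have "cdec res_dec c \<otimes>\<^bsub>D8\<^esub> cdec res_dec d =
        (int ((x + (if y = 0 then x' else 4 - x')) mod 4), int ((y + y') mod 2))"
      unfolding c d cdec_def res_dec_def list.sel dihedral_def semidirect_def
      using neg inC mult_C[of 4 x x'] mult_C[of 2 y y'] by (cases "y = 0") (simp_all del: mult_integer_mod_group inv_integer_mod_group)
    moreover have "d8_mult c d = [(x + (if y = 0 then x' else 4 - x')) mod 4, (y + y') mod 2]"
      by (simp add: d8_mult_def c d)
    ultimately show ?thesis using mem by (simp add: cdec_def res_dec_def)
  qed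
  ultimately show ?thesis unfolding group_model_def using group_dihedral by blast
qed

text \<open>An exponent vector read as a word: the generator numbered \<open>i\<close> is repeated
  as often as the first entry says, the next one as often as the second, and so on.\<close>

fun exp_word :: "nat \<Rightarrow> nat list \<Rightarrow> nat list" where
  "exp_word i [] = []"
| "exp_word i (n # ns) = replicate n i @ exp_word (Suc i) ns"

text \<open>Words in the adjacent transpositions for all elements of S3 and S4; generator 0
  exchanges 1 and 2.\<close>

definition sym_word :: "nat list \<Rightarrow> nat list" where
  "sym_word c = the (map_of
   ([([1,2,3], []), ([1,3,2], [1]), ([2,1,3], [0]), ([2,3,1], [0,1]), ([3,1,2], [1,0]),
    ([3,2,1], [0,1,0])] @
    [([1,2,3,4], []), ([1,2,4,3], [2]), ([1,3,2,4], [1]), ([1,3,4,2], [1,2]), ([1,4,2,3], [2,1]),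
    ([1,4,3,2], [1,2,1]), ([2,1,3,4], [0]), ([2,1,4,3], [2,0]), ([2,3,1,4], [0,1]),
    ([2,3,4,1], [0,1,2]), ([2,4,1,3], [2,0,1]), ([2,4,3,1], [0,1,2,1]), ([3,1,2,4], [1,0]),
    ([3,1,4,2], [1,2,0]), ([3,2,1,4], [0,1,0]), ([3,2,4,1], [0,1,2,0]), ([3,4,1,2], [1,2,0,1]),
    ([3,4,2,1], [0,1,2,0,1]), ([4,1,2,3], [2,1,0]), ([4,1,3,2], [1,2,1,0]),
    ([4,2,1,3], [2,0,1,0]), ([4,2,3,1], [0,1,2,1,0]), ([4,3,1,2], [1,2,0,1,0]),
    ([4,3,2,1], [0,1,2,0,1,0])]) c)"

text \<open>The factor of order 2 supplies generator 0, which shifts the numbers of the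
  transpositions by one.\<close>

definition c2_sym_word :: "nat list \<Rightarrow> nat list" where
  "c2_sym_word c = replicate (hd c) 0 @ map Suc (sym_word (tl c))"

text \<open>Two applications of \<open>semidirect_embedding\<close>, first to \<open>A\<close> and
  \<open>B\<close>, then to their semidirect product and \<open>D\<close>. \<open>AB\<close>,
  \<open>AD\<close> and \<open>BD\<close> express that \<open>B\<close> normalizes \<open>A\<close>
  and that \<open>D\<close> normalizes both; the search bound makes the final embedding
  onto.\<close>

lemma aut_semidirect:
  assumes T: "square k T" and k: "k \<in> {2, 3}"
    and A: "group_model A cA mA \<delta>A" "action_table k T cA mA FA" "eA \<in> set cA" "\<delta>A eA = \<one>\<^bsub>A\<^esub>"
    and B: "group_model B cB mB \<delta>B" "action_table k T cB mB FB" "eB \<in> set cB" "\<delta>B eB = \<one>\<^bsub>B\<^esub>"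
    and D: "group_model D cD mD \<delta>D" "action_table k T cD mD FD"
    and AB: "\<And>a b. a \<in> set cA \<Longrightarrow> b \<in> set cB \<Longrightarrow> \<exists>a'\<in>set cA. pcomp (FB b) (FA a) = pcomp (FA a') (FB b)"
    and AD: "\<And>a d. a \<in> set cA \<Longrightarrow> d \<in> set cD \<Longrightarrow> \<exists>a'\<in>set cA. pcomp (FD d) (FA a) = pcomp (FA a') (FD d)"
    and BD: "\<And>b d. b \<in> set cB \<Longrightarrow> d \<in> set cD \<Longrightarrow> \<exists>b'\<in>set cB. pcomp (FD d) (FB b) = pcomp (FB b') (FD d)"
    and tAB: "\<And>a b. a \<in> set cA \<Longrightarrow> b \<in> set cB \<Longrightarrow> FA a = FB b \<Longrightarrow> a = eA"
    and tABD: "\<And>a b d. a \<in> set cA \<Longrightarrow> b \<in> set cB \<Longrightarrow> d \<in> set cD \<Longrightarrow> pcomp (FA a) (FB b) = FD d \<Longrightarrow> a = eA \<and> b = eB"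
    and v: "valid k T pl us 0" and us: "distinct us" "set us = {..<18}"
    and len: "length (search k T pl []) \<le> length cA * length cB * length cD"
  shows "(\<exists>\<phi>\<in>hom B (AutoGroup A). is_semidirect_product (multinet_aut (net k (entry T))) (semidirect A B \<phi>) D) \<and>
    order (multinet_aut (net k (entry T))) = length cA * length cB * length cD"
proof -
  let ?G = "multinet_aut (net k (entry T))"
  interpret G: group ?G by (rule group_aut_net[OF square_holed[OF T]])
  obtain \<alpha> where \<alpha>: "\<alpha> \<in> hom A ?G" "inj_on \<alpha> (carrier A)" "\<And>c. c \<in> set cA \<Longrightarrow> \<alpha> (\<delta>A c) = perm_fun (FA c)"
    using action_hom[OF T A(1,2)] by blast
  obtain \<beta> where \<beta>: "\<beta> \<in> hom B ?G" "inj_on \<beta> (carrier B)" "\<And>c. c \<in> set cB \<Longrightarrow> \<beta> (\<delta>B c) = perm_fun (FB c)"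
    using action_hom[OF T B(1,2)] by blast
  obtain \<gamma> where \<gamma>: "\<gamma> \<in> hom D ?G" "inj_on \<gamma> (carrier D)" "\<And>c. c \<in> set cD \<Longrightarrow> \<gamma> (\<delta>D c) = perm_fun (FD c)"
    using action_hom[OF T D(1,2)] by blast
  have gA: "group A" and gB: "group B" and gD: "group D" using A(1) B(1) D(1) by (simp_all add: group_model_def)
  have repA: "\<exists>c\<in>set cA. h = \<delta>A c" if "h \<in> carrier A" for h using A(1) that by (auto simp: group_model_def bij_betw_def)
  have repB: "\<exists>c\<in>set cB. h = \<delta>B c" if "h \<in> carrier B" for h using B(1) that by (auto simp: group_model_def bij_betw_def)
  have repD: "\<exists>c\<in>set cD. h = \<delta>D c" if "h \<in> carrier D" for h using D(1) that by (auto simp: group_model_def bij_betw_def)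
  have inA: "\<delta>A c \<in> carrier A" if "c \<in> set cA" for c using A(1) that by (auto simp: group_model_def bij_betw_def)
  have inB: "\<delta>B c \<in> carrier B" if "c \<in> set cB" for c using B(1) that by (auto simp: group_model_def bij_betw_def)
  have alA: "aut_list k T (FA a)" if "a \<in> set cA" for a using A(2) that by (auto simp: action_table_def)
  have alB: "aut_list k T (FB a)" if "a \<in> set cB" for a using B(2) that by (auto simp: action_table_def)
  have alD: "aut_list k T (FD a)" if "a \<in> set cD" for a using D(2) that by (auto simp: action_table_def)
  have closA: "\<alpha> a \<in> carrier ?G" if "a \<in> carrier A" for a using \<alpha>(1) that by (auto simp: hom_def)
  have closB: "\<beta> a \<in> carrier ?G" if "a \<in> carrier B" for a using \<beta>(1) that by (auto simp: hom_def)
  have closD: "\<gamma> a \<in> carrier ?G" if "a \<in> carrier D" for a using \<gamma>(1) that by (auto simp: hom_def)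
  have cAB: "\<exists>a'\<in>carrier A. \<beta> b \<otimes>\<^bsub>?G\<^esub> \<alpha> a = \<alpha> a' \<otimes>\<^bsub>?G\<^esub> \<beta> b" if pr: "a \<in> carrier A" "b \<in> carrier B" for a b
  proof -
    obtain x where x: "x \<in> set cA" "a = \<delta>A x" using repA[OF pr(1)] by blast
    obtain y where y: "y \<in> set cB" "b = \<delta>B y" using repB[OF pr(2)] by blast
    obtain x' where x': "x' \<in> set cA" "pcomp (FB y) (FA x) = pcomp (FA x') (FB y)" using AB[OF x(1) y(1)] by blast
    have "\<beta> b \<otimes>\<^bsub>?G\<^esub> \<alpha> a = \<alpha> (\<delta>A x') \<otimes>\<^bsub>?G\<^esub> \<beta> b"
      unfolding x(2) y(2) \<alpha>(3)[OF x(1)] \<beta>(3)[OF y(1)] \<alpha>(3)[OF x'(1)]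
        perm_fun_pcomp[OF alB[OF y(1)] alA[OF x(1)]] perm_fun_pcomp[OF alA[OF x'(1)] alB[OF y(1)]] x'(2) ..
    then show ?thesis using inA[OF x'(1)] by blast
  qed
  have cAD: "\<exists>a'\<in>carrier A. \<gamma> d \<otimes>\<^bsub>?G\<^esub> \<alpha> a = \<alpha> a' \<otimes>\<^bsub>?G\<^esub> \<gamma> d" if pr: "a \<in> carrier A" "d \<in> carrier D" for a d
  proof -
    obtain x where x: "x \<in> set cA" "a = \<delta>A x" using repA[OF pr(1)] by blast
    obtain y where y: "y \<in> set cD" "d = \<delta>D y" using repD[OF pr(2)] by blast
    obtain x' where x': "x' \<in> set cA" "pcomp (FD y) (FA x) = pcomp (FA x') (FD y)" using AD[OF x(1) y(1)] by blast
    have "\<gamma> d \<otimes>\<^bsub>?G\<^esub> \<alpha> a = \<alpha> (\<delta>A x') \<otimes>\<^bsub>?G\<^esub> \<gamma> d"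
      unfolding x(2) y(2) \<alpha>(3)[OF x(1)] \<gamma>(3)[OF y(1)] \<alpha>(3)[OF x'(1)]
        perm_fun_pcomp[OF alD[OF y(1)] alA[OF x(1)]] perm_fun_pcomp[OF alA[OF x'(1)] alD[OF y(1)]] x'(2) ..
    then show ?thesis using inA[OF x'(1)] by blast
  qed
  have cBD: "\<exists>b'\<in>carrier B. \<gamma> d \<otimes>\<^bsub>?G\<^esub> \<beta> b = \<beta> b' \<otimes>\<^bsub>?G\<^esub> \<gamma> d" if pr: "b \<in> carrier B" "d \<in> carrier D" for b d
  proof -
    obtain x where x: "x \<in> set cB" "b = \<delta>B x" using repB[OF pr(1)] by blast
    obtain y where y: "y \<in> set cD" "d = \<delta>D y" using repD[OF pr(2)] by blast
    obtain x' where x': "x' \<in> set cB" "pcomp (FD y) (FB x) = pcomp (FB x') (FD y)" using BD[OF x(1) y(1)] by blast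
    have "\<gamma> d \<otimes>\<^bsub>?G\<^esub> \<beta> b = \<beta> (\<delta>B x') \<otimes>\<^bsub>?G\<^esub> \<gamma> d"
      unfolding x(2) y(2) \<beta>(3)[OF x(1)] \<gamma>(3)[OF y(1)] \<beta>(3)[OF x'(1)]
        perm_fun_pcomp[OF alD[OF y(1)] alB[OF x(1)]] perm_fun_pcomp[OF alB[OF x'(1)] alD[OF y(1)]] x'(2) ..
    then show ?thesis using inB[OF x'(1)] by blast
  qed
  have triv: "a = \<one>\<^bsub>A\<^esub>" if pr: "a \<in> carrier A" "b \<in> carrier B" "\<alpha> a = \<beta> b" for a b
  proof -
    obtain x where x: "x \<in> set cA" "a = \<delta>A x" using repA[OF pr(1)] by blast
    obtain y where y: "y \<in> set cB" "b = \<delta>B y" using repB[OF pr(2)] by blast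
    have "FA x = FB y" by (rule perm_fun_inj[OF alA[OF x(1)] alB[OF y(1)]]) (use pr(3) x y \<alpha>(3) \<beta>(3) in simp)
    then show ?thesis using tAB[OF x(1) y(1)] A(4) x(2) by simp
  qed
  obtain \<phi> where \<phi>: "\<phi> \<in> hom B (AutoGroup A)"
    and \<psi>: "(\<lambda>(a, b). \<alpha> a \<otimes>\<^bsub>?G\<^esub> \<beta> b) \<in> hom (semidirect A B \<phi>) ?G"
      "inj_on (\<lambda>(a, b). \<alpha> a \<otimes>\<^bsub>?G\<^esub> \<beta> b) (carrier A \<times> carrier B)"
    by (rule semidirect_embedding[OF G.is_group gA gB \<alpha>(1,2) \<beta>(1,2)]) (use cAB triv in blast)+
  \<comment> \<open>The embedded product of \<open>A\<close> and \<open>B\<close> takes the role of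
    the normal factor in the second application.\<close>
  define \<psi>' where "\<psi>' = (\<lambda>(a, b). \<alpha> a \<otimes>\<^bsub>?G\<^esub> \<beta> b)"
  let ?S = "semidirect A B \<phi>"
  have S: "carrier ?S = carrier A \<times> carrier B" "\<one>\<^bsub>?S\<^esub> = (\<one>\<^bsub>A\<^esub>, \<one>\<^bsub>B\<^esub>)" by (simp_all add: semidirect_def)
  have gS: "group ?S" by (rule group_semidirect[OF gA gB \<phi>])
  have \<psi>'h: "\<psi>' \<in> hom ?S ?G" "inj_on \<psi>' (carrier ?S)" using \<psi> unfolding \<psi>'_def S .
  \<comment> \<open>\<open>\<gamma> d\<close> is moved first past \<open>\<alpha> a\<close> and then
    past \<open>\<beta> b\<close>.\<close>
  have conj2: "\<exists>x'\<in>carrier ?S. \<gamma> d \<otimes>\<^bsub>?G\<^esub> \<psi>' x = \<psi>' x' \<otimes>\<^bsub>?G\<^esub> \<gamma> d" if x: "x \<in> carrier ?S" and d: "d \<in> carrier D" for x d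
  proof -
    obtain a b where ab: "x = (a, b)" "a \<in> carrier A" "b \<in> carrier B" using x unfolding S by blast
    obtain a' where a': "a' \<in> carrier A" "\<gamma> d \<otimes>\<^bsub>?G\<^esub> \<alpha> a = \<alpha> a' \<otimes>\<^bsub>?G\<^esub> \<gamma> d" using cAD[OF ab(2) d] by blast
    obtain b' where b': "b' \<in> carrier B" "\<gamma> d \<otimes>\<^bsub>?G\<^esub> \<beta> b = \<beta> b' \<otimes>\<^bsub>?G\<^esub> \<gamma> d" using cBD[OF ab(3) d] by blast
    note c = closA[OF ab(2)] closA[OF a'(1)] closB[OF ab(3)] closB[OF b'(1)] closD[OF d]
    have "\<gamma> d \<otimes>\<^bsub>?G\<^esub> (\<alpha> a \<otimes>\<^bsub>?G\<^esub> \<beta> b) = (\<gamma> d \<otimes>\<^bsub>?G\<^esub> \<alpha> a) \<otimes>\<^bsub>?G\<^esub> \<beta> b"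
      using c by (simp only: G.m_assoc)
    also have "\<dots> = \<alpha> a' \<otimes>\<^bsub>?G\<^esub> (\<gamma> d \<otimes>\<^bsub>?G\<^esub> \<beta> b)" unfolding a'(2) using c by (simp only: G.m_assoc)
    also have "\<dots> = (\<alpha> a' \<otimes>\<^bsub>?G\<^esub> \<beta> b') \<otimes>\<^bsub>?G\<^esub> \<gamma> d" unfolding b'(2) using c by (simp only: G.m_assoc)
    finally have "\<gamma> d \<otimes>\<^bsub>?G\<^esub> \<psi>' x = \<psi>' (a', b') \<otimes>\<^bsub>?G\<^esub> \<gamma> d" by (simp add: \<psi>'_def ab(1))
    then show ?thesis using a'(1) b'(1) unfolding S by blast
  qed
  have triv2: "x = \<one>\<^bsub>?S\<^esub>" if x: "x \<in> carrier ?S" and d: "d \<in> carrier D" and e: "\<psi>' x = \<gamma> d" for x d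
  proof -
    obtain a b where ab: "x = (a, b)" "a \<in> carrier A" "b \<in> carrier B" using x unfolding S by blast
    obtain p where p: "p \<in> set cA" "a = \<delta>A p" using repA[OF ab(2)] by blast
    obtain q where q: "q \<in> set cB" "b = \<delta>B q" using repB[OF ab(3)] by blast
    obtain r where r: "r \<in> set cD" "d = \<delta>D r" using repD[OF d] by blast
    have "perm_fun (pcomp (FA p) (FB q)) = perm_fun (FD r)"
      using e perm_fun_pcomp[OF alA[OF p(1)] alB[OF q(1)]] \<alpha>(3)[OF p(1)] \<beta>(3)[OF q(1)] \<gamma>(3)[OF r(1)]
      by (simp add: \<psi>'_def ab(1) p(2) q(2) r(2))
    then have "pcomp (FA p) (FB q) = FD r"
      by (rule perm_fun_inj[OF aut_list_pcomp[OF T alA[OF p(1)] alB[OF q(1)]] alD[OF r(1)]])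
    then have "p = eA \<and> q = eB" by (rule tABD[OF p(1) q(1) r(1)])
    then show ?thesis unfolding S ab(1) using p(2) q(2) A(4) B(4) by simp
  qed
  obtain \<theta> where \<theta>: "\<theta> \<in> hom D (AutoGroup ?S)"
    and \<chi>: "(\<lambda>(x, d). \<psi>' x \<otimes>\<^bsub>?G\<^esub> \<gamma> d) \<in> hom (semidirect ?S D \<theta>) ?G"
      "inj_on (\<lambda>(x, d). \<psi>' x \<otimes>\<^bsub>?G\<^esub> \<gamma> d) (carrier ?S \<times> carrier D)"
    by (rule semidirect_embedding[OF G.is_group gS gD \<psi>'h \<gamma>(1,2)]) (use conj2 triv2 in blast)+
  define \<chi>' where "\<chi>' = (\<lambda>(x, d). \<psi>' x \<otimes>\<^bsub>?G\<^esub> \<gamma> d)"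
  let ?U = "semidirect ?S D \<theta>"
  have U: "carrier ?U = (carrier A \<times> carrier B) \<times> carrier D" by (simp add: semidirect_def)
  have \<chi>'h: "\<chi>' \<in> hom ?U ?G" "inj_on \<chi>' (carrier ?U)" using \<chi> unfolding \<chi>'_def U S .
  have "card (carrier A) = length cA" "card (carrier B) = length cB" "card (carrier D) = length cD"
    using A(1) B(1) D(1) unfolding group_model_def by (metis bij_betw_same_card distinct_card)+
  then have cU: "card (carrier ?U) = length cA * length cB * length cD"
    unfolding U by (simp add: card_cartesian_product)
  have fin: "finite (carrier ?G)" and le: "card (carrier ?G) \<le> card (\<chi>' ` carrier ?U)"
    using card_aut_le[OF T k v us] len \<chi>'h(2) cU by (simp_all add: card_image)
  have "\<chi>' ` carrier ?U \<subseteq> carrier ?G" using \<chi>'h(1) by (auto simp: hom_def)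
  then have img: "\<chi>' ` carrier ?U = carrier ?G" by (rule card_seteq[OF fin _ le])
  then have "\<chi>' \<in> iso ?U ?G" using \<chi>'h by (simp add: iso_def bij_betw_def)
  then have "?U \<cong> ?G" by (auto simp: is_iso_def)
  then have "?G \<cong> ?U" by (rule group.iso_sym[OF group_semidirect[OF gS gD \<theta>]])
  then have "is_semidirect_product ?G ?S D" unfolding is_semidirect_product_def using \<theta> by blast
  moreover have "order ?G = length cA * length cB * length cD"
    unfolding order_def img[symmetric] using \<chi>'h(2) cU by (simp add: card_image)
  ultimately show ?thesis using \<phi> by blast
qed

text \<open>Image lists in the order of the model generators. For 0 and 1: three translations, an
  element of order 3 permuting them, two involutions. For 2 to 5: the central factor and three
  adjacent transpositions. For 6 to 9: the central factor, a rotation and a reflection. For 12: two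
  transpositions of S3; otherwise commuting involutions.\<close>

definition generators :: "nat \<Rightarrow> nat list list" where
  "generators i =
   [[[0,1,2,5,3,4,7,8,6,9,10,11,14,12,13,15,16,17],
     [1,2,0,3,4,5,6,7,8,11,9,10,14,12,13,15,16,17],
     [1,2,0,3,4,5,7,8,6,9,10,11,12,13,14,16,17,15],
     [6,7,8,9,10,11,12,14,13,15,17,16,0,2,1,3,5,4],
     [0,2,1,3,5,4,6,8,7,9,11,10,12,14,13,15,17,16],
     [0,1,2,3,4,5,12,14,13,15,17,16,6,8,7,9,11,10]],
    [[0,1,2,5,3,4,7,8,6,9,10,11,13,14,12,15,16,17],
     [1,2,0,3,4,5,6,7,8,11,9,10,14,12,13,15,16,17],
     [2,0,1,3,4,5,8,6,7,9,10,11,12,13,14,17,15,16],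
     [6,8,7,9,10,11,12,14,13,15,16,17,0,1,2,3,4,5],
     [0,2,1,3,5,4,6,8,7,9,11,10,12,14,13,15,17,16],
     [0,2,1,3,4,5,12,13,14,15,16,17,6,7,8,9,10,11]],
    [[0,1,4,5,2,3,6,7,10,11,8,9,12,13,16,17,14,15],
     [0,1,4,5,2,3,13,12,15,14,17,16,7,6,9,8,11,10],
     [13,12,15,14,17,16,6,7,10,11,8,9,1,0,3,2,5,4],
     [0,1,4,5,2,3,12,13,14,15,16,17,6,7,8,9,10,11]],
    [[0,1,5,4,3,2,6,7,11,10,9,8,12,13,17,16,15,14],
     [0,1,5,3,4,2,13,12,15,14,17,16,7,6,9,8,11,10],
     [13,12,16,17,14,15,6,7,11,9,10,8,1,0,4,5,2,3],
     [0,1,2,4,3,5,12,13,14,15,16,17,6,7,8,9,10,11]],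
    [[1,0,5,4,3,2,7,6,11,10,9,8,13,12,16,17,14,15],
     [0,1,5,4,3,2,13,12,15,14,16,17,7,6,9,8,10,11],
     [12,13,15,14,16,17,6,7,11,10,9,8,0,1,3,2,4,5],
     [0,1,5,4,3,2,12,13,14,15,17,16,6,7,8,9,11,10]],
    [[1,0,3,2,5,4,7,6,10,11,8,9,13,12,17,16,15,14],
     [0,1,3,2,4,5,12,13,15,14,16,17,6,7,9,8,10,11],
     [12,13,14,17,16,15,6,7,8,11,10,9,0,1,2,5,4,3],
     [0,1,2,3,5,4,12,13,14,15,17,16,6,7,8,9,11,10]],
    [[0,1,5,4,3,2,6,7,11,10,9,8,13,12,17,16,15,14],
     [6,7,11,9,10,8,1,0,4,2,5,3,12,13,16,14,17,15],
     [0,1,5,4,3,2,7,6,9,8,11,10,12,13,15,14,17,16]],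
    [[0,1,2,3,4,5,12,13,14,15,16,17,6,7,8,9,10,11],
     [0,1,4,5,3,2,6,7,10,11,9,8,12,13,16,17,15,14],
     [0,1,5,4,3,2,7,6,8,9,11,10,13,12,14,15,17,16]],
    [[0,1,2,3,4,5,7,6,10,11,8,9,13,12,16,17,14,15],
     [1,0,5,4,2,3,12,13,17,16,15,14,6,7,10,11,8,9],
     [0,1,2,3,5,4,12,13,14,15,16,17,6,7,8,9,10,11]],
    [[0,1,2,3,4,5,12,13,14,15,17,16,6,7,8,9,11,10],
     [1,0,4,5,3,2,6,7,11,10,8,9,12,13,16,17,15,14],
     [0,1,5,4,3,2,7,6,8,9,11,10,13,12,14,15,17,16]],
    [[0,1,4,3,2,5,12,13,14,15,16,17,6,7,8,9,10,11],
     [0,1,2,5,4,3,7,6,9,8,11,10,13,12,15,14,17,16],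
     [0,1,4,5,2,3,6,7,10,11,8,9,12,13,16,17,14,15]],
    [[1,0,4,5,2,3,6,7,11,10,9,8,12,13,16,17,14,15],
     [0,1,4,5,2,3,12,13,15,14,16,17,6,7,9,8,10,11],
     [0,1,2,5,4,3,7,6,9,8,11,10,13,12,15,14,17,16]],
    [[6,7,8,9,11,10,0,1,2,3,5,4,12,13,14,15,17,16],
     [0,1,4,3,2,5,12,13,16,15,14,17,6,7,10,9,8,11]],
    [[12,13,17,16,15,14,6,7,11,9,10,8,0,1,5,4,3,2],
     [1,0,3,2,5,4,6,7,8,9,10,11,13,12,15,14,17,16]],
    [[0,1,2,5,4,3,12,13,14,15,16,17,6,7,8,9,10,11],
     [0,1,4,5,2,3,7,6,9,8,10,11,13,12,15,14,16,17]],
    [[6,7,8,9,10,11,0,1,2,3,4,5,12,13,14,15,16,17],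
     [1,0,3,2,5,4,7,6,9,8,11,10,12,13,16,15,14,17]]] ! i"

text \<open>Each entry is an ordering of the points with a plan that it obeys. Few positions are
  free, the others are forced by lines, and checks prune wrong branches, so that the solutions can
  be counted by evaluation.\<close>

definition aut_search :: "nat \<Rightarrow> nat list \<times> step list" where
  "aut_search i =
   [([3,9,12,4,13,10,11,14,5,0,15,6,8,17,2,16,7,1],
     [Free False [], Free False [], Forced 0 1, Free False [0], Forced 1 3, Forced 0 4,
      Forced 2 3, Forced 0 6, Forced 1 7, Free True [0,2,3,4,7,8], Forced 1 9, Forced 0 10,
      Forced 3 10, Forced 0 12, Forced 1 13, Forced 3 11, Forced 0 15, Forced 1 15]),
    ([3,9,12,4,14,11,10,13,5,0,15,6,8,17,2,16,7,1],
     [Free False [], Free False [], Forced 0 1, Free False [0], Forced 1 3, Forced 0 4,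
      Forced 2 3, Forced 0 6, Forced 1 7, Free True [0,2,3,4,7,8], Forced 1 9, Forced 0 10,
      Forced 3 10, Forced 0 12, Forced 1 13, Forced 3 11, Forced 0 15, Forced 1 15]),
    ([0,2,8,14,16,10,6,12,4,3,17,11,9,15,13,7,1,5],
     [Free True [], Free False [0], Free False [], Forced 0 2, Forced 1 2, Forced 0 4,
      Forced 1 3, Forced 1 5, Forced 2 7, Check 3 8 5, Free False [0,1,8], Forced 2 9,
      Forced 0 10, Forced 1 10, Forced 0 12, Forced 1 11, Forced 1 13, Forced 2 13, Forced 2 14]),
    ([2,8,12,3,13,10,0,14,6,11,15,1,5,16,7,9,17,4],
     [Free False [], Free False [], Forced 0 1, Free False [0], Forced 1 3, Forced 0 4,
      Free True [0,2,3,4], Forced 1 6, Forced 0 7, Forced 3 7, Forced 0 9, Forced 1 10,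
      Forced 2 9, Forced 1 12, Forced 0 13, Forced 3 13, Forced 0 15, Forced 1 16]),
    ([0,6,2,14,8,16,10,4,12,13,11,17,5,9,15,3,7,1],
     [Free True [], Free True [0], Free False [0], Forced 1 2, Forced 0 3, Forced 2 4,
      Forced 0 5, Forced 1 5, Check 3 7 6, Forced 2 6, Forced 4 7, Forced 2 9, Forced 0 10,
      Forced 1 11, Forced 2 11, Forced 0 13, Forced 1 14, Forced 2 14, Forced 3 13]),
    ([2,8,12,3,16,7,9,17,4,10,15,1,13,11,5,6,14,0],
     [Free False [], Free False [], Forced 0 1, Free False [0], Forced 1 3, Forced 0 4,
      Forced 2 3, Forced 0 6, Check 3 7 5, Forced 1 7, Forced 2 8, Forced 0 9, Forced 1 10,
      Check 7 11 9, Forced 3 9, Forced 0 12, Forced 1 12, Forced 3 10, Forced 0 15, Forced 1 16]),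
    ([2,8,12,3,13,10,0,14,6,11,15,1,4,17,9,5,16,7],
     [Free False [], Free False [], Forced 0 1, Free False [0], Forced 1 3, Forced 0 4,
      Free True [0,2,3,4], Forced 1 6, Forced 0 7, Forced 3 7, Forced 0 9, Forced 1 10,
      Forced 2 9, Check 5 12 10, Forced 1 12, Forced 0 13, Forced 2 14, Forced 1 15, Forced 0 16]),
    ([2,8,12,3,16,7,9,17,4,10,13,5,11,15,1,14,6,0],
     [Free False [], Free False [], Forced 0 1, Free False [0], Forced 1 3, Forced 0 4,
      Forced 2 3, Forced 0 6, Check 3 7 5, Forced 1 7, Forced 2 8, Forced 0 9, Check 6 10 8,
      Forced 1 10, Check 4 11 6, Forced 2 11, Forced 0 12, Forced 1 13, Check 4 14 12,
      Forced 3 9, Forced 0 15, Forced 1 15]),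
    ([2,8,12,3,16,7,9,17,4,11,15,1,13,10,5,6,14,0],
     [Free False [], Free False [], Forced 0 1, Free False [0], Forced 1 3, Forced 0 4,
      Forced 2 3, Forced 0 6, Check 3 7 5, Forced 1 7, Forced 2 8, Forced 0 9, Forced 1 10,
      Check 4 11 9, Forced 3 9, Forced 0 12, Forced 1 12, Forced 3 10, Forced 0 15, Forced 1 16]),
    ([0,6,12,14,8,2,15,9,3,1,11,17,5,4,16,10,7,13],
     [Free True [], Free True [0], Free True [0,1], Free False [2], Forced 0 3, Forced 1 3,
      Check 2 5 4, Free False [2,3], Forced 0 6, Forced 1 6, Check 2 8 7, Forced 3 7,
      Check 4 9 6, Forced 3 8, Forced 0 10, Forced 1 11, Forced 2 10, Forced 1 13, Forced 0 14,
      Forced 3 12, Forced 4 12]),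
    ([0,2,8,14,16,10,6,12,4,3,17,11,9,15,13,7,1,5],
     [Free True [], Free False [0], Free False [], Forced 0 2, Forced 1 2, Forced 0 4,
      Forced 1 3, Forced 1 5, Forced 2 7, Check 3 8 5, Free False [0,1,8], Forced 2 9,
      Forced 0 10, Check 3 11 9, Forced 1 10, Forced 0 12, Forced 1 11, Forced 1 13, Forced 2 13,
      Forced 2 14]),
    ([0,6,2,14,8,16,10,4,12,3,15,9,7,17,11,5,13,1],
     [Free True [], Free True [0], Free False [0], Forced 1 2, Forced 0 3, Forced 2 4,
      Forced 0 5, Forced 1 5, Forced 2 6, Forced 3 6, Forced 1 9, Check 6 10 7, Forced 0 10,
      Forced 2 10, Forced 2 11, Forced 0 13, Forced 1 13, Forced 2 14, Forced 3 11]),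
    ([0,8,14,9,15,1,5,13,11,17,4,7,16,10,3,2,12,6],
     [Free True [], Free False [], Forced 0 1, Free False [1], Forced 0 3, Forced 1 4,
      Forced 2 3, Forced 1 6, Forced 2 5, Forced 0 8, Forced 1 9, Check 3 10 7, Check 4 10 8,
      Forced 2 10, Forced 3 5, Forced 0 12, Forced 1 12, Forced 3 9, Forced 1 15, Forced 2 15]),
    ([2,8,12,3,13,10,0,14,6,11,15,1,5,16,7,9,17,4],
     [Free False [], Free False [], Forced 0 1, Free False [0], Forced 1 3, Forced 0 4,
      Check 2 5 3, Free True [0,2,3,4], Forced 1 6, Forced 0 7, Forced 3 7, Forced 0 9,
      Forced 1 10, Forced 2 9, Check 5 12 10, Forced 1 12, Check 5 13 6, Forced 0 13,
      Forced 3 13, Forced 0 15, Forced 1 16]),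
    ([2,8,12,3,13,10,11,15,1,4,17,9,5,16,7,14,6,0],
     [Free False [], Free False [], Forced 0 1, Free False [0], Forced 1 3, Forced 0 4,
      Forced 2 3, Forced 0 6, Forced 1 7, Forced 2 5, Forced 1 9, Check 5 10 8, Forced 0 10,
      Check 4 11 9, Forced 2 11, Forced 1 12, Forced 0 13, Forced 3 5, Forced 0 15, Forced 1 15]),
    ([0,8,14,9,15,1,4,13,11,17,3,10,16,5,7,2,12,6],
     [Free True [], Free False [], Forced 0 1, Free False [1], Forced 0 3, Forced 1 4,
      Forced 2 3, Forced 1 6, Forced 2 5, Forced 0 8, Forced 1 9, Check 7 10 8, Forced 2 10,
      Check 4 11 6, Forced 0 11, Forced 1 12, Forced 2 13, Forced 3 9, Forced 1 15, Forced 2 15])] ! i"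

text \<open>The bound \<open>n\<close> will be the order of the intended group: 324 = 27 * 3 * 4, 48
  = 2 * 24, 16 = 2 * 8, then 8, 6 and 4.\<close>

definition search_ok :: "nat \<Rightarrow> nat \<Rightarrow> bool" where
  "search_ok i n = (case aut_search i of (us, pl) \<Rightarrow> valid (hole_size i) (rep i) pl us 0 \<and>
     distinct us \<and> length us = 18 \<and> list_all (\<lambda>u. u < 18) us \<and>
     length (search (hole_size i) (rep i) pl []) \<le> n)"

lemma search_ok_0: "search_ok 0 324" by code_simp

lemma search_ok_1: "search_ok 1 324" by code_simp

lemma search_ok_2: "search_ok 2 48" "search_ok 3 48" by code_simp+

lemma search_ok_4: "search_ok 4 48" "search_ok 5 48" by code_simp+

lemma search_ok_6: "search_ok 6 16" "search_ok 7 16" "search_ok 8 16" "search_ok 9 16" by code_simp+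

lemma search_ok_10: "search_ok 10 8" "search_ok 11 8" "search_ok 12 6"
  "search_ok 13 4" "search_ok 14 4" "search_ok 15 4"
  by code_simp+

lemma search_okD:
  assumes "search_ok i n"
  obtains us pl where "valid (hole_size i) (rep i) pl us 0" "distinct us" "set us = {..<18}"
    "length (search (hole_size i) (rep i) pl []) \<le> n"
proof -
  obtain us pl where *: "valid (hole_size i) (rep i) pl us 0" "distinct us" "length us = 18" "set us \<subseteq> {..<18}"
    "length (search (hole_size i) (rep i) pl []) \<le> n"
    using assms by (auto simp: search_ok_def list_all_iff split: prod.splits)
  moreover have "set us = {..<18}"
    by (rule card_subset_eq) (use * distinct_card[OF *(2)] in simp_all)
  ultimately show ?thesis using that by blast
qed

lemma hole_size: "hole_size i \<in> {2, 3}" "0 < hole_size i" "2 \<le> hole_size i"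
  by (simp_all add: hole_size_def)

lemma aut_rep_iso:
  assumes i: "i < 16" and H: "group_model H cs m \<delta>" and w: "words cs m gs e w"
    and c: "action_cert (hole_size i) (rep i) cs m gs w (generators i)" and s: "search_ok i (length cs)"
  shows "multinet_aut (net (hole_size i) (entry (rep i))) \<cong> H"
proof -
  obtain us pl where *: "valid (hole_size i) (rep i) pl us 0" "distinct us" "set us = {..<18}"
    "length (search (hole_size i) (rep i) pl []) \<le> length cs"
    by (rule search_okD[OF s])
  show ?thesis
    by (rule aut_iso[OF square_rep[OF i] hole_size(1) H action_tableI[OF square_rep[OF i] hole_size(1) H w c] *])
qed

section \<open>Evaluated certificates for the automorphism groups\<close>

definition c2_sym_codes :: "nat list list" where "c2_sym_codes = ccodes 2 (perm_codes 4)"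
definition c2_sym_gens :: "nat list list" where
  "c2_sym_gens = [[1, 1, 2, 3, 4], [0, 2, 1, 3, 4], [0, 1, 3, 2, 4], [0, 1, 2, 4, 3]]"

lemma words_c2_sym: "words c2_sym_codes (cmult 2 perm_mult) c2_sym_gens [0, 1, 2, 3, 4] c2_sym_word"
  by code_simp

lemma words_sym: "words (perm_codes 3) perm_mult [[2, 1, 3], [1, 3, 2]] [1, 2, 3] sym_word"
  by code_simp

lemma words_c2_d8: "words (ccodes 2 d8_codes) (cmult 2 d8_mult) [[1, 0, 0], [0, 1, 0], [0, 0, 1]] [0, 0, 0] (exp_word 0)"
  by code_simp

lemma words_c2_cubed: "words (ccodes 2 (ccodes 2 (res_codes 2))) (cmult 2 (cmult 2 (res_mult 2)))
    [[1, 0, 0], [0, 1, 0], [0, 0, 1]] [0, 0, 0] (exp_word 0)"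
  by code_simp

lemma words_c2_c2: "words (ccodes 2 (res_codes 2)) (cmult 2 (res_mult 2)) [[1, 0], [0, 1]] [0, 0] (exp_word 0)"
  by code_simp

lemma words_c3_cubed: "words (ccodes 3 (ccodes 3 (res_codes 3))) (cmult 3 (cmult 3 (res_mult 3)))
    [[1, 0, 0], [0, 1, 0], [0, 0, 1]] [0, 0, 0] (exp_word 0)"
  by code_simp

lemma words_c3: "words (res_codes 3) (res_mult 3) [[1]] [0] (exp_word 0)"
  by code_simp

lemma aut_c2_sym4: "list_all (\<lambda>i. action_cert 2 (rep i) c2_sym_codes (cmult 2 perm_mult) c2_sym_gens
    c2_sym_word (generators i)) [2, 3, 4, 5]"
  by code_simp

lemma aut_c2_d8: "list_all (\<lambda>i. action_cert 2 (rep i) (ccodes 2 d8_codes) (cmult 2 d8_mult)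
    [[1, 0, 0], [0, 1, 0], [0, 0, 1]] (exp_word 0) (generators i)) [6, 7, 8, 9]"
  by code_simp

lemma aut_c2_cubed: "list_all (\<lambda>i. action_cert 2 (rep i) (ccodes 2 (ccodes 2 (res_codes 2)))
    (cmult 2 (cmult 2 (res_mult 2))) [[1, 0, 0], [0, 1, 0], [0, 0, 1]] (exp_word 0) (generators i)) [10, 11]"
  by code_simp

lemma aut_sym3: "action_cert 2 (rep 12) (perm_codes 3) perm_mult [[2, 1, 3], [1, 3, 2]] sym_word (generators 12)"
  by code_simp

lemma aut_c2_c2: "list_all (\<lambda>i. action_cert 2 (rep i) (ccodes 2 (res_codes 2)) (cmult 2 (res_mult 2))
    [[1, 0], [0, 1]] (exp_word 0) (generators i)) [13, 14, 15]"
  by code_simp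

text \<open>For the nets with superline of length \<open>3\<close> the generators are three translations, permuted
  cyclically by the fourth generator, and two involutions: the fifth inverts the translations and
  centralizes the fourth generator, the sixth swaps two translations and inverts the fourth generator.\<close>

definition gen_perm :: "nat list list \<Rightarrow> nat list \<Rightarrow> nat list" where
  "gen_perm ps c = word_perm ps (exp_word 0 c)"

fun rotate_code :: "nat list \<Rightarrow> nat list \<Rightarrow> nat list" where
  "rotate_code t c = (if hd t = 0 then c else if hd t = 1 then [c ! 2, c ! 0, c ! 1] else [c ! 1, c ! 2, c ! 0])"

text \<open>\<open>(3 - x) mod 3\<close> is negation modulo 3 on natural numbers. The exponents of
  the two involutions are \<open>h ! 0\<close> and \<open>h ! 1\<close>.\<close>

definition invol_code :: "nat list \<Rightarrow> nat list \<Rightarrow> nat list" where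
  "invol_code h c = (let c' = (if h ! 1 = 1 then [c ! 0, c ! 2, c ! 1] else c)
     in if h ! 0 = 1 then map (\<lambda>x. (3 - x) mod 3) c' else c')"

definition invol_rot_code :: "nat list \<Rightarrow> nat list \<Rightarrow> nat list" where
  "invol_rot_code h t = (if h ! 1 = 1 then map (\<lambda>x. (3 - x) mod 3) t else t)"

text \<open>\<open>f d c\<close> is the code of the conjugate of \<open>c\<close> by
  \<open>d\<close>; giving it explicitly replaces a search for the conjugate by one
  comparison.\<close>

definition conj_ok :: "nat list list \<Rightarrow> nat list list \<Rightarrow> (nat list \<Rightarrow> nat list \<Rightarrow> nat list) \<Rightarrow>
    nat list list \<Rightarrow> nat list list \<Rightarrow> bool" where
  "conj_ok ps cs f qs ds \<longleftrightarrow> list_all (\<lambda>d. list_all (\<lambda>c. List.member cs (f d c) \<and>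
     pcomp (gen_perm qs d) (gen_perm ps c) = pcomp (gen_perm ps (f d c)) (gen_perm qs d)) cs) ds"

definition semidirect_ok :: "nat list list \<Rightarrow> nat list list \<Rightarrow> nat list list \<Rightarrow>
    nat list list \<Rightarrow> nat list list \<Rightarrow> nat list list \<Rightarrow> bool" where
  "semidirect_ok cA cB cD pA pB pD \<longleftrightarrow>
     conj_ok pA cA rotate_code pB cB \<and> conj_ok pA cA invol_code pD cD \<and> conj_ok pB cB invol_rot_code pD cD \<and>
     list_all (\<lambda>a. list_all (\<lambda>b. gen_perm pA a = gen_perm pB b \<longrightarrow> a = [0, 0, 0]) cB) cA \<and>
     list_all (\<lambda>a. list_all (\<lambda>b. list_all (\<lambda>d. pcomp (gen_perm pA a) (gen_perm pB b) = gen_perm pD d \<longrightarrow>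
       a = [0, 0, 0] \<and> b = [0]) cD) cB) cA"

lemma aut_c3_cubed: "list_all (\<lambda>i. action_cert 3 (rep i) (ccodes 3 (ccodes 3 (res_codes 3)))
    (cmult 3 (cmult 3 (res_mult 3))) [[1, 0, 0], [0, 1, 0], [0, 0, 1]] (exp_word 0) (take 3 (generators i))) [0, 1]"
  by code_simp

lemma aut_c3: "list_all (\<lambda>i. action_cert 3 (rep i) (res_codes 3) (res_mult 3) [[1]] (exp_word 0)
    [generators i ! 3]) [0, 1]"
  by code_simp

lemma aut_c2_c2': "list_all (\<lambda>i. action_cert 3 (rep i) (ccodes 2 (res_codes 2)) (cmult 2 (res_mult 2))
    [[1, 0], [0, 1]] (exp_word 0) (drop 4 (generators i))) [0, 1]"
  by code_simp

lemma semidirect_ok: "list_all (\<lambda>i. semidirect_ok (ccodes 3 (ccodes 3 (res_codes 3))) (res_codes 3)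
    (ccodes 2 (res_codes 2)) (take 3 (generators i)) [generators i ! 3] (drop 4 (generators i))) [0, 1]"
  by code_simp

lemma conj_okD:
  assumes "conj_ok ps cs f qs ds" "c \<in> set cs" "d \<in> set ds"
  shows "\<exists>c'\<in>set cs. pcomp (gen_perm qs d) (gen_perm ps c) = pcomp (gen_perm ps c') (gen_perm qs d)"
  using assms by (auto simp: conj_ok_def list_all_iff intro!: bexI[of _ "f d c"])

text \<open>The translations give the factor of order 27, the fourth generator the one of order 3,
  and the involutions the one of order 4.\<close>

lemma aut_rep_semidirect:
  assumes i: "i = 0 \<or> i = 1"
  shows "is_C3_cubed_C3_C2_C2 (multinet_aut (net (hole_size i) (entry (rep i)))) \<and>
    order (multinet_aut (net (hole_size i) (entry (rep i)))) = 324"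
proof -
  let ?A = "ccodes 3 (ccodes 3 (res_codes 3))" and ?B = "res_codes 3" and ?D = "ccodes 2 (res_codes 2)"
  have k: "hole_size i = 3" using i by (auto simp: hole_size_def)
  have T: "square (hole_size i) (rep i)" using i by (intro square_rep) auto
  have mA: "group_model (C 3 \<times>\<times> C 3 \<times>\<times> C 3) ?A (cmult 3 (cmult 3 (res_mult 3))) (cdec (cdec res_dec))"
    by (intro model_cons model_C) simp_all
  have mB: "group_model (C 3) ?B (res_mult 3) res_dec" by (rule model_C) simp
  have mD: "group_model (C 2 \<times>\<times> C 2) ?D (cmult 2 (res_mult 2)) (cdec res_dec)"
    by (intro model_cons model_C) simp_all
  have aA: "action_table (hole_size i) (rep i) ?A (cmult 3 (cmult 3 (res_mult 3))) (gen_perm (take 3 (generators i)))"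
    unfolding gen_perm_def[abs_def]
    by (rule action_tableI[OF T hole_size(1) mA words_c3_cubed]) (use aut_c3_cubed i k in auto)
  have aB: "action_table (hole_size i) (rep i) ?B (res_mult 3) (gen_perm [generators i ! 3])"
    unfolding gen_perm_def[abs_def]
    by (rule action_tableI[OF T hole_size(1) mB words_c3]) (use aut_c3 i k in auto)
  have aD: "action_table (hole_size i) (rep i) ?D (cmult 2 (res_mult 2)) (gen_perm (drop 4 (generators i)))"
    unfolding gen_perm_def[abs_def]
    by (rule action_tableI[OF T hole_size(1) mD words_c2_c2]) (use aut_c2_c2' i k in auto)
  have ok: "semidirect_ok ?A ?B ?D (take 3 (generators i)) [generators i ! 3] (drop 4 (generators i))"
    using semidirect_ok i by auto
  have one: "[0, 0, 0] \<in> set ?A" "[0] \<in> set ?B" "cdec (cdec res_dec) [0, 0, 0] = \<one>\<^bsub>C 3 \<times>\<times> C 3 \<times>\<times> C 3\<^esub>"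
    "res_dec [0] = \<one>\<^bsub>C 3\<^esub>"
    using words_c3_cubed words_c3 by (simp_all add: words_def cdec_def res_dec_def)
  have "search_ok i 324" using search_ok_0 search_ok_1 i by auto
  then obtain us pl where s: "valid (hole_size i) (rep i) pl us 0" "distinct us" "set us = {..<18}"
    "length (search (hole_size i) (rep i) pl []) \<le> 324"
    by (rule search_okD)
  have len: "length ?A * length ?B * length ?D = 324" by (simp add: ccodes(3) res_codes_def)
  have "(\<exists>\<phi>\<in>hom (C 3) (AutoGroup (C 3 \<times>\<times> C 3 \<times>\<times> C 3)). is_semidirect_product
      (multinet_aut (net (hole_size i) (entry (rep i)))) (semidirect (C 3 \<times>\<times> C 3 \<times>\<times> C 3) (C 3) \<phi>) (C 2 \<times>\<times> C 2)) \<and>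
    order (multinet_aut (net (hole_size i) (entry (rep i)))) = length ?A * length ?B * length ?D"
  proof (rule aut_semidirect[OF T hole_size(1) mA aA one(1,3) mB aB one(2,4) mD aD])
    note o = ok[unfolded semidirect_ok_def]
    show "\<exists>a'\<in>set ?A. pcomp (gen_perm [generators i ! 3] b) (gen_perm (take 3 (generators i)) a) =
        pcomp (gen_perm (take 3 (generators i)) a') (gen_perm [generators i ! 3] b)"
      if "a \<in> set ?A" "b \<in> set ?B" for a b using o conj_okD that by blast
    show "\<exists>a'\<in>set ?A. pcomp (gen_perm (drop 4 (generators i)) d) (gen_perm (take 3 (generators i)) a) =
        pcomp (gen_perm (take 3 (generators i)) a') (gen_perm (drop 4 (generators i)) d)"
      if "a \<in> set ?A" "d \<in> set ?D" for a d using o conj_okD that by blast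
    show "\<exists>b'\<in>set ?B. pcomp (gen_perm (drop 4 (generators i)) d) (gen_perm [generators i ! 3] b) =
        pcomp (gen_perm [generators i ! 3] b') (gen_perm (drop 4 (generators i)) d)"
      if "b \<in> set ?B" "d \<in> set ?D" for b d using o conj_okD that by blast
    show "a = [0, 0, 0]" if "a \<in> set ?A" "b \<in> set ?B"
      "gen_perm (take 3 (generators i)) a = gen_perm [generators i ! 3] b" for a b
      using o that unfolding list_all_iff by blast
    show "a = [0, 0, 0] \<and> b = [0]" if "a \<in> set ?A" "b \<in> set ?B" "d \<in> set ?D"
      "pcomp (gen_perm (take 3 (generators i)) a) (gen_perm [generators i ! 3] b) = gen_perm (drop 4 (generators i)) d" for a b d
      using o that unfolding list_all_iff by blast
  qed (use s len in simp_all)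
  then show ?thesis unfolding is_C3_cubed_C3_C2_C2_def len by simp
qed

lemma aut_reps:
  "i \<in> {2, 3, 4, 5} \<Longrightarrow> multinet_aut (net (hole_size i) (entry (rep i))) \<cong> C 2 \<times>\<times> sym_group 4"
  "i \<in> {6, 7, 8, 9} \<Longrightarrow> multinet_aut (net (hole_size i) (entry (rep i))) \<cong> C 2 \<times>\<times> D8"
  "i \<in> {10, 11} \<Longrightarrow> multinet_aut (net (hole_size i) (entry (rep i))) \<cong> C 2 \<times>\<times> C 2 \<times>\<times> C 2"
  "i = 12 \<Longrightarrow> multinet_aut (net (hole_size i) (entry (rep i))) \<cong> sym_group 3"
  "i \<in> {13, 14, 15} \<Longrightarrow> multinet_aut (net (hole_size i) (entry (rep i))) \<cong> C 2 \<times>\<times> C 2"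
proof -
  have len: "length c2_sym_codes = 48" "length (ccodes 2 d8_codes) = 16"
    "length (ccodes 2 (ccodes 2 (res_codes 2))) = 8" "length (perm_codes 3) = 6" "length (ccodes 2 (res_codes 2)) = 4"
    by code_simp+
  note s = search_ok_2 search_ok_4 search_ok_6 search_ok_10
  have k: "hole_size i = 2" if "2 \<le> i" for i using that by (simp add: hole_size_def)
  show "multinet_aut (net (hole_size i) (entry (rep i))) \<cong> C 2 \<times>\<times> sym_group 4" if "i \<in> {2, 3, 4, 5}"
  proof (rule aut_rep_iso[OF _ _ words_c2_sym])
    show "group_model (C 2 \<times>\<times> sym_group 4) c2_sym_codes (cmult 2 perm_mult) (cdec perm_of)"
      unfolding c2_sym_codes_def by (intro model_cons model_sym) simp_all
    show "action_cert (hole_size i) (rep i) c2_sym_codes (cmult 2 perm_mult) c2_sym_gens c2_sym_word (generators i)"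
      using aut_c2_sym4 that k[of i] unfolding list_all_iff by auto
  qed (use s len that in auto)
  show "multinet_aut (net (hole_size i) (entry (rep i))) \<cong> C 2 \<times>\<times> D8" if "i \<in> {6, 7, 8, 9}"
  proof (rule aut_rep_iso[OF _ _ words_c2_d8])
    show "group_model (C 2 \<times>\<times> D8) (ccodes 2 d8_codes) (cmult 2 d8_mult) (cdec (cdec res_dec))"
      by (intro model_cons model_D8) simp_all
    show "action_cert (hole_size i) (rep i) (ccodes 2 d8_codes) (cmult 2 d8_mult)
        [[1, 0, 0], [0, 1, 0], [0, 0, 1]] (exp_word 0) (generators i)"
      using aut_c2_d8 that k[of i] unfolding list_all_iff by auto
  qed (use s len that in auto)
  show "multinet_aut (net (hole_size i) (entry (rep i))) \<cong> C 2 \<times>\<times> C 2 \<times>\<times> C 2" if "i \<in> {10, 11}"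
  proof (rule aut_rep_iso[OF _ _ words_c2_cubed])
    show "group_model (C 2 \<times>\<times> C 2 \<times>\<times> C 2) (ccodes 2 (ccodes 2 (res_codes 2)))
        (cmult 2 (cmult 2 (res_mult 2))) (cdec (cdec res_dec))"
      by (intro model_cons model_C) simp_all
    show "action_cert (hole_size i) (rep i) (ccodes 2 (ccodes 2 (res_codes 2))) (cmult 2 (cmult 2 (res_mult 2)))
        [[1, 0, 0], [0, 1, 0], [0, 0, 1]] (exp_word 0) (generators i)"
      using aut_c2_cubed that k[of i] unfolding list_all_iff by auto
  qed (use s len that in auto)
  show "multinet_aut (net (hole_size i) (entry (rep i))) \<cong> sym_group 3" if "i = 12"
  proof (rule aut_rep_iso[OF _ _ words_sym])
    show "group_model (sym_group 3) (perm_codes 3) perm_mult perm_of" by (rule model_sym) simp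
    show "action_cert (hole_size i) (rep i) (perm_codes 3) perm_mult [[2, 1, 3], [1, 3, 2]] sym_word (generators i)"
      using aut_sym3 that k[of i] by simp
  qed (use s len that in auto)
  show "multinet_aut (net (hole_size i) (entry (rep i))) \<cong> C 2 \<times>\<times> C 2" if "i \<in> {13, 14, 15}"
  proof (rule aut_rep_iso[OF _ _ words_c2_c2])
    show "group_model (C 2 \<times>\<times> C 2) (ccodes 2 (res_codes 2)) (cmult 2 (res_mult 2)) (cdec res_dec)"
      by (intro model_cons model_C) simp_all
    show "action_cert (hole_size i) (rep i) (ccodes 2 (res_codes 2)) (cmult 2 (res_mult 2))
        [[1, 0], [0, 1]] (exp_word 0) (generators i)"
      using aut_c2_c2 that k[of i] unfolding list_all_iff by auto
  qed (use s len that in auto)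
qed

section \<open>Assembling the sixteen classes\<close>

definition labels :: "nat \<Rightarrow> nat list" where
  "labels i = [[1, 9], [2, 3, 9], [1, 4], [2, 5], [4], [7], [5], [8, 11], [10], [11], [9, 12], [12], [6, 7], [5, 10], [7, 10], [11, 12]] ! i"

lemma labels: "list_all (\<lambda>i. list_all (\<lambda>c. List.member (labels i) (fst c)) (fill_certs i) \<and>
    list_all (List.member (map fst (fill_certs i))) (labels i)) [0..<16]"
  by code_simp

text \<open>A sorted list without repetitions is determined by its set, so distinct lists mean
  distinct label sets.\<close>

lemma labels_inj: "list_all (\<lambda>i. sorted (labels i) \<and> distinct (labels i) \<and>
    list_all (\<lambda>j. labels i = labels j \<longrightarrow> i = j) [0..<16]) [0..<16]"
  by code_simp

lemma label_indices_labels: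
  assumes "i < 16"
  shows "label_indices (net (hole_size i) (entry (rep i))) = set (labels i)"
  unfolding label_indices_rep[OF assms] using labels assms by (fastforce simp: list_all_iff simp del: upt_Suc upt_rec_numeral)

text \<open>The classes are numbered from 1, the representatives from 0.\<close>

definition sixteen :: "nat \<Rightarrow> nat point_block" where
  "sixteen n = net (hole_size (n - 1)) (entry (rep (n - 1)))"

lemma sixteen_complete:
  assumes "light_dual_multinet Q mul P M Pc \<alpha> \<and> card Q = 6 \<and> (\<exists>!B. superline Q \<alpha> M B)"
  shows "\<exists>i\<in>{1..16}. multinet_iso (P, M) (sixteen i)"
proof -
  obtain i where "i < 16" "multinet_iso (P, M) (net (hole_size i) (entry (rep i)))"
    using light_dual_multinet.classification[of Q mul P M Pc \<alpha>] assms by blast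
  then show ?thesis by (intro bexI[of _ "Suc i"]) (simp_all add: sixteen_def)
qed

lemma sixteen_distinct:
  assumes ij: "i \<in> {1..16}" "j \<in> {1..16}" and iso: "multinet_iso (sixteen i) (sixteen j)"
  shows "i = j"
proof -
  have i: "i - 1 < 16" "j - 1 < 16" using ij by auto
  have "snd (sixteen i) \<subseteq> Pow (fst (sixteen i))"
    unfolding sixteen_def net_def using lines_sub[OF square_holed[OF square_rep[OF i(1)]]] by (auto simp: hole_def)
  then have "set (labels (i - 1)) = set (labels (j - 1))"
    using label_indices_iso[OF iso] label_indices_labels[OF i(1)] label_indices_labels[OF i(2)]
    by (simp add: sixteen_def)
  moreover have "sorted (labels n) \<and> distinct (labels n) \<and> (\<forall>n'<16. labels n = labels n' \<longrightarrow> n = n')" if "n < 16" for n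
    using labels_inj that by (simp add: list_all_iff del: upt_Suc upt_rec_numeral)
  ultimately have "i - 1 = j - 1" using i sorted_distinct_set_unique by metis
  then show ?thesis using ij by auto
qed

lemma sixteen_order: "n \<in> {1..16} \<Longrightarrow> order6_with_superline_length (sixteen n) (if n \<le> 2 then 3 else 2)"
  unfolding sixteen_def using net_order6[OF square_holed[OF square_rep[of "n - 1"]] hole_size(3)]
  by (auto simp: hole_size_def split: if_splits)

lemma sixteen_labels: "n \<in> {1..16} \<Longrightarrow> label_indices (sixteen n) = set (labels (n - 1))"
  unfolding sixteen_def by (rule label_indices_labels) auto

lemma sixteen_1: "order6_with_superline_length (sixteen 1) 3 \<and> label_indices (sixteen 1) = {1, 9} \<and>
    is_C3_cubed_C3_C2_C2 (multinet_aut (sixteen 1)) \<and> order (multinet_aut (sixteen 1)) = 324"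
  using sixteen_order[of 1] sixteen_labels[of 1] aut_rep_semidirect[of 0]
  by (simp add: labels_def sixteen_def insert_commute)

lemma sixteen_2: "order6_with_superline_length (sixteen 2) 3 \<and> label_indices (sixteen 2) = {2, 3, 9} \<and>
    is_C3_cubed_C3_C2_C2 (multinet_aut (sixteen 2)) \<and> order (multinet_aut (sixteen 2)) = 324"
  using sixteen_order[of 2] sixteen_labels[of 2] aut_rep_semidirect[of 1]
  by (simp add: labels_def sixteen_def insert_commute)

lemma sixteen_3: "order6_with_superline_length (sixteen 3) 2 \<and> label_indices (sixteen 3) = {1, 4} \<and>
    multinet_aut (sixteen 3) \<cong> C 2 \<times>\<times> sym_group 4"
  using sixteen_order[of 3] sixteen_labels[of 3] aut_reps(1)[of 2]
  by (simp add: labels_def sixteen_def insert_commute)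

lemma sixteen_4: "order6_with_superline_length (sixteen 4) 2 \<and> label_indices (sixteen 4) = {2, 5} \<and>
    multinet_aut (sixteen 4) \<cong> C 2 \<times>\<times> sym_group 4"
  using sixteen_order[of 4] sixteen_labels[of 4] aut_reps(1)[of 3]
  by (simp add: labels_def sixteen_def insert_commute)

lemma sixteen_5: "order6_with_superline_length (sixteen 5) 2 \<and> label_indices (sixteen 5) = {4} \<and>
    multinet_aut (sixteen 5) \<cong> C 2 \<times>\<times> sym_group 4"
  using sixteen_order[of 5] sixteen_labels[of 5] aut_reps(1)[of 4]
  by (simp add: labels_def sixteen_def insert_commute)

lemma sixteen_6: "order6_with_superline_length (sixteen 6) 2 \<and> label_indices (sixteen 6) = {7} \<and>
    multinet_aut (sixteen 6) \<cong> C 2 \<times>\<times> sym_group 4"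
  using sixteen_order[of 6] sixteen_labels[of 6] aut_reps(1)[of 5]
  by (simp add: labels_def sixteen_def insert_commute)

lemma sixteen_7: "order6_with_superline_length (sixteen 7) 2 \<and> label_indices (sixteen 7) = {5} \<and>
    multinet_aut (sixteen 7) \<cong> C 2 \<times>\<times> D8"
  using sixteen_order[of 7] sixteen_labels[of 7] aut_reps(2)[of 6]
  by (simp add: labels_def sixteen_def insert_commute)

lemma sixteen_8: "order6_with_superline_length (sixteen 8) 2 \<and> label_indices (sixteen 8) = {8, 11} \<and>
    multinet_aut (sixteen 8) \<cong> C 2 \<times>\<times> D8"
  using sixteen_order[of 8] sixteen_labels[of 8] aut_reps(2)[of 7]
  by (simp add: labels_def sixteen_def insert_commute)

lemma sixteen_9: "order6_with_superline_length (sixteen 9) 2 \<and> label_indices (sixteen 9) = {10} \<and>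
    multinet_aut (sixteen 9) \<cong> C 2 \<times>\<times> D8"
  using sixteen_order[of 9] sixteen_labels[of 9] aut_reps(2)[of 8]
  by (simp add: labels_def sixteen_def insert_commute)

lemma sixteen_10: "order6_with_superline_length (sixteen 10) 2 \<and> label_indices (sixteen 10) = {11} \<and>
    multinet_aut (sixteen 10) \<cong> C 2 \<times>\<times> D8"
  using sixteen_order[of 10] sixteen_labels[of 10] aut_reps(2)[of 9]
  by (simp add: labels_def sixteen_def insert_commute)

lemma sixteen_11: "order6_with_superline_length (sixteen 11) 2 \<and> label_indices (sixteen 11) = {9, 12} \<and>
    multinet_aut (sixteen 11) \<cong> C 2 \<times>\<times> C 2 \<times>\<times> C 2"
  using sixteen_order[of 11] sixteen_labels[of 11] aut_reps(3)[of 10]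
  by (simp add: labels_def sixteen_def insert_commute)

lemma sixteen_12: "order6_with_superline_length (sixteen 12) 2 \<and> label_indices (sixteen 12) = {12} \<and>
    multinet_aut (sixteen 12) \<cong> C 2 \<times>\<times> C 2 \<times>\<times> C 2"
  using sixteen_order[of 12] sixteen_labels[of 12] aut_reps(3)[of 11]
  by (simp add: labels_def sixteen_def insert_commute)

lemma sixteen_13: "order6_with_superline_length (sixteen 13) 2 \<and> label_indices (sixteen 13) = {6, 7} \<and>
    multinet_aut (sixteen 13) \<cong> sym_group 3"
  using sixteen_order[of 13] sixteen_labels[of 13] aut_reps(4)[of 12]
  by (simp add: labels_def sixteen_def insert_commute)

lemma sixteen_14: "order6_with_superline_length (sixteen 14) 2 \<and> label_indices (sixteen 14) = {5, 10} \<and>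
    multinet_aut (sixteen 14) \<cong> C 2 \<times>\<times> C 2"
  using sixteen_order[of 14] sixteen_labels[of 14] aut_reps(5)[of 13]
  by (simp add: labels_def sixteen_def insert_commute)

lemma sixteen_15: "order6_with_superline_length (sixteen 15) 2 \<and> label_indices (sixteen 15) = {7, 10} \<and>
    multinet_aut (sixteen 15) \<cong> C 2 \<times>\<times> C 2"
  using sixteen_order[of 15] sixteen_labels[of 15] aut_reps(5)[of 14]
  by (simp add: labels_def sixteen_def insert_commute)

lemma sixteen_16: "order6_with_superline_length (sixteen 16) 2 \<and> label_indices (sixteen 16) = {11, 12} \<and>
    multinet_aut (sixteen 16) \<cong> C 2 \<times>\<times> C 2"
  using sixteen_order[of 16] sixteen_labels[of 16] aut_reps(5)[of 15]
  by (simp add: labels_def sixteen_def insert_commute)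

theorem theorem4p2:
  shows "\<exists>N :: nat \<Rightarrow> nat point_block.
    (\<forall>(P :: 'p set) M (Q :: 'q set) mul Pc \<alpha>.
       light_dual_multinet Q mul P M Pc \<alpha> \<and> card Q = 6 \<and> (\<exists>!B. superline Q \<alpha> M B) \<longrightarrow>
       (\<exists>i\<in>{1..16}. multinet_iso (P, M) (N i))) \<and>
    (\<forall>i\<in>{1..16}. \<forall>j\<in>{1..16}. multinet_iso (N i) (N j) \<longrightarrow> i = j) \<and>
    (order6_with_superline_length (N 1) 3 \<and> label_indices (N 1) = {1, 9} \<and>
       is_C3_cubed_C3_C2_C2 (multinet_aut (N 1)) \<and> order (multinet_aut (N 1)) = 324) \<and>
    (order6_with_superline_length (N 2) 3 \<and> label_indices (N 2) = {2, 3, 9} \<and>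
       is_C3_cubed_C3_C2_C2 (multinet_aut (N 2)) \<and> order (multinet_aut (N 2)) = 324) \<and>
    (order6_with_superline_length (N 3) 2 \<and> label_indices (N 3) = {1, 4} \<and>
       multinet_aut (N 3) \<cong> C 2 \<times>\<times> sym_group 4) \<and>
    (order6_with_superline_length (N 4) 2 \<and> label_indices (N 4) = {2, 5} \<and>
       multinet_aut (N 4) \<cong> C 2 \<times>\<times> sym_group 4) \<and>
    (order6_with_superline_length (N 5) 2 \<and> label_indices (N 5) = {4} \<and>
       multinet_aut (N 5) \<cong> C 2 \<times>\<times> sym_group 4) \<and>
    (order6_with_superline_length (N 6) 2 \<and> label_indices (N 6) = {7} \<and>
       multinet_aut (N 6) \<cong> C 2 \<times>\<times> sym_group 4) \<and>
    (order6_with_superline_length (N 7) 2 \<and> label_indices (N 7) = {5} \<and>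
       multinet_aut (N 7) \<cong> C 2 \<times>\<times> D8) \<and>
    (order6_with_superline_length (N 8) 2 \<and> label_indices (N 8) = {8, 11} \<and>
       multinet_aut (N 8) \<cong> C 2 \<times>\<times> D8) \<and>
    (order6_with_superline_length (N 9) 2 \<and> label_indices (N 9) = {10} \<and>
       multinet_aut (N 9) \<cong> C 2 \<times>\<times> D8) \<and>
    (order6_with_superline_length (N 10) 2 \<and> label_indices (N 10) = {11} \<and>
       multinet_aut (N 10) \<cong> C 2 \<times>\<times> D8) \<and>
    (order6_with_superline_length (N 11) 2 \<and> label_indices (N 11) = {9, 12} \<and>
       multinet_aut (N 11) \<cong> C 2 \<times>\<times> C 2 \<times>\<times> C 2) \<and>
    (order6_with_superline_length (N 12) 2 \<and> label_indices (N 12) = {12} \<and>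
       multinet_aut (N 12) \<cong> C 2 \<times>\<times> C 2 \<times>\<times> C 2) \<and>
    (order6_with_superline_length (N 13) 2 \<and> label_indices (N 13) = {6, 7} \<and>
       multinet_aut (N 13) \<cong> sym_group 3) \<and>
    (order6_with_superline_length (N 14) 2 \<and> label_indices (N 14) = {5, 10} \<and>
       multinet_aut (N 14) \<cong> C 2 \<times>\<times> C 2) \<and>
    (order6_with_superline_length (N 15) 2 \<and> label_indices (N 15) = {7, 10} \<and>
       multinet_aut (N 15) \<cong> C 2 \<times>\<times> C 2) \<and>
    (order6_with_superline_length (N 16) 2 \<and> label_indices (N 16) = {11, 12} \<and>
       multinet_aut (N 16) \<cong> C 2 \<times>\<times> C 2)"
  by (rule exI[of _ sixteen], rule conjI, intro allI impI, rule sixteen_complete, assumption,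
      rule conjI, intro ballI impI, rule sixteen_distinct, assumption+, (rule conjI, rule sixteen_1 sixteen_2 sixteen_3 sixteen_4 sixteen_5 sixteen_6 sixteen_7 sixteen_8 sixteen_9 sixteen_10 sixteen_11 sixteen_12 sixteen_13 sixteen_14 sixteen_15)+, rule sixteen_16)

end
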